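(* Suppose $\mathsf f$ is an a.s. uniformly bounded additive functional on a uniformly elliptic Markov chain $\mathsf X$. Then for every interval $(a,b)$ of length $L>\delta(\mathsf f)$, for every $\epsilon>0$, $x\in\mathfrak S_1$, and every sequence $z_N\in\mathbb R$ such that $\frac{z_N-\mathbb E(S_N)}{\sqrt{V_N}}\to z\in\mathbb R$, for all $N$ large enough, $$\mathbb P_x(S_N-z_N\in(a,b))\le\frac{e^{-z^2/2}|a-b|}{\sqrt{2\pi V_N}}\left(1+\frac{21\,\delta(\mathsf f)}{L}+\epsilon\right),$$ $$\mathbb P_x(S_N-z_N\in(a,b))\ge\frac{e^{-z^2/2}|a-b|}{\sqrt{2\pi V_N}}\left(1-\frac{\delta(\mathsf f)}{L}-\epsilon\right).$$ In addition, if $0<\delta(\mathsf f)<\infty$ and $k\delta(\mathsf f)<L<(k+1)\delta(\mathsf f)$ with $k\in\mathbb N$, then $$\left(\frac{e^{-z^2/2}}{\sqrt{2\pi V_N}}\right)k\,\delta(\mathsf f)\ \lesssim\ \mathbb P_x(S_N-z_N\in(a,b))\ \lesssim\ \left(\frac{e^{-z^2/2}}{\sqrt{2\pi V_N}}\right)(k+1)\,\delta(\mathsf f),$$ where $A_N\lesssim B_N$ means $\limsup_{N\to\infty}(A_N/B_N)\le1$.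
   Context: A Markov chain $\mathsf X=\{X_n\}_{n\ge1}$ (possibly inhomogeneous) has complete separable metric state spaces $\mathfrak S_n\ni X_n$ with Borel $\sigma$-algebras, an initial distribution on $\mathfrak S_1$, and transition kernels $\pi_{n,n+1}(x,dy)$, so that $\mathbb P(X_{n+1}\in E\mid X_n,\dots,X_1)=\pi_{n,n+1}(X_n,E)$. $\mathbb P_x$ denotes probability when the initial distribution is replaced by the point mass at $x\in\mathfrak S_1$. The chain is uniformly elliptic if there are $0<\epsilon_0<1$, Borel probability measures $\mu_n$ on $\mathfrak S_n$ and measurable $p_n:\mathfrak S_n\times\mathfrak S_{n+1}\to[0,\infty)$ such that for all $n\ge1$: (a) $\pi_{n,n+1}(x,dy)=p_n(x,y)\mu_{n+1}(dy)$; (b) $0\le p_n\le1/\epsilon_0$; (c) $\int_{\mathfrak S_{n+1}}p_n(x,y)p_{n+1}(y,z)\mu_{n+1}(dy)>\epsilon_0$ for all $x\in\mathfrak S_n$, $z\in\mathfrak S_{n+2}$. An additive functional is a sequence $\mathsf f=\{f_n\}$ of measurable $f_n:\mathfrak S_n\times\mathfrak S_{n+1}\to\mathbb R$; $S_N=\sum_{n=1}^Nf_n(X_n,X_{n+1})$; $V_N=\mathrm{Var}(S_N)$. $\mathsf f$ is a.s. uniformly bounded if $\sup_n\mathrm{ess\,sup}|f_n(X_n,X_{n+1})|<\infty$. $\mathsf f$ is center-tight if there are constants $m_N$ such that for every $\epsilon>0$ there is $M$ with $\mathbb P[|S_N-m_N|>M]<\epsilon$ for all $N$. $G_{alg}(\mathsf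 X,\mathsf f)$ is the intersection of all closed subgroups $G\le\mathbb R$ for which there are $c_n\in\mathbb R$ with $\mathbb P[f_n(X_n,X_{n+1})-c_n\in G]=1$ for all $n\ge1$. The essential range is $G_{ess}(\mathsf X,\mathsf f)=\bigcap\{G_{alg}(\mathsf X,\mathsf g):\mathsf g$ an additive functional on $\mathsf X$ with $\mathsf f-\mathsf g$ center-tight$\}$. The graininess constant is $\delta(\mathsf f)=t$ if $G_{ess}(\mathsf X,\mathsf f)=t\mathbb Z$ with $t>0$; $\delta(\mathsf f)=0$ if $G_{ess}(\mathsf X,\mathsf f)=\mathbb R$; $\delta(\mathsf f)=\infty$ if $G_{ess}(\mathsf X,\mathsf f)=\{0\}$ (in which case the statement is vacuous). *)

theory Defs
  imports "HOL-Probability.Probability"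
begin

text \<open>
  The state spaces of an inhomogeneous chain are values of the library type of metric spaces with an
  explicit carrier, all over one ambient type. This loses no generality, since any sequence of
  metric spaces embeds isometrically in its disjoint union. Time indices start at 1; values of all
  sequences at index 0 are ignored.
\<close>

definition borel_msets :: "'a metric \<Rightarrow> 'a measure" where
  "borel_msets m = sigma (mspace m) {U. openin (mtopology_of m) U}"

definition past_algebra ::
  "'w measure \<Rightarrow> (nat \<Rightarrow> 'a metric) \<Rightarrow> (nat \<Rightarrow> 'w \<Rightarrow> 'a) \<Rightarrow> nat \<Rightarrow> 'w measure" where
  "past_algebra M S X n =
     vimage_algebra (space M) (\<lambda>\<omega>. \<lambda>i\<in>{1..n}. X i \<omega>) (Pi\<^sub>M {1..n} (\<lambda>i. borel_msets (S i)))"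

text \<open>
  A Markov chain with initial distribution \<open>\<nu>\<close> on \<open>S 1\<close> and transition kernels
  \<open>\<pi> n\<close> from \<open>S n\<close> to \<open>S (n + 1)\<close>, realised as a process \<open>X\<close> on the probability space \<open>M\<close>.
  The probability started from a point \<open>x\<close> is the law of a realisation with
  \<open>\<nu> = return (borel_msets (S 1)) x\<close> and the same kernels.
\<close>

locale markov_chain = prob_space M
  for M :: "'w measure" +
  fixes S :: "nat \<Rightarrow> 'a metric"
    and \<nu> :: "'a measure"
    and \<pi> :: "nat \<Rightarrow> 'a \<Rightarrow> 'a measure"
    and X :: "nat \<Rightarrow> 'w \<Rightarrow> 'a"
  assumes complete: "\<And>n. n \<ge> 1 \<Longrightarrow> mcomplete_of (S n)"
    and separable: "\<And>n. n \<ge> 1 \<Longrightarrow> separable_space (mtopology_of (S n))"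
    and kernel: "\<And>n. n \<ge> 1 \<Longrightarrow>
      \<pi> n \<in> measurable (borel_msets (S n)) (prob_algebra (borel_msets (S (Suc n))))"
    and random_variable: "\<And>n. n \<ge> 1 \<Longrightarrow> X n \<in> measurable M (borel_msets (S n))"
    and initial: "distr M (borel_msets (S 1)) (X 1) = \<nu>"
    and transition: "\<And>n E. n \<ge> 1 \<Longrightarrow> E \<in> sets (borel_msets (S (Suc n))) \<Longrightarrow>
      AE \<omega> in M. real_cond_exp M (past_algebra M S X n)
                    (\<lambda>\<omega>'. indicator E (X (Suc n) \<omega>')) \<omega> = measure (\<pi> n (X n \<omega>)) E"

definition uniformly_elliptic :: "(nat \<Rightarrow> 'a metric) \<Rightarrow> (nat \<Rightarrow> 'a \<Rightarrow> 'a measure) \<Rightarrow> bool" where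
  "uniformly_elliptic S \<pi> \<longleftrightarrow>
     (\<exists>\<epsilon>\<^sub>0 (\<mu> :: nat \<Rightarrow> 'a measure) (p :: nat \<Rightarrow> 'a \<times> 'a \<Rightarrow> real).
        0 < \<epsilon>\<^sub>0 \<and> \<epsilon>\<^sub>0 < 1 \<and>
        (\<forall>n\<ge>1. prob_space (\<mu> n) \<and> sets (\<mu> n) = sets (borel_msets (S n))) \<and>
        (\<forall>n\<ge>1. p n \<in> borel_measurable (borel_msets (S n) \<Otimes>\<^sub>M borel_msets (S (Suc n)))) \<and>
        (\<forall>n\<ge>1. \<forall>x\<in>mspace (S n). \<pi> n x = density (\<mu> (Suc n)) (\<lambda>y. ennreal (p n (x, y)))) \<and>
        (\<forall>n\<ge>1. \<forall>x\<in>mspace (S n). \<forall>y\<in>mspace (S (Suc n)). 0 \<le> p n (x, y) \<and> p n (x, y) \<le> 1 / \<epsilon>\<^sub>0) \<and>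
        (\<forall>n\<ge>1. \<forall>x\<in>mspace (S n). \<forall>z\<in>mspace (S (Suc (Suc n))).
           (\<integral>y. p n (x, y) * p (Suc n) (y, z) \<partial>\<mu> (Suc n)) > \<epsilon>\<^sub>0))"

definition additive_functional ::
  "(nat \<Rightarrow> 'a metric) \<Rightarrow> (nat \<Rightarrow> 'a \<times> 'a \<Rightarrow> real) \<Rightarrow> bool" where
  "additive_functional S f \<longleftrightarrow>
     (\<forall>n\<ge>1. f n \<in> borel_measurable (borel_msets (S n) \<Otimes>\<^sub>M borel_msets (S (Suc n))))"

definition partial_sum ::
  "(nat \<Rightarrow> 'w \<Rightarrow> 'a) \<Rightarrow> (nat \<Rightarrow> 'a \<times> 'a \<Rightarrow> real) \<Rightarrow> nat \<Rightarrow> 'w \<Rightarrow> real" where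
  "partial_sum X f N \<omega> = (\<Sum>n = 1..N. f n (X n \<omega>, X (Suc n) \<omega>))"

definition as_uniformly_bounded ::
  "'w measure \<Rightarrow> (nat \<Rightarrow> 'w \<Rightarrow> 'a) \<Rightarrow> (nat \<Rightarrow> 'a \<times> 'a \<Rightarrow> real) \<Rightarrow> bool" where
  "as_uniformly_bounded M X f \<longleftrightarrow>
     (SUP n\<in>{1..}. esssup M (\<lambda>\<omega>. ereal \<bar>f n (X n \<omega>, X (Suc n) \<omega>)\<bar>)) < \<infinity>"

definition center_tight ::
  "'w measure \<Rightarrow> (nat \<Rightarrow> 'w \<Rightarrow> 'a) \<Rightarrow> (nat \<Rightarrow> 'a \<times> 'a \<Rightarrow> real) \<Rightarrow> bool" where
  "center_tight M X f \<longleftrightarrow>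
     (\<exists>m :: nat \<Rightarrow> real. \<forall>\<epsilon>>0. \<exists>C. \<forall>N\<ge>1.
        \<P>(\<omega> in M. \<bar>partial_sum X f N \<omega> - m N\<bar> > C) < \<epsilon>)"

definition closed_subgroup :: "real set \<Rightarrow> bool" where
  "closed_subgroup G \<longleftrightarrow>
     closed G \<and> 0 \<in> G \<and> (\<forall>x\<in>G. \<forall>y\<in>G. x + y \<in> G) \<and> (\<forall>x\<in>G. - x \<in> G)"

definition alg_range ::
  "'w measure \<Rightarrow> (nat \<Rightarrow> 'w \<Rightarrow> 'a) \<Rightarrow> (nat \<Rightarrow> 'a \<times> 'a \<Rightarrow> real) \<Rightarrow> real set" where
  "alg_range M X f =
     \<Inter>{G. closed_subgroup G \<and>
         (\<exists>c :: nat \<Rightarrow> real. \<forall>n\<ge>1. \<P>(\<omega> in M. f n (X n \<omega>, X (Suc n) \<omega>) - c n \<in> G) = 1)}"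

definition ess_range ::
  "'w measure \<Rightarrow> (nat \<Rightarrow> 'a metric) \<Rightarrow> (nat \<Rightarrow> 'w \<Rightarrow> 'a) \<Rightarrow> (nat \<Rightarrow> 'a \<times> 'a \<Rightarrow> real) \<Rightarrow> real set" where
  "ess_range M S X f =
     \<Inter>{alg_range M X g | g. additive_functional S g \<and> center_tight M X (\<lambda>n xy. f n xy - g n xy)}"

text \<open>
  The essential range is an intersection of closed subgroups of the reals, hence itself one, so
  the three cases below are exhaustive and the \<open>t\<close> in the last one is unique.
\<close>

definition graininess ::
  "'w measure \<Rightarrow> (nat \<Rightarrow> 'a metric) \<Rightarrow> (nat \<Rightarrow> 'w \<Rightarrow> 'a) \<Rightarrow> (nat \<Rightarrow> 'a \<times> 'a \<Rightarrow> real) \<Rightarrow> ereal" where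
  "graininess M S X f =
     (if ess_range M S X f = {0} then \<infinity>
      else if ess_range M S X f = UNIV then 0
      else ereal (THE t. t > 0 \<and> ess_range M S X f = range (\<lambda>k :: int. of_int k * t)))"

text \<open>
  The quotient is taken in the extended reals, where a positive number divided by 0 is \<open>\<infinity>\<close>;
  real division would yield 0 and make the bound hold vacuously when \<open>B N = 0\<close>.
\<close>

definition asymp_le :: "(nat \<Rightarrow> real) \<Rightarrow> (nat \<Rightarrow> real) \<Rightarrow> bool" (infix "\<lesssim>" 50) where
  "A \<lesssim> B \<longleftrightarrow> limsup (\<lambda>N. ereal (A N) / ereal (B N)) \<le> 1"

end

theory Submission
  imports Defs
begin

text \<open>
  By Fourier inversion, the probability that \<open>S\<^sub>N - z\<^sub>N + U\<close> lies in an interval of length \<open>l\<close>, with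
  \<open>U\<close> independent and uniform on \<open>[0, \<eta>]\<close>, is an integral of the characteristic function of \<open>S\<^sub>N\<close>. At \<open>t\<close>
  this function is bounded by \<open>C exp (-c D\<^sub>N(t))\<close>, where \<open>D\<^sub>N(t)\<close> sums structure constants measuring how far
  sums along two random paths with common end points are from agreeing modulo \<open>2\<pi>/t\<close>. Since
  \<open>D\<^sub>N(s - t) \<le> 2 D\<^sub>N(s) + 2 D\<^sub>N(t)\<close> and \<open>D\<^sub>N(t) \<ge> c\<^sub>1 t\<^sup>2 V\<^sub>N - C\<^sub>1\<close> near 0, each bounded interval of frequencies
  contributes at most the order \<open>1 / sqrt V\<^sub>N\<close>, concentrated near the minimum of \<open>D\<^sub>N\<close>. Near 0 the central
  limit theorem gives the Gaussian term. The contribution of any other interval is of smaller order, because at a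
  frequency \<open>t \<noteq> 0\<close> either \<open>D\<^sub>N(t)\<close> tends to infinity or the transform of the window vanishes, provided
  that \<open>exp (itl) = 1\<close> whenever \<open>D\<^sub>N(t)\<close> stays bounded.

  If \<open>D\<^sub>N(t)\<close> stays bounded, then base points can be chosen along which \<open>f\<close> is, up to a center-tight functional,
  a functional with values in cosets of \<open>(2\<pi>/t)\<int>\<close>, so that the essential range lies in \<open>(2\<pi>/t)\<int>\<close>. Hence all
  elements \<open>l\<close> of the essential range are admissible. The interval \<open>(a, b)\<close> is then compared with windows whose
  lengths are the elements of the essential range next to \<open>b - a\<close>.
\<close>

section \<open>From characteristic functions to a smoothed local limit theorem\<close>

text \<open>The obstacle is that away from 0 the sums \<open>D N t\<close> may tend to infinity with
  no rate at all, so that \<open>exp (- c * D N t)\<close> need not be small compared with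
  \<open>1 / sqrt (V N)\<close> at any given frequency. The remedy is to split this exponential into
  two equal factors. One factor, multiplied by the transform of the window, tends to 0 uniformly on
  compact sets of frequencies that avoid 0, by Dini's theorem. The other still has an integral of
  order \<open>1 / sqrt (V N)\<close> over each short interval. The uniform variable is there to
  make the transform of the window decay like \<open>1 / (1 + t^2)\<close>, so that the inversion
  integral converges absolutely and the short intervals can be summed. Its width is never sent to 0:
  it is taken from the positive difference between the length of the interval and the length of the
  window. The decay and the central limit theorem hold for every initial distribution with the
  centring constants of the original chain, which is how the chain started at a point is
  covered.\<close>

lemma decreasing_tendsto_zero_uniform:
  fixes g :: "nat \<Rightarrow> 'a::metric_space \<Rightarrow> real"
  assumes K: "compact K"
    and cont: "\<And>N. continuous_on K (g N)"
    and dec: "\<And>N x. x \<in> K \<Longrightarrow> g (Suc N) x \<le> g N x"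
    and lim: "\<And>x. x \<in> K \<Longrightarrow> (\<lambda>N. g N x) \<longlonglongrightarrow> 0"
    and "e > 0"
  shows "\<forall>\<^sub>F N in sequentially. \<forall>x\<in>K. g N x < e"
proof -
  have "\<exists>U n. open U \<and> x \<in> U \<and> (\<forall>y\<in>U \<inter> K. g n y < e)" if x: "x \<in> K" for x
  proof -
    obtain n where n: "g n x < e"
      using order_tendstoD(2)[OF lim[OF x] \<open>e > 0\<close>] by (auto simp: eventually_sequentially)
    have "open {..<e}" "g n x \<in> {..<e}" using n by auto
    then obtain U where "open U" "x \<in> U" "\<forall>y\<in>K \<inter> U. g n y \<in> {..<e}"
      using cont[of n] x unfolding continuous_on_topological by (metis IntD1 IntD2)
    then show ?thesis by (intro exI[of _ U] exI[of _ n]) auto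
  qed
  then obtain U n where U: "\<And>x. x \<in> K \<Longrightarrow> open (U x) \<and> x \<in> U x \<and> (\<forall>y\<in>U x \<inter> K. g (n x) y < e)"
    by metis
  then obtain C where C: "C \<subseteq> K" "finite C" "K \<subseteq> (\<Union>x\<in>C. U x)"
    using compactE_image[OF K, of K U] by (metis UN_I subsetI)
  have mono: "g m x \<le> g k x" if "x \<in> K" "k \<le> m" for k m x
    using lift_Suc_antimono_le[of "\<lambda>N. g N x"] dec that by blast
  \<comment> \<open>Dini's argument: by monotonicity in \<open>N\<close> the largest index of the
    finite subcover serves all points at once.\<close>
  have "\<forall>x\<in>K. g N x < e" if N: "N \<ge> Max (insert 0 (n ` C))" for N
  proof
    fix y assume y: "y \<in> K"
    then obtain x where x: "x \<in> C" "y \<in> U x" using C by blast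
    then have "g (n x) y < e" using U C y by blast
    moreover have "n x \<le> N" using N C x by simp
    ultimately show "g N y < e" using mono[OF y] by (meson order_le_less_trans)
  qed
  then show ?thesis unfolding eventually_sequentially by blast
qed

lemma nn_integral_gaussian_shift:
  fixes k m :: real
  assumes "k > 0"
  shows "(\<integral>\<^sup>+t. ennreal (exp (- k * (t - m)\<^sup>2)) \<partial>lborel) = ennreal (sqrt (pi / k))"
proof -
  define s where "s = 1 / sqrt (2 * k)"
  have s: "s > 0" "2 * s\<^sup>2 = 1 / k" using assms by (auto simp: s_def power_divide)
  interpret prob_space "density lborel (normal_density m s)" using s(1) by (rule prob_space_normal_density)
  have "1 = (\<integral>\<^sup>+t. ennreal (normal_density m s t) \<partial>lborel)"
    using emeasure_space_1 by (simp add: emeasure_density)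
  also have "\<dots> = (\<integral>\<^sup>+t. ennreal (1 / sqrt (pi / k)) * ennreal (exp (- k * (t - m)\<^sup>2)) \<partial>lborel)"
  proof (rule nn_integral_cong)
    fix t
    have "2 * pi * s\<^sup>2 = pi / k" using s(2) by (metis mult.assoc mult.commute times_divide_eq_right mult_1_right)
    moreover have "- (t - m)\<^sup>2 / (2 * s\<^sup>2) = - k * (t - m)\<^sup>2" using s(2) assms by simp
    ultimately show "ennreal (normal_density m s t) = ennreal (1 / sqrt (pi / k)) * ennreal (exp (- k * (t - m)\<^sup>2))"
      unfolding normal_density_def using assms by (simp add: ennreal_mult[symmetric])
  qed
  also have "\<dots> = ennreal (1 / sqrt (pi / k)) * (\<integral>\<^sup>+t. ennreal (exp (- k * (t - m)\<^sup>2)) \<partial>lborel)"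
    by (rule nn_integral_cmult) simp
  finally have "ennreal (sqrt (pi / k)) * 1 = ennreal (sqrt (pi / k)) * (ennreal (1 / sqrt (pi / k)) * (\<integral>\<^sup>+t. ennreal (exp (- k * (t - m)\<^sup>2)) \<partial>lborel))"
    by simp
  also have "\<dots> = (ennreal (sqrt (pi / k)) * ennreal (1 / sqrt (pi / k))) * (\<integral>\<^sup>+t. ennreal (exp (- k * (t - m)\<^sup>2)) \<partial>lborel)"
    by (simp add: mult.assoc)
  also have "ennreal (sqrt (pi / k)) * ennreal (1 / sqrt (pi / k)) = 1"
    using assms by (simp add: ennreal_mult[symmetric])
  finally show ?thesis by simp
qed

text \<open>The quadratic lower bound near 0 transfers to any interval by recentring at the minimum of \<open>D\<close>.\<close>

lemma nn_integral_exp_minus_interval: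
  fixes D :: "real \<Rightarrow> real"
  assumes cont: "continuous_on UNIV D"
    and tri: "\<And>x y. D (x - y) \<le> 2 * D x + 2 * D y"
    and low: "\<And>x. \<bar>x\<bar> \<le> r \<Longrightarrow> D x \<ge> c1 * x\<^sup>2 * V - C1"
    and pos: "c > 0" "c1 > 0" "V > 0"
    and I: "v - u \<le> r" "u \<le> v"
  shows "(\<integral>\<^sup>+t. ennreal (exp (- c * D t)) * indicator {u..v} t \<partial>lborel)
           \<le> ennreal (exp (c * C1 / 4) * sqrt (4 * pi / (c * c1)) / sqrt V)"
proof -
  obtain m where m: "m \<in> {u..v}" "\<And>t. t \<in> {u..v} \<Longrightarrow> D m \<le> D t"
    using continuous_attains_inf[of "{u..v}" D] I continuous_on_subset[OF cont] by auto
  \<comment> \<open>Since \<open>m\<close> minimises \<open>D\<close>, the inequality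
    \<open>tri\<close> bounds \<open>D (t - m)\<close> by \<open>4 * D t\<close>, and the quadratic
    bound near 0 applies to \<open>t - m\<close>.\<close>
  have "D t \<ge> (c1 * (t - m)\<^sup>2 * V - C1) / 4" if "t \<in> {u..v}" for t
  proof -
    have "c1 * (t - m)\<^sup>2 * V - C1 \<le> D (t - m)" using m(1) that I by (intro low) auto
    also have "\<dots> \<le> 4 * D t" using tri[of t m] m(2)[OF that] by linarith
    finally show ?thesis by simp
  qed
  then have *: "- c * D t \<le> c * C1 / 4 + - (c * c1 * V / 4) * (t - m)\<^sup>2" if "t \<in> {u..v}" for t
    using that mult_left_mono[of "(c1 * (t - m)\<^sup>2 * V - C1) / 4" "D t" c] pos by (auto simp: algebra_simps)
  have "(\<integral>\<^sup>+t. ennreal (exp (- c * D t)) * indicator {u..v} t \<partial>lborel)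
     \<le> (\<integral>\<^sup>+t. ennreal (exp (c * C1 / 4)) * ennreal (exp (- (c * c1 * V / 4) * (t - m)\<^sup>2)) \<partial>lborel)"
    by (rule nn_integral_mono)
       (auto split: split_indicator simp: ennreal_mult[symmetric] exp_add[symmetric] intro!: ennreal_leI *[simplified])
  also have "\<dots> = ennreal (exp (c * C1 / 4)) * ennreal (sqrt (pi / (c * c1 * V / 4)))"
    using pos by (subst nn_integral_cmult) (simp, simp only: nn_integral_gaussian_shift[of "c * c1 * V / 4" m] mult_pos_pos divide_pos_pos zero_less_numeral)
  also have "\<dots> = ennreal (exp (c * C1 / 4) * sqrt (4 * pi / (c * c1)) / sqrt V)"
    using pos by (simp add: ennreal_mult[symmetric] real_sqrt_divide real_sqrt_mult)
  finally show ?thesis .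
qed

section \<open>Fourier inversion for intervals smoothed by a uniform variable\<close>

abbreviation smoother :: "real \<Rightarrow> real measure" where
  "smoother \<eta> \<equiv> uniform_measure lborel {0..\<eta>}"

text \<open>This is the kernel of Levy's inversion formula for the window from
  \<open>\<alpha>\<close> to \<open>\<alpha> + l\<close>, multiplied by the characteristic function
  of the smoothing variable. Division by zero gives it the value 0 at \<open>t = 0\<close>, where
  its limit is \<open>l\<close>; this single point is a null set.\<close>

definition window_ft :: "real \<Rightarrow> real \<Rightarrow> real \<Rightarrow> real \<Rightarrow> complex" where
  "window_ft \<alpha> l \<eta> t = (iexp (-(t * \<alpha>)) - iexp (-(t * (\<alpha> + l)))) / (\<i> * t) * char (smoother \<eta>) t"

lemma real_distribution_smoother: "\<eta> > 0 \<Longrightarrow> real_distribution (smoother \<eta>)"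
  by (intro real_distribution.intro real_distribution_axioms.intro prob_space_uniform_measure) auto

lemma integral_smoother:
  fixes g :: "real \<Rightarrow> 'b::{banach, second_countable_topology}"
  assumes "\<eta> > 0" and [measurable]: "g \<in> borel_measurable borel"
  shows "(\<integral>x. g x \<partial>smoother \<eta>) = (1 / \<eta>) *\<^sub>R (\<integral>x. indicator {0..\<eta>} x *\<^sub>R g x \<partial>lborel)"
proof -
  have "smoother \<eta> = density lborel (\<lambda>x. ennreal (indicator {0..\<eta>} x / \<eta>))"
    unfolding uniform_measure_def using \<open>\<eta> > 0\<close>
    by (intro density_cong) (auto split: split_indicator simp: divide_ennreal[symmetric])
  then have "(\<integral>x. g x \<partial>smoother \<eta>) = (\<integral>x. (indicator {0..\<eta>} x / \<eta>) *\<^sub>R g x \<partial>lborel)"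
    using \<open>\<eta> > 0\<close> by (simp add: integral_density)
  also have "\<dots> = (\<integral>x. (1 / \<eta>) *\<^sub>R (indicator {0..\<eta>} x *\<^sub>R g x) \<partial>lborel)"
    by (intro Bochner_Integration.integral_cong) auto
  finally show ?thesis by (simp only: integral_scaleR_right)
qed

lemma char_smoother:
  assumes "\<eta> > 0" "t \<noteq> 0"
  shows "char (smoother \<eta>) t = (iexp (t * \<eta>) - 1) / (\<i> * (t * \<eta>))"
proof -
  have "(\<integral>x. indicator {0..\<eta>} x *\<^sub>R iexp (t * x) \<partial>lborel) = iexp (t * \<eta>) / (\<i> * t) - iexp (t * 0) / (\<i> * t)"
    using assms
    by (intro integral_FTC_Icc)
       (auto intro!: derivative_eq_intros continuous_intros simp: has_vector_derivative_complex_iff Re_exp Im_exp Re_divide Im_divide power2_eq_square)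
  then show ?thesis
    unfolding char_def using assms by (subst integral_smoother) (auto simp: scaleR_conv_of_real field_simps)
qed

text \<open>The two factors are bounded by \<open>l\<close> and 1 near 0, and each of them is of
  order \<open>1 / |t|\<close> far away. The second such factor is what the smoothing contributes,
  and with it the product becomes integrable.\<close>

lemma norm_window_ft_le:
  assumes "\<eta> > 0" "l \<ge> 0"
  shows "cmod (window_ft \<alpha> l \<eta> t) \<le> (l + 4 / \<eta>) / (1 + t\<^sup>2)"
proof (cases "t = 0")
  case False
  interpret real_distribution "smoother \<eta>" using assms by (intro real_distribution_smoother)
  let ?A = "cmod ((iexp (-(t * \<alpha>)) - iexp (-(t * (\<alpha> + l)))) / (\<i> * t))" and ?B = "cmod (char (smoother \<eta>) t)"
  have A1: "?A \<le> l"
    using Levy_Inversion_aux2[of "- (\<alpha> + l)" "- \<alpha>" t] assms False by (simp add: algebra_simps)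
  have "cmod (iexp (-(t * \<alpha>)) - iexp (-(t * (\<alpha> + l)))) \<le> 1 + 1"
    by (intro order_trans[OF norm_triangle_ineq4] add_mono) (simp_all del: of_real_minus of_real_mult)
  then have A2: "?A \<le> 2 / \<bar>t\<bar>" using False by (simp add: norm_divide norm_mult divide_right_mono)
  have B1: "?B \<le> 1" by (rule cmod_char_le_1)
  have "cmod (iexp (t * \<eta>) - 1) \<le> 1 + 1"
    by (intro order_trans[OF norm_triangle_ineq4] add_mono) (simp_all del: of_real_minus of_real_mult)
  then have B2: "?B \<le> 2 / (\<bar>t\<bar> * \<eta>)" using False assms 
    by (simp add: char_smoother norm_divide norm_mult divide_right_mono)
  have "t\<^sup>2 * (?A * ?B) \<le> t\<^sup>2 * ((2 / \<bar>t\<bar>) * (2 / (\<bar>t\<bar> * \<eta>)))"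
    by (intro mult_left_mono mult_mono A2 B2) auto
  also have "\<dots> = 4 / \<eta>" using False assms by (simp add: field_simps power2_eq_square)
  finally have "(1 + t\<^sup>2) * (?A * ?B) \<le> l + 4 / \<eta>"
    using mult_mono[OF A1 B1] assms by (simp add: algebra_simps)
  moreover have "1 + t\<^sup>2 > 0" by (simp add: add_pos_nonneg)
  moreover have "cmod (window_ft \<alpha> l \<eta> t) = ?A * ?B" unfolding window_ft_def by (rule norm_mult)
  ultimately show ?thesis
    by (simp only: pos_le_divide_eq mult.commute)
qed (use assms in \<open>simp add: window_ft_def\<close>)

text \<open>The contributions of the two end points cancel when the length of the window is a
  multiple of the period \<open>2 * pi / t\<close>. Frequencies at which the characteristic
  functions do not decay are disposed of in this way.\<close>

lemma window_ft_eq_0: "t \<noteq> 0 \<Longrightarrow> iexp (t * l) = 1 \<Longrightarrow> window_ft \<alpha> l \<eta> t = 0"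
  by (simp add: window_ft_def exp_diff exp_add exp_minus algebra_simps)

lemma measurable_window_ft [measurable]:
  "\<eta> > 0 \<Longrightarrow> window_ft \<alpha> l \<eta> \<in> borel_measurable borel"
  unfolding window_ft_def
  using real_distribution.char_measurable[OF real_distribution_smoother, of \<eta>] by measurable

lemma continuous_window_ft: "\<eta> > 0 \<Longrightarrow> continuous_on (- {0}) (window_ft \<alpha> l \<eta>)"
  unfolding window_ft_def
  using real_distribution.isCont_char[OF real_distribution_smoother, of \<eta>]
  by (intro continuous_intros continuous_at_imp_continuous_on) auto

lemma window_ft_at_0:
  assumes "\<eta> > 0" "l \<ge> 0"
  shows "(window_ft \<alpha> l \<eta> \<longlongrightarrow> of_real l) (at 0)"
proof -
  interpret real_distribution "smoother \<eta>" using assms by (intro real_distribution_smoother)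
  have "((\<lambda>t. (iexp (-(t * \<alpha>)) - iexp (-(t * (\<alpha> + l)))) / (\<i> * t)) \<longlongrightarrow> of_real ((\<alpha> + l) - \<alpha>)) (at 0)"
    using Levy_Inversion_aux1[of \<alpha> "\<alpha> + l"] assms by simp
  moreover have "(char (smoother \<eta>) \<longlongrightarrow> 1) (at 0)"
    using isCont_char[of 0] by (simp add: isCont_def char_zero)
  ultimately have "((\<lambda>t. (iexp (-(t * \<alpha>)) - iexp (-(t * (\<alpha> + l)))) / (\<i> * t) * char (smoother \<eta>) t) \<longlongrightarrow> of_real l * 1) (at 0)"
    by (intro tendsto_mult) simp_all
  then show ?thesis unfolding window_ft_def[abs_def] by simp
qed

lemma integrable_inverse_1_plus_square_UNIV: "integrable lborel (\<lambda>t::real. 1 / (1 + t\<^sup>2))"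
  using integrable_inverse_1_plus_square by (simp add: set_integrable_def inverse_eq_divide)

definition smoothed_prob :: "real measure \<Rightarrow> real \<Rightarrow> real \<Rightarrow> real \<Rightarrow> real" where
  "smoothed_prob Q \<alpha> l \<eta> = measure (Q \<Otimes>\<^sub>M smoother \<eta>) {w. fst w + snd w \<in> {\<alpha><..\<alpha> + l}}"

text \<open>Levy's inversion formula is applied to the law \<open>R\<close> of the smoothed
  variable. This law has no atoms, because the smoothing variable has none, and integrability turns
  the principal value in the formula into a Lebesgue integral.\<close>

lemma smoothed_prob_inversion:
  assumes Q: "real_distribution Q" and "\<eta> > 0" "l \<ge> 0"
  shows "integrable lborel (\<lambda>t. window_ft \<alpha> l \<eta> t * char Q t)"
    and "complex_of_real (smoothed_prob Q \<alpha> l \<eta>) = 1 / (2 * pi) * (CLBINT t. window_ft \<alpha> l \<eta> t * char Q t)"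
proof -
  interpret Q: real_distribution Q by fact
  interpret U: real_distribution "smoother \<eta>" using assms by (intro real_distribution_smoother)
  interpret P: pair_prob_space Q "smoother \<eta>" ..
  let ?P = "Q \<Otimes>\<^sub>M smoother \<eta>"
  have sP [measurable_cong]: "sets ?P = sets (borel \<Otimes>\<^sub>M borel)" by (intro sets_pair_measure_cong) auto
  define R where "R = distr ?P borel (\<lambda>w. fst w + snd w)"
  interpret R: real_distribution R unfolding R_def by (intro P.real_distribution_distr) simp
  have R_char: "char R t = char Q t * char (smoother \<eta>) t" for t
  proof -
    have "char R t = (CLINT w|?P. iexp (t * (fst w + snd w)))" by (simp add: R_def char_def integral_distr)
    also have "\<dots> = (CLINT x|Q. CLINT y|smoother \<eta>. iexp (t * (x + y)))"
      by (subst P.integral_fst'[symmetric]) (auto intro!: P.integrable_const_bound[where B = 1])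
    also have "\<dots> = (CLINT x|Q. CLINT y|smoother \<eta>. iexp (t * x) * iexp (t * y))"
      by (simp add: exp_add algebra_simps)
    finally show ?thesis by (simp add: char_def)
  qed
  have R_atom: "measure R {x} = 0" for x
  proof -
    have "emeasure R {x} = emeasure ?P {w \<in> space ?P. fst w + snd w = x}"
      unfolding R_def by (subst emeasure_distr) (auto simp: vimage_def intro!: arg_cong[where f = "emeasure ?P"])
    also have "\<dots> = (\<integral>\<^sup>+s. emeasure (smoother \<eta>) (Pair s -` {w \<in> space ?P. fst w + snd w = x}) \<partial>Q)"
      by (intro U.emeasure_pair_measure_alt) measurable
    also have "\<dots> = (\<integral>\<^sup>+s. emeasure (smoother \<eta>) {x - s} \<partial>Q)"
      by (intro nn_integral_cong arg_cong2[where f = emeasure]) (auto simp: space_pair_measure)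
    also have "\<dots> = 0"
    proof -
      have "emeasure lborel ({0..\<eta>} \<inter> {y}) = 0" for y :: real
        by (rule emeasure_eq_0[of "{y}"]) auto
      then show ?thesis by (simp add: nn_integral_0_iff_AE)
    qed
    finally show ?thesis by (simp add: measure_def)
  qed
  have meas: "(\<lambda>t. window_ft \<alpha> l \<eta> t * char Q t) \<in> borel_measurable borel" using assms by measurable
  have bnd: "cmod (window_ft \<alpha> l \<eta> t * char Q t) \<le> (l + 4 / \<eta>) * (1 / (1 + t\<^sup>2))" for t
    using mult_mono[OF norm_window_ft_le[of \<eta> l \<alpha> t] Q.cmod_char_le_1[of t]] assms
    by (simp add: norm_mult)
  have dom: "integrable lborel (\<lambda>t. (l + 4 / \<eta>) * (1 / (1 + t\<^sup>2)))"
    by (intro integrable_mult_right integrable_inverse_1_plus_square_UNIV)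
  show int: "integrable lborel (\<lambda>t. window_ft \<alpha> l \<eta> t * char Q t)"
    by (rule Bochner_Integration.integrable_bound[OF dom]) (use meas in \<open>auto intro!: AE_I2 order_trans[OF bnd abs_ge_self] simp del: abs_mult abs_divide times_divide_eq_right\<close>)
  have "(\<lambda>T. CLBINT t=-real T..real T. window_ft \<alpha> l \<eta> t * char Q t) \<longlonglongrightarrow> (CLBINT t. window_ft \<alpha> l \<eta> t * char Q t)"
  proof -
    have "(\<lambda>T. CLBINT t. indicator {-real T<..<real T} t *\<^sub>R (window_ft \<alpha> l \<eta> t * char Q t)) \<longlonglongrightarrow> (CLBINT t. window_ft \<alpha> l \<eta> t * char Q t)"
    proof (rule integral_dominated_convergence[OF _ _ dom])
      show "AE t in lborel. (\<lambda>T. indicator {-real T<..<real T} t *\<^sub>R (window_ft \<alpha> l \<eta> t * char Q t)) \<longlonglongrightarrow> window_ft \<alpha> l \<eta> t * char Q t"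
      proof (intro AE_I2 tendsto_eventually)
        fix t :: real
        have "\<forall>\<^sub>F T in sequentially. real T > \<bar>t\<bar>" using eventually_gt_at_top filterlim_iff filterlim_real_sequentially by metis
        then show "\<forall>\<^sub>F T in sequentially. indicator {-real T<..<real T} t *\<^sub>R (window_ft \<alpha> l \<eta> t * char Q t) = window_ft \<alpha> l \<eta> t * char Q t"
          by eventually_elim (auto split: split_indicator)
      qed
    qed (use meas bnd in \<open>auto split: split_indicator intro!: add_nonneg_nonneg simp: assms less_imp_le\<close>)
    then show ?thesis by (simp add: interval_lebesgue_integral_def set_lebesgue_integral_def)
  qed
  then have "(\<lambda>T. 1 / (2 * pi) * (CLBINT t=-real T..real T. window_ft \<alpha> l \<eta> t * char Q t)) \<longlonglongrightarrow> 1 / (2 * pi) * (CLBINT t. window_ft \<alpha> l \<eta> t * char Q t)"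
    by (intro tendsto_intros)
  moreover have "(\<lambda>T. 1 / (2 * pi) * (CLBINT t=-real T..real T. window_ft \<alpha> l \<eta> t * char Q t)) \<longlonglongrightarrow> measure R {\<alpha><..\<alpha> + l}"
    using R.Levy_Inversion[of \<alpha> "\<alpha> + l"] R_atom assms
    by (simp add: window_ft_def R_char mult_ac)
  ultimately have "complex_of_real (measure R {\<alpha><..\<alpha> + l}) = 1 / (2 * pi) * (CLBINT t. window_ft \<alpha> l \<eta> t * char Q t)"
    by (rule LIMSEQ_unique[rotated])
  also have "measure R {\<alpha><..\<alpha> + l} = smoothed_prob Q \<alpha> l \<eta>"
    unfolding R_def smoothed_prob_def
    by (subst measure_distr) (auto simp: vimage_def space_pair_measure intro!: arg_cong[where f = "measure ?P"])
  finally show "complex_of_real (smoothed_prob Q \<alpha> l \<eta>) = 1 / (2 * pi) * (CLBINT t. window_ft \<alpha> l \<eta> t * char Q t)" .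
qed

text \<open>The analytic half of the argument, separated from the chain: all that is retained of it
  is a bound on characteristic functions through increasing sums \<open>D N\<close> and their limit
  on the scale \<open>1 / sqrt (V N)\<close>. The number \<open>z\<close> is the limit of the
  normalised centring.\<close>

locale charfun_decay =
  fixes Q :: "nat \<Rightarrow> real measure" and D :: "nat \<Rightarrow> real \<Rightarrow> real" and V :: "nat \<Rightarrow> real"
    and C c c1 C1 r z :: real
  assumes Q: "\<And>N. real_distribution (Q N)"
    and D_cont: "\<And>N. continuous_on UNIV (D N)"
    and D_mono: "\<And>N t. D N t \<le> D (Suc N) t"
    and D_tri: "\<And>N s t. D N (s - t) \<le> 2 * D N s + 2 * D N t"
    and D_low: "\<And>N t. \<bar>t\<bar> \<le> r \<Longrightarrow> D N t \<ge> c1 * t\<^sup>2 * V N - C1"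
    and decay: "\<And>N t. cmod (char (Q N) t) \<le> C * exp (- c * D N t)"
    and pos: "c > 0" "c1 > 0" "r > 0" "C \<ge> 0"
    and V: "filterlim V at_top sequentially"
    and clt: "\<And>t. (\<lambda>N. char (Q N) (t / sqrt (V N))) \<longlonglongrightarrow> complex_of_real (exp (- t\<^sup>2 / 2)) * iexp (- (t * z))"
begin

lemma D_measurable [measurable]: "D N \<in> borel_measurable borel"
  using D_cont by (intro borel_measurable_continuous_onI)

lemma V_pos: "\<forall>\<^sub>F N in sequentially. V N > 0"
  using V by (simp add: filterlim_at_top_dense)

lemma interval_bound:
  assumes "k > 0" "V N > 0" "v - u \<le> r" "u \<le> v"
  shows "(\<integral>\<^sup>+t. ennreal (exp (- k * D N t)) * indicator {u..v} t \<partial>lborel)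
           \<le> ennreal (exp (k * C1 / 4) * sqrt (4 * pi / (k * c1)) / sqrt (V N))"
  using assms by (intro nn_integral_exp_minus_interval[where r = r] D_cont D_tri D_low) (auto simp: pos)

text \<open>Rescaling \<open>t\<close> by \<open>sqrt (V N)\<close> spreads the integral over the
  whole line. There \<open>D_low\<close> supplies a Gaussian majorant, \<open>clt\<close> gives the
  pointwise limit of the characteristic function, and the window contributes its value
  \<open>l\<close> at 0.\<close>

lemma central_part:
  assumes "\<eta> > 0" "l \<ge> 0"
  shows "(\<lambda>N. sqrt (V N) *\<^sub>R (CLBINT t. indicator {-r..r} t *\<^sub>R (window_ft \<alpha> l \<eta> t * char (Q N) t)))
           \<longlonglongrightarrow> of_real (l * sqrt (2 * pi) * exp (- z\<^sup>2 / 2))"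
proof -
  let ?w = "window_ft \<alpha> l \<eta>"
  let ?s = "\<lambda>N t. indicator {-r..r} (t / sqrt (V N)) *\<^sub>R (?w (t / sqrt (V N)) * char (Q N) (t / sqrt (V N)))"
  have [measurable]: "char (Q N) \<in> borel_measurable borel" for N by (rule real_distribution.char_measurable[OF Q])
  have "\<forall>\<^sub>F N in sequentially. sqrt (V N) *\<^sub>R (CLBINT t. indicator {-r..r} t *\<^sub>R (?w t * char (Q N) t)) = (CLBINT t. ?s N t)"
    using V_pos
  proof eventually_elim
    case (elim N)
    then show ?case
      by (subst lborel_integral_real_affine[where c = "1 / sqrt (V N)" and t = 0]) simp_all
  qed
  moreover have "(\<lambda>N. CLBINT t. ?s N t) \<longlonglongrightarrow> (CLBINT t. of_real l * (complex_of_real (exp (- t\<^sup>2 / 2)) * iexp (- (t * z))))"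
  proof -
    let ?B = "(l + 4 / \<eta>) * C * exp (c * C1)"
    \<comment> \<open>The majorant is valid only where the variance is positive, so the sequence is
      shifted past the finitely many exceptions.\<close>
    obtain N0 where N0: "\<And>N. N \<ge> N0 \<Longrightarrow> V N > 0" using V_pos by (auto simp: eventually_sequentially)
    have "(\<lambda>N. CLBINT t. ?s (N + N0) t) \<longlonglongrightarrow> (CLBINT t. of_real l * (complex_of_real (exp (- t\<^sup>2 / 2)) * iexp (- (t * z))))"
    proof (rule integral_dominated_convergence[where w = "\<lambda>t. ?B * exp (- (c * c1) * (t - 0)\<^sup>2)"])
      have "integrable lborel (\<lambda>t. exp (- (c * c1) * (t - 0)\<^sup>2))"
        by (rule integrableI_nn_integral_finite[where x = "sqrt (pi / (c * c1))"], simp, simp)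
           (rule nn_integral_gaussian_shift, use pos in simp)
      then show "integrable lborel (\<lambda>t. ?B * exp (- (c * c1) * (t - 0)\<^sup>2))" by (rule integrable_mult_right)
      have "norm (?s N t) \<le> ?B * exp (- (c * c1) * (t - 0)\<^sup>2)" if N: "V N > 0" for N t
      proof (cases "\<bar>t / sqrt (V N)\<bar> \<le> r")
        case True
        have "c1 * t\<^sup>2 - C1 \<le> D N (t / sqrt (V N))"
          using D_low[OF True, of N] N by (simp add: power_divide)
        then have "- c * D N (t / sqrt (V N)) \<le> c * C1 + - (c * c1) * (t - 0)\<^sup>2"
          using mult_left_mono[of "c1 * t\<^sup>2 - C1" "D N (t / sqrt (V N))" c] pos by (simp add: algebra_simps)
        then have "C * exp (- c * D N (t / sqrt (V N))) \<le> C * (exp (c * C1) * exp (- (c * c1) * (t - 0)\<^sup>2))"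
          using pos by (intro mult_left_mono) (auto simp: exp_add[symmetric])
        with decay[of N "t / sqrt (V N)"] have 1: "cmod (char (Q N) (t / sqrt (V N))) \<le> C * (exp (c * C1) * exp (- (c * c1) * (t - 0)\<^sup>2))"
          by linarith
        have "cmod (?w (t / sqrt (V N))) \<le> (l + 4 / \<eta>) / (1 + (t / sqrt (V N))\<^sup>2)"
          using assms by (rule norm_window_ft_le)
        also have "\<dots> \<le> (l + 4 / \<eta>) / 1" using assms by (intro divide_left_mono) (auto simp: add_pos_nonneg)
        finally have 2: "cmod (?w (t / sqrt (V N))) \<le> l + 4 / \<eta>" by simp
        have "norm (?s N t) = cmod (?w (t / sqrt (V N))) * cmod (char (Q N) (t / sqrt (V N)))"
        proof -
          have "t / sqrt (V N) \<in> {-r..r}" using True by (auto simp only: abs_le_iff atLeastAtMost_iff)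
          then show ?thesis by (simp add: norm_mult)
        qed
        also have "\<dots> \<le> (l + 4 / \<eta>) * (C * (exp (c * C1) * exp (- (c * c1) * (t - 0)\<^sup>2)))"
          using assms by (intro mult_mono 1 2) auto
        finally show ?thesis by (simp only: mult_ac)
      next
        case False
        then show ?thesis using assms pos by (auto simp: indicator_def)
      qed
      then show "\<And>i. AE t in lborel. norm (?s (i + N0) t) \<le> ?B * exp (- (c * c1) * (t - 0)\<^sup>2)"
        using N0 by auto
      have "(\<lambda>N. ?s N t) \<longlonglongrightarrow> of_real l * (complex_of_real (exp (- t\<^sup>2 / 2)) * iexp (- (t * z)))" if "t \<noteq> 0" for t
      proof -
        have "(\<lambda>N. t / sqrt (V N)) \<longlonglongrightarrow> 0"
          by (intro tendsto_divide_0[OF tendsto_const] filterlim_at_top_imp_at_infinity filterlim_compose[OF sqrt_at_top V])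
        then have l0: "filterlim (\<lambda>N. t / sqrt (V N)) (at 0) sequentially"
          unfolding filterlim_at using V_pos that by (auto elim: eventually_mono)
        have "(\<lambda>N. ?w (t / sqrt (V N))) \<longlonglongrightarrow> of_real l"
          by (rule filterlim_compose[OF window_ft_at_0[OF assms] l0])
        moreover have "(\<lambda>N. indicator {-r..r} (t / sqrt (V N)) :: real) \<longlonglongrightarrow> 1"
        proof (rule tendsto_eventually)
          have "\<forall>\<^sub>F N in sequentially. \<bar>t / sqrt (V N)\<bar> < r"
            using \<open>(\<lambda>N. t / sqrt (V N)) \<longlonglongrightarrow> 0\<close> pos by (metis order_tendstoD(2) tendsto_rabs_zero)
          then show "\<forall>\<^sub>F N in sequentially. indicator {-r..r} (t / sqrt (V N)) = (1::real)"
          proof eventually_elim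
            case (elim N)
            then have "t / sqrt (V N) \<in> {-r..r}" by (auto simp only: abs_less_iff atLeastAtMost_iff less_imp_le)
            then show ?case by simp
          qed
        qed
        ultimately have "(\<lambda>N. ?s N t) \<longlonglongrightarrow> 1 *\<^sub>R (of_real l * (complex_of_real (exp (- t\<^sup>2 / 2)) * iexp (- (t * z))))"
          using clt[of t] by (intro tendsto_intros)
        then show ?thesis by simp
      qed
      then show "AE t in lborel. (\<lambda>i. ?s (i + N0) t) \<longlonglongrightarrow> of_real l * (complex_of_real (exp (- t\<^sup>2 / 2)) * iexp (- (t * z)))"
        by (intro eventually_mono[OF AE_lborel_singleton[of 0]] LIMSEQ_ignore_initial_segment[of "\<lambda>N. ?s N t" for t])
    qed (use assms in measurable)
    then show ?thesis by (rule LIMSEQ_offset)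
  qed
  moreover have "(CLBINT t. of_real l * (complex_of_real (exp (- t\<^sup>2 / 2)) * iexp (- (t * z)))) = of_real (l * sqrt (2 * pi) * exp (- z\<^sup>2 / 2))"
  proof -
    \<comment> \<open>A Gaussian is its own Fourier transform up to a factor, so the limit integral
      can be read off from the characteristic function of the normal law.\<close>
    have "of_real (exp (- z\<^sup>2 / 2)) = char std_normal_distribution (- z)"
      by (simp add: char_std_normal_distribution)
    also have "\<dots> = (CLBINT t. std_normal_density t *\<^sub>R iexp (- z * t))"
      unfolding char_def by (subst integral_density) auto
    also have "\<dots> = (CLBINT t. of_real (1 / sqrt (2 * pi)) * (complex_of_real (exp (- t\<^sup>2 / 2)) * iexp (- (t * z))))"
      by (intro Bochner_Integration.integral_cong) (auto simp: std_normal_density_def scaleR_conv_of_real mult_ac exp_of_real[symmetric])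
    also have "\<dots> = of_real (1 / sqrt (2 * pi)) * (CLBINT t. complex_of_real (exp (- t\<^sup>2 / 2)) * iexp (- (t * z)))"
      by (rule integral_mult_right_zero)
    finally have "(CLBINT t. complex_of_real (exp (- t\<^sup>2 / 2)) * iexp (- (t * z))) = of_real (sqrt (2 * pi)) * of_real (exp (- z\<^sup>2 / 2))"
      by (simp add: field_simps)
    then show ?thesis by (simp add: mult_ac)
  qed
  ultimately show ?thesis by (simp only: tendsto_cong)
qed

text \<open>The integral is localised to windows of radius \<open>\<rho>\<close> around a point
  \<open>s\<close>. The local mass \<open>\<Theta> N s\<close> is bounded uniformly in
  \<open>s\<close> and tends to 0 for each \<open>s\<close>, so that dominated convergence against
  the integrable weight \<open>W\<close> handles all frequencies together.\<close>

lemma outer_part: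
  assumes "\<eta> > 0" "l \<ge> 0"
    and per: "\<And>t. t \<noteq> 0 \<Longrightarrow> bdd_above (range (\<lambda>N. D N t)) \<Longrightarrow> iexp (t * l) = 1"
  shows "(\<lambda>N. \<integral>\<^sup>+t. ennreal (sqrt (V N) * cmod (window_ft \<alpha> l \<eta> t * char (Q N) t)) * indicator (- {-r..r}) t \<partial>lborel) \<longlonglongrightarrow> 0"
proof -
  let ?w = "window_ft \<alpha> l \<eta>"
  \<comment> \<open>Windows of length \<open>2 * \<rho>\<close> are short enough for
    \<open>interval_bound\<close>, and \<open>\<rho> \<le> 1\<close> makes the values of
    \<open>1 / (1 + t^2)\<close> at nearby points comparable.\<close>
  define \<rho> where "\<rho> = min (r / 2) 1"
  have \<rho>: "\<rho> > 0" "2 * \<rho> \<le> r" "\<rho> \<le> 1" using pos by (auto simp: \<rho>_def)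
  define A where "A = l + 4 / \<eta>"
  have A: "A \<ge> 0" using assms by (simp add: A_def)
  have wA: "cmod (?w t) * (1 + t\<^sup>2) \<le> A" for t
    using norm_window_ft_le[of \<eta> l \<alpha> t] assms by (simp add: A_def pos_le_divide_eq add_pos_nonneg)
  define K where "K k = exp (k * C1 / 4) * sqrt (4 * pi / (k * c1))" for k
  have K0 [simp]: "K c \<ge> 0" "K (c / 2) \<ge> 0" using pos by (auto simp: K_def)
  have Kb: "(\<integral>\<^sup>+t. ennreal (sqrt (V N) * exp (- k * D N t)) * indicator {s - \<rho>..s + \<rho>} t \<partial>lborel) \<le> ennreal (K k)"
    if "k > 0" "V N > 0" for k N s
  proof -
    have "(\<integral>\<^sup>+t. ennreal (sqrt (V N) * exp (- k * D N t)) * indicator {s - \<rho>..s + \<rho>} t \<partial>lborel)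
        = ennreal (sqrt (V N)) * (\<integral>\<^sup>+t. ennreal (exp (- k * D N t)) * indicator {s - \<rho>..s + \<rho>} t \<partial>lborel)"
      using that by (subst nn_integral_cmult[symmetric]) (auto simp: ennreal_mult mult_ac)
    also have "\<dots> \<le> ennreal (sqrt (V N)) * ennreal (K k / sqrt (V N))"
      unfolding K_def using that \<rho> by (intro mult_left_mono interval_bound) auto
    also have "\<dots> = ennreal (K k)" using that by (subst ennreal_mult'[symmetric]) simp_all
    finally show ?thesis .
  qed
  \<comment> \<open>The factor \<open>1 + t^2\<close> cancels the decay of the window, so that the
    bound on the local mass does not depend on its position. The decay comes back later as the
    weight \<open>W\<close>.\<close>
  define h where "h N t = sqrt (V N) * (cmod (?w t) * (1 + t\<^sup>2)) * (C * exp (- c * D N t))" for N t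
  have h0: "h N t \<ge> 0" if "V N > 0" for N t using that pos by (simp add: h_def)
  have hm [measurable]: "h N \<in> borel_measurable borel" for N unfolding h_def using assms by measurable
  define \<Theta> where "\<Theta> N s = (\<integral>\<^sup>+t. ennreal (h N t) * (indicator (- {-r..r}) t * indicator {s - \<rho>..s + \<rho>} t) \<partial>lborel)" for N s
  have ind_m [measurable]: "(\<lambda>(s, t). indicator {s - \<rho>..s + \<rho>} t :: ennreal) \<in> borel_measurable (borel \<Otimes>\<^sub>M borel)"
  proof -
    have "(\<lambda>(s, t). indicator {s - \<rho>..s + \<rho>} t :: ennreal) = (\<lambda>w. if fst w - \<rho> \<le> snd w \<and> snd w \<le> fst w + \<rho> then 1 else 0)"
      by (auto simp: fun_eq_iff indicator_def)
    then show ?thesis by simp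
  qed
  have [measurable]: "\<Theta> N \<in> borel_measurable borel" for N
    unfolding \<Theta>_def by measurable
  have \<Theta>_le: "\<Theta> N s \<le> ennreal (A * C * K c)" if "V N > 0" for N s
  proof -
    have "\<Theta> N s \<le> (\<integral>\<^sup>+t. ennreal (A * C) * (ennreal (sqrt (V N) * exp (- c * D N t)) * indicator {s - \<rho>..s + \<rho>} t) \<partial>lborel)"
      unfolding \<Theta>_def
    proof (intro nn_integral_mono)
      fix t
      have "h N t \<le> sqrt (V N) * A * (C * exp (- c * D N t))"
        unfolding h_def using that pos wA by (intro mult_right_mono mult_left_mono) auto
      then have "ennreal (h N t) \<le> ennreal (A * C) * ennreal (sqrt (V N) * exp (- c * D N t))"
        using that A pos by (simp add: ennreal_mult[symmetric] mult_ac ennreal_leI)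
      then show "ennreal (h N t) * (indicator (- {-r..r}) t * indicator {s - \<rho>..s + \<rho>} t)
         \<le> ennreal (A * C) * (ennreal (sqrt (V N) * exp (- c * D N t)) * indicator {s - \<rho>..s + \<rho>} t)"
        by (auto split: split_indicator)
    qed
    also have "\<dots> = ennreal (A * C) * (\<integral>\<^sup>+t. (ennreal (sqrt (V N) * exp (- c * D N t)) * indicator {s - \<rho>..s + \<rho>} t) \<partial>lborel)"
      by (rule nn_integral_cmult) simp
    also have "\<dots> \<le> ennreal (A * C) * ennreal (K c)"
      using that pos by (intro mult_left_mono Kb) auto
    finally show ?thesis using A pos by (simp add: ennreal_mult[symmetric])
  qed
  have \<Theta>_lim: "(\<lambda>N. \<Theta> N s) \<longlonglongrightarrow> 0" for s
  proof (rule tendsto_zero_ennreal)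
    fix e0 :: real assume "e0 > 0"
    define e where "e = e0 / 2"
    have "e > 0" "e < e0" using \<open>e0 > 0\<close> by (auto simp: e_def)
    define e' where "e' = e / (C * K (c / 2) + 1)"
    have e': "e' > 0" using \<open>e > 0\<close> pos by (auto simp: e'_def intro!: divide_pos_pos add_nonneg_pos)
    have e'e: "e' * (C * K (c / 2)) \<le> e"
    proof -
      have "e' * (C * K (c / 2)) \<le> e' * (C * K (c / 2) + 1)" using e' by (intro mult_left_mono) auto
      also have "\<dots> = e" using pos by (simp add: e'_def add_nonneg_eq_0_iff)
      finally show ?thesis .
    qed
    define S where "S = {s - \<rho>..s + \<rho>} \<inter> {t. \<bar>t\<bar> \<ge> r}"
    define g where "g N t = cmod (?w t) * (1 + t\<^sup>2) * exp (- (c / 2) * D N t)" for N t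
    have S0: "t \<noteq> 0" if "t \<in> S" for t using that pos by (auto simp: S_def)
    \<comment> \<open>Only half of the exponent is used up in \<open>g\<close>; the other half keeps
      the mass of order \<open>1 / sqrt (V N)\<close> through \<open>Kb\<close>. Pointwise
      convergence holds for one of two reasons: either \<open>D N t\<close> tends to infinity, or
      the window vanishes at \<open>t\<close> by \<open>per\<close>.\<close>
    have "\<forall>\<^sub>F N in sequentially. \<forall>t\<in>S. g N t < e'"
    proof (rule decreasing_tendsto_zero_uniform)
      show "compact S" unfolding S_def
        by (intro compact_Int_closed compact_Icc closed_Collect_le continuous_intros)
      show "continuous_on S (g N)" for N
        unfolding g_def using S0 D_cont[of N]
        by (intro continuous_intros continuous_on_subset[OF continuous_window_ft] assms) (auto intro: continuous_on_subset)
      show "g (Suc N) t \<le> g N t" for N t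
        unfolding g_def using D_mono[of N t] pos by (intro mult_left_mono) auto
      show "(\<lambda>N. g N t) \<longlonglongrightarrow> 0" if "t \<in> S" for t
      proof (cases "bdd_above (range (\<lambda>N. D N t))")
        case True
        then have "?w t = 0" using per S0[OF that] by (intro window_ft_eq_0) auto
        then show ?thesis by (simp add: g_def)
      next
        case False
        have "filterlim (\<lambda>N. D N t) at_top sequentially"
          unfolding filterlim_at_top
        proof
          fix Z
          obtain n where "D n t > Z" using False by (auto simp: bdd_above_def not_le)
          moreover have "D n t \<le> D m t" if "n \<le> m" for m
            using lift_Suc_mono_le[of "\<lambda>N. D N t"] D_mono that by blast
          ultimately show "\<forall>\<^sub>F N in sequentially. Z \<le> D N t"
            by (auto simp: eventually_sequentially intro!: exI[of _ n] dest: order.strict_trans2 less_imp_le)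
        qed
        then have "filterlim (\<lambda>N. (c / 2) * D N t) at_top sequentially"
          using pos by (intro filterlim_tendsto_pos_mult_at_top[OF tendsto_const]) auto
        then have "(\<lambda>N. exp (- ((c / 2) * D N t))) \<longlonglongrightarrow> 0"
          by (intro filterlim_compose[OF exp_at_bot] filterlim_compose[OF filterlim_uminus_at_bot_at_top])
        then show ?thesis unfolding g_def by (intro tendsto_mult_right_zero) simp
      qed
    qed (rule e')
    then show "\<forall>\<^sub>F N in sequentially. \<Theta> N s < ennreal e0"
      using V_pos
    proof eventually_elim
      case (elim N)
      have "\<Theta> N s \<le> (\<integral>\<^sup>+t. ennreal (e' * C) * (ennreal (sqrt (V N) * exp (- (c / 2) * D N t)) * indicator {s - \<rho>..s + \<rho>} t) \<partial>lborel)"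
        unfolding \<Theta>_def
      proof (intro nn_integral_mono)
        fix t
        show "ennreal (h N t) * (indicator (- {-r..r}) t * indicator {s - \<rho>..s + \<rho>} t)
         \<le> ennreal (e' * C) * (ennreal (sqrt (V N) * exp (- (c / 2) * D N t)) * indicator {s - \<rho>..s + \<rho>} t)"
        proof (cases "t \<in> {s - \<rho>..s + \<rho>} \<and> t \<notin> {-r..r}")
          case True
          then have "t \<in> S" by (auto simp: S_def)
          then have "g N t \<le> e'" using elim by (auto intro: less_imp_le)
          moreover have "h N t = g N t * (C * (sqrt (V N) * exp (- (c / 2) * D N t)))"
            unfolding h_def g_def by (simp add: exp_add[symmetric])
          ultimately have "h N t \<le> e' * (C * (sqrt (V N) * exp (- (c / 2) * D N t)))"
            using elim pos by (auto intro!: mult_right_mono)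
          then have "ennreal (h N t) \<le> ennreal (e' * C) * ennreal (sqrt (V N) * exp (- (c / 2) * D N t))"
            using e' pos elim by (simp add: ennreal_mult[symmetric] mult_ac ennreal_leI)
          then show ?thesis using True by simp
        qed (auto split: split_indicator)
      qed
      also have "\<dots> = ennreal (e' * C) * (\<integral>\<^sup>+t. (ennreal (sqrt (V N) * exp (- (c / 2) * D N t)) * indicator {s - \<rho>..s + \<rho>} t) \<partial>lborel)"
        by (rule nn_integral_cmult) simp
      also have "\<dots> \<le> ennreal (e' * C) * ennreal (K (c / 2))"
        using elim pos by (intro mult_left_mono Kb) auto
      also have "\<dots> = ennreal (e' * (C * K (c / 2)))" using e' pos by (simp add: ennreal_mult[symmetric] mult_ac)
      also have "\<dots> \<le> ennreal e" using e'e by (rule ennreal_leI)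
      also have "\<dots> < ennreal e0" using \<open>e < e0\<close> \<open>e > 0\<close> by (simp add: ennreal_less_iff)
      finally show ?case .
    qed
  qed
  define W where "W t = 1 / (1 + t\<^sup>2)" for t :: real
  have Wpos: "W t > 0" for t by (simp add: W_def add_pos_nonneg)
  have [measurable]: "W \<in> borel_measurable borel" unfolding W_def by measurable
  have W3: "W t \<le> 3 * W s" if "\<bar>s - t\<bar> \<le> \<rho>" for s t
  proof -
    have "2 * (s - t)\<^sup>2 \<le> 2 * 1" using that \<rho> by (intro mult_left_mono) (simp_all add: abs_square_le_1)
    moreover have "s\<^sup>2 \<le> 2 * t\<^sup>2 + 2 * (s - t)\<^sup>2" using zero_le_power2[of "s - 2 * t"] by (simp add: power2_eq_square algebra_simps)
    ultimately have "s\<^sup>2 \<le> 2 * t\<^sup>2 + 2" by (simp only: mult_1_right)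
    then have "1 + s\<^sup>2 \<le> 3 * (1 + t\<^sup>2)" using zero_le_power2[of t] unfolding distrib_left by linarith
    then show ?thesis unfolding W_def by (simp add: field_simps add_pos_nonneg)
  qed
  \<comment> \<open>The value at \<open>t\<close> is written as a mean over all \<open>s\<close>
    within \<open>\<rho>\<close> of \<open>t\<close>. Interchanging the integrals then collects the
    frequencies around each \<open>s\<close>; the factor 3 comes from \<open>W3\<close>.\<close>
  have main: "(\<integral>\<^sup>+t. ennreal (sqrt (V N) * cmod (?w t * char (Q N) t)) * indicator (- {-r..r}) t \<partial>lborel)
     \<le> (\<integral>\<^sup>+s. ennreal (3 / (2 * \<rho>) * W s) * \<Theta> N s \<partial>lborel)" if "V N > 0" for N
  proof -
    have "(\<integral>\<^sup>+t. ennreal (sqrt (V N) * cmod (?w t * char (Q N) t)) * indicator (- {-r..r}) t \<partial>lborel)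
      \<le> (\<integral>\<^sup>+t. (\<integral>\<^sup>+s. ennreal (3 / (2 * \<rho>) * W s) * (ennreal (h N t) * (indicator (- {-r..r}) t * indicator {s - \<rho>..s + \<rho>} t)) \<partial>lborel) \<partial>lborel)"
    proof (intro nn_integral_mono)
      fix t
      have "sqrt (V N) * cmod (?w t * char (Q N) t) \<le> sqrt (V N) * (cmod (?w t) * (C * exp (- c * D N t)))"
        using that decay[of N t] by (auto simp: norm_mult intro!: mult_left_mono)
      also have "\<dots> = h N t * W t"
        unfolding h_def W_def by (simp add: add_pos_nonneg less_imp_neq[symmetric])
      finally have "ennreal (sqrt (V N) * cmod (?w t * char (Q N) t)) * indicator (- {-r..r}) t
          \<le> ennreal (h N t * W t) * indicator (- {-r..r}) t"
        by (intro mult_right_mono ennreal_leI) auto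
      also have "\<dots> = (\<integral>\<^sup>+s. ennreal (1 / (2 * \<rho>)) * (ennreal (h N t * W t) * indicator (- {-r..r}) t) * indicator {t - \<rho>..t + \<rho>} s \<partial>lborel)"
      proof -
        have "emeasure lborel {t - \<rho>..t + \<rho>} = ennreal (2 * \<rho>)" using \<rho> by simp
        moreover have "ennreal (1 / (2 * \<rho>)) * Y * ennreal (2 * \<rho>) = Y" for Y
        proof -
          have "ennreal (1 / (2 * \<rho>)) * ennreal (2 * \<rho>) = 1"
            using \<rho> by (subst ennreal_mult'[symmetric]) auto
          then show ?thesis by (metis mult.assoc mult.commute mult.right_neutral)
        qed
        ultimately show ?thesis by (subst nn_integral_cmult_indicator) simp_all
      qed
      also have "\<dots> \<le> (\<integral>\<^sup>+s. ennreal (3 / (2 * \<rho>) * W s) * (ennreal (h N t) * (indicator (- {-r..r}) t * indicator {s - \<rho>..s + \<rho>} t)) \<partial>lborel)"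
      proof (intro nn_integral_mono)
        fix s
        show "ennreal (1 / (2 * \<rho>)) * (ennreal (h N t * W t) * indicator (- {-r..r}) t) * indicator {t - \<rho>..t + \<rho>} s
          \<le> ennreal (3 / (2 * \<rho>) * W s) * (ennreal (h N t) * (indicator (- {-r..r}) t * indicator {s - \<rho>..s + \<rho>} t))"
        proof (cases "t \<in> {s - \<rho>..s + \<rho>} \<and> t \<notin> {-r..r}")
          case True
          then have "W t \<le> 3 * W s" by (intro W3) auto
          then have "1 / (2 * \<rho>) * (h N t * W t) \<le> 1 / (2 * \<rho>) * (h N t * (3 * W s))"
            using \<rho> h0[OF that] by (intro mult_left_mono) auto
          also have "\<dots> = 3 / (2 * \<rho>) * W s * h N t" by simp
          finally have "ennreal (1 / (2 * \<rho>)) * ennreal (h N t * W t) \<le> ennreal (3 / (2 * \<rho>) * W s) * ennreal (h N t)"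
            using \<rho> h0[OF that, of t] Wpos[of t] Wpos[of s]
            by (subst (1 2) ennreal_mult[symmetric]) (auto intro!: ennreal_leI)
          then show ?thesis using True by (auto split: split_indicator)
        qed (auto split: split_indicator)
      qed
      finally show "ennreal (sqrt (V N) * cmod (?w t * char (Q N) t)) * indicator (- {-r..r}) t
          \<le> (\<integral>\<^sup>+s. ennreal (3 / (2 * \<rho>) * W s) * (ennreal (h N t) * (indicator (- {-r..r}) t * indicator {s - \<rho>..s + \<rho>} t)) \<partial>lborel)" .
    qed
    also have "\<dots> = (\<integral>\<^sup>+s. (\<integral>\<^sup>+t. ennreal (3 / (2 * \<rho>) * W s) * (ennreal (h N t) * (indicator (- {-r..r}) t * indicator {s - \<rho>..s + \<rho>} t)) \<partial>lborel) \<partial>lborel)"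
      by (rule lborel_pair.Fubini') measurable
    also have "\<dots> = (\<integral>\<^sup>+s. ennreal (3 / (2 * \<rho>) * W s) * \<Theta> N s \<partial>lborel)"
      unfolding \<Theta>_def by (intro nn_integral_cong nn_integral_cmult) measurable
    finally show ?thesis .
  qed
  obtain N0 where N0: "\<And>N. N \<ge> N0 \<Longrightarrow> V N > 0" using V_pos by (auto simp: eventually_sequentially)
  have "(\<lambda>N. \<integral>\<^sup>+s. ennreal (3 / (2 * \<rho>) * W s) * \<Theta> (N + N0) s \<partial>lborel) \<longlonglongrightarrow> (\<integral>\<^sup>+s. 0 \<partial>(lborel :: real measure))"
  proof (rule nn_integral_dominated_convergence[where w = "\<lambda>s. ennreal (3 / (2 * \<rho>) * W s) * ennreal (A * C * K c)"])
    show "AE s in lborel. ennreal (3 / (2 * \<rho>) * W s) * \<Theta> (N + N0) s \<le> ennreal (3 / (2 * \<rho>) * W s) * ennreal (A * C * K c)" for N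
      using N0 by (intro AE_I2 mult_left_mono \<Theta>_le) auto
    have "integrable lborel (\<lambda>s. 3 / (2 * \<rho>) * W s * (A * C * K c))"
      using integrable_inverse_1_plus_square_UNIV unfolding W_def
      by (intro integrable_mult_left integrable_mult_right)
    then have "(\<integral>\<^sup>+s. ennreal (3 / (2 * \<rho>) * W s * (A * C * K c)) \<partial>lborel) < \<infinity>"
      using A pos \<rho> Wpos by (subst nn_integral_eq_integral) (auto intro!: mult_nonneg_nonneg divide_nonneg_nonneg simp: less_imp_le)
    then show "(\<integral>\<^sup>+s. ennreal (3 / (2 * \<rho>) * W s) * ennreal (A * C * K c) \<partial>lborel) < \<infinity>"
      using A pos \<rho> Wpos by (subst (asm) ennreal_mult) (auto intro!: mult_nonneg_nonneg divide_nonneg_nonneg simp: less_imp_le)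
    show "AE s in lborel. (\<lambda>N. ennreal (3 / (2 * \<rho>) * W s) * \<Theta> (N + N0) s) \<longlonglongrightarrow> 0"
    proof (intro AE_I2)
      fix s
      have "(\<lambda>N. ennreal (3 / (2 * \<rho>) * W s) * \<Theta> (N + N0) s) \<longlonglongrightarrow> ennreal (3 / (2 * \<rho>) * W s) * 0"
        by (intro ennreal_tendsto_cmult LIMSEQ_ignore_initial_segment \<Theta>_lim) simp
      then show "(\<lambda>N. ennreal (3 / (2 * \<rho>) * W s) * \<Theta> (N + N0) s) \<longlonglongrightarrow> 0" by simp
    qed
  qed measurable
  then have lim: "(\<lambda>N. \<integral>\<^sup>+s. ennreal (3 / (2 * \<rho>) * W s) * \<Theta> (N + N0) s \<partial>lborel) \<longlonglongrightarrow> 0"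
    by (simp only: nn_integral_const mult_zero_left)
  have "(\<lambda>N. \<integral>\<^sup>+t. ennreal (sqrt (V (N + N0)) * cmod (?w t * char (Q (N + N0)) t)) * indicator (- {-r..r}) t \<partial>lborel) \<longlonglongrightarrow> 0"
  proof (rule tendsto_sandwich[OF _ _ tendsto_const lim])
    show "\<forall>\<^sub>F N in sequentially. (\<integral>\<^sup>+t. ennreal (sqrt (V (N + N0)) * cmod (?w t * char (Q (N + N0)) t)) * indicator (- {-r..r}) t \<partial>lborel)
        \<le> (\<integral>\<^sup>+s. ennreal (3 / (2 * \<rho>) * W s) * \<Theta> (N + N0) s \<partial>lborel)"
      by (intro always_eventually allI main N0) (rule le_add2)
  qed simp
  then show ?thesis by (rule LIMSEQ_offset)
qed

theorem smoothed_prob_asymp: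
  assumes "\<eta> > 0" "l \<ge> 0"
    and per: "\<And>t. t \<noteq> 0 \<Longrightarrow> bdd_above (range (\<lambda>N. D N t)) \<Longrightarrow> iexp (t * l) = 1"
  shows "(\<lambda>N. sqrt (V N) * smoothed_prob (Q N) \<alpha> l \<eta>) \<longlonglongrightarrow> l * exp (- z\<^sup>2 / 2) / sqrt (2 * pi)"
proof -
  let ?w = "window_ft \<alpha> l \<eta>"
  let ?out = "\<lambda>N. CLBINT t. indicator (- {-r..r}) t *\<^sub>R (?w t * char (Q N) t)"
  let ?cen = "\<lambda>N. CLBINT t. indicator {-r..r} t *\<^sub>R (?w t * char (Q N) t)"
  note int = smoothed_prob_inversion(1)[OF Q assms(1,2)]
  have "(\<lambda>N. ennreal (norm (sqrt (V N) *\<^sub>R ?out N))) \<longlonglongrightarrow> 0"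
  proof (rule tendsto_sandwich[OF _ _ tendsto_const outer_part[OF assms, of \<alpha>]])
    show "\<forall>\<^sub>F N in sequentially. ennreal (norm (sqrt (V N) *\<^sub>R ?out N))
        \<le> (\<integral>\<^sup>+t. ennreal (sqrt (V N) * cmod (?w t * char (Q N) t)) * indicator (- {-r..r}) t \<partial>lborel)"
      using V_pos
    proof eventually_elim
      case (elim N)
      have i: "integrable lborel (\<lambda>t. indicator (- {-r..r}) t *\<^sub>R (?w t * char (Q N) t))"
        by (rule integrable_mult_indicator[OF _ int]) simp
      have "ennreal (norm (sqrt (V N) *\<^sub>R ?out N)) = ennreal (norm (CLBINT t. sqrt (V N) *\<^sub>R (indicator (- {-r..r}) t *\<^sub>R (?w t * char (Q N) t))))"
        by (simp only: integral_scaleR_right)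
      also have "\<dots> \<le> (\<integral>\<^sup>+t. ennreal (norm (sqrt (V N) *\<^sub>R (indicator (- {-r..r}) t *\<^sub>R (?w t * char (Q N) t)))) \<partial>lborel)"
        by (rule integral_norm_bound_ennreal) (use i in \<open>simp only: integrable_scaleR_right\<close>)
      also have "\<dots> = (\<integral>\<^sup>+t. ennreal (sqrt (V N) * cmod (?w t * char (Q N) t)) * indicator (- {-r..r}) t \<partial>lborel)"
        using elim by (intro nn_integral_cong) (auto split: split_indicator)
      finally show ?case .
    qed
  qed simp
  then have out: "(\<lambda>N. sqrt (V N) *\<^sub>R ?out N) \<longlonglongrightarrow> 0"
    by (subst (asm) ennreal_0[symmetric], subst (asm) tendsto_ennreal_iff) (auto intro: tendsto_norm_zero_cancel)
  have eq: "sqrt (V N) *\<^sub>R complex_of_real (smoothed_prob (Q N) \<alpha> l \<eta>) = 1 / (2 * pi) * (sqrt (V N) *\<^sub>R ?cen N + sqrt (V N) *\<^sub>R ?out N)" for N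
  proof -
    have "(CLBINT t. ?w t * char (Q N) t) = (CLBINT t. indicator {-r..r} t *\<^sub>R (?w t * char (Q N) t) + indicator (- {-r..r}) t *\<^sub>R (?w t * char (Q N) t))"
      by (intro Bochner_Integration.integral_cong) (auto split: split_indicator)
    also have "\<dots> = ?cen N + ?out N"
      by (intro Bochner_Integration.integral_add integrable_mult_indicator int) auto
    finally show ?thesis
      using smoothed_prob_inversion(2)[OF Q assms(1,2), of N \<alpha>] by (simp add: scaleR_conv_of_real algebra_simps)
  qed
  have "(\<lambda>N. sqrt (V N) *\<^sub>R complex_of_real (smoothed_prob (Q N) \<alpha> l \<eta>)) \<longlonglongrightarrow> complex_of_real (1 / (2 * pi)) * (of_real (l * sqrt (2 * pi) * exp (- z\<^sup>2 / 2)) + 0)"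
    unfolding eq by (intro tendsto_intros central_part out assms)
  then have "(\<lambda>N. complex_of_real (sqrt (V N) * smoothed_prob (Q N) \<alpha> l \<eta>)) \<longlonglongrightarrow> of_real (1 / (2 * pi) * (l * sqrt (2 * pi) * exp (- z\<^sup>2 / 2)))"
    by (simp add: scaleR_conv_of_real)
  then have "(\<lambda>N. sqrt (V N) * smoothed_prob (Q N) \<alpha> l \<eta>) \<longlonglongrightarrow> 1 / (2 * pi) * (l * sqrt (2 * pi) * exp (- z\<^sup>2 / 2))"
    by (simp only: tendsto_of_real_iff)
  also have "1 / (2 * pi) * (l * sqrt (2 * pi) * exp (- z\<^sup>2 / 2)) = l * exp (- z\<^sup>2 / 2) / sqrt (2 * pi)"
    by (simp add: field_simps flip: power2_eq_square)
  finally show ?thesis .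
qed

end

section \<open>Uniformly elliptic kernels\<close>

lemma (in prob_space) integrable_bounded:
  fixes g :: "'a \<Rightarrow> 'b::{banach, second_countable_topology}"
  shows "g \<in> borel_measurable M \<Longrightarrow> (\<And>x. norm (g x) \<le> B) \<Longrightarrow> integrable M g"
  by (intro integrable_const_bound[where B = B]) auto

lemma oscillation_obtain:
  fixes g :: "'a \<Rightarrow> real"
  assumes B: "\<And>y. \<bar>g y\<bar> \<le> B" and s: "\<And>y y'. g y - g y' \<le> s"
  obtains i where "\<And>y. i \<le> g y" "\<And>y. g y \<le> i + s"
proof (rule that)
  have "- B \<le> g y" for y using B[of y] by linarith
  then have bdd: "bdd_below (range g)" by (intro bdd_belowI[of _ "- B"]) auto
  show "(INF y. g y) \<le> g y" for y by (rule cINF_lower[OF bdd]) simp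
  have "g y - s \<le> (INF y. g y)" for y by (rule cINF_greatest) (use s in \<open>auto simp: algebra_simps\<close>)
  then show "g y \<le> (INF y. g y) + s" for y by (simp add: algebra_simps)
qed

text \<open>Every reference measure lives on the whole type and time starts at 0, so no conditions
  of membership in a state space arise. The given chain is brought into this form in the last
  section.\<close>

locale elliptic_kernel =
  fixes \<mu> :: "nat \<Rightarrow> 'a measure" and p :: "nat \<Rightarrow> 'a \<Rightarrow> 'a \<Rightarrow> real" and e :: real
  assumes prob_space_\<mu>: "\<And>n. prob_space (\<mu> n)"
    and space_\<mu> [simp]: "\<And>n. space (\<mu> n) = UNIV"
    and p_pair: "\<And>n. (\<lambda>(x, y). p n x y) \<in> borel_measurable (\<mu> n \<Otimes>\<^sub>M \<mu> (Suc n))"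
    and e: "0 < e" "e < 1"
    and p_nonneg [simp]: "\<And>n x y. 0 \<le> p n x y"
    and p_le: "\<And>n x y. p n x y \<le> 1 / e"
    and p_int [simp]: "\<And>n x. (\<integral>y. p n x y \<partial>\<mu> (Suc n)) = 1"
    and p_two: "\<And>n x z. (\<integral>y. p n x y * p (Suc n) y z \<partial>\<mu> (Suc n)) \<ge> e"
begin

sublocale mu: prob_space "\<mu> n" for n by (rule prob_space_\<mu>)

sublocale mu2: pair_prob_space "\<mu> n" "\<mu> m" for n m ..

lemma p_measurable [measurable (raw)]:
  assumes "g \<in> measurable M (\<mu> n)" "h \<in> measurable M (\<mu> (Suc n))"
  shows "(\<lambda>w. p n (g w) (h w)) \<in> borel_measurable M"
  using measurable_compose[OF measurable_Pair[OF assms] p_pair] by simp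

text \<open>The transition operator. Its values lie in an arbitrary Banach space because it acts
  both on real functions and on complex characteristic functions.\<close>

definition kint :: "nat \<Rightarrow> 'a \<Rightarrow> ('a \<Rightarrow> 'b::{banach, second_countable_topology}) \<Rightarrow> 'b" where
  "kint n x g = (\<integral>y. p n x y *\<^sub>R g y \<partial>\<mu> (Suc n))"

lemma kint_measurable [measurable (raw)]:
  fixes g :: "'b \<Rightarrow> 'a \<Rightarrow> 'c::{banach, second_countable_topology}"
  assumes "h \<in> measurable M (\<mu> n)" "(\<lambda>(w, y). g w y) \<in> borel_measurable (M \<Otimes>\<^sub>M \<mu> (Suc n))"
  shows "(\<lambda>w. kint n (h w) (g w)) \<in> borel_measurable M"
  using assms unfolding kint_def by measurable

lemma kernel_integrable:
  fixes g :: "'a \<Rightarrow> 'b::{banach, second_countable_topology}"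
  assumes [measurable]: "g \<in> borel_measurable (\<mu> (Suc n))" and B: "\<And>y. norm (g y) \<le> B"
  shows "integrable (\<mu> (Suc n)) (\<lambda>y. p n x y *\<^sub>R g y)"
proof (rule mu.integrable_bounded)
  fix y
  have "p n x y * norm (g y) \<le> 1 / e * B"
    by (intro mult_mono p_le B) (use e in auto)
  then show "norm (p n x y *\<^sub>R g y) \<le> 1 / e * B" by simp
qed simp

lemma kint_const [simp]: "kint n x (\<lambda>_. a) = a"
proof -
  have "integrable (\<mu> (Suc n)) (p n x)"
    using kernel_integrable[of "\<lambda>_. 1::real" n 1 x] by simp
  then show ?thesis unfolding kint_def by simp
qed

lemma kint_add:
  fixes g h :: "'a \<Rightarrow> 'b::{banach, second_countable_topology}"
  assumes "g \<in> borel_measurable (\<mu> (Suc n))" "\<And>y. norm (g y) \<le> B"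
    "h \<in> borel_measurable (\<mu> (Suc n))" "\<And>y. norm (h y) \<le> B'"
  shows "kint n x (\<lambda>y. g y + h y) = kint n x g + kint n x h"
  unfolding kint_def scaleR_add_right
  by (intro Bochner_Integration.integral_add kernel_integrable[where B = B] kernel_integrable[where B = B'] assms)

lemma kint_diff:
  fixes g h :: "'a \<Rightarrow> 'b::{banach, second_countable_topology}"
  assumes "g \<in> borel_measurable (\<mu> (Suc n))" "\<And>y. norm (g y) \<le> B"
    "h \<in> borel_measurable (\<mu> (Suc n))" "\<And>y. norm (h y) \<le> B'"
  shows "kint n x (\<lambda>y. g y - h y) = kint n x g - kint n x h"
  unfolding kint_def scaleR_diff_right
  by (intro Bochner_Integration.integral_diff kernel_integrable[where B = B] kernel_integrable[where B = B'] assms)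

lemma kint_cmult:
  fixes g :: "'a \<Rightarrow> 'b::{real_normed_field, banach, second_countable_topology}"
  shows "kint n x (\<lambda>y. c * g y) = c * kint n x g"
  unfolding kint_def by (simp flip: mult_scaleR_right)

lemma kint_cmult_right:
  fixes g :: "'a \<Rightarrow> 'b::{real_normed_field, banach, second_countable_topology}"
  shows "kint n x (\<lambda>y. g y * c) = kint n x g * c"
  unfolding kint_def by (simp flip: mult_scaleR_left)

lemma kint_of_real: "kint n x (\<lambda>y. of_real (g y) :: complex) = of_real (kint n x g)"
  unfolding kint_def by (simp add: scaleR_conv_of_real flip: of_real_mult)

lemma kint_mono:
  fixes g h :: "'a \<Rightarrow> real"
  assumes "g \<in> borel_measurable (\<mu> (Suc n))" "\<And>y. \<bar>g y\<bar> \<le> B"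
    "h \<in> borel_measurable (\<mu> (Suc n))" "\<And>y. \<bar>h y\<bar> \<le> B'" "\<And>y. g y \<le> h y"
  shows "kint n x g \<le> kint n x h"
  unfolding kint_def
  by (intro integral_mono kernel_integrable[where B = B] kernel_integrable[where B = B'])
     (use assms in \<open>auto intro: mult_left_mono\<close>)

lemma norm_kint_le:
  fixes g :: "'a \<Rightarrow> 'b::{banach, second_countable_topology}"
  assumes [measurable]: "g \<in> borel_measurable (\<mu> (Suc n))" and "\<And>y. norm (g y) \<le> B"
  shows "norm (kint n x g) \<le> kint n x (\<lambda>y. norm (g y))"
proof -
  have "norm (kint n x g) \<le> (\<integral>y. norm (p n x y *\<^sub>R g y) \<partial>\<mu> (Suc n))"
    unfolding kint_def by (rule integral_norm_bound)
  then show ?thesis by (simp add: kint_def)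
qed

lemma norm_kint_bound:
  fixes g :: "'a \<Rightarrow> 'b::{banach, second_countable_topology}"
  assumes [measurable]: "g \<in> borel_measurable (\<mu> (Suc n))" and B: "\<And>y. norm (g y) \<le> B"
  shows "norm (kint n x g) \<le> B"
proof -
  have "norm (kint n x g) \<le> kint n x (\<lambda>y. norm (g y))" by (rule norm_kint_le[OF assms])
  also have "\<dots> \<le> kint n x (\<lambda>_. B)"
    using B by (intro kint_mono[where B = B and B' = "\<bar>B\<bar>"]) auto
  finally show ?thesis by simp
qed

lemma kint_nonneg: "(\<And>y. 0 \<le> g y) \<Longrightarrow> 0 \<le> kint n x (g :: 'a \<Rightarrow> real)"
  unfolding kint_def by (intro Bochner_Integration.integral_nonneg) simp

lemma kint_le_integral:
  fixes g :: "'a \<Rightarrow> real"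
  assumes [measurable]: "g \<in> borel_measurable (\<mu> (Suc n))" and B: "\<And>y. 0 \<le> g y" "\<And>y. g y \<le> B"
  shows "kint n x g \<le> 1 / e * (\<integral>y. g y \<partial>\<mu> (Suc n))"
proof -
  have "kint n x g \<le> (\<integral>y. 1 / e * g y \<partial>\<mu> (Suc n))"
    unfolding kint_def
  proof (intro integral_mono kernel_integrable[where B = B] integrable_mult_right mu.integrable_bounded[where B = B])
    fix y
    show "norm (g y) \<le> B" "norm (g y) \<le> B" using B[of y] by simp_all
    show "p n x y *\<^sub>R g y \<le> 1 / e * g y" using B[of y] p_le[of n x y] by (simp only: real_scaleR_def mult_right_mono)
  qed simp_all
  then show ?thesis by simp
qed

definition q2 :: "nat \<Rightarrow> 'a \<Rightarrow> 'a \<Rightarrow> real" where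
  "q2 n x z = (\<integral>y. p n x y * p (Suc n) y z \<partial>\<mu> (Suc n))"

lemma q2_measurable [measurable (raw)]:
  assumes [measurable]: "g \<in> measurable M (\<mu> n)" "h \<in> measurable M (\<mu> (Suc (Suc n)))"
  shows "(\<lambda>w. q2 n (g w) (h w)) \<in> borel_measurable M"
  unfolding q2_def by measurable

lemma q2_ge: "q2 n x z \<ge> e"
  using p_two by (simp add: q2_def)

lemma q2_le: "q2 n x z \<le> 1 / e"
proof -
  have "kint n x (\<lambda>y. p (Suc n) y z) \<le> 1 / e"
    using norm_kint_bound[of "\<lambda>y. p (Suc n) y z" n "1 / e" x] p_le by auto
  then show ?thesis by (simp add: q2_def kint_def)
qed

lemma kint_kint:
  fixes g :: "'a \<Rightarrow> 'b::{banach, second_countable_topology}"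
  assumes [measurable]: "g \<in> borel_measurable (\<mu> (Suc (Suc n)))" and B: "\<And>y. norm (g y) \<le> B"
  shows "kint n x (\<lambda>y. kint (Suc n) y g) = (\<integral>z. q2 n x z *\<^sub>R g z \<partial>\<mu> (Suc (Suc n)))"
proof -
  have "kint n x (\<lambda>y. kint (Suc n) y g) = (\<integral>y. (\<integral>z. (p n x y * p (Suc n) y z) *\<^sub>R g z \<partial>\<mu> (Suc (Suc n))) \<partial>\<mu> (Suc n))"
    unfolding kint_def by (simp only: integral_scaleR_right[symmetric] scaleR_scaleR)
  also have "\<dots> = (\<integral>z. (\<integral>y. (p n x y * p (Suc n) y z) *\<^sub>R g z \<partial>\<mu> (Suc n)) \<partial>\<mu> (Suc (Suc n)))"
  proof (rule mu2.Fubini_integral[symmetric], rule mu2.integrable_bounded)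
    fix w :: "'a \<times> 'a"
    obtain y z where w: "w = (y, z)" by force
    have "p n x y * p (Suc n) y z * norm (g z) \<le> 1 / e * (1 / e) * B"
      by (intro mult_mono p_le B) (use e in auto)
    then show "norm (case w of (y, z) \<Rightarrow> (p n x y * p (Suc n) y z) *\<^sub>R g z) \<le> 1 / e * (1 / e) * B"
      by (simp add: w)
  qed simp
  also have "\<dots> = (\<integral>z. q2 n x z *\<^sub>R g z \<partial>\<mu> (Suc (Suc n)))"
  proof (intro Bochner_Integration.integral_cong refl)
    fix z
    have "integrable (\<mu> (Suc n)) (\<lambda>y. p n x y * p (Suc n) y z)"
      using kernel_integrable[of "\<lambda>y. p (Suc n) y z" n "1 / e" x] p_le by simp
    then show "(\<integral>y. (p n x y * p (Suc n) y z) *\<^sub>R g z \<partial>\<mu> (Suc n)) = q2 n x z *\<^sub>R g z"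
      by (simp add: q2_def)
  qed
  finally show ?thesis .
qed

lemma q2_integrable:
  fixes g :: "'a \<Rightarrow> 'b::{banach, second_countable_topology}"
  assumes [measurable]: "g \<in> borel_measurable (\<mu> (Suc (Suc n)))" and B: "\<And>y. norm (g y) \<le> B"
  shows "integrable (\<mu> (Suc (Suc n))) (\<lambda>z. q2 n x z *\<^sub>R g z)"
proof (rule mu.integrable_bounded)
  fix z
  have "q2 n x z * norm (g z) \<le> 1 / e * B"
    by (intro mult_mono q2_le B) (use e in auto)
  then show "norm (q2 n x z *\<^sub>R g z) \<le> 1 / e * B" using q2_ge[of n x z] e by simp
qed simp

lemma q2_int [simp]: "(\<integral>z. q2 n x z \<partial>\<mu> (Suc (Suc n))) = 1"
  using kint_kint[of "\<lambda>_. 1::real" n 1 x] by simp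

text \<open>Doeblin's minorisation: the two-step density is at least \<open>e\<close>. It is used
  whenever an average along the chain has to be bounded from below by an average against the
  reference measure.\<close>

lemma kint_kint_ge:
  fixes g :: "'a \<Rightarrow> real"
  assumes [measurable]: "g \<in> borel_measurable (\<mu> (Suc (Suc n)))" and B: "\<And>y. 0 \<le> g y" "\<And>y. g y \<le> B"
  shows "e * (\<integral>z. g z \<partial>\<mu> (Suc (Suc n))) \<le> kint n x (\<lambda>y. kint (Suc n) y g)"
proof -
  have "(\<integral>z. e * g z \<partial>\<mu> (Suc (Suc n))) \<le> (\<integral>z. q2 n x z *\<^sub>R g z \<partial>\<mu> (Suc (Suc n)))"
  proof (rule integral_mono)
    show "integrable (\<mu> (Suc (Suc n))) (\<lambda>z. e * g z)"
      using B by (intro integrable_mult_right mu.integrable_bounded[where B = B]) auto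
    show "integrable (\<mu> (Suc (Suc n))) (\<lambda>z. q2 n x z *\<^sub>R g z)"
      using B by (intro q2_integrable[where B = B]) auto
    fix y
    show "e * g y \<le> q2 n x y *\<^sub>R g y" using B[of y] q2_ge[of n x y] by (simp only: real_scaleR_def mult_right_mono)
  qed
  also have "\<dots> = kint n x (\<lambda>y. kint (Suc n) y g)"
    using B by (subst kint_kint[where B = B]) auto
  finally show ?thesis by simp
qed

subsection \<open>Exponential mixing\<close>

fun iter :: "nat \<Rightarrow> nat \<Rightarrow> ('a \<Rightarrow> 'b::{banach, second_countable_topology}) \<Rightarrow> 'a \<Rightarrow> 'b" where
  "iter 0 n g = g"
| "iter (Suc j) n g = (\<lambda>x. kint n x (iter j (Suc n) g))"

lemma iter_measurable [measurable]:
  "g \<in> borel_measurable (\<mu> (n + j)) \<Longrightarrow> iter j n g \<in> borel_measurable (\<mu> n)"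
proof (induction j arbitrary: n)
  case (Suc j)
  then have [measurable]: "iter j (Suc n) g \<in> borel_measurable (\<mu> (Suc n))" by simp
  show ?case by simp
qed simp

lemma norm_iter_le:
  "g \<in> borel_measurable (\<mu> (n + j)) \<Longrightarrow> (\<And>y. norm (g y) \<le> B) \<Longrightarrow> norm (iter j n g x) \<le> B"
proof (induction j arbitrary: n x)
  case (Suc j)
  then show ?case by (auto intro!: norm_kint_bound iter_measurable)
qed simp

text \<open>The part \<open>e\<close> of the two-step density is common to all starting points and
  cancels in the difference. Only the remaining mass \<open>1 - e\<close> can transmit the
  oscillation of \<open>g\<close>.\<close>

lemma oscillation_kint_kint:
  fixes g :: "'a \<Rightarrow> real"
  assumes [measurable]: "g \<in> borel_measurable (\<mu> (Suc (Suc n)))" and B: "\<And>y. norm (g y) \<le> B"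
    and s: "\<And>y y'. g y - g y' \<le> s"
  shows "kint n x (\<lambda>y. kint (Suc n) y g) - kint n x' (\<lambda>y. kint (Suc n) y g) \<le> (1 - e) * s"
proof -
  obtain i where i: "i \<le> g y" "g y \<le> i + s" for y
    using oscillation_obtain[of g B s] B s by (metis real_norm_def)
  have gi: "integrable (\<mu> (Suc (Suc n))) (\<lambda>z. q2 n x z * g z)" for x
    using q2_integrable[OF assms(1) B] by simp
  have gi2: "integrable (\<mu> (Suc (Suc n))) (\<lambda>z. q2 n x z)" for x
    using q2_integrable[of "\<lambda>_. 1::real" n 1 x] by simp
  have mi: "integrable (\<mu> (Suc (Suc n))) g" using B by (intro mu.integrable_bounded[where B = B]) auto
  have eq: "kint n x (\<lambda>y. kint (Suc n) y g) = e * (\<integral>z. g z \<partial>\<mu> (Suc (Suc n))) + (\<integral>z. (q2 n x z - e) * g z \<partial>\<mu> (Suc (Suc n)))" for x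
    using kint_kint[OF assms(1) B, of x] gi[of x] mi by (simp add: left_diff_distrib)
  have int_q: "(\<integral>z. (q2 n x z - e) * c \<partial>\<mu> (Suc (Suc n))) = (1 - e) * c" for c x
    using gi2[of x] by (simp add: mu.prob_space[simplified])
  have "(\<integral>z. (q2 n x z - e) * g z \<partial>\<mu> (Suc (Suc n))) \<le> (\<integral>z. (q2 n x z - e) * (i + s) \<partial>\<mu> (Suc (Suc n)))"
  proof (rule integral_mono)
    show "(q2 n x z - e) * g z \<le> (q2 n x z - e) * (i + s)" for z
      by (intro mult_left_mono i) (simp add: q2_ge)
  qed (use gi[of x] gi2[of x] mi in \<open>auto simp: left_diff_distrib\<close>)
  moreover have "(\<integral>z. (q2 n x' z - e) * i \<partial>\<mu> (Suc (Suc n))) \<le> (\<integral>z. (q2 n x' z - e) * g z \<partial>\<mu> (Suc (Suc n)))"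
  proof (rule integral_mono)
    show "(q2 n x' z - e) * i \<le> (q2 n x' z - e) * g z" for z
      by (intro mult_left_mono i) (simp add: q2_ge)
  qed (use gi[of x'] gi2[of x'] mi in \<open>auto simp: left_diff_distrib\<close>)
  ultimately show ?thesis unfolding eq[of x] eq[of x'] int_q by (simp add: algebra_simps)
qed

lemma oscillation_kint:
  fixes g :: "'a \<Rightarrow> real"
  assumes [measurable]: "g \<in> borel_measurable (\<mu> (Suc n))" and B: "\<And>y. norm (g y) \<le> B"
    and s: "\<And>y y'. g y - g y' \<le> s"
  shows "kint n x g - kint n x' g \<le> s"
proof -
  obtain i where i: "i \<le> g y" "g y \<le> i + s" for y
    using oscillation_obtain[of g B s] B s by (metis real_norm_def)
  have "kint n x g \<le> kint n x (\<lambda>_. i + s)" using B i by (intro kint_mono[where B = B and B' = "\<bar>i + s\<bar>"]) auto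
  moreover have "kint n x' (\<lambda>_. i) \<le> kint n x' g" using B i by (intro kint_mono[where B' = B and B = "\<bar>i\<bar>"]) auto
  ultimately show ?thesis by simp
qed

lemma oscillation_iter:
  fixes g :: "'a \<Rightarrow> real"
  assumes "g \<in> borel_measurable (\<mu> (n + j))" and B: "\<And>y. norm (g y) \<le> B"
    and s: "\<And>y y'. g y - g y' \<le> s"
  shows "iter j n g x - iter j n g x' \<le> s * (1 - e) ^ (j div 2)"
  using assms(1)
proof (induction j arbitrary: n x x' rule: less_induct)
  case (less j)
  consider "j = 0" | "j = 1" | i where "j = Suc (Suc i)" by (metis One_nat_def not0_implies_Suc)
  then show ?case
  proof cases
    case 2
    have "kint n x g - kint n x' g \<le> s"
      by (rule oscillation_kint[where B = B]) (use 2 less.prems B s in auto)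
    then show ?thesis using 2 by simp
  next
    case 3
    have [measurable]: "iter i (Suc (Suc n)) g \<in> borel_measurable (\<mu> (Suc (Suc n)))"
      using less.prems 3 by (intro iter_measurable) simp
    have "iter i (Suc (Suc n)) g y - iter i (Suc (Suc n)) g y' \<le> s * (1 - e) ^ (i div 2)" for y y'
      using 3 less.prems by (intro less.IH) auto
    then have "kint n x (\<lambda>y. kint (Suc n) y (iter i (Suc (Suc n)) g)) - kint n x' (\<lambda>y. kint (Suc n) y (iter i (Suc (Suc n)) g))
       \<le> (1 - e) * (s * (1 - e) ^ (i div 2))"
      using less.prems 3 B by (intro oscillation_kint_kint[where B = B] norm_iter_le) auto
    then show ?thesis using 3 by (simp add: mult_ac)
  qed (use s in simp)
qed

lemma abs_oscillation_iter:
  fixes g :: "'a \<Rightarrow> real"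
  assumes "g \<in> borel_measurable (\<mu> (n + j))" and B: "\<And>y. \<bar>g y\<bar> \<le> B"
  shows "\<bar>iter j n g x - iter j n g x'\<bar> \<le> 2 * B * (1 - e) ^ (j div 2)"
proof -
  have "g y - g y' \<le> 2 * B" for y y' using B[of y] B[of y'] by linarith
  then show ?thesis using oscillation_iter[of g n j B "2 * B"] assms
    by (auto simp: abs_le_iff)
qed

text \<open>Two steps of the chain turn an \<open>L\<^sup>1\<close> bound into a sup bound.\<close>

lemma abs_oscillation_iter_L1:
  fixes g :: "'a \<Rightarrow> real"
  assumes g [measurable]: "g \<in> borel_measurable (\<mu> (n + j))" and B: "\<And>y. \<bar>g y\<bar> \<le> B" and j: "j \<ge> 2"
  shows "\<bar>iter j n g x - iter j n g x'\<bar> \<le> 2 / e * (\<integral>y. \<bar>g y\<bar> \<partial>\<mu> (n + j)) * (1 - e) ^ (j div 2 - 1)"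
proof -
  obtain i where i: "j = i + 2" using j by (metis add.commute le_iff_add)
  define m where "m = n + i"
  have nm: "n + j = Suc (Suc m)" using i by (simp add: m_def)
  have [measurable]: "g \<in> borel_measurable (\<mu> (Suc (Suc m)))" using g nm by simp
  define G where "G = iter 2 m g"
  have split: "iter (i + k) n g x = iter i n (iter k (n + i) g) x" for k n x
  proof (induction i arbitrary: n x)
    case (Suc i)
    have "iter (i + k) (Suc n) g = iter i (Suc n) (iter k (Suc n + i) g)" using Suc.IH by (intro ext)
    then show ?case by simp
  qed simp
  have G: "G y = kint m y (\<lambda>y. kint (Suc m) y g)" for y by (simp add: G_def numeral_2_eq_2)
  have G_meas: "G \<in> borel_measurable (\<mu> (n + i))"
    unfolding G_def m_def[symmetric] by (rule iter_measurable) (use g nm m_def in simp)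
  have "\<bar>G y\<bar> \<le> 1 / e * (\<integral>y. \<bar>g y\<bar> \<partial>\<mu> (n + j))" for y
  proof -
    have "\<bar>G y\<bar> \<le> (\<integral>z. \<bar>q2 m y z * g z\<bar> \<partial>\<mu> (Suc (Suc m)))"
      unfolding G using B by (subst kint_kint[where B = B]) (auto intro: order_trans[OF integral_abs_bound])
    also have "\<dots> \<le> (\<integral>z. 1 / e * \<bar>g z\<bar> \<partial>\<mu> (Suc (Suc m)))"
    proof (intro integral_mono integrable_mult_right)
      show "integrable (\<mu> (Suc (Suc m))) (\<lambda>z. \<bar>q2 m y z * g z\<bar>)"
        using q2_integrable[of g m B y] B by (intro integrable_abs) auto
      show "integrable (\<mu> (Suc (Suc m))) (\<lambda>z. \<bar>g z\<bar>)"
        using B by (intro mu.integrable_bounded[where B = B]) auto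
      show "\<bar>q2 m y z * g z\<bar> \<le> 1 / e * \<bar>g z\<bar>" for z
        unfolding abs_mult using q2_le[of m y z] q2_ge[of m y z] e by (intro mult_right_mono) auto
    qed
    finally show ?thesis by (simp add: nm)
  qed
  from abs_oscillation_iter[OF G_meas this, of x x'] show ?thesis
    unfolding i split by (simp add: G_def m_def[symmetric] flip: i)
qed

end

section \<open>Decay of characteristic functions\<close>

lemma abs_sin_add_le: "\<bar>sin (a + b :: real)\<bar> \<le> \<bar>sin a\<bar> + \<bar>sin b\<bar>"
proof -
  have "\<bar>sin (a + b)\<bar> \<le> \<bar>sin a\<bar> * \<bar>cos b\<bar> + \<bar>cos a\<bar> * \<bar>sin b\<bar>"
    unfolding sin_add by (intro order_trans[OF abs_triangle_ineq]) (simp add: abs_mult)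
  also have "\<dots> \<le> \<bar>sin a\<bar> * 1 + 1 * \<bar>sin b\<bar>"
    by (intro add_mono mult_mono abs_cos_le_one) auto
  finally show ?thesis by simp
qed

lemma one_minus_cos: "1 - cos (x :: real) = 2 * (sin (x / 2))\<^sup>2"
  using cos_double_sin[of "x / 2"] by simp

text \<open>Up to a factor, \<open>1 - cos x\<close> is the square of a chord of the unit circle,
  and chord lengths satisfy the triangle inequality. This is the source of the inequality for
  \<open>D N (s - t)\<close>.\<close>

lemma one_minus_cos_diff_le: "1 - cos (a - b :: real) \<le> 2 * (1 - cos a) + 2 * (1 - cos b)"
proof -
  have "\<bar>sin ((a - b) / 2)\<bar> \<le> \<bar>sin (a / 2)\<bar> + \<bar>sin (b / 2)\<bar>"
    using abs_sin_add_le[of "a / 2" "- (b / 2)"] by (simp add: diff_divide_distrib)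
  then have "(sin ((a - b) / 2))\<^sup>2 \<le> (\<bar>sin (a / 2)\<bar> + \<bar>sin (b / 2)\<bar>)\<^sup>2"
    by (metis abs_ge_zero power2_abs power_mono)
  also have "\<dots> \<le> 2 * (sin (a / 2))\<^sup>2 + 2 * (sin (b / 2))\<^sup>2"
    using zero_le_power2[of "\<bar>sin (a / 2)\<bar> - \<bar>sin (b / 2)\<bar>"] by (simp add: power2_eq_square algebra_simps)
  finally show ?thesis by (simp add: one_minus_cos)
qed

lemma one_minus_cos_add3_le:
  "1 - cos (a + b + c :: real) \<le> 3 * ((1 - cos a) + (1 - cos b) + (1 - cos c))"
proof -
  have "\<bar>sin ((a + b + c) / 2)\<bar> \<le> \<bar>sin (a / 2)\<bar> + \<bar>sin (b / 2)\<bar> + \<bar>sin (c / 2)\<bar>"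
    using abs_sin_add_le[of "a / 2" "b / 2"] abs_sin_add_le[of "a / 2 + b / 2" "c / 2"]
    by (simp add: add_divide_distrib)
  then have "(sin ((a + b + c) / 2))\<^sup>2 \<le> (\<bar>sin (a / 2)\<bar> + \<bar>sin (b / 2)\<bar> + \<bar>sin (c / 2)\<bar>)\<^sup>2"
    by (metis abs_ge_zero power2_abs power_mono)
  also have "\<dots> \<le> 3 * ((sin (a / 2))\<^sup>2 + (sin (b / 2))\<^sup>2 + (sin (c / 2))\<^sup>2)"
    using zero_le_power2[of "\<bar>sin (a / 2)\<bar> - \<bar>sin (b / 2)\<bar>"] zero_le_power2[of "\<bar>sin (a / 2)\<bar> - \<bar>sin (c / 2)\<bar>"]
      zero_le_power2[of "\<bar>sin (b / 2)\<bar> - \<bar>sin (c / 2)\<bar>"]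
    by (simp add: power2_eq_square algebra_simps)
  finally show ?thesis by (simp add: one_minus_cos)
qed

lemma one_minus_cos_bounds: "0 \<le> 1 - cos (x::real)" "1 - cos x \<le> 2" 
  using cos_le_one[of x] cos_ge_minus_one[of x] by linarith+

lemma one_minus_cos_le: "1 - cos x \<le> (x::real)\<^sup>2 / 2"
proof -
  have "(sin (x / 2))\<^sup>2 \<le> (x / 2)\<^sup>2"
    using abs_sin_x_le_abs_x[of "x / 2"] by (simp only: abs_le_square_iff)
  then show ?thesis by (simp add: one_minus_cos power_divide)
qed

lemma one_minus_cos_ge_quarter:
  assumes "\<bar>x\<bar> \<le> (1::real)" shows "x\<^sup>2 / 4 \<le> 1 - cos x"
proof -
  define y where "y = \<bar>x / 2\<bar>"
  have y: "0 \<le> y" "y \<le> 1 / 2" using assms by (auto simp: y_def)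
  have "\<bar>sin y - y\<bar> \<le> y ^ 3 / 6"
    using Maclaurin_sin_bound[of y 3] y by (simp add: eval_nat_numeral sin_coeff_def)
  moreover have "y ^ 3 / 6 \<le> y / 24"
  proof -
    have "y * y \<le> 1 / 2 * (1 / 2)" using y by (intro mult_mono) auto
    then have "y * (y * y) \<le> y * (1 / 4)" using y by (intro mult_left_mono) auto
    then show ?thesis by (simp add: power3_eq_cube mult.assoc)
  qed
  ultimately have "y * (23 / 24) \<le> sin y" by linarith
  then have "(y * (23 / 24))\<^sup>2 \<le> (sin y)\<^sup>2" using y by (intro power_mono) auto
  moreover have "(sin y)\<^sup>2 = (sin (x / 2))\<^sup>2" by (auto simp: y_def abs_if)
  moreover have "y\<^sup>2 = x\<^sup>2 / 4" by (simp add: y_def power_divide)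
  moreover have "(y * (23 / 24))\<^sup>2 = y\<^sup>2 * (529 / 576)" by (simp add: power2_eq_square)
  ultimately show ?thesis using zero_le_power2[of x] unfolding one_minus_cos by linarith
qed

text \<open>For \<open>|x|\<close> between 1 and \<open>pi\<close> the left numerator is at most 16
  while \<open>1 - cos x\<close> is at least 1/4; the quotient of these numbers is 64. The range is
  that of a remainder after rounding to the nearest multiple of a period.\<close>

lemma one_minus_cos_ge:
  assumes "\<bar>x\<bar> \<le> pi" shows "x\<^sup>2 / 64 \<le> 1 - cos x"
proof (cases "\<bar>x\<bar> \<le> 1")
  case True
  then show ?thesis using one_minus_cos_ge_quarter[of x] zero_le_power2[of x] by linarith
next
  case False
  have "cos x = cos \<bar>x\<bar>" by simp
  also have "\<dots> \<le> cos 1" using False assms by (subst cos_mono_le_eq) auto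
  also have "\<dots> \<le> 3 / 4" using one_minus_cos_ge_quarter[of 1] by simp
  finally have "cos x \<le> 3 / 4" .
  moreover have "x\<^sup>2 \<le> 4\<^sup>2" using assms pi_less_4 by (intro abs_le_square_iff[THEN iffD1]) auto
  ultimately show ?thesis by simp
qed

lemma sum_Un_le:
  fixes g :: "'b \<Rightarrow> real"
  assumes "finite A" "finite B" "\<And>i. 0 \<le> g i"
  shows "sum g (A \<union> B) \<le> sum g A + sum g B"
proof -
  have "0 \<le> sum g (A \<inter> B)" using assms(3) by (intro sum_nonneg)
  then show ?thesis using sum.union_inter[OF assms(1,2), of g] by linarith
qed

lemma borel_measurable_cis [measurable (raw)]:
  assumes [measurable]: "g \<in> borel_measurable M"
  shows "(\<lambda>w. cis (g w)) \<in> borel_measurable M"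
proof -
  have "cis \<in> borel_measurable borel"
    by (intro borel_measurable_continuous_onI) (simp add: cis_conv_exp continuous_intros)
  then show ?thesis by measurable
qed

text \<open>The bound on \<open>f\<close> is required everywhere and not just almost surely; a
  truncation of the given functional achieves this.\<close>

locale elliptic_functional = elliptic_kernel \<mu> p e
  for \<mu> :: "nat \<Rightarrow> 'a measure" and p e +
  fixes f :: "nat \<Rightarrow> 'a \<Rightarrow> 'a \<Rightarrow> real" and K :: real
  assumes f_pair: "\<And>n. (\<lambda>(x, y). f n x y) \<in> borel_measurable (\<mu> n \<Otimes>\<^sub>M \<mu> (Suc n))"
    and f_le: "\<And>n x y. \<bar>f n x y\<bar> \<le> K"
begin

lemma K_nonneg: "0 \<le> K" using f_le[of 0 undefined undefined] by linarith

lemma f_measurable [measurable (raw)]: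
  assumes "g \<in> measurable M (\<mu> n)" "h \<in> measurable M (\<mu> (Suc n))"
  shows "(\<lambda>w. f n (g w) (h w)) \<in> borel_measurable M"
  using measurable_compose[OF measurable_Pair[OF assms] f_pair] by simp

text \<open>\<open>U t k n x\<close> is the characteristic function at \<open>t\<close> of the sum of \<open>k\<close> terms
  of the functional along the chain started from \<open>x\<close> at time \<open>n\<close>.\<close>

fun U :: "real \<Rightarrow> nat \<Rightarrow> nat \<Rightarrow> 'a \<Rightarrow> complex" where
  "U t 0 n = (\<lambda>_. 1)"
| "U t (Suc k) n = (\<lambda>x. kint n x (\<lambda>y. cis (t * f n x y) * U t k (Suc n) y))"

lemma U_measurable [measurable]: "U t k n \<in> borel_measurable (\<mu> n)"
  by (induction k arbitrary: n) simp_all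

lemma norm_U_prefix:
  assumes "\<And>y. cmod (U t k (n + r) y) \<le> B"
  shows "cmod (U t (r + k) n x) \<le> B"
  using assms
proof (induction r arbitrary: n x)
  case (Suc r)
  then have "cmod (U t (r + k) (Suc n) y) \<le> B" for y by simp
  then show ?case by (auto intro!: norm_kint_bound simp: norm_mult)
qed simp

lemma norm_U_le_1: "cmod (U t k n x) \<le> 1"
  using norm_U_prefix[of t 0 n k 1 x] by simp

section \<open>Structure constants of hexagons\<close>

definition pw :: "nat \<Rightarrow> 'a \<Rightarrow> 'a \<Rightarrow> 'a \<Rightarrow> 'a \<Rightarrow> real" where
  "pw n a m x y = p n a m * p (Suc n) m x * p (Suc (Suc n)) x y"

definition ps :: "nat \<Rightarrow> 'a \<Rightarrow> 'a \<Rightarrow> 'a \<Rightarrow> 'a \<Rightarrow> real" where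
  "ps n a m x y = f n a m + f (Suc n) m x + f (Suc (Suc n)) x y"

lemma pw_measurable [measurable (raw)]:
  assumes [measurable]: "g1 \<in> measurable M (\<mu> n)" "g2 \<in> measurable M (\<mu> (Suc n))"
    "g3 \<in> measurable M (\<mu> (Suc (Suc n)))" "g4 \<in> measurable M (\<mu> (Suc (Suc (Suc n))))"
  shows "(\<lambda>w. pw n (g1 w) (g2 w) (g3 w) (g4 w)) \<in> borel_measurable M"
  unfolding pw_def by measurable

lemma ps_measurable [measurable (raw)]:
  assumes [measurable]: "g1 \<in> measurable M (\<mu> n)" "g2 \<in> measurable M (\<mu> (Suc n))"
    "g3 \<in> measurable M (\<mu> (Suc (Suc n)))" "g4 \<in> measurable M (\<mu> (Suc (Suc (Suc n))))"
  shows "(\<lambda>w. ps n (g1 w) (g2 w) (g3 w) (g4 w)) \<in> borel_measurable M"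
  unfolding ps_def by measurable

lemma pw_nonneg [simp]: "0 \<le> pw n a m x y" by (simp add: pw_def)

lemma pw_le: "pw n a m x y \<le> 1 / e ^ 3"
proof -
  have "pw n a m x y \<le> 1 / e * (1 / e) * (1 / e)"
    unfolding pw_def by (intro mult_mono p_le) (use e in auto)
  then show ?thesis by (simp add: power3_eq_cube)
qed

lemma ps_diff_le: "\<bar>ps n a m x y - ps n a b m' y\<bar> \<le> 6 * K"
  using f_le[of n a m] f_le[of "Suc n" m x] f_le[of "Suc (Suc n)" x y]
    f_le[of n a b] f_le[of "Suc n" b m'] f_le[of "Suc (Suc n)" m' y]
  unfolding ps_def by linarith

text \<open>A hexagon consists of two three-step paths, \<open>a, m, x, y\<close> and
  \<open>a, b, m', y\<close>. The length three is chosen so that the edge from \<open>x\<close> to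
  \<open>y\<close> can be compared with the edge from \<open>a\<close> to \<open>b\<close> by means
  of one two-step path from \<open>a\<close> to \<open>x\<close> and another from \<open>b\<close>
  to \<open>y\<close>; this comparison is the germ of the coboundary decomposition. The points
  \<open>a\<close>, \<open>b\<close>, \<open>y\<close> come first because they are the outer
  variables when base points are chosen.\<close>

abbreviation cycles :: "nat \<Rightarrow> ('a \<times> 'a \<times> 'a \<times> 'a \<times> 'a \<times> 'a) measure" where
  "cycles n \<equiv> \<mu> n \<Otimes>\<^sub>M \<mu> (Suc n) \<Otimes>\<^sub>M \<mu> (Suc (Suc (Suc n))) \<Otimes>\<^sub>M \<mu> (Suc n) \<Otimes>\<^sub>M \<mu> (Suc (Suc n)) \<Otimes>\<^sub>M \<mu> (Suc (Suc n))"

lemma prob_space_cycles: "prob_space (cycles n)"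
  by (intro prob_space_pair prob_space_\<mu>)

definition cw :: "nat \<Rightarrow> 'a \<times> 'a \<times> 'a \<times> 'a \<times> 'a \<times> 'a \<Rightarrow> real" where
  "cw n = (\<lambda>(a, b, y, m, x, m'). pw n a m x y * pw n a b m' y)"

definition cb :: "nat \<Rightarrow> 'a \<times> 'a \<times> 'a \<times> 'a \<times> 'a \<times> 'a \<Rightarrow> real" where
  "cb n = (\<lambda>(a, b, y, m, x, m'). ps n a m x y - ps n a b m' y)"

lemma cw_measurable [measurable]: "cw n \<in> borel_measurable (cycles n)"
  unfolding cw_def by measurable

lemma cb_measurable [measurable]: "cb n \<in> borel_measurable (cycles n)"
  unfolding cb_def by measurable

lemma cw_nonneg [simp]: "0 \<le> cw n w"
  by (cases w) (simp add: cw_def)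

lemma cw_le: "cw n w \<le> 1 / e ^ 6"
proof (cases w)
  case (fields a b y m x m')
  have "cw n w \<le> 1 / e ^ 3 * (1 / e ^ 3)"
    unfolding fields cw_def prod.case by (intro mult_mono pw_le) (use e in auto)
  then show ?thesis by (simp flip: power_add)
qed

lemma cb_le: "\<bar>cb n w\<bar> \<le> 6 * K"
  by (cases w) (simp add: cb_def ps_diff_le)

text \<open>The structure constants: \<open>d2\<close> measures how far the sums along two random paths with
  common end points are from agreeing modulo \<open>2 * pi / t\<close>.\<close>

definition d2 :: "nat \<Rightarrow> real \<Rightarrow> real" where
  "d2 n t = (\<integral>w. cw n w * (1 - cos (t * cb n w)) \<partial>cycles n)"

lemma d2_integrable: "integrable (cycles n) (\<lambda>w. cw n w * (1 - cos (t * cb n w)))"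
proof -
  interpret prob_space "cycles n" by (rule prob_space_cycles)
  show ?thesis
  proof (rule integrable_bounded)
    fix w
    have "cw n w * (1 - cos (t * cb n w)) \<le> 1 / e ^ 6 * 2"
      using e by (intro mult_mono cw_le) (auto simp: one_minus_cos_bounds)
    then show "norm (cw n w * (1 - cos (t * cb n w))) \<le> 1 / e ^ 6 * 2"
      by (simp add: abs_mult abs_of_nonneg one_minus_cos_bounds)
  qed measurable
qed

lemma d2_nonneg: "0 \<le> d2 n t"
  unfolding d2_def by (intro Bochner_Integration.integral_nonneg mult_nonneg_nonneg cw_nonneg one_minus_cos_bounds)

lemma d2_le: "d2 n t \<le> 2 / e ^ 6"
proof -
  interpret prob_space "cycles n" by (rule prob_space_cycles)
  have "d2 n t \<le> (\<integral>w. 1 / e ^ 6 * 2 \<partial>cycles n)"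
    unfolding d2_def
  proof (rule integral_mono[OF d2_integrable])
    show "cw n w * (1 - cos (t * cb n w)) \<le> 1 / e ^ 6 * 2" for w
      using e by (intro mult_mono cw_le) (auto simp: one_minus_cos_bounds)
  qed simp
  then show ?thesis by (simp add: prob_space)
qed

lemma d2_diff_le: "d2 n (s - t) \<le> 2 * d2 n s + 2 * d2 n t"
proof -
  have "d2 n (s - t) \<le> (\<integral>w. 2 * (cw n w * (1 - cos (s * cb n w))) + 2 * (cw n w * (1 - cos (t * cb n w))) \<partial>cycles n)"
    unfolding d2_def
  proof (rule integral_mono[OF d2_integrable])
    fix w
    have "cw n w * (1 - cos (s * cb n w - t * cb n w)) \<le> cw n w * (2 * (1 - cos (s * cb n w)) + 2 * (1 - cos (t * cb n w)))"
      by (intro mult_left_mono one_minus_cos_diff_le cw_nonneg)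
    then show "cw n w * (1 - cos ((s - t) * cb n w)) \<le> 2 * (cw n w * (1 - cos (s * cb n w))) + 2 * (cw n w * (1 - cos (t * cb n w)))"
      by (simp add: algebra_simps)
  qed (intro Bochner_Integration.integrable_add integrable_mult_right d2_integrable)
  also have "\<dots> = 2 * d2 n s + 2 * d2 n t"
    unfolding d2_def by (simp add: d2_integrable)
  finally show ?thesis .
qed

lemma continuous_d2: "continuous_on UNIV (d2 n)"
proof -
  interpret prob_space "cycles n" by (rule prob_space_cycles)
  have "isCont (d2 n) t" for t
    unfolding continuous_at_sequentially comp_def d2_def
  proof (intro allI impI)
    fix u :: "nat \<Rightarrow> real" assume u: "u \<longlonglongrightarrow> t"
    show "(\<lambda>k. \<integral>w. cw n w * (1 - cos (u k * cb n w)) \<partial>cycles n) \<longlonglongrightarrow> (\<integral>w. cw n w * (1 - cos (t * cb n w)) \<partial>cycles n)"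
    proof (rule integral_dominated_convergence[where w = "\<lambda>_. 1 / e ^ 6 * 2"])
      have "norm (cw n w * (1 - cos (u k * cb n w))) \<le> 1 / e ^ 6 * 2" for k w
      proof -
        have "cw n w * (1 - cos (u k * cb n w)) \<le> 1 / e ^ 6 * 2"
          using e by (intro mult_mono cw_le) (auto simp: one_minus_cos_bounds)
        then show ?thesis by (simp add: abs_mult abs_of_nonneg one_minus_cos_bounds)
      qed
      then show "AE w in cycles n. norm (cw n w * (1 - cos (u k * cb n w))) \<le> 1 / e ^ 6 * 2" for k
        by (intro AE_I2)
      show "AE w in cycles n. (\<lambda>k. cw n w * (1 - cos (u k * cb n w))) \<longlonglongrightarrow> cw n w * (1 - cos (t * cb n w))"
        by (intro AE_I2 tendsto_intros u)
    qed simp_all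
  qed
  then show ?thesis by (intro continuous_at_imp_continuous_on) auto
qed

section \<open>Loss of modulus over a block of five steps\<close>

definition q3 :: "nat \<Rightarrow> 'a \<Rightarrow> 'a \<Rightarrow> real" where
  "q3 n a y = (\<integral>(m, x). pw n a m x y \<partial>(\<mu> (Suc n) \<Otimes>\<^sub>M \<mu> (Suc (Suc n))))"

text \<open>\<open>q3\<close> is the three-step transition density, and \<open>K3\<close> is the
  same density twisted by the phases of the paths. The amount by which its modulus falls short of
  \<open>q3\<close> measures the cancellation among paths from \<open>a\<close> to
  \<open>y\<close>.\<close>

definition K3 :: "real \<Rightarrow> nat \<Rightarrow> 'a \<Rightarrow> 'a \<Rightarrow> complex" where
  "K3 t n a y = (\<integral>(m, x). pw n a m x y *\<^sub>R cis (t * ps n a m x y) \<partial>(\<mu> (Suc n) \<Otimes>\<^sub>M \<mu> (Suc (Suc n))))"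

lemma K3_measurable [measurable (raw)]:
  assumes [measurable]: "g \<in> measurable M (\<mu> n)" "h \<in> measurable M (\<mu> (Suc (Suc (Suc n))))"
  shows "(\<lambda>w. K3 t n (g w) (h w)) \<in> borel_measurable M"
  unfolding K3_def by measurable

lemma q3_measurable [measurable (raw)]:
  assumes [measurable]: "g \<in> measurable M (\<mu> n)" "h \<in> measurable M (\<mu> (Suc (Suc (Suc n))))"
  shows "(\<lambda>w. q3 n (g w) (h w)) \<in> borel_measurable M"
  unfolding q3_def by measurable

lemma pw_integrable:
  fixes g :: "'a \<times> 'a \<Rightarrow> 'b::{banach, second_countable_topology}"
  assumes [measurable]: "g \<in> borel_measurable (\<mu> (Suc n) \<Otimes>\<^sub>M \<mu> (Suc (Suc n)))" and B: "\<And>w. norm (g w) \<le> B"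
  shows "integrable (\<mu> (Suc n) \<Otimes>\<^sub>M \<mu> (Suc (Suc n))) (\<lambda>(m, x). pw n a m x y *\<^sub>R g (m, x))"
proof (rule mu2.integrable_bounded)
  fix w :: "'a \<times> 'a"
  obtain m x where w: "w = (m, x)" by force
  have "pw n a m x y * norm (g (m, x)) \<le> 1 / e ^ 3 * B"
    by (intro mult_mono pw_le B) (use e in auto)
  then show "norm (case w of (m, x) \<Rightarrow> pw n a m x y *\<^sub>R g (m, x)) \<le> 1 / e ^ 3 * B" by (simp add: w)
qed measurable

lemma three_steps:
  assumes [measurable]: "u \<in> borel_measurable (\<mu> (Suc (Suc (Suc n))))" and B: "\<And>y. cmod (u y) \<le> B"
  shows "kint n a (\<lambda>m. cis (t * f n a m) * kint (Suc n) m (\<lambda>x. cis (t * f (Suc n) m x) *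
           kint (Suc (Suc n)) x (\<lambda>y. cis (t * f (Suc (Suc n)) x y) * u y)))
         = (\<integral>y. K3 t n a y * u y \<partial>\<mu> (Suc (Suc (Suc n))))" (is "?L = _")
proof -
  let ?W = "\<mu> (Suc n) \<Otimes>\<^sub>M \<mu> (Suc (Suc n))" and ?M = "\<mu> (Suc (Suc (Suc n)))"
  let ?h = "\<lambda>m x y. pw n a m x y *\<^sub>R (cis (t * ps n a m x y) * u y)"
  interpret W: prob_space ?W by (intro prob_space_pair prob_space_\<mu>)
  interpret WM: pair_prob_space ?W ?M ..
  have h_int: "integrable (?W \<Otimes>\<^sub>M ?M) (\<lambda>w. ?h (fst (fst w)) (snd (fst w)) (snd w))"
  proof (rule WM.integrable_bounded)
    fix w :: "('a \<times> 'a) \<times> 'a"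
    have "pw n a (fst (fst w)) (snd (fst w)) (snd w) * norm (u (snd w)) \<le> 1 / e ^ 3 * B"
      by (intro mult_mono pw_le B) (use e in auto)
    then show "norm (?h (fst (fst w)) (snd (fst w)) (snd w)) \<le> 1 / e ^ 3 * B" by (simp add: norm_mult)
  qed measurable
  have inner_bound: "norm (\<integral>y. ?h m x y \<partial>?M) \<le> 1 / e ^ 3 * B" for m x
  proof -
    have "norm (\<integral>y. ?h m x y \<partial>?M) \<le> (\<integral>y. norm (?h m x y) \<partial>?M)" by (rule integral_norm_bound)
    also have "\<dots> \<le> (\<integral>y. 1 / e ^ 3 * B \<partial>?M)"
    proof (rule integral_mono)
      have le: "norm (?h m x y) \<le> 1 / e ^ 3 * B" for y
      proof -
        have "pw n a m x y * norm (u y) \<le> 1 / e ^ 3 * B"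
          by (intro mult_mono pw_le B) (use e in auto)
        then show ?thesis by (simp add: norm_mult)
      qed
      then show "norm (?h m x y) \<le> 1 / e ^ 3 * B" for y .
      show "integrable ?M (\<lambda>y. norm (?h m x y))"
        by (rule mu.integrable_bounded[where B = "1 / e ^ 3 * B"]) (use le in auto)
    qed simp
    finally show ?thesis by (simp add: mu.prob_space[simplified])
  qed
  have "?L = (\<integral>m. (\<integral>x. (\<integral>y. ?h m x y \<partial>?M) \<partial>\<mu> (Suc (Suc n))) \<partial>\<mu> (Suc n))"
    unfolding kint_def
    by (simp only: integral_scaleR_right[symmetric] integral_mult_right_zero[symmetric] pw_def ps_def distrib_left cis_mult[symmetric])
       (simp only: mult_scaleR_right mult_scaleR_left scaleR_scaleR mult.assoc)
  also have "\<dots> = (\<integral>w. (\<integral>y. (case w of (m, x) \<Rightarrow> ?h m x y) \<partial>?M) \<partial>?W)"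
  proof (subst mu2.integral_fst'[symmetric])
    show "integrable ?W (\<lambda>w. \<integral>y. (case w of (m, x) \<Rightarrow> ?h m x y) \<partial>?M)"
      by (rule mu2.integrable_bounded[where B = "1 / e ^ 3 * B"]) (use inner_bound in \<open>auto split: prod.split\<close>)
  qed simp
  also have "\<dots> = (\<integral>y. (\<integral>w. (case w of (m, x) \<Rightarrow> ?h m x y) \<partial>?W) \<partial>?M)"
    by (rule WM.Fubini_integral[symmetric]) (use h_int in \<open>simp only: case_prod_unfold\<close>)
  also have "\<dots> = (\<integral>y. K3 t n a y * u y \<partial>?M)"
  proof (rule Bochner_Integration.integral_cong[OF refl])
    fix y
    have "(\<integral>w. (case w of (m, x) \<Rightarrow> ?h m x y) \<partial>?W) = (\<integral>w. (case w of (m, x) \<Rightarrow> pw n a m x y *\<^sub>R cis (t * ps n a m x y)) * u y \<partial>?W)"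
      by (intro Bochner_Integration.integral_cong) auto
    also have "\<dots> = K3 t n a y * u y"
      by (simp only: K3_def integral_mult_left_zero)
    finally show "(\<integral>w. (case w of (m, x) \<Rightarrow> ?h m x y) \<partial>?W) = K3 t n a y * u y" .
  qed
  finally show ?thesis .
qed

lemma K3_0: "K3 0 n a y = of_real (q3 n a y)"
  unfolding K3_def q3_def by (simp add: scaleR_conv_of_real case_prod_unfold)

lemma q3_int: "(\<integral>y. q3 n a y \<partial>\<mu> (Suc (Suc (Suc n)))) = 1"
proof -
  have "(\<integral>y. K3 0 n a y * 1 \<partial>\<mu> (Suc (Suc (Suc n)))) = 1"
    by (subst three_steps[symmetric, where B = 1]) simp_all
  then have "complex_of_real (\<integral>y. q3 n a y \<partial>\<mu> (Suc (Suc (Suc n)))) = of_real 1" by (simp add: K3_0)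
  then show ?thesis by (simp only: of_real_eq_iff)
qed

lemma q3_nonneg: "0 \<le> q3 n a y"
  unfolding q3_def by (intro Bochner_Integration.integral_nonneg) auto

lemma abs_q2_le: "\<bar>q2 n x z\<bar> \<le> 1 / e"
  using q2_le[of n x z] q2_ge[of n x z] e by (simp only: abs_of_nonneg)

lemma q3_le: "q3 n a y \<le> 1 / e"
proof -
  have "q3 n a y = (\<integral>m. (\<integral>x. pw n a m x y \<partial>\<mu> (Suc (Suc n))) \<partial>\<mu> (Suc n))"
    unfolding q3_def using pw_integrable[of "\<lambda>_. 1::real" n 1 a y]
    by (subst mu2.integral_fst'[symmetric]) simp_all
  also have "\<dots> = kint n a (\<lambda>m. q2 (Suc n) m y)"
    unfolding kint_def q2_def pw_def by (simp add: mult.assoc)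
  also have "\<dots> \<le> 1 / e"
    using norm_kint_bound[of "\<lambda>m. q2 (Suc n) m y" n "1 / e" a] abs_q2_le
    by (simp add: abs_le_iff)
  finally show ?thesis .
qed

lemma cmod_K3_le: "cmod (K3 t n a y) \<le> q3 n a y"
proof -
  have "cmod (K3 t n a y) \<le> (\<integral>w. norm (case w of (m, x) \<Rightarrow> pw n a m x y *\<^sub>R cis (t * ps n a m x y)) \<partial>(\<mu> (Suc n) \<Otimes>\<^sub>M \<mu> (Suc (Suc n))))"
    unfolding K3_def by (rule integral_norm_bound)
  also have "\<dots> = q3 n a y"
    unfolding q3_def by (intro Bochner_Integration.integral_cong) auto
  finally show ?thesis .
qed

text \<open>Squares are compared, and not moduli, because the difference of squares is an integral
  over pairs of paths that is linear in \<open>1 - cos\<close> of the phase difference. Its mean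
  over \<open>a\<close> is therefore a structure constant.\<close>

definition defect :: "real \<Rightarrow> nat \<Rightarrow> 'a \<Rightarrow> real" where
  "defect t n a = (\<integral>y. (q3 n a y)\<^sup>2 - (cmod (K3 t n a y))\<^sup>2 \<partial>\<mu> (Suc (Suc (Suc n))))"

lemma defect_integrand: "0 \<le> (q3 n a y)\<^sup>2 - (cmod (K3 t n a y))\<^sup>2" "(q3 n a y)\<^sup>2 - (cmod (K3 t n a y))\<^sup>2 \<le> 1 / e\<^sup>2"
proof -
  show "0 \<le> (q3 n a y)\<^sup>2 - (cmod (K3 t n a y))\<^sup>2" using cmod_K3_le[of t n a y] by (simp add: power_mono)
  have "(q3 n a y)\<^sup>2 \<le> (1 / e)\<^sup>2" by (intro power_mono q3_le q3_nonneg)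
  then show "(q3 n a y)\<^sup>2 - (cmod (K3 t n a y))\<^sup>2 \<le> 1 / e\<^sup>2"
    using zero_le_power2[of "cmod (K3 t n a y)"] by (simp only: power_divide power_one)
qed

lemma defect_measurable [measurable]: "defect t n \<in> borel_measurable (\<mu> n)"
  unfolding defect_def by measurable

lemma defect_bounds: "0 \<le> defect t n a" "defect t n a \<le> 1 / e\<^sup>2"
proof -
  show "0 \<le> defect t n a" unfolding defect_def by (intro Bochner_Integration.integral_nonneg defect_integrand)
  have "defect t n a \<le> (\<integral>y. 1 / e\<^sup>2 \<partial>\<mu> (Suc (Suc (Suc n))))"
    unfolding defect_def
    by (intro integral_mono mu.integrable_bounded[where B = "1 / e\<^sup>2"]) (use defect_integrand in auto)
  then show "defect t n a \<le> 1 / e\<^sup>2" by (simp add: mu.prob_space[simplified])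
qed

lemma norm_U_three:
  assumes s: "\<And>y. cmod (U t k (Suc (Suc (Suc n))) y) \<le> s"
  shows "cmod (U t (Suc (Suc (Suc k))) n a) \<le> s * (1 - e / 2 * defect t n a)"
proof -
  let ?M = "\<mu> (Suc (Suc (Suc n)))"
  have s0: "0 \<le> s" by (rule order_trans[OF norm_ge_zero s])
  have K_int: "integrable ?M (\<lambda>y. cmod (K3 t n a y))"
    by (rule mu.integrable_bounded[where B = "1 / e"]) (simp_all only: real_norm_def abs_norm_cancel order_trans[OF cmod_K3_le q3_le], measurable)
  have q_int: "integrable ?M (\<lambda>y. q3 n a y)"
    by (rule mu.integrable_bounded[where B = "1 / e"]) (simp_all only: real_norm_def abs_of_nonneg q3_nonneg q3_le, measurable)
  have d_int: "integrable ?M (\<lambda>y. (q3 n a y)\<^sup>2 - (cmod (K3 t n a y))\<^sup>2)"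
    by (rule mu.integrable_bounded[where B = "1 / e\<^sup>2"]) (use defect_integrand in auto)
  have eq: "U t (Suc (Suc (Suc k))) n a = (\<integral>y. K3 t n a y * U t k (Suc (Suc (Suc n))) y \<partial>?M)"
    using three_steps[OF U_measurable norm_U_le_1] by simp
  have "cmod (U t (Suc (Suc (Suc k))) n a) \<le> (\<integral>y. cmod (K3 t n a y * U t k (Suc (Suc (Suc n))) y) \<partial>?M)"
    unfolding eq by (rule integral_norm_bound)
  also have "\<dots> \<le> (\<integral>y. s * cmod (K3 t n a y) \<partial>?M)"
  proof (rule integral_mono)
    show "integrable ?M (\<lambda>y. cmod (K3 t n a y * U t k (Suc (Suc (Suc n))) y))"
    proof (rule mu.integrable_bounded)
      fix y
      have "cmod (K3 t n a y) * cmod (U t k (Suc (Suc (Suc n))) y) \<le> 1 / e * 1"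
        using e by (intro mult_mono order_trans[OF cmod_K3_le q3_le] norm_U_le_1) auto
      then show "norm (cmod (K3 t n a y * U t k (Suc (Suc (Suc n))) y)) \<le> 1 / e * 1"
        by (simp only: norm_mult[of "K3 t n a y"] real_norm_def abs_mult abs_norm_cancel)
    qed measurable
    show "cmod (K3 t n a y * U t k (Suc (Suc (Suc n))) y) \<le> s * cmod (K3 t n a y)" for y
      using mult_right_mono[OF s norm_ge_zero, of y "K3 t n a y"] by (simp only: norm_mult mult.commute)
  qed (rule integrable_mult_right[OF K_int])
  also have "\<dots> \<le> s * (\<integral>y. q3 n a y - e / 2 * ((q3 n a y)\<^sup>2 - (cmod (K3 t n a y))\<^sup>2) \<partial>?M)"
    unfolding integral_mult_right_zero
  proof (intro mult_left_mono s0 integral_mono K_int)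
    fix y
    let ?q = "q3 n a y" and ?r = "cmod (K3 t n a y)"
    have r: "0 \<le> ?r" "?r \<le> ?q" "?q \<le> 1 / e" by (simp_all only: norm_ge_zero cmod_K3_le q3_le)
    \<comment> \<open>Factoring the difference of squares passes from the quadratic to the linear
      loss: the sum of \<open>?q\<close> and \<open>?r\<close> is at most
      \<open>2 / e\<close>.\<close>
    then have "e / 2 * (?q + ?r) \<le> e / 2 * (2 / e)" using e by (intro mult_left_mono) auto
    then have "e / 2 * (?q + ?r) * (?q - ?r) \<le> 1 * (?q - ?r)" using r e by (intro mult_right_mono) auto
    then show "?r \<le> ?q - e / 2 * (?q\<^sup>2 - ?r\<^sup>2)" by (simp add: power2_eq_square algebra_simps)
  qed (intro Bochner_Integration.integrable_diff integrable_mult_right q_int d_int)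
  also have "(\<integral>y. q3 n a y - e / 2 * ((q3 n a y)\<^sup>2 - (cmod (K3 t n a y))\<^sup>2) \<partial>?M) = 1 - e / 2 * defect t n a"
    by (subst Bochner_Integration.integral_diff[OF q_int integrable_mult_right[OF d_int]]) (simp only: q3_int integral_mult_right_zero defect_def)
  finally show ?thesis .
qed

text \<open>The squared modulus is the sum of the squares of a cosine and a sine integral. Written
  as double integrals over pairs of paths, these combine by the addition formula for the
  cosine.\<close>

lemma defect_integrand_eq:
  "(q3 n a y)\<^sup>2 - (cmod (K3 t n a y))\<^sup>2 =
     (\<integral>v. (\<integral>w. pw n a (fst v) (snd v) y * pw n a (fst w) (snd w) y *
        (1 - cos (t * (ps n a (fst v) (snd v) y - ps n a (fst w) (snd w) y)))
        \<partial>(\<mu> (Suc n) \<Otimes>\<^sub>M \<mu> (Suc (Suc n)))) \<partial>(\<mu> (Suc n) \<Otimes>\<^sub>M \<mu> (Suc (Suc n))))"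
proof -
  let ?W = "\<mu> (Suc n) \<Otimes>\<^sub>M \<mu> (Suc (Suc n))"
  define P where "P v = pw n a (fst v) (snd v) y" for v
  define F where "F v = t * ps n a (fst v) (snd v) y" for v
  have [measurable]: "P \<in> borel_measurable ?W" "F \<in> borel_measurable ?W" unfolding P_def F_def by measurable
  have int: "integrable ?W (\<lambda>v. P v * g v)" if "g \<in> borel_measurable ?W" "\<And>v. \<bar>g v\<bar> \<le> 1" for g
    using pw_integrable[of g n 1 a y] that by (simp add: P_def case_prod_unfold)
  have intc: "integrable ?W (\<lambda>v. P v * cos (F v))" and ints: "integrable ?W (\<lambda>v. P v * sin (F v))" and int1: "integrable ?W P"
    using int[of "\<lambda>v. cos (F v)"] int[of "\<lambda>v. sin (F v)"] int[of "\<lambda>v. 1"] by simp_all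
  define c where "c = (\<integral>v. P v * cos (F v) \<partial>?W)"
  define s where "s = (\<integral>v. P v * sin (F v) \<partial>?W)"
  define q where "q = (\<integral>v. P v \<partial>?W)"
  have q: "q3 n a y = q" unfolding q3_def q_def P_def by (simp add: case_prod_unfold)
  have "K3 t n a y = (\<integral>v. of_real (P v * cos (F v)) + \<i> * of_real (P v * sin (F v)) \<partial>?W)"
    unfolding K3_def
    by (intro Bochner_Integration.integral_cong refl) (auto simp: P_def F_def case_prod_unfold complex_eq_iff)
  also have "\<dots> = of_real c + \<i> * of_real s"
    using intc ints unfolding c_def s_def
    by (subst Bochner_Integration.integral_add) (auto intro: integrable_of_real simp del: of_real_mult)
  finally have "(cmod (K3 t n a y))\<^sup>2 = c\<^sup>2 + s\<^sup>2" by (simp add: cmod_power2)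
  then have "(q3 n a y)\<^sup>2 - (cmod (K3 t n a y))\<^sup>2 = q\<^sup>2 - (c\<^sup>2 + s\<^sup>2)" by (simp add: q)
  also have "\<dots> = (\<integral>v. q * P v - c * (P v * cos (F v)) - s * (P v * sin (F v)) \<partial>?W)"
    using intc ints int1 by (simp add: c_def[symmetric] s_def[symmetric] q_def[symmetric] power2_eq_square)
  also have "\<dots> = (\<integral>v. (\<integral>w. P v * P w * (1 - cos (F v - F w)) \<partial>?W) \<partial>?W)"
  proof (intro Bochner_Integration.integral_cong refl)
    fix v
    have "(\<integral>w. P v * P w * (1 - cos (F v - F w)) \<partial>?W)
        = (\<integral>w. P v * P w - P v * cos (F v) * (P w * cos (F w)) - P v * sin (F v) * (P w * sin (F w)) \<partial>?W)"
      by (intro Bochner_Integration.integral_cong refl) (simp add: cos_diff algebra_simps)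
    also have "\<dots> = P v * q - P v * cos (F v) * c - P v * sin (F v) * s"
      using intc ints int1 by (simp add: c_def[symmetric] s_def[symmetric] q_def[symmetric])
    finally show "q * P v - c * (P v * cos (F v)) - s * (P v * sin (F v)) = (\<integral>w. P v * P w * (1 - cos (F v - F w)) \<partial>?W)"
      by (simp add: mult_ac)
  qed
  finally show ?thesis by (simp add: P_def F_def right_diff_distrib)
qed

lemma ennreal_defect_integrand:
  "ennreal ((q3 n a y)\<^sup>2 - (cmod (K3 t n a y))\<^sup>2) =
     (\<integral>\<^sup>+m. \<integral>\<^sup>+x. \<integral>\<^sup>+b. \<integral>\<^sup>+m'. ennreal (pw n a m x y * pw n a b m' y *
        (1 - cos (t * (ps n a m x y - ps n a b m' y)))) \<partial>\<mu> (Suc (Suc n)) \<partial>\<mu> (Suc n) \<partial>\<mu> (Suc (Suc n)) \<partial>\<mu> (Suc n))"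
proof -
  let ?W = "\<mu> (Suc n) \<Otimes>\<^sub>M \<mu> (Suc (Suc n))"
  let ?h = "\<lambda>v w. pw n a (fst v) (snd v) y * pw n a (fst w) (snd w) y *
        (1 - cos (t * (ps n a (fst v) (snd v) y - ps n a (fst w) (snd w) y)))"
  have h: "0 \<le> ?h v w" "?h v w \<le> 1 / e ^ 3 * (1 / e ^ 3) * 2" for v w
  proof -
    show "0 \<le> ?h v w" by (intro mult_nonneg_nonneg pw_nonneg one_minus_cos_bounds)
    show "?h v w \<le> 1 / e ^ 3 * (1 / e ^ 3) * 2"
      by (intro mult_mono pw_le one_minus_cos_bounds) (use e in \<open>auto simp: one_minus_cos_bounds\<close>)
  qed
  have int: "integrable ?W (\<lambda>w. ?h v w)" for v
    by (rule mu2.integrable_bounded[where B = "1 / e ^ 3 * (1 / e ^ 3) * 2"]) (use h in \<open>auto simp only: real_norm_def abs_of_nonneg\<close>, measurable)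
  have hb: "0 \<le> (\<integral>w. ?h v w \<partial>?W)" "(\<integral>w. ?h v w \<partial>?W) \<le> 1 / e ^ 3 * (1 / e ^ 3) * 2" for v
  proof -
    show "0 \<le> (\<integral>w. ?h v w \<partial>?W)" by (intro Bochner_Integration.integral_nonneg h)
    have "(\<integral>w. ?h v w \<partial>?W) \<le> (\<integral>w. 1 / e ^ 3 * (1 / e ^ 3) * 2 \<partial>?W)"
      by (rule integral_mono[OF int _ h(2)]) simp
    then show "(\<integral>w. ?h v w \<partial>?W) \<le> 1 / e ^ 3 * (1 / e ^ 3) * 2" by (simp only: mu2.prob_space lebesgue_integral_const scaleR_one)
  qed
  have "ennreal ((q3 n a y)\<^sup>2 - (cmod (K3 t n a y))\<^sup>2) = (\<integral>\<^sup>+v. ennreal (\<integral>w. ?h v w \<partial>?W) \<partial>?W)"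
    unfolding defect_integrand_eq
  proof (rule nn_integral_eq_integral[symmetric])
    show "integrable ?W (\<lambda>v. \<integral>w. ?h v w \<partial>?W)"
      by (rule mu2.integrable_bounded[where B = "1 / e ^ 3 * (1 / e ^ 3) * 2"]) (use hb in \<open>auto simp only: real_norm_def abs_of_nonneg\<close>, measurable)
  qed (use hb in auto)
  also have "\<dots> = (\<integral>\<^sup>+v. (\<integral>\<^sup>+w. ennreal (?h v w) \<partial>?W) \<partial>?W)"
    by (intro nn_integral_cong nn_integral_eq_integral[symmetric] int AE_I2 h)
  also have "\<dots> = (\<integral>\<^sup>+m. \<integral>\<^sup>+x. (\<integral>\<^sup>+w. ennreal (?h (m, x) w) \<partial>?W) \<partial>\<mu> (Suc (Suc n)) \<partial>\<mu> (Suc n))"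
    by (rule mu.nn_integral_fst[symmetric]) measurable
  also have "\<dots> = (\<integral>\<^sup>+m. \<integral>\<^sup>+x. \<integral>\<^sup>+b. \<integral>\<^sup>+m'. ennreal (?h (m, x) (b, m')) \<partial>\<mu> (Suc (Suc n)) \<partial>\<mu> (Suc n) \<partial>\<mu> (Suc (Suc n)) \<partial>\<mu> (Suc n))"
    by (intro nn_integral_cong mu.nn_integral_fst[symmetric]) measurable
  finally show ?thesis by simp
qed

lemma ennreal_d2:
  "ennreal (d2 n t) = (\<integral>\<^sup>+a. \<integral>\<^sup>+b. \<integral>\<^sup>+y. \<integral>\<^sup>+m. \<integral>\<^sup>+x. \<integral>\<^sup>+m'.
      ennreal (pw n a m x y * pw n a b m' y * (1 - cos (t * (ps n a m x y - ps n a b m' y))))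
      \<partial>\<mu> (Suc (Suc n)) \<partial>\<mu> (Suc (Suc n)) \<partial>\<mu> (Suc n) \<partial>\<mu> (Suc (Suc (Suc n))) \<partial>\<mu> (Suc n) \<partial>\<mu> n)"
proof -
  have "ennreal (d2 n t) = (\<integral>\<^sup>+w. ennreal (cw n w * (1 - cos (t * cb n w))) \<partial>cycles n)"
    unfolding d2_def
    by (intro nn_integral_eq_integral[symmetric] d2_integrable AE_I2 mult_nonneg_nonneg cw_nonneg one_minus_cos_bounds)
  also have "\<dots> = (\<integral>\<^sup>+a. \<integral>\<^sup>+b. \<integral>\<^sup>+y. \<integral>\<^sup>+m. \<integral>\<^sup>+x. \<integral>\<^sup>+m'.
      ennreal (cw n (a, b, y, m, x, m') * (1 - cos (t * cb n (a, b, y, m, x, m'))))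
      \<partial>\<mu> (Suc (Suc n)) \<partial>\<mu> (Suc (Suc n)) \<partial>\<mu> (Suc n) \<partial>\<mu> (Suc (Suc (Suc n))) \<partial>\<mu> (Suc n) \<partial>\<mu> n)"
    by (simp add: sigma_finite_measure.nn_integral_fst[symmetric] prob_space_imp_sigma_finite prob_space_pair prob_space_\<mu>)
  finally show ?thesis by (simp add: cw_def cb_def)
qed

text \<open>Both sides integrate the same function over hexagons. The integrand is nonnegative, so
  the order of integration may be changed one adjacent pair at a time.\<close>

lemma integral_defect: "(\<integral>a. defect t n a \<partial>\<mu> n) = d2 n t"
proof -
  let ?F = "\<lambda>a b y m x m'. ennreal (pw n a m x y * pw n a b m' y * (1 - cos (t * (ps n a m x y - ps n a b m' y))))"
  let ?M1 = "\<mu> (Suc n)" and ?M2 = "\<mu> (Suc (Suc n))" and ?M3 = "\<mu> (Suc (Suc (Suc n)))"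
  have "ennreal (\<integral>a. defect t n a \<partial>\<mu> n) = (\<integral>\<^sup>+a. ennreal (defect t n a) \<partial>\<mu> n)"
    by (intro nn_integral_eq_integral[symmetric] AE_I2 defect_bounds mu.integrable_bounded[where B = "1 / e\<^sup>2"])
       (simp_all only: real_norm_def abs_of_nonneg defect_bounds defect_measurable)
  also have "\<dots> = (\<integral>\<^sup>+a. (\<integral>\<^sup>+y. ennreal ((q3 n a y)\<^sup>2 - (cmod (K3 t n a y))\<^sup>2) \<partial>?M3) \<partial>\<mu> n)"
    unfolding defect_def
    by (intro nn_integral_cong nn_integral_eq_integral[symmetric] AE_I2 defect_integrand mu.integrable_bounded[where B = "1 / e\<^sup>2"])
       (simp_all only: real_norm_def abs_of_nonneg defect_integrand, measurable)
  also have "\<dots> = (\<integral>\<^sup>+a. \<integral>\<^sup>+y. \<integral>\<^sup>+m. \<integral>\<^sup>+x. \<integral>\<^sup>+b. \<integral>\<^sup>+m'. ?F a b y m x m' \<partial>?M2 \<partial>?M1 \<partial>?M2 \<partial>?M1 \<partial>?M3 \<partial>\<mu> n)"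
    unfolding ennreal_defect_integrand ..
  also have "\<dots> = (\<integral>\<^sup>+a. \<integral>\<^sup>+y. \<integral>\<^sup>+m. \<integral>\<^sup>+b. \<integral>\<^sup>+x. \<integral>\<^sup>+m'. ?F a b y m x m' \<partial>?M2 \<partial>?M2 \<partial>?M1 \<partial>?M1 \<partial>?M3 \<partial>\<mu> n)"
    by (intro nn_integral_cong mu2.Fubini') measurable
  also have "\<dots> = (\<integral>\<^sup>+a. \<integral>\<^sup>+y. \<integral>\<^sup>+b. \<integral>\<^sup>+m. \<integral>\<^sup>+x. \<integral>\<^sup>+m'. ?F a b y m x m' \<partial>?M2 \<partial>?M2 \<partial>?M1 \<partial>?M1 \<partial>?M3 \<partial>\<mu> n)"
    by (intro nn_integral_cong mu2.Fubini') measurable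
  also have "\<dots> = (\<integral>\<^sup>+a. \<integral>\<^sup>+b. \<integral>\<^sup>+y. \<integral>\<^sup>+m. \<integral>\<^sup>+x. \<integral>\<^sup>+m'. ?F a b y m x m' \<partial>?M2 \<partial>?M2 \<partial>?M1 \<partial>?M3 \<partial>?M1 \<partial>\<mu> n)"
    by (intro nn_integral_cong mu2.Fubini') measurable
  also have "\<dots> = ennreal (d2 n t)" unfolding ennreal_d2 ..
  finally show ?thesis
    by (subst (asm) ennreal_inj) (auto intro!: Bochner_Integration.integral_nonneg defect_bounds d2_nonneg)
qed

text \<open>Two steps bring the chain from any starting point to at least \<open>e\<close> times the
  reference measure, so the average defect seen is at least \<open>e * d2\<close>. The next three
  steps lose \<open>e / 2\<close> times this average, which explains \<open>e^2 / 2\<close>.\<close>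

lemma norm_U_five:
  assumes s: "\<And>y. cmod (U t k (n + 5) y) \<le> s"
  shows "cmod (U t (k + 5) n x) \<le> s * exp (- (e\<^sup>2 / 2) * d2 (n + 2) t)"
proof -
  have s0: "0 \<le> s" by (rule order_trans[OF norm_ge_zero s])
  let ?n1 = "Suc n" let ?n2 = "Suc (Suc n)"
  define g where "g a = s * (1 - e / 2 * defect t ?n2 a)" for a
  have [measurable]: "g \<in> borel_measurable (\<mu> ?n2)" unfolding g_def by measurable
  have three: "cmod (U t (k + 3) ?n2 a) \<le> g a" for a
    unfolding g_def using norm_U_three[of t k ?n2 s a] s by (simp add: eval_nat_numeral)
  have gb: "0 \<le> g a" "g a \<le> s" for a
  proof -
    show "0 \<le> g a" by (rule order_trans[OF norm_ge_zero three])
    have "s * (1 - e / 2 * defect t ?n2 a) \<le> s * 1"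
      using e defect_bounds(1)[of t ?n2 a] by (intro mult_left_mono s0) auto
    then show "g a \<le> s" by (simp add: g_def)
  qed
  have four: "cmod (U t (k + 4) ?n1 y) \<le> kint ?n1 y g" for y
  proof -
    have "cmod (U t (k + 4) ?n1 y) \<le> kint ?n1 y (\<lambda>a. cmod (cis (t * f ?n1 y a) * U t (k + 3) ?n2 a))"
      using norm_kint_le[of "\<lambda>a. cis (t * f ?n1 y a) * U t (k + 3) ?n2 a" ?n1 1 y] norm_U_le_1[of t "k + 3" ?n2]
      by (simp add: eval_nat_numeral norm_mult)
    also have "\<dots> \<le> kint ?n1 y g"
      using norm_U_le_1[of t "k + 3" ?n2] three gb by (intro kint_mono[where B = 1 and B' = s]) (auto simp: norm_mult)
    finally show ?thesis .
  qed
  have gk: "0 \<le> kint ?n1 y g" "kint ?n1 y g \<le> s" for y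
    using kint_nonneg[OF gb(1)] norm_kint_bound[of g ?n1 s y] gb by auto
  have "cmod (U t (k + 5) n x) \<le> kint n x (\<lambda>y. cmod (cis (t * f n x y) * U t (k + 4) ?n1 y))"
    using norm_kint_le[of "\<lambda>y. cis (t * f n x y) * U t (k + 4) ?n1 y" n 1 x] norm_U_le_1[of t "k + 4" ?n1]
    by (simp add: eval_nat_numeral norm_mult)
  also have "\<dots> \<le> kint n x (\<lambda>y. kint ?n1 y g)"
    using norm_U_le_1[of t "k + 4" ?n1] four gk by (intro kint_mono[where B = 1 and B' = s]) (auto simp: norm_mult)
  also have "\<dots> = s - s * (e / 2) * kint n x (\<lambda>y. kint ?n1 y (defect t ?n2))"
  proof -
    have db: "\<bar>defect t ?n2 a\<bar> \<le> 1 / e\<^sup>2" for a using defect_bounds[of t ?n2 a] by simp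
    have cb: "\<bar>s * (e / 2) * defect t ?n2 a\<bar> \<le> s * (e / 2) * (1 / e\<^sup>2)" for a
      unfolding abs_mult using s0 e db by (intro mult_mono) auto
    have "kint ?n1 y g = s - s * (e / 2) * kint ?n1 y (defect t ?n2)" for y
    proof -
      have "kint ?n1 y g = kint ?n1 y (\<lambda>a. s - s * (e / 2) * defect t ?n2 a)"
        by (simp add: g_def[abs_def] algebra_simps)
      also have "\<dots> = s - s * (e / 2) * kint ?n1 y (defect t ?n2)"
      proof -
        have "kint ?n1 y (\<lambda>a. s - s * (e / 2) * defect t ?n2 a) = kint ?n1 y (\<lambda>_. s) - kint ?n1 y (\<lambda>a. s * (e / 2) * defect t ?n2 a)"
          by (rule kint_diff[where B = s and B' = "s * (e / 2) * (1 / e\<^sup>2)"]) (use cb s0 in simp_all)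
        then show ?thesis by (simp only: kint_const kint_cmult)
      qed
      finally show ?thesis .
    qed
    moreover have "\<bar>s * (e / 2) * kint ?n1 y (defect t ?n2)\<bar> \<le> s * (e / 2) * (1 / e\<^sup>2)" for y
      unfolding abs_mult using s0 e norm_kint_bound[of "defect t ?n2" ?n1 "1 / e\<^sup>2" y] db by (intro mult_mono) auto
    ultimately have "kint n x (\<lambda>y. kint ?n1 y g) = kint n x (\<lambda>_. s) - kint n x (\<lambda>y. s * (e / 2) * kint ?n1 y (defect t ?n2))"
      by (simp only:) (rule kint_diff[where B = s and B' = "s * (e / 2) * (1 / e\<^sup>2)"], simp_all add: s0)
    then show ?thesis by (simp only: kint_const kint_cmult)
  qed
  also have "\<dots> \<le> s - s * (e / 2) * (e * d2 ?n2 t)"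
    using kint_kint_ge[of "defect t ?n2" n "1 / e\<^sup>2" x] defect_bounds[of t ?n2] s0 e
    by (intro diff_left_mono mult_left_mono) (auto simp: integral_defect)
  also have "\<dots> = s * (1 + (- (e\<^sup>2 / 2) * d2 ?n2 t))" by (simp add: power2_eq_square algebra_simps)
  also have "\<dots> \<le> s * exp (- (e\<^sup>2 / 2) * d2 ?n2 t)" by (intro mult_left_mono s0 exp_ge_add_one_self)
  finally show ?thesis by simp
qed

lemma norm_U_blocks: "cmod (U t (5 * q + r) n x) \<le> exp (- (e\<^sup>2 / 2) * (\<Sum>j<q. d2 (n + 2 + 5 * j) t))"
proof (induction q arbitrary: n x)
  case 0
  then show ?case by (simp add: norm_U_le_1)
next
  case (Suc q)
  have "cmod (U t ((5 * q + r) + 5) n x) \<le> exp (- (e\<^sup>2 / 2) * (\<Sum>j<q. d2 (n + 5 + 2 + 5 * j) t)) * exp (- (e\<^sup>2 / 2) * d2 (n + 2) t)"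
    by (rule norm_U_five) (rule Suc.IH)
  also have "\<dots> = exp (- (e\<^sup>2 / 2) * (\<Sum>j<Suc q. d2 (n + 2 + 5 * j) t))"
    unfolding sum.lessThan_Suc_shift by (simp add: exp_add[symmetric] algebra_simps)
  finally show ?case by (simp add: algebra_simps)
qed

definition D :: "nat \<Rightarrow> real \<Rightarrow> real" where "D N t = (\<Sum>i<N. d2 i t)"

text \<open>The five residue classes of the block decomposition are combined by multiplying the bounds.\<close>

lemma norm_U_le_D:
  "cmod (U t k n x) \<le> exp (e\<^sup>2 / 10 * (2 / e ^ 6 * real (n + 12))) * exp (- (e\<^sup>2 / 10) * D (n + k) t)"
proof -
  \<comment> \<open>One block is given up so that \<open>q\<close> blocks fit for each of the five
    offsets.\<close>
  define q where "q = k div 5 - 1"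
  \<comment> \<open>The blocks miss the first \<open>n + 2\<close> indices and at most 10 indices at
    the end, each costing at most \<open>2 / e ^ 6\<close>.\<close>
  have all: "D (n + k) t \<le> (\<Sum>i<5 * q. d2 (n + 2 + i) t) + 2 / e ^ 6 * real (n + 12)"
  proof -
    have "{..<n + k} \<subseteq> {..<n + 2} \<union> (\<lambda>i. n + 2 + i) ` {..<5 * q} \<union> {n + k - 10..<n + k}"
    proof
      fix i assume "i \<in> {..<n + k}"
      then have i: "i < n + k" by simp
      show "i \<in> {..<n + 2} \<union> (\<lambda>i. n + 2 + i) ` {..<5 * q} \<union> {n + k - 10..<n + k}"
      proof (cases "i < n + 2 \<or> n + k - 10 \<le> i")
        case False
        then have "i - (n + 2) < 5 * q" using i unfolding q_def by simp presburger
        moreover have "i = n + 2 + (i - (n + 2))" using False by linarith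
        ultimately show ?thesis by blast
      qed (use i in auto)
    qed
    then have "D (n + k) t \<le> (\<Sum>i\<in>{..<n + 2} \<union> (\<lambda>i. n + 2 + i) ` {..<5 * q} \<union> {n + k - 10..<n + k}. d2 i t)"
      unfolding D_def by (intro sum_mono2) (auto simp: d2_nonneg)
    also have "\<dots> \<le> (\<Sum>i\<in>{..<n + 2}. d2 i t) + (\<Sum>i\<in>(\<lambda>i. n + 2 + i) ` {..<5 * q}. d2 i t) + (\<Sum>i\<in>{n + k - 10..<n + k}. d2 i t)"
      by (intro order_trans[OF sum_Un_le] add_mono order_refl) (auto simp: d2_nonneg)
    also have "(\<Sum>i\<in>(\<lambda>i. n + 2 + i) ` {..<5 * q}. d2 i t) = (\<Sum>i<5 * q. d2 (n + 2 + i) t)"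
      by (subst sum.reindex) (auto simp: inj_on_def)
    also have "(\<Sum>i\<in>{..<n + 2}. d2 i t) \<le> real (n + 2) * (2 / e ^ 6)"
      using sum_bounded_above[of "{..<n + 2}" "\<lambda>i. d2 i t" "2 / e ^ 6"] d2_le by simp
    also have "(\<Sum>i\<in>{n + k - 10..<n + k}. d2 i t) \<le> 10 * (2 / e ^ 6)"
    proof -
      have "(\<Sum>i\<in>{n + k - 10..<n + k}. d2 i t) \<le> real (card {n + k - 10..<n + k}) * (2 / e ^ 6)"
        using d2_le by (intro sum_bounded_above) simp
      also have "\<dots> \<le> 10 * (2 / e ^ 6)" using e by (intro mult_right_mono) auto
      finally show ?thesis .
    qed
    finally show ?thesis by (simp add: algebra_simps add_divide_distrib)
  qed
  have "cmod (U t k n x) \<le> exp (- (e\<^sup>2 / 2) * (\<Sum>j<q. d2 (n + 2 + 5 * j + r) t))" if "r < 5" for r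
  proof (cases "q = 0")
    case True
    then show ?thesis by (simp add: norm_U_le_1)
  next
    case False
    then have "k = r + (5 * q + (k - r - 5 * q))" using that unfolding q_def by simp
    then obtain r' where k: "k = r + (5 * q + r')" by blast
    have "cmod (U t k n x) \<le> exp (- (e\<^sup>2 / 2) * (\<Sum>j<q. d2 (n + r + 2 + 5 * j) t))"
      unfolding k by (rule norm_U_prefix) (rule norm_U_blocks)
    then show ?thesis by (simp add: ac_simps)
  qed
  then have "(\<Prod>r<(5::nat). cmod (U t k n x)) \<le> (\<Prod>r<(5::nat). exp (- (e\<^sup>2 / 2) * (\<Sum>j<q. d2 (n + 2 + 5 * j + r) t)))"
    by (intro prod_mono) auto
  also have "\<dots> = exp (\<Sum>r<(5::nat). - (e\<^sup>2 / 2) * (\<Sum>j<q. d2 (n + 2 + 5 * j + r) t))"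
    by (simp add: exp_sum)
  also have "(\<Sum>r<(5::nat). - (e\<^sup>2 / 2) * (\<Sum>j<q. d2 (n + 2 + 5 * j + r) t)) = - (e\<^sup>2 / 2) * (\<Sum>j<q. \<Sum>r<(5::nat). d2 (n + 2 + 5 * j + r) t)"
    by (subst sum_distrib_left[symmetric], subst sum.swap) simp
  also have "(\<Sum>j<q. \<Sum>r<(5::nat). d2 (n + 2 + 5 * j + r) t) = (\<Sum>i<5 * q. d2 (n + 2 + i) t)"
  proof -
    have "(\<Sum>r<(5::nat). d2 (n + 2 + 5 * j + r) t) = (\<Sum>i = j * 5..<j * 5 + 5. d2 (n + 2 + i) t)" for j
      by (rule sum.reindex_bij_witness[of _ "\<lambda>i. i - j * 5" "\<lambda>r. j * 5 + r"]) (auto simp: ac_simps)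
    then show ?thesis using sum.nat_group[of "\<lambda>i. d2 (n + 2 + i) t" 5 q] by (simp add: mult.commute)
  qed
  finally have "cmod (U t k n x) ^ 5 \<le> exp (- (e\<^sup>2 / 2) * (\<Sum>i<5 * q. d2 (n + 2 + i) t))" by simp
  also have "\<dots> \<le> exp (e\<^sup>2 / 2 * (2 / e ^ 6 * real (n + 12)) - (e\<^sup>2 / 2) * D (n + k) t)"
    using mult_left_mono[OF all, of "e\<^sup>2 / 2"] e by (simp add: algebra_simps)
  also have "\<dots> = exp (e\<^sup>2 / 10 * (2 / e ^ 6 * real (n + 12)) + - (e\<^sup>2 / 10) * D (n + k) t) ^ 5"
    by (subst exp_of_nat_mult[symmetric]) (simp add: algebra_simps)
  finally have "cmod (U t k n x) \<le> exp (e\<^sup>2 / 10 * (2 / e ^ 6 * real (n + 12)) + - (e\<^sup>2 / 10) * D (n + k) t)"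
    by (rule power_le_imp_le_base[of _ 4, simplified]) simp
  then show ?thesis by (simp only: exp_add)
qed

lemma D_mono: "D N t \<le> D (Suc N) t"
  by (simp add: D_def d2_nonneg)

lemma D_nonneg: "0 \<le> D N t"
  unfolding D_def by (intro sum_nonneg d2_nonneg)

lemma D_diff_le: "D N (s - t) \<le> 2 * D N s + 2 * D N t"
  unfolding D_def sum_distrib_left sum.distrib[symmetric] by (intro sum_mono d2_diff_le)

lemma continuous_D: "continuous_on UNIV (D N)"
  unfolding D_def[abs_def] by (intro continuous_intros continuous_d2)

text \<open>All phases are at most 1 in modulus here, where \<open>1 - cos x\<close> lies between
  \<open>x^2 / 4\<close> and \<open>x^2 / 2\<close>. The quotient of these two constants accounts
  for the factor 2 in the denominator.\<close>

lemma d2_small_le: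
  assumes r: "0 < r" "r * (6 * K) \<le> 1" and t: "\<bar>t\<bar> \<le> r"
  shows "t\<^sup>2 / (2 * r\<^sup>2) * d2 n r \<le> d2 n t"
proof -
  have "(\<integral>w. t\<^sup>2 / (2 * r\<^sup>2) * (cw n w * (1 - cos (r * cb n w))) \<partial>cycles n) \<le> (\<integral>w. cw n w * (1 - cos (t * cb n w)) \<partial>cycles n)"
  proof (intro integral_mono integrable_mult_right d2_integrable)
    fix w
    have "\<bar>t * cb n w\<bar> \<le> r * (6 * K)" unfolding abs_mult using t r by (intro mult_mono cb_le) auto
    then have "(t * cb n w)\<^sup>2 / 4 \<le> 1 - cos (t * cb n w)" using r by (intro one_minus_cos_ge_quarter) auto
    moreover have "t\<^sup>2 / (2 * r\<^sup>2) * (1 - cos (r * cb n w)) \<le> t\<^sup>2 / (2 * r\<^sup>2) * ((r * cb n w)\<^sup>2 / 2)"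
      by (intro mult_left_mono one_minus_cos_le) auto
    moreover have "t\<^sup>2 / (2 * r\<^sup>2) * ((r * cb n w)\<^sup>2 / 2) = (t * cb n w)\<^sup>2 / 4"
      using r by (simp add: power_mult_distrib)
    ultimately have "t\<^sup>2 / (2 * r\<^sup>2) * (1 - cos (r * cb n w)) \<le> 1 - cos (t * cb n w)" by linarith
    from mult_left_mono[OF this cw_nonneg[of n w]]
    show "t\<^sup>2 / (2 * r\<^sup>2) * (cw n w * (1 - cos (r * cb n w))) \<le> cw n w * (1 - cos (t * cb n w))"
      by (simp only: mult.left_commute)
  qed
  then show ?thesis by (simp only: d2_def integral_mult_right_zero)
qed

lemma D_small_le:
  assumes r: "0 < r" "r * (6 * K) \<le> 1" and t: "\<bar>t\<bar> \<le> r"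
  shows "t\<^sup>2 / (2 * r\<^sup>2) * D N r \<le> D N t"
  unfolding D_def sum_distrib_left by (intro sum_mono d2_small_le assms)

end

section \<open>Coboundary decomposition\<close>

lemma abs_cos_diff_le: "\<bar>cos u - cos v\<bar> \<le> \<bar>u - v :: real\<bar>"
proof -
  have "\<bar>cos u - cos v\<bar> = 2 * \<bar>sin ((u + v) / 2)\<bar> * \<bar>sin ((v - u) / 2)\<bar>"
    unfolding cos_diff_cos by (simp add: abs_mult)
  also have "\<dots> \<le> 2 * 1 * \<bar>(v - u) / 2\<bar>"
    by (intro mult_mono abs_sin_le_one abs_sin_x_le_abs_x) auto
  finally show ?thesis by simp
qed

text \<open>Countably many candidate values allow a measurable choice: the first one that is good
  enough can be taken.\<close>

lemma dense_sequence_in_interval: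
  fixes B :: real assumes "B \<ge> 0"
  obtains q :: "nat \<Rightarrow> real" where "\<And>k. \<bar>q k\<bar> \<le> B" "\<And>r d. \<bar>r\<bar> \<le> B \<Longrightarrow> d > 0 \<Longrightarrow> \<exists>k. \<bar>q k - r\<bar> < d"
proof (rule that)
  let ?rr = "\<lambda>k. real_of_rat (nat_to_rat_surj k)"
  let ?q = "\<lambda>k. max (- B) (min B (?rr k))"
  show "\<bar>?q k\<bar> \<le> B" for k using assms by (auto simp: abs_le_iff)
  show "\<exists>k. \<bar>?q k - r\<bar> < d" if "\<bar>r\<bar> \<le> B" "d > 0" for r d
  proof -
    obtain s where s: "r < of_rat s" "of_rat s < r + d" using of_rat_dense[of r "r + d"] \<open>d > 0\<close> by auto
    obtain k where "s = nat_to_rat_surj k" using surj_nat_to_rat_surj by (metis surj_def)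
    then have "\<bar>?q k - r\<bar> < d" using s that by (auto simp: abs_le_iff max_def min_def)
    then show ?thesis ..
  qed
qed

context elliptic_functional
begin

section \<open>Costs of hexagons and the choice of base points\<close>

lemma nn_p [simp]: "(\<integral>\<^sup>+y. ennreal (p n x y) \<partial>\<mu> (Suc n)) = 1"
  using kernel_integrable[of "\<lambda>_. 1::real" n 1 x] by (subst nn_integral_eq_integral) simp_all

lemma nn_q2: "(\<integral>\<^sup>+y. ennreal (p n x y * p (Suc n) y z) \<partial>\<mu> (Suc n)) = ennreal (q2 n x z)"
  using kernel_integrable[of "\<lambda>y. p (Suc n) y z" n "1 / e" x] p_le
  by (subst nn_integral_eq_integral) (simp_all add: q2_def)

lemma nn_p_le:
  assumes [measurable]: "g \<in> borel_measurable (\<mu> (Suc n))"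
  shows "(\<integral>\<^sup>+y. ennreal (p n x y) * g y \<partial>\<mu> (Suc n)) \<le> ennreal (1 / e) * (\<integral>\<^sup>+y. g y \<partial>\<mu> (Suc n))"
proof -
  have "(\<integral>\<^sup>+y. ennreal (p n x y) * g y \<partial>\<mu> (Suc n)) \<le> (\<integral>\<^sup>+y. ennreal (1 / e) * g y \<partial>\<mu> (Suc n))"
    by (intro nn_integral_mono mult_right_mono ennreal_leI p_le) simp
  also have "\<dots> = ennreal (1 / e) * (\<integral>\<^sup>+y. g y \<partial>\<mu> (Suc n))" by (rule nn_integral_cmult) measurable
  finally show ?thesis .
qed

text \<open>\<open>gap t s\<close> is half the squared distance of \<open>t * s\<close> to \<open>0\<close> on the unit circle.\<close>

definition gap :: "real \<Rightarrow> real \<Rightarrow> real" where "gap t s = 1 - cos (t * s)"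

lemma gap_nonneg [simp]: "0 \<le> gap t s" by (simp add: gap_def)

lemma gap_measurable [measurable]: "gap t \<in> borel_measurable borel"
  unfolding gap_def[abs_def] by measurable

lemma gap_minus: "gap t (- s) = gap t s" by (simp add: gap_def)

lemma gap_add3: "gap t (a + b + c) \<le> 3 * (gap t a + gap t b + gap t c)"
  unfolding gap_def using one_minus_cos_add3_le[of "t * a" "t * b" "t * c"] by (simp only: distrib_left)

lemma gap_lipschitz: "gap t (s - r') \<le> gap t (s - r) + \<bar>t\<bar> * \<bar>r - r'\<bar>"
proof -
  have "gap t (s - r') - gap t (s - r) \<le> \<bar>t * (s - r) - t * (s - r')\<bar>"
    unfolding gap_def using abs_cos_diff_le[of "t * (s - r)" "t * (s - r')"] by linarith
  also have "t * (s - r) - t * (s - r') = t * (r' - r)" by (simp add: algebra_simps)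
  finally show ?thesis by (simp add: abs_mult abs_minus_commute)
qed

text \<open>A small value says that the sum along a random two-step path from \<open>b\<close> to
  \<open>y\<close> nearly equals \<open>r\<close> modulo \<open>2 * pi / t\<close>. Such an
  \<open>r\<close> is a candidate for the potential at \<open>y\<close>.\<close>

definition fork :: "real \<Rightarrow> nat \<Rightarrow> 'a \<Rightarrow> 'a \<Rightarrow> real \<Rightarrow> ennreal" where
  "fork t n b y r = (\<integral>\<^sup>+m. ennreal (p n b m * p (Suc n) m y * gap t (f n b m + f (Suc n) m y - r)) \<partial>\<mu> (Suc n))"

lemma fork_measurable [measurable (raw)]:
  assumes [measurable]: "g1 \<in> measurable M (\<mu> n)" "g2 \<in> measurable M (\<mu> (Suc (Suc n)))" "g3 \<in> borel_measurable M"
  shows "(\<lambda>w. fork t n (g1 w) (g2 w) (g3 w)) \<in> borel_measurable M"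
  unfolding fork_def by measurable

text \<open>This permits replacing a good value of \<open>r\<close> by a nearby member of a dense
  sequence.\<close>

lemma fork_lipschitz: "fork t n b y r' \<le> fork t n b y r + ennreal (\<bar>t\<bar> * \<bar>r - r'\<bar> / e)"
proof -
  have "fork t n b y r' \<le> (\<integral>\<^sup>+m. ennreal (p n b m * p (Suc n) m y * gap t (f n b m + f (Suc n) m y - r))
        + ennreal (\<bar>t\<bar> * \<bar>r - r'\<bar>) * ennreal (p n b m * p (Suc n) m y) \<partial>\<mu> (Suc n))"
    unfolding fork_def
  proof (intro nn_integral_mono)
    fix m
    have "p n b m * p (Suc n) m y * gap t (f n b m + f (Suc n) m y - r')
        \<le> p n b m * p (Suc n) m y * (gap t (f n b m + f (Suc n) m y - r) + \<bar>t\<bar> * \<bar>r - r'\<bar>)"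
      by (intro mult_left_mono gap_lipschitz) simp
    also have "\<dots> = p n b m * p (Suc n) m y * gap t (f n b m + f (Suc n) m y - r) + \<bar>t\<bar> * \<bar>r - r'\<bar> * (p n b m * p (Suc n) m y)"
      by (simp add: algebra_simps)
    finally show "ennreal (p n b m * p (Suc n) m y * gap t (f n b m + f (Suc n) m y - r'))
      \<le> ennreal (p n b m * p (Suc n) m y * gap t (f n b m + f (Suc n) m y - r))
        + ennreal (\<bar>t\<bar> * \<bar>r - r'\<bar>) * ennreal (p n b m * p (Suc n) m y)"
      by (simp add: ennreal_plus[symmetric] ennreal_mult[symmetric] ennreal_leI del: ennreal_plus)
  qed
  also have "\<dots> = fork t n b y r + ennreal (\<bar>t\<bar> * \<bar>r - r'\<bar>) * ennreal (q2 n b y)"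
    unfolding fork_def by (subst nn_integral_add) (simp_all add: nn_integral_cmult nn_q2)
  also have "\<dots> \<le> fork t n b y r + ennreal (\<bar>t\<bar> * \<bar>r - r'\<bar> / e)"
  proof -
    have "\<bar>t\<bar> * \<bar>r - r'\<bar> * q2 n b y \<le> \<bar>t\<bar> * \<bar>r - r'\<bar> * (1 / e)" by (intro mult_left_mono q2_le) simp
    then show ?thesis by (intro add_left_mono) (simp add: ennreal_mult'[symmetric] ennreal_leI)
  qed
  finally show ?thesis .
qed

text \<open>The integral defining \<open>d2\<close> is taken apart in stages. \<open>cost2\<close>
  omits the densities of the edges from \<open>a\<close> to \<open>b\<close> and from
  \<open>x\<close> to \<open>y\<close>; the second is restored in \<open>cost1\<close> and the first
  in \<open>cost0\<close>, whose integral over \<open>a\<close> is \<open>d2\<close> again. Thus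
  \<open>cost\<close> is the cost of all hexagons with the base edge from \<open>a\<close> to
  \<open>b\<close>.\<close>

definition cost2 :: "real \<Rightarrow> nat \<Rightarrow> 'a \<Rightarrow> 'a \<Rightarrow> 'a \<Rightarrow> 'a \<Rightarrow> ennreal" where
  "cost2 t n a b x y = (\<integral>\<^sup>+m. \<integral>\<^sup>+m'. ennreal (p n a m * p (Suc n) m x * (p (Suc n) b m' * p (Suc (Suc n)) m' y) *
      gap t (ps n a m x y - ps n a b m' y)) \<partial>\<mu> (Suc (Suc n)) \<partial>\<mu> (Suc n))"

lemma cost2_measurable [measurable (raw)]:
  assumes [measurable]: "g1 \<in> measurable M (\<mu> n)" "g2 \<in> measurable M (\<mu> (Suc n))"
    "g3 \<in> measurable M (\<mu> (Suc (Suc n)))" "g4 \<in> measurable M (\<mu> (Suc (Suc (Suc n))))"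
  shows "(\<lambda>w. cost2 t n (g1 w) (g2 w) (g3 w) (g4 w)) \<in> borel_measurable M"
  unfolding cost2_def by measurable

definition cost1 :: "real \<Rightarrow> nat \<Rightarrow> 'a \<Rightarrow> 'a \<Rightarrow> 'a \<Rightarrow> ennreal" where
  "cost1 t n a b y = (\<integral>\<^sup>+x. ennreal (p (Suc (Suc n)) x y) * cost2 t n a b x y \<partial>\<mu> (Suc (Suc n)))"

lemma cost1_measurable [measurable (raw)]:
  assumes [measurable]: "g1 \<in> measurable M (\<mu> n)" "g2 \<in> measurable M (\<mu> (Suc n))" "g4 \<in> measurable M (\<mu> (Suc (Suc (Suc n))))"
  shows "(\<lambda>w. cost1 t n (g1 w) (g2 w) (g4 w)) \<in> borel_measurable M"
  unfolding cost1_def by measurable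

definition cost :: "real \<Rightarrow> nat \<Rightarrow> 'a \<Rightarrow> 'a \<Rightarrow> ennreal" where
  "cost t n a b = (\<integral>\<^sup>+y. cost1 t n a b y \<partial>\<mu> (Suc (Suc (Suc n))))"

lemma cost_measurable [measurable (raw)]:
  assumes [measurable]: "g1 \<in> measurable M (\<mu> n)" "g2 \<in> measurable M (\<mu> (Suc n))"
  shows "(\<lambda>w. cost t n (g1 w) (g2 w)) \<in> borel_measurable M"
  unfolding cost_def by measurable

definition cost0 :: "real \<Rightarrow> nat \<Rightarrow> 'a \<Rightarrow> ennreal" where
  "cost0 t n a = (\<integral>\<^sup>+b. ennreal (p n a b) * cost t n a b \<partial>\<mu> (Suc n))"

lemma cost0_measurable [measurable]: "cost0 t n \<in> borel_measurable (\<mu> n)"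
  unfolding cost0_def by measurable

lemma cost2_eq_fork:
  "cost2 t n a b x y = (\<integral>\<^sup>+m. ennreal (p n a m * p (Suc n) m x) * fork t (Suc n) b y (ps n a m x y - f n a b) \<partial>\<mu> (Suc n))"
  unfolding cost2_def fork_def
proof (intro nn_integral_cong)
  fix m
  have "ps n a m x y - ps n a b m' y = - (f (Suc n) b m' + f (Suc (Suc n)) m' y - (ps n a m x y - f n a b))" for m'
    by (simp add: ps_def[of n a b])
  then have "gap t (ps n a m x y - ps n a b m' y) = gap t (f (Suc n) b m' + f (Suc (Suc n)) m' y - (ps n a m x y - f n a b))" for m'
    by (simp only: gap_minus)
  then show "(\<integral>\<^sup>+m'. ennreal (p n a m * p (Suc n) m x * (p (Suc n) b m' * p (Suc (Suc n)) m' y) * gap t (ps n a m x y - ps n a b m' y)) \<partial>\<mu> (Suc (Suc n)))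
    = ennreal (p n a m * p (Suc n) m x) * (\<integral>\<^sup>+m'. ennreal (p (Suc n) b m' * p (Suc (Suc n)) m' y * gap t (f (Suc n) b m' + f (Suc (Suc n)) m' y - (ps n a m x y - f n a b))) \<partial>\<mu> (Suc (Suc n)))"
    by (subst nn_integral_cmult[symmetric]) (simp_all add: ennreal_mult[symmetric] mult.assoc)
qed

lemma integral_cost0: "(\<integral>\<^sup>+a. cost0 t n a \<partial>\<mu> n) = ennreal (d2 n t)"
proof -
  let ?M1 = "\<mu> (Suc n)" and ?M2 = "\<mu> (Suc (Suc n))" and ?M3 = "\<mu> (Suc (Suc (Suc n)))"
  let ?F = "\<lambda>a b y m x m'. ennreal (pw n a m x y * pw n a b m' y * (1 - cos (t * (ps n a m x y - ps n a b m' y))))"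
  have "cost0 t n a = (\<integral>\<^sup>+b. \<integral>\<^sup>+y. \<integral>\<^sup>+x. \<integral>\<^sup>+m. \<integral>\<^sup>+m'. ?F a b y m x m' \<partial>?M2 \<partial>?M1 \<partial>?M2 \<partial>?M3 \<partial>?M1)" for a
    unfolding cost0_def cost_def cost1_def cost2_def
    by (simp add: nn_integral_cmult[symmetric] ennreal_mult[symmetric] pw_def gap_def mult_ac)
  also have "\<dots> a = (\<integral>\<^sup>+b. \<integral>\<^sup>+y. \<integral>\<^sup>+m. \<integral>\<^sup>+x. \<integral>\<^sup>+m'. ?F a b y m x m' \<partial>?M2 \<partial>?M2 \<partial>?M1 \<partial>?M3 \<partial>?M1)" for a
    by (intro nn_integral_cong mu2.Fubini') measurable
  finally show ?thesis unfolding ennreal_d2 by simp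
qed

text \<open>The geometric term makes the bound strictly positive, so that it can be divided by and
  can serve as a tolerance, without affecting summability.\<close>

definition slack :: "real \<Rightarrow> nat \<Rightarrow> real" where "slack t n = d2 n t + (1 / 2) ^ n"

lemma slack_pos: "0 < slack t n"
  unfolding slack_def by (intro add_nonneg_pos d2_nonneg) simp

lemma slack_ge: "d2 n t \<le> slack t n" by (simp add: slack_def)

text \<open>Since the transition densities are bounded, base points can be chosen one after another:
  a \<open>p\<close>-average over the next point controls both the cost of the current
  step and the average cost of all steps that may follow.\<close>

lemma base_points:
  "\<exists>a. \<forall>n. cost0 t n (a n) \<le> ennreal (3 / e * slack t n) \<and> cost t n (a n) (a (Suc n)) \<le> ennreal (9 / e * slack t n)"
proof -
  have "\<exists>a. \<forall>n. (cost0 t n (a n) \<le> ennreal (3 / e * slack t n)) \<and> (cost t n (a n) (a (Suc n)) \<le> ennreal (9 / e * slack t n))"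
  proof (rule dependent_nat_choice)
    show "\<exists>x. cost0 t 0 x \<le> ennreal (3 / e * slack t 0)"
    proof (rule ccontr)
      assume "\<not> ?thesis"
      then have "ennreal (3 / e * slack t 0) \<le> cost0 t 0 x" for x by (auto simp: not_le less_imp_le)
      then have "(\<integral>\<^sup>+a. ennreal (3 / e * slack t 0) \<partial>\<mu> 0) \<le> (\<integral>\<^sup>+a. cost0 t 0 a \<partial>\<mu> 0)" by (intro nn_integral_mono)
      then have "ennreal (3 / e * slack t 0) \<le> ennreal (d2 0 t)"
        by (simp add: integral_cost0 mu.emeasure_space_1[simplified])
      then have "3 / e * slack t 0 \<le> slack t 0"
        using slack_ge[of 0 t] d2_nonneg[of 0 t] by (simp add: ennreal_le_iff)
      moreover have "3 / e * slack t 0 > 1 * slack t 0"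
        using e slack_pos by (intro mult_strict_right_mono) auto
      ultimately show False by simp
    qed
  next
    fix a n assume a: "cost0 t n a \<le> ennreal (3 / e * slack t n)"
    let ?c1 = "e / (3 * slack t n)" and ?c2 = "e / slack t (Suc n)"
    \<comment> \<open>Both summands are normalised to have mean at most 1 under the transition
      density: the first by the property inherited from \<open>a\<close>, the second by
      \<open>integral_cost0\<close> and the bound \<open>1 / e\<close> on the density. Hence some
      \<open>b\<close> has \<open>Z b < 3\<close>, which bounds both costs at once.\<close>
    define Z where "Z b = ennreal ?c1 * cost t n a b + ennreal ?c2 * cost0 t (Suc n) b" for b
    have [measurable]: "Z \<in> borel_measurable (\<mu> (Suc n))" unfolding Z_def by measurable
    have "\<exists>b. Z b < 3"
    proof (rule ccontr)
      assume "\<not> ?thesis"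
      then have "3 \<le> Z b" for b by (auto simp: not_less)
      then have "(\<integral>\<^sup>+b. ennreal (p n a b) * 3 \<partial>\<mu> (Suc n)) \<le> (\<integral>\<^sup>+b. ennreal (p n a b) * Z b \<partial>\<mu> (Suc n))"
        by (intro nn_integral_mono mult_left_mono) auto
      also have "\<dots> = (\<integral>\<^sup>+b. ennreal ?c1 * (ennreal (p n a b) * cost t n a b) + ennreal ?c2 * (ennreal (p n a b) * cost0 t (Suc n) b) \<partial>\<mu> (Suc n))"
        unfolding Z_def by (simp add: distrib_left mult_ac)
      also have "\<dots> = ennreal ?c1 * cost0 t n a + ennreal ?c2 * (\<integral>\<^sup>+b. ennreal (p n a b) * cost0 t (Suc n) b \<partial>\<mu> (Suc n))"
        unfolding cost0_def[of t n a] by (subst nn_integral_add) (simp_all add: nn_integral_cmult)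
      also have "\<dots> \<le> ennreal ?c1 * ennreal (3 / e * slack t n) + ennreal ?c2 * (ennreal (1 / e) * ennreal (d2 (Suc n) t))"
        by (intro add_mono mult_left_mono a order_trans[OF nn_p_le]) (simp_all add: integral_cost0)
      also have "\<dots> \<le> ennreal 1 + ennreal 1"
      proof (intro add_mono)
        show "ennreal ?c1 * ennreal (3 / e * slack t n) \<le> ennreal 1"
          using e slack_pos[of t n] by (subst ennreal_mult[symmetric]) (auto simp: less_imp_le)
        have "?c2 * (1 / e * d2 (Suc n) t) \<le> ?c2 * (1 / e * slack t (Suc n))"
          using e slack_pos[of t "Suc n"] by (intro mult_left_mono slack_ge) auto
        also have "\<dots> = 1" using e slack_pos[of t "Suc n"] by simp
        finally have le: "?c2 * (1 / e * d2 (Suc n) t) \<le> 1" .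
        have nn: "0 \<le> 1 / e" "0 \<le> ?c2" using e slack_pos[of t "Suc n"] by auto
        show "ennreal ?c2 * (ennreal (1 / e) * ennreal (d2 (Suc n) t)) \<le> ennreal 1"
          unfolding ennreal_mult'[OF nn(1), symmetric] ennreal_mult'[OF nn(2), symmetric] by (rule ennreal_leI[OF le])
      qed
      also have "(\<integral>\<^sup>+b. ennreal (p n a b) * 3 \<partial>\<mu> (Suc n)) = 3"
        by (subst nn_integral_multc) simp_all
      finally show False by (simp flip: ennreal_plus) 
    qed
    then obtain b where b: "Z b < 3" ..
    have Z: "ennreal ?c1 * cost t n a b \<le> Z b" "ennreal ?c2 * cost0 t (Suc n) b \<le> Z b"
      unfolding Z_def by simp_all
    have "cost t n a b = ennreal (1 / ?c1) * (ennreal ?c1 * cost t n a b)"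
      using e slack_pos[of t n] by (simp add: mult.assoc[symmetric] ennreal_mult[symmetric])
    also have "\<dots> \<le> ennreal (1 / ?c1) * 3"
      by (intro mult_left_mono order_trans[OF Z(1) less_imp_le[OF b]]) simp
    also have "\<dots> = ennreal (9 / e * slack t n)"
      using e slack_pos[of t n] by (simp add: ennreal_mult''[symmetric] mult.commute flip: ennreal_numeral)
    finally have 1: "cost t n a b \<le> ennreal (9 / e * slack t n)" .
    have "cost0 t (Suc n) b = ennreal (1 / ?c2) * (ennreal ?c2 * cost0 t (Suc n) b)"
      using e slack_pos[of t "Suc n"] by (simp add: mult.assoc[symmetric] ennreal_mult[symmetric])
    also have "\<dots> \<le> ennreal (1 / ?c2) * 3"
      by (intro mult_left_mono order_trans[OF Z(2) less_imp_le[OF b]]) simp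
    also have "\<dots> = ennreal (3 / e * slack t (Suc n))"
      using e slack_pos[of t "Suc n"] by (simp add: ennreal_mult''[symmetric] mult.commute flip: ennreal_numeral)
    finally have "cost0 t (Suc n) b \<le> ennreal (3 / e * slack t (Suc n))" .
    with 1 show "\<exists>y. cost0 t (Suc n) y \<le> ennreal (3 / e * slack t (Suc n)) \<and> cost t n a y \<le> ennreal (9 / e * slack t n)"
      by blast
  qed
  then show ?thesis .
qed

text \<open>A random path from \<open>a\<close> through \<open>m\<close> and \<open>x\<close> to
  \<open>y\<close> proposes the value \<open>ps n a m x y - f n a b\<close>. The paths have total
  weight at least \<open>e\<close> and their mean fork is \<open>cost1\<close>, so one of the
  proposals is no worse than \<open>1 / e\<close> times \<open>cost1\<close>, up to the tolerance
  \<open>s\<close>. A second \<open>s\<close> pays for moving to a dense sequence, where the least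
  good index gives a measurable choice. The bound \<open>4 * K\<close> comes from the four values of
  \<open>f\<close> in a proposal.\<close>

lemma fork_selection:
  assumes "0 < s"
  shows "\<exists>h. h \<in> borel_measurable (\<mu> (Suc (Suc (Suc n)))) \<and> (\<forall>y. \<bar>h y\<bar> \<le> 4 * K) \<and>
    (\<forall>y. fork t (Suc n) b y (h y) \<le> ennreal (1 / e) * (cost1 t n a b y + ennreal (2 * s)))"
proof -
  let ?M3 = "\<mu> (Suc (Suc (Suc n)))"
  have K4: "0 \<le> 4 * K" using K_nonneg by simp
  obtain q :: "nat \<Rightarrow> real" where q: "\<And>k. \<bar>q k\<bar> \<le> 4 * K"
    and qd: "\<And>r d. \<bar>r\<bar> \<le> 4 * K \<Longrightarrow> d > 0 \<Longrightarrow> \<exists>k. \<bar>q k - r\<bar> < d"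
    using dense_sequence_in_interval[OF K4] by blast
  have ex: "\<exists>k. fork t (Suc n) b y (q k) \<le> ennreal (1 / e) * (cost1 t n a b y + ennreal (2 * s))" for y
  proof -
    let ?V = "ennreal (1 / e) * (cost1 t n a b y + ennreal s)"
    have "\<exists>r. \<bar>r\<bar> \<le> 4 * K \<and> fork t (Suc n) b y r \<le> ?V"
    proof (rule ccontr)
      assume "\<not> ?thesis"
      then have big: "?V < fork t (Suc n) b y r" if "\<bar>r\<bar> \<le> 4 * K" for r using that by (meson not_le)
      have R: "\<bar>ps n a m x y - f n a b\<bar> \<le> 4 * K" for m x
        using f_le[of n a m] f_le[of "Suc n" m x] f_le[of "Suc (Suc n)" x y] f_le[of n a b] unfolding ps_def by linarith
      have "ennreal e * ?V \<le> (\<integral>\<^sup>+m. ennreal (p n a m) * (ennreal (q2 (Suc n) m y) * ?V) \<partial>\<mu> (Suc n))"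
      proof -
        have "ennreal e * ?V = (\<integral>\<^sup>+m. ennreal (p n a m) * (ennreal e * ?V) \<partial>\<mu> (Suc n))"
          by (subst nn_integral_multc) simp_all
        also have "\<dots> \<le> (\<integral>\<^sup>+m. ennreal (p n a m) * (ennreal (q2 (Suc n) m y) * ?V) \<partial>\<mu> (Suc n))"
          by (intro nn_integral_mono mult_left_mono mult_right_mono ennreal_leI q2_ge) auto
        finally show ?thesis .
      qed
      also have "\<dots> = (\<integral>\<^sup>+m. \<integral>\<^sup>+x. ennreal (p (Suc (Suc n)) x y) * (ennreal (p n a m * p (Suc n) m x) * ?V) \<partial>\<mu> (Suc (Suc n)) \<partial>\<mu> (Suc n))"
      proof (intro nn_integral_cong)
        fix m
        have "ennreal (p n a m) * (ennreal (q2 (Suc n) m y) * ?V) = (\<integral>\<^sup>+x. ennreal (p n a m) * (ennreal (p (Suc n) m x * p (Suc (Suc n)) x y) * ?V) \<partial>\<mu> (Suc (Suc n)))"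
          by (simp add: nn_integral_cmult nn_integral_multc nn_q2)
        also have "\<dots> = (\<integral>\<^sup>+x. ennreal (p (Suc (Suc n)) x y) * (ennreal (p n a m * p (Suc n) m x) * ?V) \<partial>\<mu> (Suc (Suc n)))"
          by (intro nn_integral_cong) (simp add: ennreal_mult mult_ac)
        finally show "ennreal (p n a m) * (ennreal (q2 (Suc n) m y) * ?V) = \<dots>" .
      qed
      also have "\<dots> \<le> (\<integral>\<^sup>+m. \<integral>\<^sup>+x. ennreal (p (Suc (Suc n)) x y) * (ennreal (p n a m * p (Suc n) m x) * fork t (Suc n) b y (ps n a m x y - f n a b)) \<partial>\<mu> (Suc (Suc n)) \<partial>\<mu> (Suc n))"
        by (intro nn_integral_mono mult_left_mono less_imp_le[OF big] R) auto
      also have "\<dots> = (\<integral>\<^sup>+x. \<integral>\<^sup>+m. ennreal (p (Suc (Suc n)) x y) * (ennreal (p n a m * p (Suc n) m x) * fork t (Suc n) b y (ps n a m x y - f n a b)) \<partial>\<mu> (Suc n) \<partial>\<mu> (Suc (Suc n)))"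
        by (rule mu2.Fubini') measurable
      also have "\<dots> = cost1 t n a b y"
        unfolding cost1_def cost2_eq_fork by (simp add: nn_integral_cmult)
      finally have "ennreal e * ?V \<le> cost1 t n a b y" .
      moreover have "ennreal e * ?V = cost1 t n a b y + ennreal s"
        using e by (simp add: mult.assoc[symmetric] ennreal_mult[symmetric])
      ultimately have "cost1 t n a b y + ennreal s \<le> cost1 t n a b y + 0" by simp
      moreover have "cost1 t n a b y \<noteq> top"
      proof
        assume "cost1 t n a b y = top"
        then have "?V = top" using e by (simp add: ennreal_mult_top)
        with big[of 0] K_nonneg show False by simp
      qed
      ultimately show False using \<open>0 < s\<close> by (subst (asm) ennreal_add_left_cancel_le) (auto simp: top.not_eq_extremum)
    qed
    then obtain r where r: "\<bar>r\<bar> \<le> 4 * K" "fork t (Suc n) b y r \<le> ?V" by blast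
    obtain k where k: "\<bar>q k - r\<bar> < s / (\<bar>t\<bar> + 1)" using qd[OF r(1), of "s / (\<bar>t\<bar> + 1)"] \<open>0 < s\<close> by auto
    have "\<bar>t\<bar> * \<bar>r - q k\<bar> \<le> (\<bar>t\<bar> + 1) * (s / (\<bar>t\<bar> + 1))" using k \<open>0 < s\<close> by (intro mult_mono) auto
    also have "\<dots> = s" using abs_ge_zero[of t] by (simp add: add_nonneg_eq_0_iff)
    finally have "\<bar>t\<bar> * \<bar>r - q k\<bar> / e \<le> s / e" using e by (intro divide_right_mono) auto
    then have "fork t (Suc n) b y (q k) \<le> ?V + ennreal (s / e)"
      by (intro order_trans[OF fork_lipschitz[of t "Suc n" b y "q k" r]] add_mono r ennreal_leI)
    also have "\<dots> = ennreal (1 / e) * (cost1 t n a b y + (ennreal s + ennreal s))"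
      using \<open>0 < s\<close> e by (simp add: distrib_left ennreal_mult'[symmetric] add.assoc)
    also have "ennreal s + ennreal s = ennreal (2 * s)" using \<open>0 < s\<close> by (simp flip: ennreal_plus)
    finally show ?thesis ..
  qed
  define h where "h y = q (LEAST k. fork t (Suc n) b y (q k) \<le> ennreal (1 / e) * (cost1 t n a b y + ennreal (2 * s)))" for y
  have "h \<in> borel_measurable ?M3"
    unfolding h_def by (rule measurable_compose[where N = "count_space UNIV"]) measurable
  moreover have "fork t (Suc n) b y (h y) \<le> ennreal (1 / e) * (cost1 t n a b y + ennreal (2 * s))" for y
    unfolding h_def by (rule LeastI_ex[OF ex])
  ultimately show ?thesis using q by (intro exI[of _ h]) (auto simp: h_def)
qed

text \<open>The three summands are those of \<open>edge_estimate\<close>, evaluated with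
  \<open>9 / e\<close> for a cost and \<open>(9 / e + 2) / e\<close> for an integrated fork; the
  prefactor is the 3 and the \<open>e^2\<close> of that lemma.\<close>

definition const_dec :: real where
  "const_dec = 3 / e\<^sup>2 * ((9 / e + 2) / e\<^sup>2 + 9 / e + (9 / e + 2) / e ^ 3)"

text \<open>Going around a cycle of length three, \<open>f\<close> agrees up to the cost of that cycle with a coboundary
  plus a constant.\<close>

lemma edge_estimate:
  assumes h [measurable]: "h \<in> borel_measurable (\<mu> (Suc (Suc n)))" and h' [measurable]: "h' \<in> borel_measurable (\<mu> (Suc (Suc (Suc n))))"
  shows "ennreal (e\<^sup>2) * (\<integral>\<^sup>+x. \<integral>\<^sup>+y. ennreal (p (Suc (Suc n)) x y * gap t (f (Suc (Suc n)) x y + h x - h' y - f n a b))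
           \<partial>\<mu> (Suc (Suc (Suc n))) \<partial>\<mu> (Suc (Suc n)))
       \<le> 3 * (ennreal (1 / e) * (\<integral>\<^sup>+x. fork t n a x (h x) \<partial>\<mu> (Suc (Suc n))) + cost t n a b
         + ennreal (1 / e\<^sup>2) * (\<integral>\<^sup>+y. fork t (Suc n) b y (h' y) \<partial>\<mu> (Suc (Suc (Suc n)))))"
proof -
  let ?M1 = "\<mu> (Suc n)" and ?M2 = "\<mu> (Suc (Suc n))" and ?M3 = "\<mu> (Suc (Suc (Suc n)))" and ?p = "p (Suc (Suc n))"
  have pt: "ennreal (e\<^sup>2) * ennreal (gap t (f (Suc (Suc n)) x y + h x - h' y - f n a b))
     \<le> 3 * (ennreal (1 / e) * fork t n a x (h x) + cost2 t n a b x y + ennreal (1 / e) * fork t (Suc n) b y (h' y))" for x y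
  proof -
    let ?g = "gap t (f (Suc (Suc n)) x y + h x - h' y - f n a b)"
    let ?w = "\<lambda>m. p n a m * p (Suc n) m x" and ?w' = "\<lambda>m'. p (Suc n) b m' * p (Suc (Suc n)) m' y"
    let ?A = "\<lambda>m. gap t (f n a m + f (Suc n) m x - h x)" and ?B = "\<lambda>m'. gap t (f (Suc n) b m' + f (Suc (Suc n)) m' y - h' y)"
    let ?G = "\<lambda>m m'. gap t (ps n a m x y - ps n a b m' y)"
    have g: "?g \<le> 3 * (?A m + ?G m m' + ?B m')" for m m'
    proof -
      \<comment> \<open>The edge is completed to a hexagon: the middle term is the difference of the
        sums along its two paths, and the outer terms are the errors of \<open>h\<close> and
        \<open>h'\<close> as values of the two forks.\<close>
      have "f (Suc (Suc n)) x y + h x - h' y - f n a b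
        = - (f n a m + f (Suc n) m x - h x) + (ps n a m x y - ps n a b m' y) + (f (Suc n) b m' + f (Suc (Suc n)) m' y - h' y)"
        by (simp add: ps_def)
      then show ?thesis using gap_add3[of t "- (f n a m + f (Suc n) m x - h x)" "ps n a m x y - ps n a b m' y"]
        by (simp only: gap_minus)
    qed
    \<comment> \<open>The two-step densities bring in the intermediate points \<open>m\<close> and
      \<open>m'\<close>, each at the price of a factor \<open>e\<close>.\<close>
    have "e\<^sup>2 * ?g \<le> q2 n a x * q2 (Suc n) b y * ?g"
      unfolding power2_eq_square using e q2_ge[of n a x] q2_ge[of "Suc n" b y] by (intro mult_right_mono mult_mono q2_ge gap_nonneg) auto
    then have "ennreal (e\<^sup>2) * ennreal ?g \<le> ennreal (q2 n a x) * (ennreal (q2 (Suc n) b y) * ennreal ?g)"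
      using e q2_ge[of n a x] q2_ge[of "Suc n" b y] by (simp add: ennreal_mult[symmetric] mult.assoc ennreal_leI)
    also have "\<dots> = (\<integral>\<^sup>+m. \<integral>\<^sup>+m'. ennreal (?w m) * (ennreal (?w' m') * ennreal ?g) \<partial>?M2 \<partial>?M1)"
      by (simp add: nn_integral_cmult nn_integral_multc nn_q2)
    also have "\<dots> \<le> (\<integral>\<^sup>+m. \<integral>\<^sup>+m'. 3 * (ennreal (?w' m') * ennreal (?w m * ?A m) + ennreal (?w m * ?w' m' * ?G m m') + ennreal (?w m) * ennreal (?w' m' * ?B m')) \<partial>?M2 \<partial>?M1)"
    proof (intro nn_integral_mono)
      fix m m'
      have "?w m * (?w' m' * ?g) \<le> ?w m * (?w' m' * (3 * (?A m + ?G m m' + ?B m')))"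
        by (intro mult_left_mono g) auto
      also have "\<dots> = 3 * (?w' m' * (?w m * ?A m) + ?w m * ?w' m' * ?G m m' + ?w m * (?w' m' * ?B m'))"
        by (simp add: algebra_simps)
      finally have "ennreal (?w m * (?w' m' * ?g)) \<le> ennreal (3 * (?w' m' * (?w m * ?A m) + ?w m * ?w' m' * ?G m m' + ?w m * (?w' m' * ?B m')))"
        by (rule ennreal_leI)
      also have "\<dots> = 3 * (ennreal (?w' m' * (?w m * ?A m)) + ennreal (?w m * ?w' m' * ?G m m') + ennreal (?w m * (?w' m' * ?B m')))"
        by (simp only: ennreal_mult'[of 3, simplified] ennreal_numeral ennreal_plus mult_nonneg_nonneg p_nonneg gap_nonneg add_nonneg_nonneg)
      finally show "ennreal (?w m) * (ennreal (?w' m') * ennreal ?g)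
        \<le> 3 * (ennreal (?w' m') * ennreal (?w m * ?A m) + ennreal (?w m * ?w' m' * ?G m m') + ennreal (?w m) * ennreal (?w' m' * ?B m'))"
        by (simp only: ennreal_mult' mult_nonneg_nonneg p_nonneg gap_nonneg)
    qed
    also have "\<dots> = 3 * (ennreal (q2 (Suc n) b y) * fork t n a x (h x) + cost2 t n a b x y + ennreal (q2 n a x) * fork t (Suc n) b y (h' y))"
    proof -
      have "(\<integral>\<^sup>+m'. 3 * (ennreal (?w' m') * ennreal (?w m * ?A m) + ennreal (?w m * ?w' m' * ?G m m') + ennreal (?w m) * ennreal (?w' m' * ?B m')) \<partial>?M2)
        = 3 * (ennreal (q2 (Suc n) b y) * ennreal (?w m * ?A m) + (\<integral>\<^sup>+m'. ennreal (?w m * ?w' m' * ?G m m') \<partial>?M2) + ennreal (?w m) * fork t (Suc n) b y (h' y))" for m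
        unfolding fork_def by (subst nn_integral_cmult, measurable, subst nn_integral_add, measurable, subst nn_integral_add, measurable)
           (simp add: nn_integral_cmult nn_integral_multc nn_q2)
      then show ?thesis
        unfolding fork_def[of t n] cost2_def
        by (simp only:) (subst nn_integral_cmult, measurable, subst nn_integral_add, measurable, subst nn_integral_add, measurable, simp add: nn_integral_cmult nn_integral_multc nn_q2)
    qed
    also have "\<dots> \<le> 3 * (ennreal (1 / e) * fork t n a x (h x) + cost2 t n a b x y + ennreal (1 / e) * fork t (Suc n) b y (h' y))"
      by (intro mult_left_mono add_mono mult_right_mono ennreal_leI q2_le order_refl) auto
    finally show ?thesis .
  qed
  have "ennreal (e\<^sup>2) * (\<integral>\<^sup>+x. \<integral>\<^sup>+y. ennreal (?p x y * gap t (f (Suc (Suc n)) x y + h x - h' y - f n a b)) \<partial>?M3 \<partial>?M2)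
    = (\<integral>\<^sup>+x. \<integral>\<^sup>+y. ennreal (?p x y) * (ennreal (e\<^sup>2) * ennreal (gap t (f (Suc (Suc n)) x y + h x - h' y - f n a b))) \<partial>?M3 \<partial>?M2)"
    by (simp add: nn_integral_cmult[symmetric] ennreal_mult mult_ac)
  also have "\<dots> \<le> (\<integral>\<^sup>+x. \<integral>\<^sup>+y. ennreal (?p x y) * (3 * (ennreal (1 / e) * fork t n a x (h x) + cost2 t n a b x y + ennreal (1 / e) * fork t (Suc n) b y (h' y))) \<partial>?M3 \<partial>?M2)"
    by (intro nn_integral_mono mult_left_mono pt) auto
  also have "\<dots> = (\<integral>\<^sup>+x. \<integral>\<^sup>+y. 3 * (ennreal (1 / e) * (ennreal (?p x y) * fork t n a x (h x)) + ennreal (?p x y) * cost2 t n a b x y + ennreal (1 / e) * (ennreal (?p x y) * fork t (Suc n) b y (h' y))) \<partial>?M3 \<partial>?M2)"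
    by (simp add: distrib_left mult_ac)
  also have "\<dots> = 3 * (ennreal (1 / e) * (\<integral>\<^sup>+x. fork t n a x (h x) \<partial>?M2)
      + (\<integral>\<^sup>+x. \<integral>\<^sup>+y. ennreal (?p x y) * cost2 t n a b x y \<partial>?M3 \<partial>?M2)
      + ennreal (1 / e) * (\<integral>\<^sup>+x. \<integral>\<^sup>+y. ennreal (?p x y) * fork t (Suc n) b y (h' y) \<partial>?M3 \<partial>?M2))"
    by (simp add: nn_integral_cmult nn_integral_add nn_integral_multc)
  also have "(\<integral>\<^sup>+x. \<integral>\<^sup>+y. ennreal (?p x y) * cost2 t n a b x y \<partial>?M3 \<partial>?M2) = cost t n a b"
    unfolding cost_def cost1_def by (rule mu2.Fubini'[symmetric]) measurable
  also have "(\<integral>\<^sup>+x. \<integral>\<^sup>+y. ennreal (?p x y) * fork t (Suc n) b y (h' y) \<partial>?M3 \<partial>?M2) \<le> (\<integral>\<^sup>+x. ennreal (1 / e) * (\<integral>\<^sup>+y. fork t (Suc n) b y (h' y) \<partial>?M3) \<partial>?M2)"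
    by (intro nn_integral_mono nn_p_le) measurable
  also have "\<dots> = ennreal (1 / e) * (\<integral>\<^sup>+y. fork t (Suc n) b y (h' y) \<partial>?M3)"
    by (simp add: mu.emeasure_space_1[simplified])
  finally show ?thesis
    using e by (simp add: mult.assoc[symmetric] ennreal_mult[symmetric] power2_eq_square mult_left_mono add_left_mono)
qed

text \<open>The potential at a point of level \<open>N\<close> is the value selected for two-step
  paths that reach it from the base point at level \<open>N - 2\<close>, and the constant is
  \<open>f\<close> on the base edge from level \<open>N - 2\<close> to \<open>N - 1\<close>. The
  selection at level \<open>N\<close> also looks at the base point of level \<open>N - 3\<close>, so
  the estimate begins at 3, and \<open>h\<close> is 0 below that level.\<close>

theorem coboundary_decomposition:
  "\<exists>h c. (\<forall>n. h n \<in> borel_measurable (\<mu> n)) \<and> (\<forall>n y. \<bar>h n y\<bar> \<le> 4 * K) \<and> (\<forall>n. \<bar>c n\<bar> \<le> K) \<and>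
     (\<forall>n\<ge>3. (\<integral>\<^sup>+x. \<integral>\<^sup>+y. ennreal (p n x y * gap t (f n x y + h n x - h (Suc n) y - c n)) \<partial>\<mu> (Suc n) \<partial>\<mu> n)
        \<le> ennreal (const_dec * (slack t (n - 3) + slack t (n - 2))))"
proof -
  obtain a where a: "\<And>n. cost t n (a n) (a (Suc n)) \<le> ennreal (9 / e * slack t n)"
    using base_points[of t] by blast
  have "\<exists>h. h \<in> borel_measurable (\<mu> (Suc (Suc (Suc n)))) \<and> (\<forall>y. \<bar>h y\<bar> \<le> 4 * K) \<and>
    (\<forall>y. fork t (Suc n) (a (Suc n)) y (h y) \<le> ennreal (1 / e) * (cost1 t n (a n) (a (Suc n)) y + ennreal (2 * slack t n)))" for n
    by (rule fork_selection) (rule slack_pos)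
  then obtain g where g: "\<And>n. g n \<in> borel_measurable (\<mu> (Suc (Suc (Suc n))))" "\<And>n y. \<bar>g n y\<bar> \<le> 4 * K"
    "\<And>n y. fork t (Suc n) (a (Suc n)) y (g n y) \<le> ennreal (1 / e) * (cost1 t n (a n) (a (Suc n)) y + ennreal (2 * slack t n))"
    by metis
  have [measurable]: "g n \<in> borel_measurable (\<mu> (Suc (Suc (Suc n))))" for n by (rule g)
  have fork_int: "(\<integral>\<^sup>+y. fork t (Suc n) (a (Suc n)) y (g n y) \<partial>\<mu> (Suc (Suc (Suc n)))) \<le> ennreal ((9 / e + 2) / e * slack t n)" for n
  proof -
    have "(\<integral>\<^sup>+y. fork t (Suc n) (a (Suc n)) y (g n y) \<partial>\<mu> (Suc (Suc (Suc n))))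
      \<le> (\<integral>\<^sup>+y. ennreal (1 / e) * (cost1 t n (a n) (a (Suc n)) y + ennreal (2 * slack t n)) \<partial>\<mu> (Suc (Suc (Suc n))))"
      by (intro nn_integral_mono g)
    also have "\<dots> = ennreal (1 / e) * (cost t n (a n) (a (Suc n)) + ennreal (2 * slack t n))"
      by (simp add: nn_integral_cmult nn_integral_add cost_def mu.emeasure_space_1[simplified])
    also have "\<dots> \<le> ennreal (1 / e) * (ennreal (9 / e * slack t n) + ennreal (2 * slack t n))"
      by (intro mult_left_mono add_right_mono a) simp
    also have "\<dots> = ennreal (1 / e * (9 / e * slack t n + 2 * slack t n))"
    proof -
      have nn: "0 \<le> 1 / e" "0 \<le> 9 / e * slack t n" "0 \<le> 2 * slack t n" using e slack_pos[of t n] by auto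
      show ?thesis unfolding ennreal_mult'[OF nn(1)] ennreal_plus[OF nn(2,3)] ..
    qed
    also have "1 / e * (9 / e * slack t n + 2 * slack t n) = (9 / e + 2) / e * slack t n" by (simp add: algebra_simps add_divide_distrib)
    finally show ?thesis .
  qed
  define h where "h N = (if 3 \<le> N then g (N - 3) else (\<lambda>_. 0))" for N
  define c where "c N = f (N - 2) (a (N - 2)) (a (N - 1))" for N
  have "h n \<in> borel_measurable (\<mu> n)" for n
  proof (cases "3 \<le> n")
    case True
    then have eq: "Suc (Suc (Suc (n - 3))) = n" by arith
    show ?thesis using g(1)[of "n - 3"] unfolding eq h_def by (simp only: True if_True)
  next
    case False
    then show ?thesis unfolding h_def by (simp only: if_False borel_measurable_const)
  qed
  moreover have "\<bar>h n y\<bar> \<le> 4 * K" for n y using g(2)[of "n - 3" y] K_nonneg by (cases "3 \<le> n") (simp_all only: h_def if_True if_False abs_zero mult_nonneg_nonneg zero_le_numeral)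
  moreover have "\<bar>c n\<bar> \<le> K" for n unfolding c_def by (rule f_le)
  moreover have "(\<integral>\<^sup>+x. \<integral>\<^sup>+y. ennreal (p N x y * gap t (f N x y + h N x - h (Suc N) y - c N)) \<partial>\<mu> (Suc N) \<partial>\<mu> N)
        \<le> ennreal (const_dec * (slack t (N - 3) + slack t (N - 2)))" if "3 \<le> N" for N
  proof -
    define n where "n = N - 3"
    have N: "N = Suc (Suc (Suc n))" using \<open>3 \<le> N\<close> by (simp add: n_def)
    have hN: "h N = g n" "h (Suc N) = g (Suc n)" "c N = f (Suc n) (a (Suc n)) (a (Suc (Suc n)))" "N - 3 = n" "N - 2 = Suc n"
      by (simp_all add: h_def c_def N)
    let ?I = "(\<integral>\<^sup>+x. \<integral>\<^sup>+y. ennreal (p N x y * gap t (f N x y + h N x - h (Suc N) y - c N)) \<partial>\<mu> (Suc N) \<partial>\<mu> N)"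
    let ?s = "slack t n" and ?s' = "slack t (Suc n)"
    let ?R = "3 * (1 / e * ((9 / e + 2) / e * ?s) + 9 / e * ?s' + 1 / e\<^sup>2 * ((9 / e + 2) / e * ?s'))"
    have "ennreal (e\<^sup>2) * ?I
      \<le> 3 * (ennreal (1 / e) * (\<integral>\<^sup>+x. fork t (Suc n) (a (Suc n)) x (g n x) \<partial>\<mu> (Suc (Suc (Suc n)))) + cost t (Suc n) (a (Suc n)) (a (Suc (Suc n)))
         + ennreal (1 / e\<^sup>2) * (\<integral>\<^sup>+y. fork t (Suc (Suc n)) (a (Suc (Suc n))) y (g (Suc n) y) \<partial>\<mu> (Suc (Suc (Suc (Suc n))))))"
      unfolding hN unfolding N by (rule edge_estimate) (rule g)+
    also have "\<dots> \<le> ennreal 3 * (ennreal (1 / e) * ennreal ((9 / e + 2) / e * ?s) + ennreal (9 / e * ?s') + ennreal (1 / e\<^sup>2) * ennreal ((9 / e + 2) / e * ?s'))"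
      unfolding ennreal_numeral by (intro mult_left_mono add_mono a fork_int) auto
    also have "\<dots> = ennreal ?R"
    proof -
      have nn: "0 \<le> 1 / e" "0 \<le> (9 / e + 2) / e * ?s" "0 \<le> 9 / e * ?s'" "0 \<le> 1 / e\<^sup>2" "0 \<le> (9 / e + 2) / e * ?s'"
        using e slack_pos[of t n] slack_pos[of t "Suc n"] by (auto intro!: mult_nonneg_nonneg divide_nonneg_nonneg add_nonneg_nonneg)
      show ?thesis
        by (simp only: ennreal_mult' ennreal_plus nn mult_nonneg_nonneg add_nonneg_nonneg zero_le_numeral)
    qed
    finally have "ennreal (1 / e\<^sup>2) * (ennreal (e\<^sup>2) * ?I) \<le> ennreal (1 / e\<^sup>2) * ennreal ?R" by (rule mult_left_mono) simp
    moreover have "ennreal (1 / e\<^sup>2) * (ennreal (e\<^sup>2) * ?I) = ?I"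
      using e by (simp add: mult.assoc[symmetric] ennreal_mult[symmetric])
    moreover have "ennreal (1 / e\<^sup>2) * ennreal ?R = ennreal (1 / e\<^sup>2 * ?R)" using e by (subst ennreal_mult') auto
    moreover have "1 / e\<^sup>2 * ?R \<le> const_dec * (?s + ?s')"
    proof -
      let ?u = "3 / e\<^sup>2 * ((9 / e + 2) / e\<^sup>2)" and ?v = "3 / e\<^sup>2 * (9 / e + (9 / e + 2) / e ^ 3)"
      have uv: "0 \<le> ?u" "0 \<le> ?v" using e by auto
      have "1 / e\<^sup>2 * ?R = ?u * ?s + ?v * ?s'"
        using e by (simp add: field_simps power2_eq_square power3_eq_cube)
      also have "\<dots> \<le> (?u + ?v) * ?s + (?u + ?v) * ?s'"
        using uv slack_pos[of t n] slack_pos[of t "Suc n"] by (intro add_mono mult_right_mono) auto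
      also have "?u + ?v = const_dec" unfolding const_dec_def by (simp only: distrib_left[symmetric]) (simp only: add_ac)
      finally show ?thesis by (simp only: distrib_left)
    qed
    ultimately have I: "?I \<le> ennreal (1 / e\<^sup>2 * ?R)" and R: "1 / e\<^sup>2 * ?R \<le> const_dec * (?s + ?s')" by (simp_all only:)
    show ?thesis unfolding hN(4,5) by (rule order_trans[OF I ennreal_leI[OF R]])
  qed
  ultimately show ?thesis by blast
qed

end

section \<open>Markov processes\<close>

text \<open>The Markov property is assumed in the form in which conditional expectations deliver it:
  for indicators of the next state, tested against bounded variables of the past.\<close>

locale chain_process = elliptic_kernel \<mu> p e + prob_space M
  for \<mu> :: "nat \<Rightarrow> 'a measure" and p e and M :: "'w measure" +
  fixes X :: "nat \<Rightarrow> 'w \<Rightarrow> 'a" and Fil :: "nat \<Rightarrow> 'w measure"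
  assumes X_measurable [measurable]: "\<And>n. X n \<in> measurable M (\<mu> n)"
    and X_Fil: "\<And>n. X n \<in> measurable (Fil n) (\<mu> n)"
    and space_Fil: "\<And>n. space (Fil n) = space M"
    and Fil_sub: "\<And>n. sets (Fil n) \<subseteq> sets M"
    and Fil_mono: "\<And>n. sets (Fil n) \<subseteq> sets (Fil (Suc n))"
    and markov_set: "\<And>n (Y :: 'w \<Rightarrow> real) B A. Y \<in> borel_measurable (Fil n) \<Longrightarrow> (\<And>w. \<bar>Y w\<bar> \<le> B) \<Longrightarrow> A \<in> sets (\<mu> (Suc n)) \<Longrightarrow>
      (\<integral>w. Y w * indicator A (X (Suc n) w) \<partial>M) = (\<integral>w. Y w * kint n (X n w) (indicator A) \<partial>M)"
begin

lemma Fil_measurable_M: "Y \<in> measurable (Fil n) N \<Longrightarrow> Y \<in> measurable M N"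
  using Fil_sub[of n] space_Fil[of n] by (auto simp: measurable_def)

lemma Fil_measurable_Suc: "Y \<in> measurable (Fil n) N \<Longrightarrow> Y \<in> measurable (Fil (Suc n)) N"
  using Fil_mono[of n] space_Fil[of n] space_Fil[of "Suc n"] by (auto simp: measurable_def)

lemma X_Fil_Suc: "X n \<in> measurable (Fil (Suc n)) (\<mu> n)"
  by (rule Fil_measurable_Suc[OF X_Fil])

text \<open>A nonnegative \<open>Y\<close> can be used as the density of a measure. Both sides then
  become integrals of \<open>k\<close> against finite measures on pairs of states, which agree on
  rectangles by \<open>markov_set\<close> and are therefore equal.\<close>

lemma markov_nonneg:
  fixes k :: "'a \<Rightarrow> 'a \<Rightarrow> 'b::{banach, second_countable_topology}"
  assumes Y: "Y \<in> borel_measurable (Fil n)" "\<And>w. 0 \<le> Y w" "\<And>w. Y w \<le> B"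
    and k [measurable]: "(\<lambda>(x, y). k x y) \<in> borel_measurable (\<mu> n \<Otimes>\<^sub>M \<mu> (Suc n))" and kb: "\<And>x y. norm (k x y) \<le> B'"
  shows "(\<integral>w. Y w *\<^sub>R k (X n w) (X (Suc n) w) \<partial>M) = (\<integral>w. Y w *\<^sub>R kint n (X n w) (k (X n w)) \<partial>M)"
proof -
  have [measurable]: "Y \<in> borel_measurable M" by (rule Fil_measurable_M[OF Y(1)])
  let ?P = "\<mu> n \<Otimes>\<^sub>M \<mu> (Suc n)"
  define D where "D = density M (\<lambda>w. ennreal (Y w))"
  define M1 where "M1 = distr D ?P (\<lambda>w. (X n w, X (Suc n) w))"
  define N where "N = distr D (\<mu> n) (X n)"
  define M2 where "M2 = density (N \<Otimes>\<^sub>M \<mu> (Suc n)) (\<lambda>(x, y). ennreal (p n x y))"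
  have [measurable_cong]: "sets D = sets M" by (simp add: D_def)
  have [measurable_cong]: "sets N = sets (\<mu> n)" by (simp add: N_def)
  have sP: "sets (N \<Otimes>\<^sub>M \<mu> (Suc n)) = sets ?P" by (intro sets_pair_measure_cong) (simp_all add: N_def)
  have finD: "emeasure D (space D) \<noteq> \<infinity>"
  proof -
    have "emeasure D (space D) = (\<integral>\<^sup>+w. ennreal (Y w) \<partial>M)"
      unfolding D_def by (simp add: emeasure_density cong: nn_integral_cong_simp)
    also have "\<dots> \<le> (\<integral>\<^sup>+w. ennreal B \<partial>M)" by (intro nn_integral_mono ennreal_leI Y)
    also have "\<dots> < \<infinity>" by (simp add: emeasure_space_1)
    finally show ?thesis by simp
  qed
  interpret N: finite_measure N
  proof (rule finite_measureI)
    have "emeasure N (space N) = emeasure D (X n -` UNIV \<inter> space D)"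
      unfolding N_def by (subst emeasure_distr) (auto simp: D_def sets.top[of "\<mu> n", simplified])
    then show "emeasure N (space N) \<noteq> \<infinity>" using finD by simp
  qed
  interpret NP: pair_sigma_finite N "\<mu> (Suc n)" ..
  have "M1 = M2"
  proof (rule measure_eqI_generator_eq[OF Int_stable_pair_measure_generator[of "\<mu> n" "\<mu> (Suc n)"], where A = "\<lambda>_. UNIV"])
    show "{a \<times> b |a b. a \<in> sets (\<mu> n) \<and> b \<in> sets (\<mu> (Suc n))} \<subseteq> Pow UNIV" by auto
    show "sets M1 = sigma_sets UNIV {a \<times> b |a b. a \<in> sets (\<mu> n) \<and> b \<in> sets (\<mu> (Suc n))}"
      "sets M2 = sigma_sets UNIV {a \<times> b |a b. a \<in> sets (\<mu> n) \<and> b \<in> sets (\<mu> (Suc n))}"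
      unfolding M1_def M2_def sets_distr sets_density sP by (simp_all add: sets_pair_measure)
    have UN: "UNIV \<in> sets (\<mu> m)" for m using sets.top[of "\<mu> m"] by simp
    show "range (\<lambda>_. UNIV) \<subseteq> {a \<times> b |a b. a \<in> sets (\<mu> n) \<and> b \<in> sets (\<mu> (Suc n))}" using UN by (auto intro!: exI[of _ UNIV])
    show "emeasure M1 UNIV \<noteq> \<infinity>" for i :: nat
      unfolding M1_def using finD by (subst emeasure_distr) (auto simp: D_def space_pair_measure intro: UN sets.top[of ?P, simplified space_pair_measure space_\<mu>, simplified])
    fix R assume "R \<in> {a \<times> b |a b. a \<in> sets (\<mu> n) \<and> b \<in> sets (\<mu> (Suc n))}"
    then obtain A C where R: "R = A \<times> C" and A [measurable]: "A \<in> sets (\<mu> n)" and C [measurable]: "C \<in> sets (\<mu> (Suc n))" by auto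
    have RP: "R \<in> sets ?P" unfolding R by measurable
    let ?Y = "\<lambda>w. Y w * indicator A (X n w)"
    have Yb: "0 \<le> ?Y w" "?Y w \<le> \<bar>B\<bar>" for w using Y(2)[of w] Y(3)[of w] by (auto simp: indicator_def)
    have kC: "0 \<le> kint n x (indicat_real C)" "kint n x (indicat_real C) \<le> 1" for x
      using kint_nonneg[of "indicat_real C" n x] norm_kint_bound[of "indicat_real C" n 1 x] by (auto simp: indicator_def)
    have i1: "integrable M (\<lambda>w. ?Y w * indicator C (X (Suc n) w))"
    proof (rule integrable_bounded[where B = "\<bar>B\<bar> * 1"])
      show "norm (?Y w * indicator C (X (Suc n) w)) \<le> \<bar>B\<bar> * 1" for w
        unfolding norm_mult using Yb[of w] by (intro mult_mono) (auto simp: indicator_def)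
    qed measurable
    have i2: "integrable M (\<lambda>w. ?Y w * kint n (X n w) (indicator C))"
    proof (rule integrable_bounded[where B = "\<bar>B\<bar> * 1"])
      show "norm (?Y w * kint n (X n w) (indicator C)) \<le> \<bar>B\<bar> * 1" for w
        unfolding norm_mult using Yb[of w] kC[of "X n w"] by (intro mult_mono) (auto simp: abs_of_nonneg)
    qed measurable
    have "emeasure M1 R = emeasure D ((\<lambda>w. (X n w, X (Suc n) w)) -` R \<inter> space D)"
      unfolding M1_def using RP by (intro emeasure_distr) measurable
    also have "\<dots> = (\<integral>\<^sup>+w. ennreal (?Y w * indicator C (X (Suc n) w)) \<partial>M)"
    proof -
      have "(\<lambda>w. (X n w, X (Suc n) w)) -` R \<inter> space M \<in> sets M" using RP by measurable
      then show ?thesis unfolding D_def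
        by (simp add: emeasure_density) (auto intro!: nn_integral_cong simp: R indicator_def)
    qed
    also have "\<dots> = ennreal (\<integral>w. ?Y w * indicator C (X (Suc n) w) \<partial>M)"
      by (rule nn_integral_eq_integral[OF i1]) (use Yb in auto)
    also have "(\<integral>w. ?Y w * indicator C (X (Suc n) w) \<partial>M) = (\<integral>w. ?Y w * kint n (X n w) (indicator C) \<partial>M)"
    proof (rule markov_set[where B = "\<bar>B\<bar>"])
      have [measurable]: "Y \<in> borel_measurable (Fil n)" "X n \<in> measurable (Fil n) (\<mu> n)" by (fact Y X_Fil)+
      show "?Y \<in> borel_measurable (Fil n)" by measurable
    qed (use Yb in auto)
    also have "ennreal \<dots> = (\<integral>\<^sup>+w. ennreal (?Y w * kint n (X n w) (indicator C)) \<partial>M)"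
      by (rule nn_integral_eq_integral[symmetric, OF i2]) (intro AE_I2 mult_nonneg_nonneg Yb kC)
    also have "\<dots> = (\<integral>\<^sup>+w. (indicator A (X n w) * ennreal (kint n (X n w) (indicator C))) \<partial>D)"
      unfolding D_def by (subst nn_integral_density) (auto intro!: nn_integral_cong simp: indicator_def ennreal_mult Y kC)
    also have "\<dots> = (\<integral>\<^sup>+x. indicator A x * ennreal (kint n x (indicator C)) \<partial>N)"
      unfolding N_def by (rule nn_integral_distr[symmetric]) measurable
    also have "\<dots> = (\<integral>\<^sup>+x. \<integral>\<^sup>+y. ennreal (p n x y) * indicator R (x, y) \<partial>\<mu> (Suc n) \<partial>N)"
    proof (intro nn_integral_cong)
      fix x
      have "ennreal (kint n x (indicator C)) = (\<integral>\<^sup>+y. ennreal (p n x y *\<^sub>R indicator C y) \<partial>\<mu> (Suc n))"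
        unfolding kint_def
        by (rule nn_integral_eq_integral[symmetric], rule kernel_integrable[where B = 1]) (auto simp: indicator_def)
      also have "indicator A x * \<dots> = (\<integral>\<^sup>+y. indicator A x * ennreal (p n x y *\<^sub>R indicator C y) \<partial>\<mu> (Suc n))"
        by (rule nn_integral_cmult[symmetric]) measurable
      also have "\<dots> = (\<integral>\<^sup>+y. ennreal (p n x y) * indicator R (x, y) \<partial>\<mu> (Suc n))"
        by (intro nn_integral_cong) (auto simp: R indicator_def)
      finally show "indicator A x * ennreal (kint n x (indicator C)) = (\<integral>\<^sup>+y. ennreal (p n x y) * indicator R (x, y) \<partial>\<mu> (Suc n))" .
    qed
    also have "\<dots> = emeasure M2 R"
    proof -
      have [measurable]: "R \<in> sets (N \<Otimes>\<^sub>M \<mu> (Suc n))" using RP sP by simp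
      have "emeasure M2 R = (\<integral>\<^sup>+w. ennreal (p n (fst w) (snd w)) * indicator R w \<partial>(N \<Otimes>\<^sub>M \<mu> (Suc n)))"
        unfolding M2_def by (subst emeasure_density) (auto simp: case_prod_unfold)
      also have "\<dots> = (\<integral>\<^sup>+x. \<integral>\<^sup>+y. ennreal (p n x y) * indicator R (x, y) \<partial>\<mu> (Suc n) \<partial>N)"
        by (subst mu.nn_integral_fst[symmetric]) simp_all
      finally show ?thesis ..
    qed
    finally show "emeasure M1 R = emeasure M2 R" .
  qed auto
  have kk: "(\<lambda>w. k (fst w) (snd w)) \<in> borel_measurable ?P" using k by (simp add: case_prod_unfold)
  have [measurable]: "(\<lambda>w. k (fst w) (snd w)) \<in> borel_measurable (N \<Otimes>\<^sub>M \<mu> (Suc n))"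
    using kk sP by (simp cong: measurable_cong_sets)
  have "(\<integral>w. Y w *\<^sub>R k (X n w) (X (Suc n) w) \<partial>M) = (\<integral>w. k (X n w) (X (Suc n) w) \<partial>D)"
    unfolding D_def by (subst integral_density) (auto simp: Y)
  also have "\<dots> = (\<integral>w. k (fst w) (snd w) \<partial>M1)"
    unfolding M1_def by (subst integral_distr) (auto intro: kk)
  also have "\<dots> = (\<integral>w. k (fst w) (snd w) \<partial>M2)" by (simp only: \<open>M1 = M2\<close>)
  also have "\<dots> = (\<integral>w. p n (fst w) (snd w) *\<^sub>R k (fst w) (snd w) \<partial>(N \<Otimes>\<^sub>M \<mu> (Suc n)))"
    unfolding M2_def by (subst integral_density[symmetric]) (auto simp: case_prod_unfold)
  also have "\<dots> = (\<integral>x. \<integral>y. p n x y *\<^sub>R k x y \<partial>\<mu> (Suc n) \<partial>N)"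
  proof (subst NP.integral_fst'[symmetric])
    interpret finite_measure "N \<Otimes>\<^sub>M \<mu> (Suc n)" by (intro finite_measure_pair_measure N.finite_measure_axioms mu.finite_measure_axioms)
    show "integrable (N \<Otimes>\<^sub>M \<mu> (Suc n)) (\<lambda>w. p n (fst w) (snd w) *\<^sub>R k (fst w) (snd w))"
    proof (rule integrable_const_bound[where B = "1 / e * B'"])
      have "p n x y * norm (k x y) \<le> 1 / e * B'" for x y
        by (intro mult_mono p_le kb) (use e in auto)
      then show "AE w in N \<Otimes>\<^sub>M \<mu> (Suc n). norm (p n (fst w) (snd w) *\<^sub>R k (fst w) (snd w)) \<le> 1 / e * B'"
        by (intro AE_I2) simp
    qed measurable
  qed simp
  also have "\<dots> = (\<integral>x. kint n x (k x) \<partial>N)" by (simp add: kint_def)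
  also have "\<dots> = (\<integral>w. kint n (X n w) (k (X n w)) \<partial>D)"
    unfolding N_def by (rule integral_distr) measurable
  also have "\<dots> = (\<integral>w. Y w *\<^sub>R kint n (X n w) (k (X n w)) \<partial>M)"
    unfolding D_def by (subst integral_density) (auto simp: Y)
  finally show ?thesis .
qed

lemma k_X_measurable:
  assumes "(\<lambda>(x, y). k x y) \<in> borel_measurable (\<mu> n \<Otimes>\<^sub>M \<mu> (Suc n))"
  shows "(\<lambda>w. k (X n w) (X (Suc n) w)) \<in> borel_measurable M"
  using measurable_compose[OF measurable_Pair[OF X_measurable X_measurable] assms] by simp

lemma markov_scaleR:
  fixes k :: "'a \<Rightarrow> 'a \<Rightarrow> 'b::{banach, second_countable_topology}"
  assumes Y: "Y \<in> borel_measurable (Fil n)" "\<And>w. \<bar>Y w\<bar> \<le> B"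
    and k [measurable]: "(\<lambda>(x, y). k x y) \<in> borel_measurable (\<mu> n \<Otimes>\<^sub>M \<mu> (Suc n))" and kb: "\<And>x y. norm (k x y) \<le> B'"
  shows "(\<integral>w. Y w *\<^sub>R k (X n w) (X (Suc n) w) \<partial>M) = (\<integral>w. Y w *\<^sub>R kint n (X n w) (k (X n w)) \<partial>M)"
proof -
  have [measurable]: "Y \<in> borel_measurable M" by (rule Fil_measurable_M[OF Y(1)])
  have [measurable]: "(\<lambda>w. k (X n w) (X (Suc n) w)) \<in> borel_measurable M" by (rule k_X_measurable[OF k])
  have km: "k x \<in> borel_measurable (\<mu> (Suc n))" for x by measurable
  have kib: "norm (kint n x (k x)) \<le> B'" for x by (rule norm_kint_bound[OF km kb])
  have B0: "0 \<le> B" using Y(2) abs_ge_zero order_trans by blast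
  have B'0: "0 \<le> B'" using kb norm_ge_zero order_trans by blast
  have int: "integrable M (\<lambda>w. Z w *\<^sub>R g w)"
    if "Z \<in> borel_measurable M" "\<And>w. \<bar>Z w\<bar> \<le> 2 * B" "g \<in> borel_measurable M" "\<And>w. norm (g w) \<le> B'" for Z and g :: "'w \<Rightarrow> 'b"
  proof (rule integrable_bounded[where B = "2 * B * B'"])
    show "norm (Z w *\<^sub>R g w) \<le> 2 * B * B'" for w
      using mult_mono[OF that(2)[of w] that(4)[of w]] B0 by simp
  qed (use that in measurable)
  \<comment> \<open>Adding the bound \<open>B\<close> makes the weight nonnegative; the constant
    weight is handled in the same way and subtracted.\<close>
  have lin: "(\<integral>w. Y w *\<^sub>R g w \<partial>M) = (\<integral>w. (Y w + B) *\<^sub>R g w \<partial>M) - (\<integral>w. B *\<^sub>R g w \<partial>M)"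
    if "g \<in> borel_measurable M" "\<And>w. norm (g w) \<le> B'" for g :: "'w \<Rightarrow> 'b"
  proof -
    have "\<bar>Y w + B\<bar> \<le> 2 * B" for w using Y(2)[of w] by linarith
    then have "integrable M (\<lambda>w. (Y w + B) *\<^sub>R g w)" using that by (intro int) auto
    moreover have "integrable M (\<lambda>w. B *\<^sub>R g w)" using that B0 by (intro int) auto
    ultimately have "(\<integral>w. (Y w + B) *\<^sub>R g w \<partial>M) - (\<integral>w. B *\<^sub>R g w \<partial>M) = (\<integral>w. (Y w + B) *\<^sub>R g w - B *\<^sub>R g w \<partial>M)" by simp
    then show ?thesis by (simp add: scaleR_add_left)
  qed
  have "(\<integral>w. (Y w + B) *\<^sub>R k (X n w) (X (Suc n) w) \<partial>M) = (\<integral>w. (Y w + B) *\<^sub>R kint n (X n w) (k (X n w)) \<partial>M)"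
  proof (rule markov_nonneg[OF _ _ _ k kb])
    show "0 \<le> Y w + B" "Y w + B \<le> 2 * B" for w using Y(2)[of w] by linarith+
  qed (use Y(1) in measurable)
  moreover have "(\<integral>w. B *\<^sub>R k (X n w) (X (Suc n) w) \<partial>M) = (\<integral>w. B *\<^sub>R kint n (X n w) (k (X n w)) \<partial>M)"
    by (rule markov_nonneg[OF _ _ _ k kb]) (use B0 in auto)
  ultimately show ?thesis
    by (subst (1 2) lin) (auto simp: kb kib)
qed

lemma markov_real:
  assumes "Y \<in> borel_measurable (Fil n)" "\<And>w. \<bar>Y w\<bar> \<le> B"
    "(\<lambda>(x, y). k x y) \<in> borel_measurable (\<mu> n \<Otimes>\<^sub>M \<mu> (Suc n))" "\<And>x y. \<bar>k x y\<bar> \<le> (B'::real)"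
  shows "(\<integral>w. Y w * k (X n w) (X (Suc n) w) \<partial>M) = (\<integral>w. Y w * kint n (X n w) (k (X n w)) \<partial>M)"
  using markov_scaleR[of Y n B k B'] assms by simp

lemma markov_complex:
  fixes k :: "'a \<Rightarrow> 'a \<Rightarrow> complex"
  assumes Y: "Y \<in> borel_measurable (Fil n)" "\<And>w. cmod (Y w) \<le> B"
    and k [measurable]: "(\<lambda>(x, y). k x y) \<in> borel_measurable (\<mu> n \<Otimes>\<^sub>M \<mu> (Suc n))" and kb: "\<And>x y. cmod (k x y) \<le> B'"
  shows "(\<integral>w. Y w * k (X n w) (X (Suc n) w) \<partial>M) = (\<integral>w. Y w * kint n (X n w) (k (X n w)) \<partial>M)"
proof -
  have [measurable]: "Y \<in> borel_measurable M" by (rule Fil_measurable_M[OF Y(1)])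
  have [measurable]: "(\<lambda>w. k (X n w) (X (Suc n) w)) \<in> borel_measurable M" by (rule k_X_measurable[OF k])
  have km: "k x \<in> borel_measurable (\<mu> (Suc n))" for x by measurable
  have kib: "cmod (kint n x (k x)) \<le> B'" for x by (rule norm_kint_bound[OF km kb])
  have B0: "0 \<le> B" using Y(2) norm_ge_zero order_trans by blast
  have YR: "\<bar>Re (Y w)\<bar> \<le> B" "\<bar>Im (Y w)\<bar> \<le> B" for w
    using abs_Re_le_cmod[of "Y w"] abs_Im_le_cmod[of "Y w"] Y(2)[of w] by linarith+
  have int: "integrable M (\<lambda>w. Z w *\<^sub>R g w)"
    if "Z \<in> borel_measurable M" "\<And>w. \<bar>Z w\<bar> \<le> B" "g \<in> borel_measurable M" "\<And>w. norm (g w) \<le> B'" for Z and g :: "'w \<Rightarrow> complex"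
  proof (rule integrable_bounded[where B = "B * B'"])
    show "norm (Z w *\<^sub>R g w) \<le> B * B'" for w
      using mult_mono[OF that(2)[of w] that(4)[of w]] B0 by simp
  qed (use that in measurable)
  have lin: "(\<integral>w. Y w * g w \<partial>M) = (\<integral>w. Re (Y w) *\<^sub>R g w \<partial>M) + \<i> * (\<integral>w. Im (Y w) *\<^sub>R g w \<partial>M)"
    if "g \<in> borel_measurable M" "\<And>w. norm (g w) \<le> B'" for g :: "'w \<Rightarrow> complex"
  proof -
    have "(\<integral>w. Re (Y w) *\<^sub>R g w \<partial>M) + \<i> * (\<integral>w. Im (Y w) *\<^sub>R g w \<partial>M) = (\<integral>w. Re (Y w) *\<^sub>R g w + \<i> * (Im (Y w) *\<^sub>R g w) \<partial>M)"
      using int[of "\<lambda>w. Re (Y w)" g] int[of "\<lambda>w. Im (Y w)" g] that YR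
      by (subst Bochner_Integration.integral_add) (auto simp del: mult_scaleR_right)
    also have "\<dots> = (\<integral>w. Y w * g w \<partial>M)"
      by (intro Bochner_Integration.integral_cong refl) (simp add: complex_eq_iff algebra_simps)
    finally show ?thesis ..
  qed
  have "(\<integral>w. Re (Y w) *\<^sub>R k (X n w) (X (Suc n) w) \<partial>M) = (\<integral>w. Re (Y w) *\<^sub>R kint n (X n w) (k (X n w)) \<partial>M)"
    by (rule markov_scaleR[OF _ YR(1) k kb]) (use Y(1) in measurable)
  moreover have "(\<integral>w. Im (Y w) *\<^sub>R k (X n w) (X (Suc n) w) \<partial>M) = (\<integral>w. Im (Y w) *\<^sub>R kint n (X n w) (k (X n w)) \<partial>M)"
    by (rule markov_scaleR[OF _ YR(2) k kb]) (use Y(1) in measurable)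
  ultimately show ?thesis
    by (subst (1 2) lin) (auto simp: kb kib)
qed

lemma expectation_step:
  assumes [measurable]: "g \<in> borel_measurable (\<mu> (Suc n))" and "\<And>x. \<bar>g x\<bar> \<le> (B::real)"
  shows "expectation (\<lambda>w. g (X (Suc n) w)) = expectation (\<lambda>w. kint n (X n w) g)"
  using markov_real[of "\<lambda>_. 1" n 1 "\<lambda>_. g" B] assms by simp

lemma expectation_step2:
  assumes "(\<lambda>(x, y). k x y) \<in> borel_measurable (\<mu> n \<Otimes>\<^sub>M \<mu> (Suc n))" "\<And>x y. \<bar>k x y\<bar> \<le> (B::real)"
  shows "expectation (\<lambda>w. k (X n w) (X (Suc n) w)) = expectation (\<lambda>w. kint n (X n w) (k (X n w)))"
  using markov_real[of "\<lambda>_. 1" n 1 k B] assms by simp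

lemma expectation_iter:
  assumes "g \<in> borel_measurable (\<mu> (n + j))" "\<And>x. \<bar>g x\<bar> \<le> (B::real)"
  shows "expectation (\<lambda>w. g (X (n + j) w)) = expectation (\<lambda>w. iter j n g (X n w))"
  using assms(1)
proof (induction j arbitrary: n)
  case (Suc j)
  have m: "iter j (Suc n) g \<in> borel_measurable (\<mu> (Suc n))" using Suc.prems by (intro iter_measurable) simp
  have b: "\<bar>iter j (Suc n) g x\<bar> \<le> B" for x using norm_iter_le[of g "Suc n" j B x] Suc.prems assms(2) by simp
  have "expectation (\<lambda>w. g (X (n + Suc j) w)) = expectation (\<lambda>w. iter j (Suc n) g (X (Suc n) w))"
    using Suc.IH[of "Suc n"] Suc.prems by simp
  also have "\<dots> = expectation (\<lambda>w. iter (Suc j) n g (X n w))"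
    using expectation_step[OF m b] by simp
  finally show ?case .
qed simp

text \<open>By the tower property the expectation is an average of values of
  \<open>iter j n g\<close>, so it is as close to any one of them as they are to each other.\<close>

lemma abs_iter_minus_expectation_le:
  assumes g: "g \<in> borel_measurable (\<mu> (n + j))" and B: "\<And>x. \<bar>g x\<bar> \<le> (B::real)"
    and osc: "\<And>x x'. \<bar>iter j n g x - iter j n g x'\<bar> \<le> s"
  shows "\<bar>iter j n g x - expectation (\<lambda>w. g (X (n + j) w))\<bar> \<le> s"
proof -
  have [measurable]: "iter j n g \<in> borel_measurable (\<mu> n)" by (rule iter_measurable[OF g])
  have b: "\<bar>iter j n g x\<bar> \<le> B" for x using norm_iter_le[OF g, of B x] B by simp
  have i: "integrable M (\<lambda>w. iter j n g (X n w))" by (rule integrable_bounded[where B = B]) (use b in auto)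
  have "\<bar>expectation (\<lambda>w. iter j n g x - iter j n g (X n w))\<bar> \<le> expectation (\<lambda>w. s)"
    by (rule order_trans[OF integral_abs_bound]) (intro integral_mono, use i osc in auto)
  then show ?thesis
    unfolding expectation_iter[OF g B] using i by (simp add: prob_space)
qed

end

section \<open>Central limit theorem\<close>

lemma sum_power_div2_le:
  assumes "0 \<le> r" "r < (1::real)"
  shows "(\<Sum>j<k. r ^ (j div 2)) \<le> 2 / (1 - r)"
proof -
  have "(\<Sum>j<k. r ^ (j div 2)) \<le> (\<Sum>j<2 * k. r ^ (j div 2))" using assms by (intro sum_mono2) auto
  also have "\<dots> = 2 * (\<Sum>i<k. r ^ i)" by (induction k) auto
  also have "(\<Sum>i<k. r ^ i) \<le> 1 / (1 - r)"
  proof -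
    have "(\<Sum>i<k. r ^ i) = (1 - r ^ k) / (1 - r)" using assms by (subst geometric_sum) (auto simp: field_simps)
    also have "\<dots> \<le> 1 / (1 - r)" using assms by (intro divide_right_mono) auto
    finally show ?thesis .
  qed
  finally show ?thesis by simp
qed

lemma exp_minus_taylor: "0 \<le> u \<Longrightarrow> \<bar>exp (- u) - (1 - u)\<bar> \<le> (u::real)\<^sup>2 / 2"
proof -
  assume u: "0 \<le> u"
  have 1: "1 - u \<le> exp (- u)" using exp_ge_add_one_self[of "- u"] by simp
  have "exp (- u) \<le> 1 - u + u\<^sup>2 / 2"
  proof -
    have "((\<lambda>x. 1 - x + x\<^sup>2 / 2 - exp (- x)) has_real_derivative (- 1 + x + exp (- x))) (at x)" for x :: real
      by (auto intro!: derivative_eq_intros)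
    moreover have "0 \<le> - 1 + x + exp (- x)" for x :: real using exp_ge_add_one_self[of "- x"] by simp
    ultimately have "1 - 0 + 0\<^sup>2 / 2 - exp (- 0) \<le> 1 - u + u\<^sup>2 / 2 - exp (- u)"
      using u by (intro DERIV_nonneg_imp_nondecreasing[of 0 u "\<lambda>x. 1 - x + x\<^sup>2 / 2 - exp (- x)"]) blast+
    then show ?thesis by simp
  qed
  with 1 show ?thesis by (simp add: abs_le_iff)
qed

lemma cis_taylor2: "cmod (cis x - (1 + \<i> * of_real x - of_real (x\<^sup>2 / 2))) \<le> \<bar>x\<bar> ^ 3 / 6"
  and cis_taylor1: "cmod (cis x - (1 + \<i> * of_real x)) \<le> x\<^sup>2 / 2"
  using iexp_approx1[of x 2] iexp_approx1[of x 1]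
  by (simp_all add: cis_conv_exp eval_nat_numeral power2_eq_square algebra_simps)

context elliptic_kernel
begin

section \<open>Correctors and the one-step error\<close>

lemma kint_sum:
  fixes g :: "'i \<Rightarrow> 'a \<Rightarrow> real"
  assumes "finite I" "\<And>i. i \<in> I \<Longrightarrow> g i \<in> borel_measurable (\<mu> (Suc n))" "\<And>i y. i \<in> I \<Longrightarrow> \<bar>g i y\<bar> \<le> B"
  shows "kint n x (\<lambda>y. \<Sum>i\<in>I. g i y) = (\<Sum>i\<in>I. kint n x (g i))"
  unfolding kint_def scaleR_sum_right
  by (rule Bochner_Integration.integral_sum, rule kernel_integrable[where B = B]) (use assms in auto)

text \<open>The Poisson equation with a finite horizon: this is the expected sum of the next
  \<open>k\<close> centred terms. The horizon makes the corrector vanish at the final time and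
  avoids infinite series.\<close>

fun pot :: "(nat \<Rightarrow> 'a \<Rightarrow> real) \<Rightarrow> (nat \<Rightarrow> real) \<Rightarrow> nat \<Rightarrow> nat \<Rightarrow> 'a \<Rightarrow> real" where
  "pot \<phi> c 0 n = (\<lambda>_. 0)"
| "pot \<phi> c (Suc k) n = (\<lambda>x. \<phi> n x - c n + kint n x (pot \<phi> c k (Suc n)))"

lemma pot_measurable:
  assumes "\<And>n. \<phi> n \<in> borel_measurable (\<mu> n)"
  shows "pot \<phi> c k n \<in> borel_measurable (\<mu> n)"
proof (induction k arbitrary: n)
  case (Suc k)
  have [measurable]: "\<phi> n \<in> borel_measurable (\<mu> n)" "pot \<phi> c k (Suc n) \<in> borel_measurable (\<mu> (Suc n))" by (fact assms Suc)+
  show ?case by simp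
qed simp

lemma pot_eq_sum:
  assumes \<phi>: "\<And>n. \<phi> n \<in> borel_measurable (\<mu> n)" and B: "\<And>n x. \<bar>\<phi> n x\<bar> \<le> B"
  shows "pot \<phi> c k n x = (\<Sum>j<k. iter j n (\<phi> (n + j)) x - c (n + j))"
proof (induction k arbitrary: n x)
  case (Suc k)
  have B0: "0 \<le> B" using B[of 0 undefined] by linarith
  have m: "iter j (Suc n) (\<phi> (Suc n + j)) \<in> borel_measurable (\<mu> (Suc n))" for j by (intro iter_measurable \<phi>)
  have b: "\<bar>iter j (Suc n) (\<phi> (Suc n + j)) y\<bar> \<le> B" for j y
    using norm_iter_le[of "\<phi> (Suc n + j)" "Suc n" j B y] \<phi>[of "Suc n + j"] B by simp
  have "kint n x (pot \<phi> c k (Suc n)) = kint n x (\<lambda>y. (\<Sum>j<k. iter j (Suc n) (\<phi> (Suc n + j)) y) - (\<Sum>j<k. c (Suc n + j)))"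
    by (intro arg_cong[where f = "kint n x"] ext) (simp add: Suc.IH sum_subtractf)
  also have "\<dots> = kint n x (\<lambda>y. \<Sum>j<k. iter j (Suc n) (\<phi> (Suc n + j)) y) - kint n x (\<lambda>_. \<Sum>j<k. c (Suc n + j))"
  proof (rule kint_diff[where B = "real k * B" and B' = "\<bar>\<Sum>j<k. c (Suc n + j)\<bar>"])
    show "norm (\<Sum>j<k. iter j (Suc n) (\<phi> (Suc n + j)) y) \<le> real k * B" for y
      using sum_norm_bound[of "{..<k}" "\<lambda>j. iter j (Suc n) (\<phi> (Suc n + j)) y" B] b by simp
  qed (use m in auto)
  also have "kint n x (\<lambda>y. \<Sum>j<k. iter j (Suc n) (\<phi> (Suc n + j)) y) = (\<Sum>j<k. iter (Suc j) n (\<phi> (Suc n + j)) x)"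
    by (subst kint_sum[where B = B]) (use m b in auto)
  finally show ?case
    unfolding sum.lessThan_Suc_shift by (simp add: sum_subtractf)
qed simp

lemma kint_sq_bound:
  fixes d :: "'a \<Rightarrow> real"
  assumes "d \<in> borel_measurable (\<mu> (Suc n))" "\<And>y. \<bar>d y\<bar> \<le> B"
  shows "0 \<le> kint n x (\<lambda>y. (d y)\<^sup>2)" "kint n x (\<lambda>y. (d y)\<^sup>2) \<le> B\<^sup>2"
proof -
  have "norm ((d y)\<^sup>2) \<le> B\<^sup>2" for y using power_mono[OF assms(2)[of y], of 2] by simp
  then have "norm (kint n x (\<lambda>y. (d y)\<^sup>2)) \<le> B\<^sup>2" using assms(1) by (intro norm_kint_bound) auto
  then show "kint n x (\<lambda>y. (d y)\<^sup>2) \<le> B\<^sup>2" by simp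
qed (simp add: kint_nonneg)

definition kvar :: "nat \<Rightarrow> 'a \<Rightarrow> ('a \<Rightarrow> real) \<Rightarrow> real" where
  "kvar n x G = kint n x (\<lambda>y. (G y - kint n x G)\<^sup>2)"

lemma kvar_nonneg: "0 \<le> kvar n x G"
  unfolding kvar_def by (rule kint_nonneg) simp

lemma kvar_eq:
  assumes G: "G \<in> borel_measurable (\<mu> (Suc n))" "\<And>y. \<bar>G y\<bar> \<le> B"
  shows "kvar n x G = kint n x (\<lambda>y. (G y)\<^sup>2) - (kint n x G)\<^sup>2"
proof -
  define c where "c = kint n x G"
  have c: "\<bar>c\<bar> \<le> B" unfolding c_def using norm_kint_bound[OF G(1), of B] G(2) by simp
  have sq: "\<bar>(G y)\<^sup>2\<bar> \<le> B\<^sup>2" for y using power_mono[OF G(2)[of y], of 2] by simp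
  have l: "\<bar>2 * c * G y - c\<^sup>2\<bar> \<le> 2 * \<bar>c\<bar> * B + c\<^sup>2" for y
  proof -
    have "\<bar>2 * c * G y - c\<^sup>2\<bar> \<le> \<bar>2 * c * G y\<bar> + \<bar>c\<^sup>2\<bar>" by (rule abs_triangle_ineq4)
    also have "\<bar>2 * c * G y\<bar> \<le> 2 * \<bar>c\<bar> * B" unfolding abs_mult using G(2)[of y] by (intro mult_mono) auto
    finally show ?thesis by simp
  qed
  have cG: "\<bar>2 * c * G y\<bar> \<le> 2 * \<bar>c\<bar> * B" for y unfolding abs_mult using G(2)[of y] by (intro mult_mono) auto
  have "kvar n x G = kint n x (\<lambda>y. (G y)\<^sup>2 - (2 * c * G y - c\<^sup>2))"
    unfolding kvar_def c_def[symmetric] by (simp add: power2_eq_square algebra_simps)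
  also have "\<dots> = kint n x (\<lambda>y. (G y)\<^sup>2) - kint n x (\<lambda>y. 2 * c * G y - c\<^sup>2)"
    by (rule kint_diff[where B = "B\<^sup>2" and B' = "2 * \<bar>c\<bar> * B + c\<^sup>2"]) (use G sq l in auto)
  also have "kint n x (\<lambda>y. 2 * c * G y - c\<^sup>2) = kint n x (\<lambda>y. 2 * c * G y) - kint n x (\<lambda>_. c\<^sup>2)"
    by (rule kint_diff[where B = "2 * \<bar>c\<bar> * B" and B' = "c\<^sup>2"]) (use G cG in auto)
  also have "\<dots> = c\<^sup>2" by (simp add: kint_cmult c_def[symmetric] power2_eq_square)
  finally show ?thesis by (simp add: c_def)
qed

text \<open>A common majorant of the coefficients that arise at the end of
  \<open>local_error\<close>.\<close>

definition clt_const :: "real \<Rightarrow> real \<Rightarrow> real" where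
  "clt_const BD BG = BD + BG + BD\<^sup>2 * (1 + BG) + 1"

text \<open>One step of the chain multiplies the approximate characteristic function
  \<open>exp (- t\<^sup>2 * \<sigma> / 2) * (1 - t\<^sup>2 * G / 2)\<close> correctly up to third order; the corrector \<open>G\<close> absorbs
  the fluctuation of the conditional variances.\<close>

lemma local_error:
  assumes d [measurable]: "d \<in> borel_measurable (\<mu> (Suc n))" and dB: "\<And>y. \<bar>d y\<bar> \<le> BD" and d0: "kint n x d = 0"
    and G [measurable]: "G \<in> borel_measurable (\<mu> (Suc n))" and GB: "\<And>y. \<bar>G y\<bar> \<le> BG"
    and \<gamma>: "0 \<le> \<gamma>" "\<gamma> \<le> BD\<^sup>2" and G0: "G0 = kint n x (\<lambda>y. (d y)\<^sup>2) - \<gamma> + kint n x G" "\<bar>G0\<bar> \<le> BG" and t: "\<bar>t\<bar> \<le> 1"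
  shows "cmod (kint n x (\<lambda>y. cis (t * d y) * of_real (1 - t\<^sup>2 / 2 * G y)) - of_real (exp (- (t\<^sup>2 / 2 * \<gamma>)) * (1 - t\<^sup>2 / 2 * G0)))
     \<le> \<bar>t\<bar> ^ 3 * clt_const BD BG * (kint n x (\<lambda>y. (d y)\<^sup>2) + kvar n x G + \<gamma>)"
proof -
  let ?g = "kint n x (\<lambda>y. (d y)\<^sup>2)" and ?v = "kvar n x G"
  have BD: "0 \<le> BD" using dB[of undefined] by linarith
  have BG: "0 \<le> BG" using GB[of undefined] by linarith
  have g0: "0 \<le> ?g" "?g \<le> BD\<^sup>2" by (rule kint_sq_bound[OF d dB])+
  have d2: "\<bar>(d y)\<^sup>2\<bar> \<le> BD\<^sup>2" for y using power_mono[OF dB[of y], of 2] by simp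
  have dG: "\<bar>d y * G y\<bar> \<le> BD * BG" for y unfolding abs_mult using dB GB BD by (intro mult_mono) auto
  have t4: "t\<^sup>2 * t\<^sup>2 \<le> \<bar>t\<bar> ^ 3"
  proof -
    have "\<bar>t\<bar> ^ 4 \<le> \<bar>t\<bar> ^ 3" using t by (intro power_decreasing) auto
    then show ?thesis by (simp add: power_even_abs flip: power_add)
  qed
  \<comment> \<open>\<open>W\<close> is the remainder after the expansion up to third order. The
    cubic cross term \<open>d y * G y\<close> is kept out of it, because it needs a finer estimate
    than its supremum.\<close>
  define W where "W y = cis (t * d y) * of_real (1 - t\<^sup>2 / 2 * G y)
     - (of_real (1 - t\<^sup>2 / 2 * ((d y)\<^sup>2 + G y)) + \<i> * of_real (t * d y - t ^ 3 / 2 * (d y * G y)))" for y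
  have Wm [measurable]: "W \<in> borel_measurable (\<mu> (Suc n))" unfolding W_def by measurable
  have W_le: "cmod (W y) \<le> \<bar>t\<bar> ^ 3 * (BD / 6 + BG / 4) * (d y)\<^sup>2" for y
  proof -
    let ?x = "t * d y"
    have "W y = (cis ?x - (1 + \<i> * of_real ?x - of_real (?x\<^sup>2 / 2))) - of_real (t\<^sup>2 / 2 * G y) * (cis ?x - (1 + \<i> * of_real ?x))"
      unfolding W_def by (simp add: complex_eq_iff power2_eq_square power3_eq_cube algebra_simps)
    then have "cmod (W y) \<le> \<bar>?x\<bar> ^ 3 / 6 + \<bar>t\<^sup>2 / 2 * G y\<bar> * (?x\<^sup>2 / 2)"
      by (simp only:) (intro order_trans[OF norm_triangle_ineq4] add_mono cis_taylor2, simp only: norm_mult norm_of_real, intro mult_left_mono cis_taylor1 abs_ge_zero)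
    also have "\<bar>?x\<bar> ^ 3 / 6 \<le> \<bar>t\<bar> ^ 3 * (BD / 6) * (d y)\<^sup>2"
    proof -
      have "\<bar>?x\<bar> ^ 3 / 6 = \<bar>t\<bar> ^ 3 * (\<bar>d y\<bar> / 6) * (d y)\<^sup>2"
      proof -
        have "\<bar>d y\<bar> ^ 3 = \<bar>d y\<bar> * (d y)\<^sup>2" by (simp add: power3_eq_cube power2_eq_square mult.assoc)
        then show ?thesis by (simp add: abs_mult power_mult_distrib)
      qed
      also have "\<dots> \<le> \<bar>t\<bar> ^ 3 * (BD / 6) * (d y)\<^sup>2" using dB[of y] by (intro mult_right_mono mult_left_mono) auto
      finally show ?thesis .
    qed
    also have "\<bar>t\<^sup>2 / 2 * G y\<bar> * (?x\<^sup>2 / 2) \<le> \<bar>t\<bar> ^ 3 * (BG / 4) * (d y)\<^sup>2"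
    proof -
      have "\<bar>t\<^sup>2 / 2 * G y\<bar> * (?x\<^sup>2 / 2) = (t\<^sup>2 * t\<^sup>2) * (\<bar>G y\<bar> / 4) * (d y)\<^sup>2"
        by (simp add: abs_mult power_mult_distrib)
      also have "\<dots> \<le> \<bar>t\<bar> ^ 3 * (BG / 4) * (d y)\<^sup>2"
        using GB[of y] t4 BG by (intro mult_right_mono mult_mono) auto
      finally show ?thesis .
    qed
    finally show ?thesis by (simp add: algebra_simps)
  qed
  have Wb: "cmod (W y) \<le> \<bar>t\<bar> ^ 3 * (BD / 6 + BG / 4) * BD\<^sup>2" for y
    using W_le[of y] d2[of y] BD BG by (elim order_trans) (intro mult_left_mono, auto)
  have W_int: "cmod (kint n x W) \<le> \<bar>t\<bar> ^ 3 * (BD / 6 + BG / 4) * ?g"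
  proof -
    have "cmod (kint n x W) \<le> kint n x (\<lambda>y. cmod (W y))" by (rule norm_kint_le[OF Wm Wb])
    also have "\<dots> \<le> kint n x (\<lambda>y. \<bar>t\<bar> ^ 3 * (BD / 6 + BG / 4) * (d y)\<^sup>2)"
      by (rule kint_mono[where B = "\<bar>t\<bar> ^ 3 * (BD / 6 + BG / 4) * BD\<^sup>2" and B' = "\<bar>t\<bar> ^ 3 * (BD / 6 + BG / 4) * BD\<^sup>2"])
         (use W_le Wb d2 BD BG in \<open>auto simp: abs_mult intro!: mult_left_mono\<close>)
    finally show ?thesis by (simp add: kint_cmult)
  qed
  \<comment> \<open>Since \<open>d\<close> has conditional mean 0, \<open>G\<close> may be centred
    first, and the product is then bounded by conditional variances. These add up to the order of
    the total variance, whereas supremum bounds would add up to the number of steps.\<close>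
  have dGk: "\<bar>kint n x (\<lambda>y. d y * G y)\<bar> \<le> (?g + ?v) / 2"
  proof -
    let ?c = "kint n x G"
    have c: "\<bar>?c\<bar> \<le> BG" using norm_kint_bound[OF G, of BG x] GB by simp
    have dc: "\<bar>d y * ?c\<bar> \<le> BD * BG" for y unfolding abs_mult using dB c BD by (intro mult_mono) auto
    have "kint n x (\<lambda>y. d y * (G y - ?c)) = kint n x (\<lambda>y. d y * G y) - kint n x (\<lambda>y. d y * ?c)"
      unfolding right_diff_distrib
      by (rule kint_diff[where B = "BD * BG" and B' = "BD * BG"]) (use dG dc in auto)
    then have eq: "kint n x (\<lambda>y. d y * G y) = kint n x (\<lambda>y. d y * (G y - ?c))"
      by (simp add: kint_cmult_right d0)
    have Gc: "\<bar>G y - ?c\<bar> \<le> 2 * BG" for y using GB[of y] c by linarith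
    have dGc: "\<bar>d y * (G y - ?c)\<bar> \<le> BD * (2 * BG)" for y unfolding abs_mult using dB Gc BD by (intro mult_mono) auto
    have Gc2: "\<bar>(G y - ?c)\<^sup>2\<bar> \<le> (2 * BG)\<^sup>2" for y using power_mono[OF Gc[of y], of 2] by simp
    have s2: "\<bar>(d y)\<^sup>2 + (G y - ?c)\<^sup>2\<bar> \<le> BD\<^sup>2 + (2 * BG)\<^sup>2" for y using d2[of y] Gc2[of y] by linarith
    have "\<bar>kint n x (\<lambda>y. d y * (G y - ?c))\<bar> \<le> kint n x (\<lambda>y. \<bar>d y * (G y - ?c)\<bar>)"
      using norm_kint_le[of "\<lambda>y. d y * (G y - ?c)" n "BD * (2 * BG)" x] dGc by simp
    also have "\<dots> \<le> kint n x (\<lambda>y. 1 / 2 * ((d y)\<^sup>2 + (G y - ?c)\<^sup>2))"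
    proof (rule kint_mono[where B = "BD * (2 * BG)" and B' = "1 / 2 * (BD\<^sup>2 + (2 * BG)\<^sup>2)"])
      show "\<bar>d y * (G y - ?c)\<bar> \<le> 1 / 2 * ((d y)\<^sup>2 + (G y - ?c)\<^sup>2)" for y
        using sum_squares_bound[of "\<bar>d y\<bar>" "\<bar>G y - ?c\<bar>"] by (simp add: abs_mult)
      show "\<bar>1 / 2 * ((d y)\<^sup>2 + (G y - ?c)\<^sup>2)\<bar> \<le> 1 / 2 * (BD\<^sup>2 + (2 * BG)\<^sup>2)" for y
        unfolding abs_mult using s2[of y] by (intro mult_mono) auto
    qed (use dGc in auto)
    also have "\<dots> = 1 / 2 * (?g + ?v)"
      unfolding kint_cmult kvar_def by (subst kint_add[where B = "BD\<^sup>2" and B' = "(2 * BG)\<^sup>2"]) (use d2 Gc2 in auto)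
    finally show ?thesis using eq by simp
  qed
  have main: "kint n x (\<lambda>y. cis (t * d y) * of_real (1 - t\<^sup>2 / 2 * G y))
     = of_real (1 - t\<^sup>2 / 2 * (G0 + \<gamma>)) - \<i> * of_real (t ^ 3 / 2 * kint n x (\<lambda>y. d y * G y)) + kint n x W"
  proof -
    let ?a = "\<lambda>y. 1 - t\<^sup>2 / 2 * ((d y)\<^sup>2 + G y)" and ?b = "\<lambda>y. t * d y - t ^ 3 / 2 * (d y * G y)"
    have ab: "\<bar>t\<^sup>2 / 2 * ((d y)\<^sup>2 + G y)\<bar> \<le> t\<^sup>2 / 2 * (BD\<^sup>2 + BG)" for y
      unfolding abs_mult using d2[of y] GB[of y] by (intro mult_mono) (auto intro: order_trans[OF abs_triangle_ineq])
    have aB: "\<bar>?a y\<bar> \<le> 1 + t\<^sup>2 / 2 * (BD\<^sup>2 + BG)" for y using ab[of y] by linarith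
    have b1: "\<bar>t * d y\<bar> \<le> \<bar>t\<bar> * BD" for y unfolding abs_mult using dB by (intro mult_left_mono) auto
    have b2: "\<bar>t ^ 3 / 2 * (d y * G y)\<bar> \<le> \<bar>t ^ 3 / 2\<bar> * (BD * BG)" for y
      unfolding abs_mult[of "t ^ 3 / 2"] using dG by (intro mult_left_mono) auto
    have bB: "\<bar>?b y\<bar> \<le> \<bar>t\<bar> * BD + \<bar>t ^ 3 / 2\<bar> * (BD * BG)" for y using b1[of y] b2[of y] by linarith
    have ka: "kint n x ?a = 1 - t\<^sup>2 / 2 * (G0 + \<gamma>)"
    proof -
      have "kint n x ?a = kint n x (\<lambda>_. 1) - kint n x (\<lambda>y. t\<^sup>2 / 2 * ((d y)\<^sup>2 + G y))"
        by (rule kint_diff[where B = 1 and B' = "t\<^sup>2 / 2 * (BD\<^sup>2 + BG)"]) (use ab in auto)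
      also have "kint n x (\<lambda>y. t\<^sup>2 / 2 * ((d y)\<^sup>2 + G y)) = t\<^sup>2 / 2 * (?g + kint n x G)"
        unfolding kint_cmult by (subst kint_add[where B = "BD\<^sup>2" and B' = BG]) (use d2 GB in auto)
      finally show ?thesis by (simp add: G0)
    qed
    have kb: "kint n x ?b = - (t ^ 3 / 2 * kint n x (\<lambda>y. d y * G y))"
    proof -
      have "kint n x ?b = kint n x (\<lambda>y. t * d y) - kint n x (\<lambda>y. t ^ 3 / 2 * (d y * G y))"
        by (rule kint_diff[where B = "\<bar>t\<bar> * BD" and B' = "\<bar>t ^ 3 / 2\<bar> * (BD * BG)"]) (use b1 b2 in auto)
      then show ?thesis by (simp only: kint_cmult d0)
    qed
    have "kint n x (\<lambda>y. cis (t * d y) * of_real (1 - t\<^sup>2 / 2 * G y)) = kint n x (\<lambda>y. (of_real (?a y) + \<i> * of_real (?b y)) + W y)"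
      by (simp add: W_def)
    also have "\<dots> = kint n x (\<lambda>y. of_real (?a y) + \<i> * of_real (?b y)) + kint n x W"
    proof (rule kint_add[where B = "(1 + t\<^sup>2 / 2 * (BD\<^sup>2 + BG)) + (\<bar>t\<bar> * BD + \<bar>t ^ 3 / 2\<bar> * (BD * BG))", OF _ _ Wm Wb])
      show "norm (complex_of_real (?a y) + \<i> * of_real (?b y)) \<le> (1 + t\<^sup>2 / 2 * (BD\<^sup>2 + BG)) + (\<bar>t\<bar> * BD + \<bar>t ^ 3 / 2\<bar> * (BD * BG))" for y
        using aB[of y] bB[of y] by (intro order_trans[OF norm_triangle_ineq] add_mono) (simp_all only: norm_mult norm_ii norm_of_real mult_1)
    qed measurable
    also have "kint n x (\<lambda>y. complex_of_real (?a y) + \<i> * of_real (?b y)) = kint n x (\<lambda>y. of_real (?a y)) + kint n x (\<lambda>y. \<i> * of_real (?b y))"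
      by (rule kint_add[where B = "1 + t\<^sup>2 / 2 * (BD\<^sup>2 + BG)" and B' = "\<bar>t\<bar> * BD + \<bar>t ^ 3 / 2\<bar> * (BD * BG)"])
         (use aB bB in \<open>simp_all only: norm_mult norm_ii norm_of_real mult_1\<close>, measurable)
    finally show ?thesis by (simp only: kint_cmult kint_of_real ka kb) simp
  qed
  define u where "u = t\<^sup>2 / 2 * \<gamma>"
  have u: "0 \<le> u" "u \<le> t\<^sup>2 / 2 * BD\<^sup>2" using \<gamma> by (auto simp: u_def intro!: mult_left_mono)
  have t2: "t\<^sup>2 \<le> 1" using t by (simp add: abs_square_le_1)
  have e1: "\<bar>(1 - t\<^sup>2 / 2 * (G0 + \<gamma>)) - exp (- u) * (1 - t\<^sup>2 / 2 * G0)\<bar> \<le> \<bar>t\<bar> ^ 3 * (BG / 4 + BD\<^sup>2 * (1 + BG) / 8) * \<gamma>"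
  proof -
    have "(1 - t\<^sup>2 / 2 * (G0 + \<gamma>)) - exp (- u) * (1 - t\<^sup>2 / 2 * G0)
      = - (u * (t\<^sup>2 / 2 * G0)) - (exp (- u) - (1 - u)) * (1 - t\<^sup>2 / 2 * G0)" by (simp add: u_def algebra_simps)
    also have "\<bar>\<dots>\<bar> \<le> \<bar>u * (t\<^sup>2 / 2 * G0)\<bar> + \<bar>exp (- u) - (1 - u)\<bar> * \<bar>1 - t\<^sup>2 / 2 * G0\<bar>"
      by (rule order_trans[OF abs_triangle_ineq4]) (simp only: abs_minus_cancel abs_mult)
    also have "\<bar>u * (t\<^sup>2 / 2 * G0)\<bar> \<le> \<bar>t\<bar> ^ 3 * (BG / 4) * \<gamma>"
    proof -
      have "\<bar>u * (t\<^sup>2 / 2 * G0)\<bar> = (t\<^sup>2 * t\<^sup>2) * (\<bar>G0\<bar> / 4) * \<gamma>" using \<gamma> by (simp add: u_def abs_mult)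
      also have "\<dots> \<le> \<bar>t\<bar> ^ 3 * (BG / 4) * \<gamma>" using t4 G0(2) BG \<gamma> by (intro mult_right_mono mult_mono) auto
      finally show ?thesis .
    qed
    also have "\<bar>exp (- u) - (1 - u)\<bar> * \<bar>1 - t\<^sup>2 / 2 * G0\<bar> \<le> (u\<^sup>2 / 2) * (1 + BG)"
    proof (intro mult_mono exp_minus_taylor u)
      have "\<bar>t\<^sup>2 / 2 * G0\<bar> \<le> 1 * BG" unfolding abs_mult using t2 G0(2) by (intro mult_mono) auto
      then show "\<bar>1 - t\<^sup>2 / 2 * G0\<bar> \<le> 1 + BG" by linarith
    qed auto
    also have "(u\<^sup>2 / 2) * (1 + BG) \<le> \<bar>t\<bar> ^ 3 * (BD\<^sup>2 * (1 + BG) / 8) * \<gamma>"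
    proof -
      have "(u\<^sup>2 / 2) * (1 + BG) = (t\<^sup>2 * t\<^sup>2) * (\<gamma> * (1 + BG) / 8) * \<gamma>" by (simp add: u_def power2_eq_square)
      also have "\<dots> \<le> \<bar>t\<bar> ^ 3 * (BD\<^sup>2 * (1 + BG) / 8) * \<gamma>"
        using t4 \<gamma> BG by (intro mult_right_mono mult_mono divide_right_mono) auto
      finally show ?thesis .
    qed
    finally show ?thesis by (simp add: algebra_simps)
  qed
  have e2: "\<bar>t ^ 3 / 2 * kint n x (\<lambda>y. d y * G y)\<bar> \<le> \<bar>t\<bar> ^ 3 * (1 / 4) * (?g + ?v)"
    using mult_left_mono[OF dGk, of "\<bar>t ^ 3 / 2\<bar>"] by (simp add: abs_mult power_abs)
  have "kint n x (\<lambda>y. cis (t * d y) * of_real (1 - t\<^sup>2 / 2 * G y)) - of_real (exp (- u) * (1 - t\<^sup>2 / 2 * G0))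
    = of_real ((1 - t\<^sup>2 / 2 * (G0 + \<gamma>)) - exp (- u) * (1 - t\<^sup>2 / 2 * G0)) - \<i> * of_real (t ^ 3 / 2 * kint n x (\<lambda>y. d y * G y)) + kint n x W"
    unfolding main of_real_diff[of "1 - t\<^sup>2 / 2 * (G0 + \<gamma>)"] by simp
  also have "cmod \<dots> \<le> \<bar>t\<bar> ^ 3 * (BG / 4 + BD\<^sup>2 * (1 + BG) / 8) * \<gamma> + \<bar>t\<bar> ^ 3 * (1 / 4) * (?g + ?v) + \<bar>t\<bar> ^ 3 * (BD / 6 + BG / 4) * ?g"
    using e1 e2 W_int
    by (intro order_trans[OF norm_triangle_ineq] order_trans[OF norm_triangle_ineq4] add_mono) (simp_all only: norm_mult norm_ii norm_of_real mult_1)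
  also have "\<dots> \<le> \<bar>t\<bar> ^ 3 * clt_const BD BG * (?g + ?v + \<gamma>)"
  proof -
    let ?C = "clt_const BD BG"
    have C: "BG / 4 + BD\<^sup>2 * (1 + BG) / 8 \<le> ?C" "1 / 4 \<le> ?C" "1 / 4 + (BD / 6 + BG / 4) \<le> ?C"
    proof -
      have "0 \<le> BD\<^sup>2 * (1 + BG)" using BG by simp
      then show "BG / 4 + BD\<^sup>2 * (1 + BG) / 8 \<le> ?C" "1 / 4 \<le> ?C" "1 / 4 + (BD / 6 + BG / 4) \<le> ?C"
        unfolding clt_const_def using BD BG by linarith+
    qed
    have "(BG / 4 + BD\<^sup>2 * (1 + BG) / 8) * \<gamma> + ((1 / 4) * ?v + (1 / 4 + (BD / 6 + BG / 4)) * ?g) \<le> ?C * \<gamma> + (?C * ?v + ?C * ?g)"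
      using C \<gamma> g0 kvar_nonneg[of n x G] by (intro add_mono mult_right_mono) auto
    from mult_left_mono[OF this, of "\<bar>t\<bar> ^ 3"] show ?thesis by (simp add: algebra_simps)
  qed
  finally show ?thesis unfolding u_def .
qed

end

context chain_process
begin

section \<open>Characteristic functions of martingales along the chain\<close>

lemma pot_bound:
  assumes \<phi>: "\<And>n. \<phi> n \<in> borel_measurable (\<mu> n)" and B: "\<And>n x. \<bar>\<phi> n x\<bar> \<le> B"
    and c: "\<And>n. c n = expectation (\<lambda>w. \<phi> n (X n w))"
  shows "\<bar>pot \<phi> c k n x\<bar> \<le> 4 * B / e"
proof -
  have B0: "0 \<le> B" using B[of 0 undefined] by linarith
  have "\<bar>iter j n (\<phi> (n + j)) x - c (n + j)\<bar> \<le> 2 * B * (1 - e) ^ (j div 2)" for j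
    unfolding c by (intro abs_iter_minus_expectation_le[OF \<phi> B] abs_oscillation_iter[OF \<phi> B])
  then have "\<bar>pot \<phi> c k n x\<bar> \<le> (\<Sum>j<k. 2 * B * (1 - e) ^ (j div 2))"
    unfolding pot_eq_sum[OF \<phi> B] by (intro order_trans[OF sum_abs] sum_mono)
  also have "\<dots> = 2 * B * (\<Sum>j<k. (1 - e) ^ (j div 2))" by (simp add: sum_distrib_left)
  also have "\<dots> \<le> 2 * B * (2 / (1 - (1 - e)))"
    using e B0 by (intro mult_left_mono sum_power_div2_le) auto
  finally show ?thesis by simp
qed

text \<open>\<open>A n\<close> approximates the conditional characteristic function of the
  increments still to come, with remaining variance \<open>\<sigma> n\<close>. The expectation of
  \<open>Y n\<close> times \<open>A n\<close> leads from the approximation at \<open>n = 0\<close>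
  to the true characteristic function at \<open>n = N\<close>, and \<open>local_error\<close> bounds
  each change. What must be shown is that the accumulated errors are proportional to the sum of the
  \<open>\<gamma> n\<close>, up to a constant.\<close>

lemma char_martingale:
  assumes Dm: "\<And>n. (\<lambda>(x, y). D n x y) \<in> borel_measurable (\<mu> n \<Otimes>\<^sub>M \<mu> (Suc n))" and DB: "\<And>n x y. \<bar>D n x y\<bar> \<le> BD"
    and D0: "\<And>n x. n < N \<Longrightarrow> kint n x (D n x) = 0"
    and Gm [measurable]: "\<And>n. G n \<in> borel_measurable (\<mu> n)" and GB: "\<And>n x. \<bar>G n x\<bar> \<le> BG" and GN: "G N = (\<lambda>_. 0)"
    and G: "\<And>n x. n < N \<Longrightarrow> G n x = kint n x (\<lambda>y. (D n x y)\<^sup>2) - \<gamma> n + kint n x (G (Suc n))"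
    and \<gamma>: "\<And>n. 0 \<le> \<gamma> n" "\<And>n. \<gamma> n \<le> BD\<^sup>2" and t: "\<bar>t\<bar> \<le> 1"
  shows "cmod ((\<integral>w. cis (t * (\<Sum>n<N. D n (X n w) (X (Suc n) w))) \<partial>M) - exp (- (t\<^sup>2 / 2 * (\<Sum>n<N. \<gamma> n))))
     \<le> \<bar>t\<bar> ^ 3 * clt_const BD BG * ((2 + 5 * BG + 2 * BG\<^sup>2) * ((\<Sum>n<N. \<gamma> n) + 1)) + t\<^sup>2 / 2 * BG"
proof -
  have BD: "0 \<le> BD" using DB[of 0 undefined undefined] by linarith
  have BG: "0 \<le> BG" using GB[of 0 undefined] by linarith
  have [measurable (raw)]: "(\<lambda>w. D n (g w) (h w)) \<in> borel_measurable L" if "g \<in> measurable L (\<mu> n)" "h \<in> measurable L (\<mu> (Suc n))" for n g h L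
    using measurable_compose[OF measurable_Pair[OF that] Dm] by simp
  define \<sigma> where "\<sigma> n = (\<Sum>j = n..<N. \<gamma> j)" for n
  have \<sigma>0: "0 \<le> \<sigma> n" for n unfolding \<sigma>_def by (intro sum_nonneg \<gamma>)
  define A where "A n x = exp (- (t\<^sup>2 / 2 * \<sigma> n)) * (1 - t\<^sup>2 / 2 * G n x)" for n x
  have [measurable]: "A n \<in> borel_measurable (\<mu> n)" for n unfolding A_def by measurable
  have t2: "t\<^sup>2 \<le> 1" using t by (simp add: abs_square_le_1)
  have AB: "\<bar>A n x\<bar> \<le> 1 + BG" for n x
  proof -
    have "\<bar>t\<^sup>2 / 2 * G n x\<bar> \<le> 1 * BG" unfolding abs_mult using t2 GB by (intro mult_mono) auto
    then have "\<bar>1 - t\<^sup>2 / 2 * G n x\<bar> \<le> 1 + BG" by linarith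
    then have "\<bar>A n x\<bar> \<le> 1 * (1 + BG)" unfolding A_def abs_mult using \<sigma>0[of n] by (intro mult_mono) auto
    then show ?thesis by simp
  qed
  define Y where "Y n w = cis (t * (\<Sum>k<n. D k (X k w) (X (Suc k) w)))" for n w
  have YF: "Y n \<in> borel_measurable (Fil n)" for n
  proof (induction n)
    case 0
    then show ?case by (simp add: Y_def)
  next
    case (Suc n)
    have [measurable]: "X n \<in> measurable (Fil (Suc n)) (\<mu> n)" "X (Suc n) \<in> measurable (Fil (Suc n)) (\<mu> (Suc n))"
      "Y n \<in> borel_measurable (Fil (Suc n))"
      by (rule X_Fil_Suc, rule X_Fil, rule Fil_measurable_Suc[OF Suc])
    have "Y (Suc n) = (\<lambda>w. Y n w * cis (t * D n (X n w) (X (Suc n) w)))" by (simp add: Y_def cis_mult algebra_simps fun_eq_iff)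
    then show ?case by simp
  qed
  have [measurable]: "Y n \<in> borel_measurable M" for n by (rule Fil_measurable_M[OF YF])
  have Y1: "cmod (Y n w) = 1" for n w by (simp add: Y_def)
  define g where "g n x = kint n x (\<lambda>y. (D n x y)\<^sup>2)" for n x
  define v where "v n x = kvar n x (G (Suc n))" for n x
  have [measurable]: "g n \<in> borel_measurable (\<mu> n)" "v n \<in> borel_measurable (\<mu> n)" for n
    unfolding g_def v_def kvar_def by measurable
  have gB: "0 \<le> g n x" "g n x \<le> BD\<^sup>2" for n x
    unfolding g_def by (rule kint_sq_bound[OF _ DB], measurable)+
  have Gsq: "\<bar>(G n x)\<^sup>2\<bar> \<le> BG\<^sup>2" for n x using power_mono[OF GB[of n x], of 2] by simp
  have vB: "0 \<le> v n x" "v n x \<le> BG\<^sup>2" for n x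
  proof -
    show "0 \<le> v n x" unfolding v_def by (rule kvar_nonneg)
    have "v n x \<le> kint n x (\<lambda>y. (G (Suc n) y)\<^sup>2)" unfolding v_def by (subst kvar_eq[OF Gm GB]) simp
    also have "\<dots> \<le> BG\<^sup>2" by (rule kint_sq_bound[OF Gm GB])
    finally show "v n x \<le> BG\<^sup>2" .
  qed
  have ig: "integrable M (\<lambda>w. g n (X n w))" for n by (rule integrable_bounded[where B = "BD\<^sup>2"]) (use gB in auto)
  have iv: "integrable M (\<lambda>w. v n (X n w))" for n by (rule integrable_bounded[where B = "BG\<^sup>2"]) (use vB in auto)
  let ?C = "\<bar>t\<bar> ^ 3 * clt_const BD BG"
  have C0: "0 \<le> ?C" unfolding clt_const_def using BD BG by simp
  have step: "cmod ((\<integral>w. Y (Suc n) w * of_real (A (Suc n) (X (Suc n) w)) \<partial>M) - (\<integral>w. Y n w * of_real (A n (X n w)) \<partial>M))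
      \<le> ?C * (\<integral>w. g n (X n w) + v n (X n w) + \<gamma> n \<partial>M)" if "n < N" for n
  proof -
    let ?k = "\<lambda>x y. cis (t * D n x y) * complex_of_real (A (Suc n) y)"
    have kb: "cmod (?k x y) \<le> 1 + BG" for x y using AB by (simp add: norm_mult)
    have km: "(\<lambda>(x, y). ?k x y) \<in> borel_measurable (\<mu> n \<Otimes>\<^sub>M \<mu> (Suc n))" by measurable
    have kib: "cmod (kint n x (?k x)) \<le> 1 + BG" for x by (rule norm_kint_bound[OF _ kb]) measurable
    have "(\<integral>w. Y (Suc n) w * of_real (A (Suc n) (X (Suc n) w)) \<partial>M) = (\<integral>w. Y n w * ?k (X n w) (X (Suc n) w) \<partial>M)"
      by (simp add: Y_def cis_mult[symmetric] distrib_left mult.assoc)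
    also have "\<dots> = (\<integral>w. Y n w * kint n (X n w) (?k (X n w)) \<partial>M)"
      by (rule markov_complex[OF YF _ km kb, where B = 1]) (simp add: Y1)
    finally have eq1: "(\<integral>w. Y (Suc n) w * of_real (A (Suc n) (X (Suc n) w)) \<partial>M) = (\<integral>w. Y n w * kint n (X n w) (?k (X n w)) \<partial>M)" .
    have i1: "integrable M (\<lambda>w. Y n w * kint n (X n w) (?k (X n w)))"
      by (rule integrable_bounded[where B = "1 + BG"]) (use kib Y1 in \<open>simp_all add: norm_mult\<close>)
    have i2: "integrable M (\<lambda>w. Y n w * of_real (A n (X n w)))"
      by (rule integrable_bounded[where B = "1 + BG"]) (use AB Y1 in \<open>simp_all add: norm_mult\<close>)
    have pt: "cmod (Y n w * kint n (X n w) (?k (X n w)) - Y n w * of_real (A n (X n w))) \<le> ?C * (g n (X n w) + v n (X n w) + \<gamma> n)" for w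
    proof -
      let ?x = "X n w"
      define E where "E = exp (- (t\<^sup>2 / 2 * \<sigma> (Suc n)))"
      have E: "0 \<le> E" "E \<le> 1" using \<sigma>0[of "Suc n"] by (auto simp: E_def)
      have k1: "kint n ?x (?k ?x) = of_real E * kint n ?x (\<lambda>y. cis (t * D n ?x y) * of_real (1 - t\<^sup>2 / 2 * G (Suc n) y))"
        unfolding kint_cmult[symmetric] by (rule arg_cong[where f = "kint n ?x"]) (simp add: fun_eq_iff A_def E_def)
      have \<sigma>s: "\<sigma> n = \<gamma> n + \<sigma> (Suc n)" unfolding \<sigma>_def using that by (rule sum.atLeast_Suc_lessThan)
      have A1: "A n ?x = E * (exp (- (t\<^sup>2 / 2 * \<gamma> n)) * (1 - t\<^sup>2 / 2 * G n ?x))"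
        unfolding A_def E_def \<sigma>s by (simp add: exp_add[symmetric] distrib_left)
      have "cmod (Y n w * kint n ?x (?k ?x) - Y n w * of_real (A n ?x)) = cmod (kint n ?x (?k ?x) - of_real (A n ?x))"
        unfolding right_diff_distrib[symmetric] norm_mult Y1 by simp
      also have "kint n ?x (?k ?x) - of_real (A n ?x) = of_real E * (kint n ?x (\<lambda>y. cis (t * D n ?x y) * of_real (1 - t\<^sup>2 / 2 * G (Suc n) y)) - of_real (exp (- (t\<^sup>2 / 2 * \<gamma> n)) * (1 - t\<^sup>2 / 2 * G n ?x)))"
        unfolding k1 A1 by (simp add: right_diff_distrib)
      also have "cmod \<dots> \<le> 1 * (\<bar>t\<bar> ^ 3 * clt_const BD BG * (kint n ?x (\<lambda>y. (D n ?x y)\<^sup>2) + kvar n ?x (G (Suc n)) + \<gamma> n))"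
        unfolding norm_mult norm_of_real
        by (intro mult_mono local_error DB D0 GB \<gamma> G t that) (use E in \<open>auto intro: Gm\<close>)
      finally show ?thesis by (simp add: g_def v_def)
    qed
    have "cmod ((\<integral>w. Y (Suc n) w * of_real (A (Suc n) (X (Suc n) w)) \<partial>M) - (\<integral>w. Y n w * of_real (A n (X n w)) \<partial>M))
      = cmod (\<integral>w. Y n w * kint n (X n w) (?k (X n w)) - Y n w * of_real (A n (X n w)) \<partial>M)"
      unfolding eq1 using i1 i2 by simp
    also have "\<dots> \<le> (\<integral>w. cmod (Y n w * kint n (X n w) (?k (X n w)) - Y n w * of_real (A n (X n w))) \<partial>M)"
      by (rule integral_norm_bound)
    also have "\<dots> \<le> (\<integral>w. ?C * (g n (X n w) + v n (X n w) + \<gamma> n) \<partial>M)"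
    proof (intro integral_mono pt)
      show "integrable M (\<lambda>w. cmod (Y n w * kint n (X n w) (?k (X n w)) - Y n w * of_real (A n (X n w))))"
        by (intro integrable_norm Bochner_Integration.integrable_diff i1 i2)
      show "integrable M (\<lambda>w. ?C * (g n (X n w) + v n (X n w) + \<gamma> n))"
        by (intro integrable_mult_right Bochner_Integration.integrable_add ig iv integrable_const)
    qed
    finally show ?thesis by simp
  qed
  have tele: "(\<Sum>n<N. a (Suc n) - a n) = a N - a 0" for a :: "nat \<Rightarrow> complex" by (rule sum_lessThan_telescope)
  have iG: "integrable M (\<lambda>w. G n (X n w))" for n by (rule integrable_bounded[where B = BG]) (use GB in auto)
  have iGs: "integrable M (\<lambda>w. (G n (X n w))\<^sup>2)" for n by (rule integrable_bounded[where B = "BG\<^sup>2"]) (use Gsq in auto)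
  \<comment> \<open>The recursion for \<open>G\<close> shows that the expected conditional variances
    differ from the \<open>\<gamma> n\<close> only by a telescoping term.\<close>
  have Eg: "(\<integral>w. g n (X n w) \<partial>M) = (\<integral>w. G n (X n w) \<partial>M) - (\<integral>w. G (Suc n) (X (Suc n) w) \<partial>M) + \<gamma> n" if "n < N" for n
  proof -
    have "(\<integral>w. G (Suc n) (X (Suc n) w) \<partial>M) = (\<integral>w. kint n (X n w) (G (Suc n)) \<partial>M)" by (rule expectation_step[OF Gm GB])
    also have "\<dots> = (\<integral>w. G n (X n w) - g n (X n w) + \<gamma> n \<partial>M)"
      using G[OF that] by (intro Bochner_Integration.integral_cong refl) (simp add: g_def)
    also have "\<dots> = (\<integral>w. G n (X n w) \<partial>M) - (\<integral>w. g n (X n w) \<partial>M) + \<gamma> n" using iG ig by (simp add: prob_space)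
    finally show ?thesis by simp
  qed
  have EG: "\<bar>\<integral>w. G n (X n w) \<partial>M\<bar> \<le> BG" for n
    by (rule order_trans[OF integral_abs_bound]) (use GB integral_mono[of M "\<lambda>w. \<bar>G n (X n w)\<bar>" "\<lambda>_. BG"] iG in \<open>auto simp: prob_space\<close>)
  have Sg: "(\<Sum>n<N. \<integral>w. g n (X n w) \<partial>M) \<le> BG + (\<Sum>n<N. \<gamma> n)"
  proof -
    have "(\<Sum>n<N. \<integral>w. g n (X n w) \<partial>M) = (\<Sum>n<N. ((\<integral>w. G n (X n w) \<partial>M) - (\<integral>w. G (Suc n) (X (Suc n) w) \<partial>M)) + \<gamma> n)"
      by (intro sum.cong) (auto simp: Eg)
    also have "\<dots> = (\<integral>w. G 0 (X 0 w) \<partial>M) - (\<integral>w. G N (X N w) \<partial>M) + (\<Sum>n<N. \<gamma> n)"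
      unfolding sum.distrib by (subst sum_lessThan_telescope') simp
    finally show ?thesis using EG[of 0] by (simp add: GN)
  qed
  \<comment> \<open>The same idea for the squares of \<open>G\<close>: their increments telescope,
    and the cross terms are controlled by \<open>g\<close> and \<open>\<gamma>\<close>.\<close>
  have Ev: "(\<integral>w. v n (X n w) \<partial>M) \<le> (\<integral>w. (G (Suc n) (X (Suc n) w))\<^sup>2 \<partial>M) - (\<integral>w. (G n (X n w))\<^sup>2 \<partial>M) + 2 * BG * (\<gamma> n + (\<integral>w. g n (X n w) \<partial>M))"
    if "n < N" for n
  proof -
    have "v n x \<le> kint n x (\<lambda>y. (G (Suc n) y)\<^sup>2) - (G n x)\<^sup>2 + 2 * BG * (\<gamma> n + g n x)" for x
    proof -
      have k: "kint n x (G (Suc n)) = G n x + (\<gamma> n - g n x)" using G[OF that, of x] by (simp add: g_def)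
      have "\<bar>G n x * (\<gamma> n - g n x)\<bar> \<le> BG * (\<gamma> n + g n x)"
        unfolding abs_mult using GB[of n x] gB[of n x] \<gamma>[of n] BG by (intro mult_mono) auto
      then have "(G n x)\<^sup>2 - 2 * BG * (\<gamma> n + g n x) \<le> (G n x)\<^sup>2 + 2 * (G n x * (\<gamma> n - g n x))" by (simp add: abs_le_iff)
      also have "\<dots> \<le> (kint n x (G (Suc n)))\<^sup>2"
        unfolding k using zero_le_power2[of "\<gamma> n - g n x"] by (simp add: power2_sum)
      finally show ?thesis unfolding v_def by (subst kvar_eq[OF Gm GB]) simp
    qed
    then have "(\<integral>w. v n (X n w) \<partial>M) \<le> (\<integral>w. kint n (X n w) (\<lambda>y. (G (Suc n) y)\<^sup>2) - (G n (X n w))\<^sup>2 + 2 * BG * (\<gamma> n + g n (X n w)) \<partial>M)"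
    proof (intro integral_mono iv)
      show "integrable M (\<lambda>w. kint n (X n w) (\<lambda>y. (G (Suc n) y)\<^sup>2) - (G n (X n w))\<^sup>2 + 2 * BG * (\<gamma> n + g n (X n w)))"
        using kint_sq_bound[OF Gm GB] by (intro Bochner_Integration.integrable_add Bochner_Integration.integrable_diff integrable_mult_right iGs ig integrable_const integrable_bounded[where B = "BG\<^sup>2"]) auto
    qed
    also have "\<dots> = (\<integral>w. kint n (X n w) (\<lambda>y. (G (Suc n) y)\<^sup>2) \<partial>M) - (\<integral>w. (G n (X n w))\<^sup>2 \<partial>M) + 2 * BG * (\<gamma> n + (\<integral>w. g n (X n w) \<partial>M))"
    proof -
      have "integrable M (\<lambda>w. kint n (X n w) (\<lambda>y. (G (Suc n) y)\<^sup>2))"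
        using kint_sq_bound[OF Gm GB] by (intro integrable_bounded[where B = "BG\<^sup>2"]) auto
      then show ?thesis using iGs ig by (simp add: prob_space)
    qed
    also have "(\<integral>w. kint n (X n w) (\<lambda>y. (G (Suc n) y)\<^sup>2) \<partial>M) = (\<integral>w. (G (Suc n) (X (Suc n) w))\<^sup>2 \<partial>M)"
      by (rule expectation_step[symmetric, OF _ Gsq]) measurable
    finally show ?thesis .
  qed
  have Sv: "(\<Sum>n<N. \<integral>w. v n (X n w) \<partial>M) \<le> 2 * BG * (BG + 2 * (\<Sum>n<N. \<gamma> n))"
  proof -
    have "(\<Sum>n<N. \<integral>w. v n (X n w) \<partial>M) \<le> (\<Sum>n<N. ((\<integral>w. (G (Suc n) (X (Suc n) w))\<^sup>2 \<partial>M) - (\<integral>w. (G n (X n w))\<^sup>2 \<partial>M)) + 2 * BG * (\<gamma> n + (\<integral>w. g n (X n w) \<partial>M)))"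
      by (intro sum_mono Ev) simp
    also have "\<dots> = (\<integral>w. (G N (X N w))\<^sup>2 \<partial>M) - (\<integral>w. (G 0 (X 0 w))\<^sup>2 \<partial>M) + 2 * BG * ((\<Sum>n<N. \<gamma> n) + (\<Sum>n<N. \<integral>w. g n (X n w) \<partial>M))"
      unfolding sum.distrib sum_distrib_left[symmetric] by (subst sum_lessThan_telescope) simp
    also have "\<dots> \<le> 0 + 2 * BG * ((\<Sum>n<N. \<gamma> n) + (BG + (\<Sum>n<N. \<gamma> n)))"
      using BG Sg by (intro add_mono mult_left_mono) (auto simp: GN)
    finally show ?thesis by (simp add: algebra_simps)
  qed
  let ?S = "\<Sum>n<N. \<gamma> n"
  have S0: "0 \<le> ?S" by (intro sum_nonneg \<gamma>)
  have "(\<Sum>n<N. \<integral>w. g n (X n w) + v n (X n w) + \<gamma> n \<partial>M) = (\<Sum>n<N. \<integral>w. g n (X n w) \<partial>M) + (\<Sum>n<N. \<integral>w. v n (X n w) \<partial>M) + ?S"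
    using ig iv by (simp add: prob_space sum.distrib)
  also have "\<dots> \<le> (2 + 5 * BG + 2 * BG\<^sup>2) * (?S + 1)"
  proof -
    have "0 \<le> BG * ?S" "0 \<le> BG * (BG * ?S)" using S0 BG by auto
    then have "(BG + ?S) + 2 * BG * (BG + 2 * ?S) + ?S \<le> (2 + 5 * BG + 2 * BG\<^sup>2) * (?S + 1)"
      using BG by (simp add: power2_eq_square algebra_simps)
    then show ?thesis using Sg Sv by linarith
  qed
  finally have tot: "(\<Sum>n<N. \<integral>w. g n (X n w) + v n (X n w) + \<gamma> n \<partial>M) \<le> (2 + 5 * BG + 2 * BG\<^sup>2) * (?S + 1)" .
  define I where "I n = (\<integral>w. Y n w * of_real (A n (X n w)) \<partial>M)" for n
  have "cmod (I N - I 0) \<le> (\<Sum>n<N. ?C * (\<integral>w. g n (X n w) + v n (X n w) + \<gamma> n \<partial>M))"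
  proof -
    have "cmod (I N - I 0) = cmod (\<Sum>n<N. I (Suc n) - I n)" by (simp only: tele)
    also have "\<dots> \<le> (\<Sum>n<N. cmod (I (Suc n) - I n))" by (rule norm_sum)
    also have "\<dots> \<le> (\<Sum>n<N. ?C * (\<integral>w. g n (X n w) + v n (X n w) + \<gamma> n \<partial>M))"
      unfolding I_def by (intro sum_mono step) simp
    finally show ?thesis .
  qed
  also have "\<dots> \<le> ?C * ((2 + 5 * BG + 2 * BG\<^sup>2) * (?S + 1))"
    unfolding sum_distrib_left[symmetric] by (intro mult_left_mono tot C0)
  finally have 1: "cmod (I N - I 0) \<le> ?C * ((2 + 5 * BG + 2 * BG\<^sup>2) * (?S + 1))" .
  have IN: "I N = (\<integral>w. cis (t * (\<Sum>n<N. D n (X n w) (X (Suc n) w))) \<partial>M)"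
    by (simp add: I_def A_def \<sigma>_def GN Y_def)
  have "I 0 = of_real (\<integral>w. A 0 (X 0 w) \<partial>M)" by (simp add: I_def Y_def)
  also have "(\<integral>w. A 0 (X 0 w) \<partial>M) = exp (- (t\<^sup>2 / 2 * ?S)) * (1 - t\<^sup>2 / 2 * (\<integral>w. G 0 (X 0 w) \<partial>M))"
    unfolding A_def \<sigma>_def using iG by (simp add: prob_space atLeast0LessThan)
  finally have I0: "I 0 - exp (- (t\<^sup>2 / 2 * ?S)) = - of_real (exp (- (t\<^sup>2 / 2 * ?S)) * (t\<^sup>2 / 2 * (\<integral>w. G 0 (X 0 w) \<partial>M)))"
    by (simp add: algebra_simps)
  have 2: "cmod (I 0 - exp (- (t\<^sup>2 / 2 * ?S))) \<le> t\<^sup>2 / 2 * BG"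
  proof -
    have "\<bar>exp (- (t\<^sup>2 / 2 * ?S)) * (t\<^sup>2 / 2 * (\<integral>w. G 0 (X 0 w) \<partial>M))\<bar> \<le> 1 * (t\<^sup>2 / 2 * BG)"
      unfolding abs_mult using S0 EG[of 0] by (intro mult_mono mult_nonneg_nonneg) auto
    then show ?thesis unfolding I0 by (simp only: norm_minus_cancel norm_of_real mult_1)
  qed
  have "I N - exp (- (t\<^sup>2 / 2 * ?S)) = (I N - I 0) + (I 0 - exp (- (t\<^sup>2 / 2 * ?S)))" by simp
  then show ?thesis unfolding IN[symmetric] using 1 2 norm_triangle_ineq[of "I N - I 0" "I 0 - exp (- (t\<^sup>2 / 2 * ?S))"] by simp
qed

end

context elliptic_functional
begin

text \<open>The corrector \<open>cpot\<close> solves the Poisson equation, so that \<open>mdiff\<close> is a martingale difference.\<close>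

definition cpot :: "(nat \<Rightarrow> real) \<Rightarrow> nat \<Rightarrow> nat \<Rightarrow> 'a \<Rightarrow> real" where
  "cpot en = pot (\<lambda>n x. kint n x (f n x)) en"

definition mdiff :: "(nat \<Rightarrow> real) \<Rightarrow> nat \<Rightarrow> nat \<Rightarrow> 'a \<Rightarrow> 'a \<Rightarrow> real" where
  "mdiff en N n x y = f n x y - en n + cpot en (N - Suc n) (Suc n) y - cpot en (N - n) n x"

lemma abs_kint_f_le: "\<bar>kint n x (f n x)\<bar> \<le> K"
  using norm_kint_bound[of "f n x" n K x] f_le by simp

lemma cpot_measurable [measurable]: "cpot en k n \<in> borel_measurable (\<mu> n)"
  unfolding cpot_def by (rule pot_measurable) measurable

lemma mdiff_measurable: "(\<lambda>(x, y). mdiff en N n x y) \<in> borel_measurable (\<mu> n \<Otimes>\<^sub>M \<mu> (Suc n))"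
  unfolding mdiff_def by measurable

lemma mdiff_measurable_raw [measurable (raw)]:
  assumes "g \<in> measurable L (\<mu> n)" "h \<in> measurable L (\<mu> (Suc n))"
  shows "(\<lambda>w. mdiff en N n (g w) (h w)) \<in> borel_measurable L"
  using measurable_compose[OF measurable_Pair[OF assms] mdiff_measurable] by simp

lemma kint_mdiff:
  assumes B: "\<And>k n x. \<bar>cpot en k n x\<bar> \<le> B" and "n < N"
  shows "kint n x (mdiff en N n x) = 0"
proof -
  have "N - n = Suc (N - Suc n)" using \<open>n < N\<close> by simp
  then have rec: "cpot en (N - n) n x = kint n x (f n x) - en n + kint n x (cpot en (N - Suc n) (Suc n))"
    by (simp add: cpot_def)
  have "kint n x (mdiff en N n x) = kint n x (\<lambda>y. (f n x y + cpot en (N - Suc n) (Suc n) y) - (en n + cpot en (N - n) n x))"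
    by (rule arg_cong[where f = "kint n x"]) (simp add: mdiff_def fun_eq_iff)
  also have "\<dots> = kint n x (\<lambda>y. f n x y + cpot en (N - Suc n) (Suc n) y) - kint n x (\<lambda>_. en n + cpot en (N - n) n x)"
  proof (rule kint_diff[where B = "K + B" and B' = "\<bar>en n + cpot en (N - n) n x\<bar>"])
    show "norm (f n x y + cpot en (N - Suc n) (Suc n) y) \<le> K + B" for y
      using f_le[of n x y] B[of "N - Suc n" "Suc n" y] by simp
  qed simp_all
  also have "kint n x (\<lambda>y. f n x y + cpot en (N - Suc n) (Suc n) y) = kint n x (f n x) + kint n x (cpot en (N - Suc n) (Suc n))"
    by (rule kint_add[where B = K and B' = B]) (use f_le B in auto)
  finally show ?thesis by (simp add: rec)
qed

lemma sum_mdiff: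
  "(\<Sum>n<N. mdiff en N n (z n) (z (Suc n))) = (\<Sum>n<N. f n (z n) (z (Suc n))) - (\<Sum>n<N. en n) - cpot en N 0 (z 0)"
proof -
  have "(\<Sum>n<N. mdiff en N n (z n) (z (Suc n)))
      = (\<Sum>n<N. (f n (z n) (z (Suc n)) - en n) + (cpot en (N - Suc n) (Suc n) (z (Suc n)) - cpot en (N - n) n (z n)))"
    by (simp add: mdiff_def algebra_simps)
  also have "\<dots> = (\<Sum>n<N. f n (z n) (z (Suc n)) - en n) + (cpot en (N - N) N (z N) - cpot en (N - 0) 0 (z 0))"
    unfolding sum.distrib by (subst sum_lessThan_telescope) simp
  also have "cpot en (N - N) N (z N) = 0" by (simp add: cpot_def)
  finally show ?thesis by (simp add: sum_subtractf)
qed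

end

locale functional_process = elliptic_functional \<mu> p e f K + chain_process \<mu> p e M X Fil
  for \<mu> :: "nat \<Rightarrow> 'a measure" and p e f K and M :: "'w measure" and X Fil
begin

definition S :: "nat \<Rightarrow> 'w \<Rightarrow> real" where
  "S N w = (\<Sum>n<N. f n (X n w) (X (Suc n) w))"

definition en :: "nat \<Rightarrow> real" where
  "en n = expectation (\<lambda>w. f n (X n w) (X (Suc n) w))"

text \<open>\<open>BH\<close> bounds the corrector by \<open>pot_bound\<close>. Then
  \<open>BD\<close> bounds the martingale differences, made of two terms of size \<open>K\<close>
  and two correctors, and \<open>BG\<close> bounds the second corrector \<open>Gp\<close>.\<close>

definition BH :: real where "BH = 4 * K / e"

definition BD :: real where "BD = 2 * K + 2 * BH"

definition \<gamma> :: "nat \<Rightarrow> nat \<Rightarrow> real" where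
  "\<gamma> N n = expectation (\<lambda>w. kint n (X n w) (\<lambda>y. (mdiff en N n (X n w) y)\<^sup>2))"

text \<open>A second corrector, which solves the Poisson equation for the conditional variances of
  the martingale differences.\<close>

definition Gp :: "nat \<Rightarrow> nat \<Rightarrow> 'a \<Rightarrow> real" where
  "Gp N n = pot (\<lambda>n x. kint n x (\<lambda>y. (mdiff en N n x y)\<^sup>2)) (\<gamma> N) (N - n) n"

definition BG :: real where "BG = 4 * BD\<^sup>2 / e"

lemma S_measurable [measurable]: "S N \<in> borel_measurable M"
  unfolding S_def by measurable

lemma abs_S_le: "\<bar>S N w\<bar> \<le> N * K"
  unfolding S_def using sum_norm_bound[of "{..<N}" "\<lambda>n. f n (X n w) (X (Suc n) w)" K] f_le by simp

lemma f_integrable: "integrable M (\<lambda>w. f n (X n w) (X (Suc n) w))"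
  by (rule integrable_bounded[where B = K]) (use f_le in auto)

lemma expectation_S: "expectation (S N) = (\<Sum>n<N. en n)"
  unfolding S_def[abs_def] en_def using f_integrable by simp

lemma abs_en_le: "\<bar>en n\<bar> \<le> K"
proof -
  have "\<bar>en n\<bar> \<le> expectation (\<lambda>w. \<bar>f n (X n w) (X (Suc n) w)\<bar>)" unfolding en_def by (rule integral_abs_bound)
  also have "\<dots> \<le> expectation (\<lambda>w. K)" using f_integrable f_le by (intro integral_mono) auto
  finally show ?thesis by (simp add: prob_space)
qed

lemma en_eq: "en n = expectation (\<lambda>w. kint n (X n w) (f n (X n w)))"
  unfolding en_def by (rule expectation_step2[OF f_pair f_le])

lemma BH_nonneg: "0 \<le> BH" using K_nonneg e by (simp add: BH_def)

lemma cpot_bound: "\<bar>cpot en k n x\<bar> \<le> BH"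
  unfolding cpot_def BH_def by (rule pot_bound[OF _ abs_kint_f_le en_eq]) measurable

lemma mdiff_bound: "\<bar>mdiff en N n x y\<bar> \<le> BD"
  using f_le[of n x y] abs_en_le[of n] cpot_bound[of "N - Suc n" "Suc n" y] cpot_bound[of "N - n" n x]
  unfolding mdiff_def BD_def by linarith

lemma mdiff_sq: "0 \<le> kint n x (\<lambda>y. (mdiff en N n x y)\<^sup>2)" "kint n x (\<lambda>y. (mdiff en N n x y)\<^sup>2) \<le> BD\<^sup>2"
  by (rule kint_sq_bound[OF _ mdiff_bound], measurable)+

lemma \<gamma>_bounds: "0 \<le> \<gamma> N n" "\<gamma> N n \<le> BD\<^sup>2"
proof -
  show "0 \<le> \<gamma> N n" unfolding \<gamma>_def using mdiff_sq by (intro Bochner_Integration.integral_nonneg)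
  have "\<gamma> N n \<le> expectation (\<lambda>w. BD\<^sup>2)"
    unfolding \<gamma>_def using mdiff_sq by (intro integral_mono integrable_bounded[where B = "BD\<^sup>2"]) auto
  then show "\<gamma> N n \<le> BD\<^sup>2" by (simp add: prob_space)
qed

lemma Gp_measurable: "Gp N n \<in> borel_measurable (\<mu> n)"
  unfolding Gp_def by (rule pot_measurable) measurable

lemma Gp_bound: "\<bar>Gp N n x\<bar> \<le> BG"
  unfolding Gp_def BG_def by (rule pot_bound) (use mdiff_sq in \<open>auto simp: \<gamma>_def\<close>)

lemma Gp_rec: "n < N \<Longrightarrow> Gp N n x = kint n x (\<lambda>y. (mdiff en N n x y)\<^sup>2) - \<gamma> N n + kint n x (Gp N (Suc n))"
  unfolding Gp_def by (subst Suc_diff_Suc[symmetric]) simp_all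

text \<open>The increments are martingale differences, hence orthogonal.\<close>

lemma variance_S: "variance (S N) = (\<Sum>n<N. \<gamma> N n) + expectation (\<lambda>w. (cpot en N 0 (X 0 w))\<^sup>2)"
proof -
  \<comment> \<open>The corrector at time 0 is taken as the initial value, so that the last member
    \<open>Z N\<close> is the centred sum itself.\<close>
  define Z where "Z n w = cpot en N 0 (X 0 w) + (\<Sum>k<n. mdiff en N k (X k w) (X (Suc k) w))" for n w
  have ZF: "Z n \<in> borel_measurable (Fil n)" for n
  proof (induction n)
    case 0
    have [measurable]: "X 0 \<in> measurable (Fil 0) (\<mu> 0)" by (rule X_Fil)
    show ?case by (simp add: Z_def)
  next
    case (Suc n)
    have [measurable]: "X n \<in> measurable (Fil (Suc n)) (\<mu> n)" "X (Suc n) \<in> measurable (Fil (Suc n)) (\<mu> (Suc n))"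
      "Z n \<in> borel_measurable (Fil (Suc n))"
      by (rule X_Fil_Suc, rule X_Fil, rule Fil_measurable_Suc[OF Suc])
    have "Z (Suc n) = (\<lambda>w. Z n w + mdiff en N n (X n w) (X (Suc n) w))" by (simp add: Z_def fun_eq_iff)
    then show ?case by simp
  qed
  have [measurable]: "Z n \<in> borel_measurable M" for n by (rule Fil_measurable_M[OF ZF])
  have ZB: "\<bar>Z n w\<bar> \<le> BH + real n * BD" for n w
  proof -
    have "\<bar>\<Sum>k<n. mdiff en N k (X k w) (X (Suc k) w)\<bar> \<le> real n * BD"
      using sum_norm_bound[of "{..<n}" "\<lambda>k. mdiff en N k (X k w) (X (Suc k) w)" BD] mdiff_bound by simp
    then show ?thesis unfolding Z_def using cpot_bound[of N 0 "X 0 w"] by linarith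
  qed
  have BD0: "0 \<le> BD" using BH_nonneg K_nonneg by (simp add: BD_def)
  have step: "expectation (\<lambda>w. (Z (Suc n) w)\<^sup>2) = expectation (\<lambda>w. (Z n w)\<^sup>2) + \<gamma> N n" if "n < N" for n
  proof -
    let ?d = "\<lambda>w. mdiff en N n (X n w) (X (Suc n) w)"
    have i1: "integrable M (\<lambda>w. (Z n w)\<^sup>2)"
    proof (rule integrable_bounded[where B = "(BH + real n * BD)\<^sup>2"])
      show "norm ((Z n w)\<^sup>2) \<le> (BH + real n * BD)\<^sup>2" for w
        using power_mono[OF ZB[of n w] abs_ge_zero, of 2] by simp
    qed simp
    have i2: "integrable M (\<lambda>w. Z n w * ?d w)"
    proof (rule integrable_bounded[where B = "(BH + real n * BD) * BD"])
      show "norm (Z n w * ?d w) \<le> (BH + real n * BD) * BD" for w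
        unfolding norm_mult using ZB[of n w] mdiff_bound[of N n] BD0 by (intro mult_mono) (auto intro: order_trans[OF abs_ge_zero])
    qed measurable
    have sqB: "\<bar>(mdiff en N n x y)\<^sup>2\<bar> \<le> BD\<^sup>2" for x y
      using power_mono[OF mdiff_bound[of N n x y] abs_ge_zero, of 2] by simp
    have i3: "integrable M (\<lambda>w. (?d w)\<^sup>2)"
      by (rule integrable_bounded[where B = "BD\<^sup>2"]) (use sqB in auto)
    have "expectation (\<lambda>w. Z n w * ?d w) = expectation (\<lambda>w. Z n w * kint n (X n w) (mdiff en N n (X n w)))"
      by (rule markov_real[OF ZF ZB mdiff_measurable mdiff_bound])
    also have "\<dots> = 0" using kint_mdiff[OF cpot_bound that] by simp
    finally have 2: "expectation (\<lambda>w. Z n w * ?d w) = 0" .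
    have 3: "expectation (\<lambda>w. (?d w)\<^sup>2) = \<gamma> N n"
      unfolding \<gamma>_def by (rule expectation_step2[OF _ sqB]) measurable
    have "expectation (\<lambda>w. (Z (Suc n) w)\<^sup>2) = expectation (\<lambda>w. (Z n w)\<^sup>2 + 2 * (Z n w * ?d w) + (?d w)\<^sup>2)"
      by (intro Bochner_Integration.integral_cong refl) (simp add: Z_def power2_eq_square algebra_simps)
    also have "\<dots> = expectation (\<lambda>w. (Z n w)\<^sup>2) + 2 * expectation (\<lambda>w. Z n w * ?d w) + expectation (\<lambda>w. (?d w)\<^sup>2)"
      using i1 i2 i3 by simp
    finally show ?thesis using 2 3 by simp
  qed
  have "expectation (\<lambda>w. (Z n w)\<^sup>2) = expectation (\<lambda>w. (Z 0 w)\<^sup>2) + (\<Sum>k<n. \<gamma> N k)" if "n \<le> N" for n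
    using that by (induction n) (simp_all add: step)
  from this[of N] have "expectation (\<lambda>w. (Z N w)\<^sup>2) = expectation (\<lambda>w. (Z 0 w)\<^sup>2) + (\<Sum>k<N. \<gamma> N k)" by simp
  moreover have "Z N w = S N w - expectation (S N)" for w
    unfolding Z_def sum_mdiff[of en N "\<lambda>n. X n w"] expectation_S by (simp add: S_def)
  ultimately show ?thesis by (simp add: Z_def)
qed

lemma variance_S_bounds:
  "(\<Sum>n<N. \<gamma> N n) \<le> variance (S N)" "variance (S N) \<le> (\<Sum>n<N. \<gamma> N n) + BH\<^sup>2"
proof -
  have sq: "(cpot en N 0 x)\<^sup>2 \<le> BH\<^sup>2" for x using power_mono[OF cpot_bound[of N 0 x], of 2] by simp
  have "0 \<le> expectation (\<lambda>w. (cpot en N 0 (X 0 w))\<^sup>2)" by simp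
  moreover have "expectation (\<lambda>w. (cpot en N 0 (X 0 w))\<^sup>2) \<le> expectation (\<lambda>w. BH\<^sup>2)"
    using sq by (intro integral_mono integrable_bounded[where B = "BH\<^sup>2"]) auto
  ultimately show "(\<Sum>n<N. \<gamma> N n) \<le> variance (S N)" "variance (S N) \<le> (\<Sum>n<N. \<gamma> N n) + BH\<^sup>2"
    unfolding variance_S by (simp_all add: prob_space)
qed

text \<open>The reference process only provides the centring constants; the chain may be started anywhere.\<close>

theorem clt_error:
  assumes P: "chain_process \<mu> p e M' X' Fil'"
  shows "\<exists>C\<ge>0. \<forall>N t. \<bar>t\<bar> \<le> 1 \<longrightarrow>
     cmod ((\<integral>w. cis (t * ((\<Sum>n<N. f n (X' n w) (X' (Suc n) w)) - expectation (S N))) \<partial>M') - exp (- (t\<^sup>2 / 2 * variance (S N))))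
       \<le> C * (\<bar>t\<bar> + \<bar>t\<bar> ^ 3 * variance (S N))"
proof -
  interpret P: chain_process \<mu> p e M' X' Fil' by fact
  let ?c = "clt_const BD BG * (2 + 5 * BG + 2 * BG\<^sup>2)"
  define C where "C = BH + ?c + BG + BH\<^sup>2"
  have BG0: "0 \<le> BG" using e by (simp add: BG_def)
  have BD0: "0 \<le> BD" using BH_nonneg K_nonneg by (simp add: BD_def)
  have c0: "0 \<le> ?c" unfolding clt_const_def using BD0 BG0 by (intro mult_nonneg_nonneg add_nonneg_nonneg) auto
  have "cmod ((\<integral>w. cis (t * ((\<Sum>n<N. f n (X' n w) (X' (Suc n) w)) - expectation (S N))) \<partial>M') - exp (- (t\<^sup>2 / 2 * variance (S N))))
       \<le> C * (\<bar>t\<bar> + \<bar>t\<bar> ^ 3 * variance (S N))" if t: "\<bar>t\<bar> \<le> 1" for N t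
  proof -
    let ?V = "variance (S N)" and ?G = "\<Sum>n<N. \<gamma> N n"
    let ?T = "\<lambda>w. \<Sum>n<N. mdiff en N n (X' n w) (X' (Suc n) w)"
    let ?Q = "\<lambda>w. (\<Sum>n<N. f n (X' n w) (X' (Suc n) w)) - expectation (S N)"
    have V0: "0 \<le> ?V" by simp
    \<comment> \<open>The only trace of the initial distribution is the corrector at time 0, which
      is bounded by \<open>BH\<close>; it costs at most \<open>|t| * BH\<close>.\<close>
    have QT: "?Q w = ?T w + cpot en N 0 (X' 0 w)" for w
      unfolding sum_mdiff[of en N "\<lambda>n. X' n w"] expectation_S by simp
    have i1: "integrable M' (\<lambda>w. cis (t * ?Q w))" by (rule P.integrable_bounded[where B = 1]) (simp_all add: norm_mult)
    have i2: "integrable M' (\<lambda>w. cis (t * ?T w))" by (rule P.integrable_bounded[where B = 1]) simp_all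
    have 1: "cmod ((\<integral>w. cis (t * ?Q w) \<partial>M') - (\<integral>w. cis (t * ?T w) \<partial>M')) \<le> \<bar>t\<bar> * BH"
    proof -
      have pt: "cmod (cis (t * ?Q w) - cis (t * ?T w)) \<le> \<bar>t\<bar> * BH" for w
      proof -
        have eq: "cis (t * ?Q w) - cis (t * ?T w) = cis (t * ?T w) * (cis (t * cpot en N 0 (X' 0 w)) - 1)"
          unfolding QT by (simp add: distrib_left cis_mult[symmetric] algebra_simps)
        have "cmod (cis (t * ?Q w) - cis (t * ?T w)) \<le> \<bar>t * cpot en N 0 (X' 0 w)\<bar>"
          unfolding eq norm_mult norm_cis mult_1
          using iexp_approx1[of "t * cpot en N 0 (X' 0 w)" 0] by (simp add: cis_conv_exp)
        also have "\<dots> \<le> \<bar>t\<bar> * BH" unfolding abs_mult by (intro mult_left_mono cpot_bound) simp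
        finally show ?thesis .
      qed
      have "cmod (\<integral>w. cis (t * ?Q w) - cis (t * ?T w) \<partial>M') \<le> (\<integral>w. cmod (cis (t * ?Q w) - cis (t * ?T w)) \<partial>M')"
        by (rule integral_norm_bound)
      also have "\<dots> \<le> (\<integral>w. \<bar>t\<bar> * BH \<partial>M')"
        by (intro integral_mono integrable_norm Bochner_Integration.integrable_diff i1 i2 pt) simp
      finally show ?thesis using i1 i2 by (simp add: P.prob_space)
    qed
    have 2: "cmod ((\<integral>w. cis (t * ?T w) \<partial>M') - exp (- (t\<^sup>2 / 2 * ?G))) \<le> \<bar>t\<bar> ^ 3 * clt_const BD BG * ((2 + 5 * BG + 2 * BG\<^sup>2) * (?G + 1)) + t\<^sup>2 / 2 * BG"
      by (rule P.char_martingale[where G = "Gp N"])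
         (use mdiff_bound kint_mdiff[OF cpot_bound] Gp_bound Gp_rec \<gamma>_bounds t in \<open>auto intro: mdiff_measurable Gp_measurable simp: Gp_def[of N N]\<close>)
    have 3: "\<bar>exp (- (t\<^sup>2 / 2 * ?G)) - exp (- (t\<^sup>2 / 2 * ?V))\<bar> \<le> t\<^sup>2 / 2 * BH\<^sup>2"
    proof -
      define a where "a = t\<^sup>2 / 2 * ?G"
      define b where "b = t\<^sup>2 / 2 * ?V"
      have ab: "a \<le> b" "b - a \<le> t\<^sup>2 / 2 * BH\<^sup>2"
        unfolding a_def b_def right_diff_distrib[symmetric] using variance_S_bounds[of N] by (auto intro!: mult_left_mono)
      have a0: "0 \<le> a" unfolding a_def by (intro mult_nonneg_nonneg sum_nonneg \<gamma>_bounds) auto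
      have "exp (- a) - exp (- b) = exp (- a) * (1 - exp (- (b - a)))" by (simp add: right_diff_distrib exp_add[symmetric])
      also have "\<dots> \<le> 1 * (b - a)"
      proof (intro mult_mono)
        show "1 - exp (- (b - a)) \<le> b - a" using exp_ge_add_one_self[of "- (b - a)"] by linarith
      qed (use a0 ab in auto)
      finally show ?thesis using ab unfolding a_def[symmetric] b_def[symmetric] by simp
    qed
    have t2: "t\<^sup>2 \<le> \<bar>t\<bar>" "\<bar>t\<bar> ^ 3 \<le> \<bar>t\<bar>"
      using t power_decreasing[of 1 2 "\<bar>t\<bar>"] power_decreasing[of 1 3 "\<bar>t\<bar>"] by auto
    have GV: "?G \<le> ?V" by (rule variance_S_bounds)
    have "cmod ((\<integral>w. cis (t * ?Q w) \<partial>M') - exp (- (t\<^sup>2 / 2 * ?V)))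
      \<le> cmod ((\<integral>w. cis (t * ?Q w) \<partial>M') - (\<integral>w. cis (t * ?T w) \<partial>M')) + cmod ((\<integral>w. cis (t * ?T w) \<partial>M') - exp (- (t\<^sup>2 / 2 * ?G)))
        + \<bar>exp (- (t\<^sup>2 / 2 * ?G)) - exp (- (t\<^sup>2 / 2 * ?V))\<bar>"
    proof -
      have "cmod (a - d) \<le> cmod (a - b) + cmod (b - c) + cmod (c - d)" for a b c d :: complex
        using norm_triangle_ineq[of "(a - b) + (b - c)" "c - d"] norm_triangle_ineq[of "a - b" "b - c"] by simp
      from this[of _ "of_real (exp (- (t\<^sup>2 / 2 * ?V)))" _ "of_real (exp (- (t\<^sup>2 / 2 * ?G)))"]
      show ?thesis by (simp only: of_real_diff[symmetric] norm_of_real)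
    qed
    also have "\<dots> \<le> \<bar>t\<bar> * BH + (\<bar>t\<bar> ^ 3 * clt_const BD BG * ((2 + 5 * BG + 2 * BG\<^sup>2) * (?G + 1)) + t\<^sup>2 / 2 * BG) + t\<^sup>2 / 2 * BH\<^sup>2"
      by (intro add_mono 1 2 3)
    also have "\<dots> = \<bar>t\<bar> * BH + ?c * (\<bar>t\<bar> ^ 3 * ?G) + ?c * \<bar>t\<bar> ^ 3 + BG * (t\<^sup>2 / 2) + BH\<^sup>2 * (t\<^sup>2 / 2)"
      by (simp add: algebra_simps)
    also have "\<dots> \<le> \<bar>t\<bar> * BH + ?c * (\<bar>t\<bar> ^ 3 * ?V) + ?c * \<bar>t\<bar> + BG * \<bar>t\<bar> + BH\<^sup>2 * \<bar>t\<bar>"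
      using t2 GV BG0 by (intro add_mono mult_left_mono c0) auto
    also have "\<dots> \<le> C * \<bar>t\<bar> + C * (\<bar>t\<bar> ^ 3 * ?V)"
    proof -
      have "?c * (\<bar>t\<bar> ^ 3 * ?V) \<le> C * (\<bar>t\<bar> ^ 3 * ?V)"
        unfolding C_def using BH_nonneg BG0 V0 by (intro mult_right_mono) auto
      then show ?thesis by (simp add: C_def algebra_simps)
    qed
    finally show ?thesis by (simp add: distrib_left)
  qed
  moreover have "0 \<le> C" unfolding C_def using BH_nonneg c0 BG0 by simp
  ultimately show ?thesis by blast
qed

end

section \<open>Variance and tightness\<close>

lemma sum_power_dist_le:
  assumes r: "0 \<le> r" "r < (1::real)" and I: "finite I"
  shows "(\<Sum>k\<in>I. r ^ ((if j \<le> k then k - j else j - k) div 2)) \<le> 4 / (1 - r)"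
proof -
  let ?g = "\<lambda>k. r ^ ((if j \<le> k then k - j else j - k) div 2)"
  obtain N where N: "I \<subseteq> {..<N}" using I finite_nat_iff_bounded by blast
  have "sum ?g I \<le> sum ?g ({..<j} \<union> {j..<j + N})" using N r by (intro sum_mono2) auto
  also have "\<dots> = sum ?g {..<j} + sum ?g {j..<j + N}" by (rule sum.union_disjoint) auto
  also have "sum ?g {j..<j + N} = (\<Sum>i<N. r ^ (i div 2))"
    by (rule sum.reindex_bij_witness[of _ "\<lambda>i. j + i" "\<lambda>k. k - j"]) auto
  also have "\<dots> \<le> 2 / (1 - r)" by (rule sum_power_div2_le[OF r])
  also have "sum ?g {..<j} = (\<Sum>i<j. r ^ (Suc i div 2))"
    by (rule sum.reindex_bij_witness[of _ "\<lambda>i. j - Suc i" "\<lambda>k. j - Suc k"]) (auto simp: Suc_diff_Suc)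
  also have "\<dots> \<le> (\<Sum>i<j. r ^ (i div 2))" using r by (intro sum_mono power_decreasing div_le_mono) auto
  also have "\<dots> \<le> 2 / (1 - r)" by (rule sum_power_div2_le[OF r])
  finally show ?thesis by simp
qed

lemma (in prob_space) variance_le_second_moment:
  fixes Y :: "'a \<Rightarrow> real"
  assumes [measurable]: "Y \<in> borel_measurable M" and B: "\<And>w. \<bar>Y w\<bar> \<le> B"
  shows "variance Y \<le> expectation (\<lambda>w. (Y w - m)\<^sup>2)"
proof -
  have sq: "\<bar>(Y w)\<^sup>2\<bar> \<le> B\<^sup>2" for w using power_mono[OF B[of w] abs_ge_zero, of 2] by simp
  have i: "integrable M Y" "integrable M (\<lambda>w. (Y w)\<^sup>2)"
    by (rule integrable_bounded[where B = B], use B in auto, rule integrable_bounded[where B = "B\<^sup>2"], use sq in auto)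
  have "expectation (\<lambda>w. (Y w - m)\<^sup>2) = expectation (\<lambda>w. (Y w)\<^sup>2 - 2 * m * Y w + m\<^sup>2)"
    by (intro Bochner_Integration.integral_cong refl) (simp add: power2_eq_square algebra_simps)
  also have "\<dots> = expectation (\<lambda>w. (Y w)\<^sup>2) - 2 * m * expectation Y + m\<^sup>2"
    using i by (simp add: prob_space)
  also have "\<dots> = variance Y + (expectation Y - m)\<^sup>2"
    by (subst variance_eq[OF i]) (simp add: power2_eq_square algebra_simps)
  finally show ?thesis by simp
qed

context chain_process
begin

section \<open>Almost orthogonality of the summands\<close>

lemma Fil_measurable_add: "Y \<in> measurable (Fil n) N \<Longrightarrow> Y \<in> measurable (Fil (n + i)) N"
proof (induction i)
  case (Suc i)
  then show ?case unfolding add_Suc_right by (intro Fil_measurable_Suc)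
qed (simp only: add_0_right)

lemma markov_iter:
  assumes "Y \<in> borel_measurable (Fil n)" and YB: "\<And>w. \<bar>Y w\<bar> \<le> B"
    and "g \<in> borel_measurable (\<mu> (n + i))" and gB: "\<And>x. \<bar>g x\<bar> \<le> (B'::real)"
  shows "(\<integral>w. Y w * g (X (n + i) w) \<partial>M) = (\<integral>w. Y w * iter i n g (X n w) \<partial>M)"
  using assms(1,3)
proof (induction i arbitrary: n)
  case (Suc i)
  have m [measurable]: "iter i (Suc n) g \<in> borel_measurable (\<mu> (Suc n))" using Suc.prems by (intro iter_measurable) simp
  have b: "\<bar>iter i (Suc n) g x\<bar> \<le> B'" for x using norm_iter_le[of g "Suc n" i B' x] Suc.prems gB by simp
  have "(\<integral>w. Y w * g (X (n + Suc i) w) \<partial>M) = (\<integral>w. Y w * iter i (Suc n) g (X (Suc n) w) \<partial>M)"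
    using Suc.IH[of "Suc n"] Suc.prems Fil_measurable_Suc[OF Suc.prems(1)] by simp
  also have "\<dots> = (\<integral>w. Y w * kint n (X n w) (iter i (Suc n) g) \<partial>M)"
    by (rule markov_real[OF Suc.prems(1) YB _ b]) measurable
  finally show ?case by simp
qed simp

text \<open>This is \<open>2 * C0 * (4 / e)\<close> with the \<open>C0\<close> of the next proof:
  \<open>4 / e\<close> sums the geometric weights in both directions, and 2 comes from symmetrising
  \<open>a j + a k\<close>.\<close>

definition var_const :: real where "var_const = 8 / (e ^ 3 * (1 - e)\<^sup>2)"

lemma var_const_nonneg: "0 \<le> var_const" using e by (simp add: var_const_def)

text \<open>Exponential mixing makes the terms of the sum almost orthogonal.\<close>

lemma second_moment_sum_le:
  assumes Fm: "\<And>n. (\<lambda>(x, y). F n x y) \<in> borel_measurable (\<mu> n \<Otimes>\<^sub>M \<mu> (Suc n))" and FB: "\<And>n x y. \<bar>F n x y\<bar> \<le> B"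
    and I: "finite I" "\<And>n. n \<in> I \<Longrightarrow> 1 \<le> n"
    and a: "\<And>n. n \<in> I \<Longrightarrow> 0 \<le> a n" "\<And>n. n \<in> I \<Longrightarrow> (\<integral>\<^sup>+x. \<integral>\<^sup>+y. ennreal (p n x y * (F n x y)\<^sup>2) \<partial>\<mu> (Suc n) \<partial>\<mu> n) \<le> ennreal (a n)"
  shows "expectation (\<lambda>w. (\<Sum>n\<in>I. F n (X n w) (X (Suc n) w) - expectation (\<lambda>w. F n (X n w) (X (Suc n) w)))\<^sup>2) \<le> var_const * (\<Sum>n\<in>I. a n)"
proof -
  have B0: "0 \<le> B" using FB[of 0 undefined undefined] by linarith
  have Fr [measurable (raw)]: "(\<lambda>w. F n (g w) (h w)) \<in> borel_measurable L" if "g \<in> measurable L (\<mu> n)" "h \<in> measurable L (\<mu> (Suc n))" for n g h L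
    using measurable_compose[OF measurable_Pair[OF that] Fm] by simp
  define \<phi> where "\<phi> n x = kint n x (F n x)" for n x
  define \<psi> where "\<psi> n x = kint n x (\<lambda>y. (F n x y)\<^sup>2)" for n x
  have [measurable]: "\<phi> n \<in> borel_measurable (\<mu> n)" "\<psi> n \<in> borel_measurable (\<mu> n)" for n unfolding \<phi>_def \<psi>_def by measurable
  have FB2: "\<bar>(F n x y)\<^sup>2\<bar> \<le> B\<^sup>2" for n x y using power_mono[OF FB[of n x y] abs_ge_zero, of 2] by simp
  have \<phi>B: "\<bar>\<phi> n x\<bar> \<le> B" for n x unfolding \<phi>_def using norm_kint_bound[of "F n x" n B x] FB by simp
  have \<psi>B: "0 \<le> \<psi> n x" "\<psi> n x \<le> B\<^sup>2" for n x
    unfolding \<psi>_def by (rule kint_sq_bound[OF _ FB], measurable)+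
  have \<phi>\<psi>: "(\<phi> n x)\<^sup>2 \<le> \<psi> n x" for n x
    using kvar_nonneg[of n x "F n x"] kvar_eq[of "F n x" n B x] FB unfolding \<phi>_def \<psi>_def by simp
  have \<psi>i: "integrable (\<mu> n) (\<psi> n)" for n by (rule mu.integrable_bounded[where B = "B\<^sup>2"]) (use \<psi>B in auto)
  have \<psi>a: "(\<integral>x. \<psi> n x \<partial>\<mu> n) \<le> a n" if "n \<in> I" for n
  proof -
    have "ennreal (\<integral>x. \<psi> n x \<partial>\<mu> n) = (\<integral>\<^sup>+x. ennreal (\<psi> n x) \<partial>\<mu> n)"
      by (rule nn_integral_eq_integral[symmetric, OF \<psi>i]) (simp add: \<psi>B)
    also have "\<dots> = (\<integral>\<^sup>+x. \<integral>\<^sup>+y. ennreal (p n x y * (F n x y)\<^sup>2) \<partial>\<mu> (Suc n) \<partial>\<mu> n)"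
    proof (intro nn_integral_cong)
      fix x
      have "integrable (\<mu> (Suc n)) (\<lambda>y. p n x y *\<^sub>R (F n x y)\<^sup>2)" by (rule kernel_integrable[where B = "B\<^sup>2"]) (use FB2 in auto)
      then show "ennreal (\<psi> n x) = (\<integral>\<^sup>+y. ennreal (p n x y * (F n x y)\<^sup>2) \<partial>\<mu> (Suc n))"
        unfolding \<psi>_def kint_def by (subst nn_integral_eq_integral[symmetric]) auto
    qed
    finally show ?thesis using a[OF that] by (metis ennreal_le_iff)
  qed
  define m where "m n = expectation (\<lambda>w. F n (X n w) (X (Suc n) w))" for n
  define Z where "Z n w = F n (X n w) (X (Suc n) w) - m n" for n w
  have [measurable]: "Z n \<in> borel_measurable M" for n unfolding Z_def by measurable
  have Fi: "integrable M (\<lambda>w. F n (X n w) (X (Suc n) w))" for n by (rule integrable_bounded[where B = B]) (use FB in auto)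
  have mB: "\<bar>m n\<bar> \<le> B" for n
  proof -
    have "\<bar>m n\<bar> \<le> expectation (\<lambda>w. \<bar>F n (X n w) (X (Suc n) w)\<bar>)" unfolding m_def by (rule integral_abs_bound)
    also have "\<dots> \<le> expectation (\<lambda>w. B)" using Fi FB by (intro integral_mono) auto
    finally show ?thesis by (simp add: prob_space)
  qed
  have ZB: "\<bar>Z n w\<bar> \<le> 2 * B" for n w using FB[of n "X n w" "X (Suc n) w"] mB[of n] unfolding Z_def by linarith
  have ZZB: "\<bar>Z j w * Z k w\<bar> \<le> 2 * B * (2 * B)" for j k w unfolding abs_mult using ZB B0 by (intro mult_mono) auto
  have ZZi: "integrable M (\<lambda>w. Z j w * Z k w)" for j k by (rule integrable_bounded[where B = "2 * B * (2 * B)"]) (use ZZB in auto)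
  have ZF: "Z n \<in> borel_measurable (Fil (Suc n))" for n
  proof -
    have [measurable]: "X n \<in> measurable (Fil (Suc n)) (\<mu> n)" "X (Suc n) \<in> measurable (Fil (Suc n)) (\<mu> (Suc n))"
      by (rule X_Fil_Suc, rule X_Fil)
    show ?thesis unfolding Z_def by measurable
  qed
  \<comment> \<open>Because \<open>n\<close> is positive, \<open>X n\<close> is reached by a step of
    the chain, and its law has a density of at most \<open>1 / e\<close>. This converts the integral
    against the reference measure into an expectation.\<close>
  have EZ2: "expectation (\<lambda>w. Z n w * Z n w) \<le> a n / e" if n: "n \<in> I" for n
  proof -
    obtain n' where n': "n = Suc n'" using I(2)[OF n] by (cases n) auto
    have "expectation (\<lambda>w. Z n w * Z n w) \<le> expectation (\<lambda>w. (F n (X n w) (X (Suc n) w))\<^sup>2)"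
      using variance_le_second_moment[of "\<lambda>w. F n (X n w) (X (Suc n) w)" B 0] FB by (simp add: Z_def m_def power2_eq_square)
    also have "\<dots> = expectation (\<lambda>w. \<psi> n (X n w))"
      unfolding \<psi>_def by (rule expectation_step2[OF _ FB2]) measurable
    also have "\<dots> = expectation (\<lambda>w. kint n' (X n' w) (\<psi> n))"
      unfolding n' by (rule expectation_step[where B = "B\<^sup>2"]) (use \<psi>B in auto)
    also have "\<dots> \<le> expectation (\<lambda>w. 1 / e * (\<integral>x. \<psi> n x \<partial>\<mu> n))"
    proof (intro integral_mono)
      have [measurable]: "\<psi> n \<in> borel_measurable (\<mu> (Suc n'))" unfolding n'[symmetric] by measurable
      have "\<bar>kint n' x (\<psi> n)\<bar> \<le> B\<^sup>2" for x using norm_kint_bound[of "\<psi> n" n' "B\<^sup>2" x] \<psi>B by simp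
      then show "integrable M (\<lambda>w. kint n' (X n' w) (\<psi> n))" by (intro integrable_bounded[where B = "B\<^sup>2"]) auto
      show "kint n' (X n' w) (\<psi> n) \<le> 1 / e * (\<integral>x. \<psi> n x \<partial>\<mu> n)" for w
        unfolding n' using \<psi>B by (intro kint_le_integral[where B = "B\<^sup>2"]) auto
    qed simp
    also have "\<dots> = 1 / e * (\<integral>x. \<psi> n x \<partial>\<mu> n)" by (simp add: prob_space)
    also have "\<dots> \<le> 1 / e * a n" using e by (intro mult_left_mono \<psi>a n) auto
    finally show ?thesis by simp
  qed
  define r where "r = 1 - e"
  have r: "0 < r" "r < 1" using e by (auto simp: r_def)
  \<comment> \<open>The factor \<open>1 / r^2\<close> absorbs the powers of \<open>r\<close> missing
    for close indices and those lost in the exponent \<open>d div 2 - 1\<close> for distant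
    ones.\<close>
  define C0 where "C0 = 1 / (e\<^sup>2 * r\<^sup>2)"
  have C0: "0 \<le> C0" by (simp add: C0_def)
  have e1: "1 / e \<le> 1 / e\<^sup>2" using e power_decreasing[of 1 2 e] by (intro divide_left_mono) auto
  have amgm: "\<bar>expectation (\<lambda>w. Z j w * Z k w)\<bar> \<le> (a j + a k) / (2 * e)" if "j \<in> I" "k \<in> I" for j k
  proof -
    have "\<bar>expectation (\<lambda>w. Z j w * Z k w)\<bar> \<le> expectation (\<lambda>w. \<bar>Z j w * Z k w\<bar>)" by (rule integral_abs_bound)
    also have "\<dots> \<le> expectation (\<lambda>w. 1 / 2 * (Z j w * Z j w + Z k w * Z k w))"
    proof (rule integral_mono[OF integrable_abs[OF ZZi] integrable_mult_right[OF Bochner_Integration.integrable_add[OF ZZi ZZi]]])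
      show "\<bar>Z j w * Z k w\<bar> \<le> 1 / 2 * (Z j w * Z j w + Z k w * Z k w)" for w
        using sum_squares_bound[of "\<bar>Z j w\<bar>" "\<bar>Z k w\<bar>"] by (simp add: abs_mult power2_eq_square)
    qed
    also have "\<dots> = 1 / 2 * (expectation (\<lambda>w. Z j w * Z j w) + expectation (\<lambda>w. Z k w * Z k w))" using ZZi by simp
    also have "\<dots> \<le> 1 / 2 * (a j / e + a k / e)" by (intro mult_left_mono add_mono EZ2 that) simp
    finally show ?thesis by (simp add: add_divide_distrib)
  qed
  \<comment> \<open>For distant indices the mixing estimate must be the one with the integral of
    \<open>\<phi> k\<close>. A supremum bound would leave the constant \<open>B\<close> in the
    result, but the covariance has to be controlled by \<open>a j\<close> and \<open>a k\<close>
    alone.\<close>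
  have cov: "expectation (\<lambda>w. Z j w * Z k w) \<le> C0 * r ^ ((k - j) div 2) * (a j + a k)" if jk: "j \<in> I" "k \<in> I" "j \<le> k" for j k
  proof -
    have aa: "0 \<le> a j + a k" using a(1) jk by (intro add_nonneg_nonneg) auto
    show ?thesis
    proof (cases "k - j \<le> 2")
      case True
      have "1 / (2 * e) \<le> 1 / e\<^sup>2 * 1"
      proof -
        have "1 / (2 * e) \<le> 1 / e" using e by (intro divide_left_mono) auto
        then show ?thesis using e1 by simp
      qed
      also have "\<dots> \<le> 1 / e\<^sup>2 * (r ^ ((k - j) div 2) / r\<^sup>2)"
      proof (intro mult_left_mono)
        have "r\<^sup>2 \<le> r ^ ((k - j) div 2)" using r True by (intro power_decreasing) auto
        then show "1 \<le> r ^ ((k - j) div 2) / r\<^sup>2" using r by simp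
      qed simp
      also have "\<dots> = C0 * r ^ ((k - j) div 2)" by (simp add: C0_def)
      finally have "1 / (2 * e) * (a j + a k) \<le> C0 * r ^ ((k - j) div 2) * (a j + a k)" by (rule mult_right_mono[OF _ aa])
      then show ?thesis using amgm[OF jk(1,2)] by simp
    next
      case False
      define d where "d = k - Suc j"
      have d: "2 \<le> d" "k = Suc j + d" using False by (auto simp: d_def)
      let ?c = "\<integral>x. \<bar>\<phi> k x\<bar> \<partial>\<mu> k"
      let ?q = "r ^ (d div 2 - 1)"
      have mk: "m k = expectation (\<lambda>w. \<phi> k (X k w))"
        unfolding m_def \<phi>_def by (rule expectation_step2[OF _ FB]) measurable
      have \<phi>m: "\<phi> k \<in> borel_measurable (\<mu> (Suc j + d))" using d(2) by (metis \<open>\<And>n. \<phi> n \<in> borel_measurable (\<mu> n)\<close>)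
      have it: "\<bar>iter d (Suc j) (\<phi> k) x - m k\<bar> \<le> 2 / e * ?c * ?q" for x
      proof -
        have "\<bar>iter d (Suc j) (\<phi> k) x - expectation (\<lambda>w. \<phi> k (X (Suc j + d) w))\<bar> \<le> 2 / e * (\<integral>x. \<bar>\<phi> k x\<bar> \<partial>\<mu> (Suc j + d)) * (1 - e) ^ (d div 2 - 1)"
          by (rule abs_iter_minus_expectation_le[OF \<phi>m \<phi>B]) (rule abs_oscillation_iter_L1[OF \<phi>m \<phi>B d(1)])
        then show ?thesis unfolding mk r_def d(2)[symmetric] .
      qed
      have ZFk: "Z j \<in> borel_measurable (Fil k)"
        unfolding d(2) by (rule Fil_measurable_add[OF ZF])
      have "expectation (\<lambda>w. Z j w * Z k w) = expectation (\<lambda>w. Z j w * (kint k (X k w) (\<lambda>y. F k (X k w) y - m k)))"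
        unfolding Z_def[of k]
      proof (rule markov_real[OF ZFk ZB, where B' = "2 * B"])
        show "\<bar>F k x y - m k\<bar> \<le> 2 * B" for x y using FB[of k x y] mB[of k] by linarith
      qed measurable
      also have "\<dots> = expectation (\<lambda>w. Z j w * (\<phi> k (X k w) - m k))"
      proof -
        have "kint k x (\<lambda>y. F k x y - m k) = \<phi> k x - m k" for x
          unfolding \<phi>_def using FB mB by (subst kint_diff[where B = B and B' = B]) auto
        then show ?thesis by simp
      qed
      also have "\<dots> = expectation (\<lambda>w. Z j w * \<phi> k (X k w)) - expectation (\<lambda>w. Z j w * m k)"
      proof -
        have b1: "\<bar>Z j w * \<phi> k x\<bar> \<le> 2 * B * B" for w x unfolding abs_mult using ZB \<phi>B B0 by (intro mult_mono) auto
        have b2: "\<bar>Z j w * m k\<bar> \<le> 2 * B * B" for w unfolding abs_mult using ZB mB B0 by (intro mult_mono) auto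
        have "integrable M (\<lambda>w. Z j w * \<phi> k (X k w))" by (rule integrable_bounded[where B = "2 * B * B"]) (use b1 in auto)
        moreover have "integrable M (\<lambda>w. Z j w * m k)" by (rule integrable_bounded[where B = "2 * B * B"]) (use b2 in auto)
        ultimately show ?thesis by (simp add: right_diff_distrib)
      qed
      also have "expectation (\<lambda>w. Z j w * \<phi> k (X k w)) = expectation (\<lambda>w. Z j w * iter d (Suc j) (\<phi> k) (X (Suc j) w))"
        using markov_iter[OF ZF ZB \<phi>m \<phi>B] by (simp only: d(2)[symmetric])
      also have "\<dots> - expectation (\<lambda>w. Z j w * m k) = expectation (\<lambda>w. Z j w * (iter d (Suc j) (\<phi> k) (X (Suc j) w) - m k))"
      proof -
        have [measurable]: "iter d (Suc j) (\<phi> k) \<in> borel_measurable (\<mu> (Suc j))" by (rule iter_measurable[OF \<phi>m])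
        have ib: "\<bar>iter d (Suc j) (\<phi> k) x\<bar> \<le> B" for x using norm_iter_le[OF \<phi>m, of B x] \<phi>B by simp
        have b1: "\<bar>Z j w * iter d (Suc j) (\<phi> k) x\<bar> \<le> 2 * B * B" for w x unfolding abs_mult using ZB ib B0 by (intro mult_mono) auto
        have b2: "\<bar>Z j w * m k\<bar> \<le> 2 * B * B" for w unfolding abs_mult using ZB mB B0 by (intro mult_mono) auto
        have "integrable M (\<lambda>w. Z j w * iter d (Suc j) (\<phi> k) (X (Suc j) w))" by (rule integrable_bounded[where B = "2 * B * B"]) (use b1 in auto)
        moreover have "integrable M (\<lambda>w. Z j w * m k)" by (rule integrable_bounded[where B = "2 * B * B"]) (use b2 in auto)
        ultimately show ?thesis by (simp add: right_diff_distrib)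
      qed
      also have "\<dots> \<le> expectation (\<lambda>w. 1 / e * ?q * (Z j w * Z j w + ?c\<^sup>2))"
      proof (rule integral_mono)
        have [measurable]: "iter d (Suc j) (\<phi> k) \<in> borel_measurable (\<mu> (Suc j))" by (rule iter_measurable[OF \<phi>m])
        have b: "\<bar>Z j w * (iter d (Suc j) (\<phi> k) x - m k)\<bar> \<le> 2 * B * (2 / e * ?c * ?q)" for w x
          unfolding abs_mult using ZB it B0 by (intro mult_mono) auto
        show "integrable M (\<lambda>w. Z j w * (iter d (Suc j) (\<phi> k) (X (Suc j) w) - m k))"
          by (rule integrable_bounded[where B = "2 * B * (2 / e * ?c * ?q)"]) (use b in auto)
        show "integrable M (\<lambda>w. 1 / e * ?q * (Z j w * Z j w + ?c\<^sup>2))"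
          by (rule integrable_mult_right[OF Bochner_Integration.integrable_add[OF ZZi integrable_const]])
        fix w
        have "Z j w * (iter d (Suc j) (\<phi> k) (X (Suc j) w) - m k) \<le> \<bar>Z j w\<bar> * (2 / e * ?c * ?q)"
          by (rule order_trans[OF abs_ge_self]) (simp only: abs_mult mult_left_mono[OF it abs_ge_zero])
        also have "\<dots> = 1 / e * ?q * (2 * \<bar>Z j w\<bar> * ?c)" by simp
        also have "\<dots> \<le> 1 / e * ?q * (Z j w * Z j w + ?c\<^sup>2)"
          using sum_squares_bound[of "\<bar>Z j w\<bar>" ?c] e r by (intro mult_left_mono) (auto simp: power2_eq_square)
        finally show "Z j w * (iter d (Suc j) (\<phi> k) (X (Suc j) w) - m k) \<le> 1 / e * ?q * (Z j w * Z j w + ?c\<^sup>2)" .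
      qed
      also have "\<dots> = 1 / e * ?q * (expectation (\<lambda>w. Z j w * Z j w) + ?c\<^sup>2)" using ZZi by (simp add: prob_space)
      also have "\<dots> \<le> 1 / e * ?q * (a j / e + a k / e)"
      proof (intro mult_left_mono add_mono EZ2 jk)
        have "?c\<^sup>2 \<le> (\<integral>x. \<psi> k x \<partial>\<mu> k)"
        proof -
          have i1: "integrable (\<mu> k) (\<lambda>x. \<bar>\<phi> k x\<bar>)" by (rule mu.integrable_bounded[where B = B]) (use \<phi>B in auto)
          have i2: "integrable (\<mu> k) (\<lambda>x. (\<phi> k x)\<^sup>2)"
          proof (rule mu.integrable_bounded[where B = "B\<^sup>2"])
            show "norm ((\<phi> k x)\<^sup>2) \<le> B\<^sup>2" for x using power_mono[OF \<phi>B[of k x] abs_ge_zero, of 2] by simp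
          qed simp
          have "0 \<le> mu.variance k (\<lambda>x. \<bar>\<phi> k x\<bar>)" by simp
          also have "\<dots> = (\<integral>x. (\<phi> k x)\<^sup>2 \<partial>\<mu> k) - ?c\<^sup>2" using i1 i2 by (subst mu.variance_eq) simp_all
          finally have "?c\<^sup>2 \<le> (\<integral>x. (\<phi> k x)\<^sup>2 \<partial>\<mu> k)" by simp
          also have "\<dots> \<le> (\<integral>x. \<psi> k x \<partial>\<mu> k)" by (intro integral_mono i2 \<psi>i \<phi>\<psi>)
          finally show ?thesis .
        qed
        also have "\<dots> \<le> a k" by (rule \<psi>a[OF jk(2)])
        also have "\<dots> \<le> a k / e" using a(1)[OF jk(2)] e by (simp add: pos_le_divide_eq mult_left_le)
        finally show "?c\<^sup>2 \<le> a k / e" .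
      qed (use e r in auto)
      also have "\<dots> = 1 / e\<^sup>2 * ?q * (a j + a k)" by (simp add: power2_eq_square add_divide_distrib distrib_left)
      also have "\<dots> \<le> 1 / e\<^sup>2 * (r ^ ((k - j) div 2) / r\<^sup>2) * (a j + a k)"
      proof (intro mult_right_mono mult_left_mono aa)
        have "?q * r\<^sup>2 = r ^ (d div 2 - 1 + 2)" by (simp only: power_add)
        also have "\<dots> \<le> r ^ ((k - j) div 2)" using r d by (intro power_decreasing) auto
        finally show "?q \<le> r ^ ((k - j) div 2) / r\<^sup>2" using r by (simp add: pos_le_divide_eq)
      qed simp
      also have "\<dots> = C0 * r ^ ((k - j) div 2) * (a j + a k)" by (simp add: C0_def)
      finally show ?thesis .
    qed
  qed
  let ?d = "\<lambda>j k :: nat. (if j \<le> k then k - j else j - k) div 2"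
  have cov': "expectation (\<lambda>w. Z j w * Z k w) \<le> C0 * r ^ ?d j k * (a j + a k)" if "j \<in> I" "k \<in> I" for j k
  proof (cases "j \<le> k")
    case True
    then show ?thesis using cov[OF that True] by (simp only: if_True)
  next
    case False
    then have "k \<le> j" by simp
    have "expectation (\<lambda>w. Z j w * Z k w) = expectation (\<lambda>w. Z k w * Z j w)" by (simp only: mult.commute)
    then show ?thesis using cov[OF that(2,1) \<open>k \<le> j\<close>] False by (simp only: if_False add.commute)
  qed
  have "expectation (\<lambda>w. (\<Sum>n\<in>I. Z n w)\<^sup>2) = expectation (\<lambda>w. \<Sum>j\<in>I. \<Sum>k\<in>I. Z j w * Z k w)"
    by (simp add: power2_eq_square sum_product)
  also have "\<dots> = (\<Sum>j\<in>I. \<Sum>k\<in>I. expectation (\<lambda>w. Z j w * Z k w))" using ZZi by simp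
  also have "\<dots> \<le> (\<Sum>j\<in>I. \<Sum>k\<in>I. C0 * r ^ ?d j k * (a j + a k))" by (intro sum_mono cov')
  also have "\<dots> = (\<Sum>j\<in>I. \<Sum>k\<in>I. C0 * r ^ ?d j k * a j) + (\<Sum>j\<in>I. \<Sum>k\<in>I. C0 * r ^ ?d j k * a k)"
    by (simp add: distrib_left sum.distrib)
  also have "(\<Sum>j\<in>I. \<Sum>k\<in>I. C0 * r ^ ?d j k * a k) = (\<Sum>j\<in>I. \<Sum>k\<in>I. C0 * r ^ ?d j k * a j)"
    by (subst sum.swap) (intro sum.cong refl, auto)
  also have "(\<Sum>j\<in>I. \<Sum>k\<in>I. C0 * r ^ ?d j k * a j) = (\<Sum>j\<in>I. C0 * a j * (\<Sum>k\<in>I. r ^ ?d j k))"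
    by (simp add: sum_distrib_left mult_ac)
  also have "\<dots> \<le> (\<Sum>j\<in>I. C0 * a j * (4 / (1 - r)))"
    using C0 a(1) r I(1) by (intro sum_mono mult_left_mono sum_power_dist_le) auto
  also have "\<dots> = C0 * (4 / e) * (\<Sum>j\<in>I. a j)" unfolding sum_distrib_left r_def by (intro sum.cong refl) simp
  finally have "expectation (\<lambda>w. (\<Sum>n\<in>I. Z n w)\<^sup>2) \<le> 2 * (C0 * (4 / e) * (\<Sum>j\<in>I. a j))"
    by (simp add: mult_left_mono)
  also have "\<dots> = var_const * (\<Sum>j\<in>I. a j)"
    by (simp add: var_const_def C0_def r_def power2_eq_square power3_eq_cube mult_ac)
  finally show ?thesis by (simp add: Z_def m_def)
qed

end

context elliptic_functional
begin

lemma D_bounded_slack: "D N t \<le> Z \<Longrightarrow> (\<Sum>n<N. slack t n) \<le> Z + 2"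
proof -
  assume "D N t \<le> Z"
  moreover have "(\<Sum>n<N. (1 / 2 :: real) ^ n) \<le> 2"
    by (subst geometric_sum) (simp_all add: field_simps)
  ultimately show ?thesis by (simp add: slack_def sum.distrib D_def)
qed

lemma slack_shift_sum: "(\<Sum>n = 3..<N. slack t (n - 3) + slack t (n - 2)) \<le> 2 * (\<Sum>n<N. slack t n)"
proof -
  have s: "(\<Sum>n = 3..<N. slack t (n - i)) \<le> (\<Sum>n<N. slack t n)" if "i \<le> 3" for i
  proof -
    have "(\<Sum>n = 3..<N. slack t (n - i)) = sum (slack t) ((\<lambda>n. n - i) ` {3..<N})"
      using that by (subst sum.reindex) (auto simp: inj_on_def)
    also have "\<dots> \<le> (\<Sum>n<N. slack t n)" using slack_pos by (intro sum_mono2) (auto intro: less_imp_le)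
    finally show ?thesis .
  qed
  show ?thesis using s[of 3] s[of 2] by (simp add: sum.distrib)
qed

lemma const_dec_nonneg: "0 \<le> const_dec"
  using e unfolding const_dec_def by (intro mult_nonneg_nonneg add_nonneg_nonneg divide_nonneg_nonneg) auto

end

context functional_process
begin

lemma char_eq_U:
  assumes "Y \<in> borel_measurable (Fil n)" "\<And>w. cmod (Y w) \<le> B"
  shows "(\<integral>w. Y w * cis (t * (\<Sum>j<k. f (n + j) (X (n + j) w) (X (Suc (n + j)) w))) \<partial>M) = (\<integral>w. Y w * U t k n (X n w) \<partial>M)"
  using assms
proof (induction k arbitrary: n Y)
  case (Suc k)
  let ?Y = "\<lambda>w. Y w * cis (t * f n (X n w) (X (Suc n) w))"
  have [measurable]: "X n \<in> measurable (Fil (Suc n)) (\<mu> n)" "X (Suc n) \<in> measurable (Fil (Suc n)) (\<mu> (Suc n))"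
    "Y \<in> borel_measurable (Fil (Suc n))"
    by (rule X_Fil_Suc, rule X_Fil, rule Fil_measurable_Suc[OF Suc.prems(1)])
  have "(\<integral>w. Y w * cis (t * (\<Sum>j<Suc k. f (n + j) (X (n + j) w) (X (Suc (n + j)) w))) \<partial>M)
      = (\<integral>w. ?Y w * cis (t * (\<Sum>j<k. f (Suc n + j) (X (Suc n + j) w) (X (Suc (Suc n + j)) w))) \<partial>M)"
    unfolding sum.lessThan_Suc_shift by (simp add: distrib_left cis_mult[symmetric] mult.assoc)
  also have "\<dots> = (\<integral>w. ?Y w * U t k (Suc n) (X (Suc n) w) \<partial>M)"
    by (rule Suc.IH) (use Suc.prems in \<open>simp_all add: norm_mult\<close>)
  also have "\<dots> = (\<integral>w. Y w * (cis (t * f n (X n w) (X (Suc n) w)) * U t k (Suc n) (X (Suc n) w)) \<partial>M)"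
    by (simp only: mult.assoc)
  also have "\<dots> = (\<integral>w. Y w * kint n (X n w) (\<lambda>y. cis (t * f n (X n w) y) * U t k (Suc n) y) \<partial>M)"
    by (rule markov_complex[OF Suc.prems, where B' = 1]) (simp_all add: norm_mult norm_U_le_1)
  finally show ?case by simp
qed simp

text \<open>The coboundary telescopes to two boundary values of size at most \<open>4 * K\<close>
  each, and the first three terms contribute at most \<open>3 * K\<close>; hence
  \<open>11 * K\<close>. The remaining sum of the \<open>F n\<close> is almost orthogonal.\<close>

lemma second_moment_coboundary_le:
  assumes qm: "\<And>n. (\<lambda>(x, y). q n x y) \<in> borel_measurable (\<mu> n \<Otimes>\<^sub>M \<mu> (Suc n))"
    and q: "\<And>n x y. 3 \<le> n \<Longrightarrow> q n x y = c n + h (Suc n) y - h n x + F n x y"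
    and q3: "\<And>n x y. n < 3 \<Longrightarrow> \<bar>q n x y\<bar> \<le> K" and h: "\<And>n x. \<bar>h n x\<bar> \<le> 4 * K"
    and Fm: "\<And>n. (\<lambda>(x, y). F n x y) \<in> borel_measurable (\<mu> n \<Otimes>\<^sub>M \<mu> (Suc n))" and FB: "\<And>n x y. \<bar>F n x y\<bar> \<le> B"
    and a: "\<And>n. 3 \<le> n \<Longrightarrow> 0 \<le> a n" "\<And>n. 3 \<le> n \<Longrightarrow> (\<integral>\<^sup>+x. \<integral>\<^sup>+y. ennreal (p n x y * (F n x y)\<^sup>2) \<partial>\<mu> (Suc n) \<partial>\<mu> n) \<le> ennreal (a n)"
  shows "\<exists>m. \<forall>N. integrable M (\<lambda>w. ((\<Sum>n<N. q n (X n w) (X (Suc n) w)) - m N)\<^sup>2) \<and>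
     expectation (\<lambda>w. ((\<Sum>n<N. q n (X n w) (X (Suc n) w)) - m N)\<^sup>2) \<le> 2 * (var_const * (\<Sum>n = 3..<N. a n)) + 2 * (11 * K)\<^sup>2"
proof -
  have Fr [measurable (raw)]: "(\<lambda>w. F n (g w) (h w)) \<in> borel_measurable L" if "g \<in> measurable L (\<mu> n)" "h \<in> measurable L (\<mu> (Suc n))" for n g h L
    using measurable_compose[OF measurable_Pair[OF that] Fm] by simp
  have qr [measurable (raw)]: "(\<lambda>w. q n (g w) (h w)) \<in> borel_measurable L" if "g \<in> measurable L (\<mu> n)" "h \<in> measurable L (\<mu> (Suc n))" for n g h L
    using measurable_compose[OF measurable_Pair[OF that] qm] by simp
  have B0: "0 \<le> B" using FB[of 0 undefined undefined] by linarith
  define mF where "mF n = expectation (\<lambda>w. F n (X n w) (X (Suc n) w))" for n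
  have mB: "\<bar>mF n\<bar> \<le> B" for n
  proof -
    have "\<bar>mF n\<bar> \<le> expectation (\<lambda>w. \<bar>F n (X n w) (X (Suc n) w)\<bar>)" unfolding mF_def by (rule integral_abs_bound)
    also have "\<dots> \<le> expectation (\<lambda>w. B)" using FB B0 by (intro integral_mono integrable_bounded[where B = B]) auto
    finally show ?thesis by (simp add: prob_space)
  qed
  define T where "T N w = (\<Sum>n = 3..<N. F n (X n w) (X (Suc n) w) - mF n)" for N w
  have [measurable]: "T N \<in> borel_measurable M" for N unfolding T_def by measurable
  have TB: "\<bar>T N w\<bar> \<le> real N * (2 * B)" for N w
  proof -
    have "\<bar>F n (X n w) (X (Suc n) w) - mF n\<bar> \<le> 2 * B" for n using FB[of n "X n w" "X (Suc n) w"] mB[of n] by linarith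
    then have "\<bar>T N w\<bar> \<le> real (card {3..<N}) * (2 * B)"
      unfolding T_def using sum_norm_bound[of "{3..<N}" "\<lambda>n. F n (X n w) (X (Suc n) w) - mF n" "2 * B"] by simp
    also have "\<dots> \<le> real N * (2 * B)" using B0 by (intro mult_right_mono) auto
    finally show ?thesis .
  qed
  have Tsq: "\<bar>(T N w)\<^sup>2\<bar> \<le> (real N * (2 * B))\<^sup>2" for N w using power_mono[OF TB[of N w] abs_ge_zero, of 2] by simp
  have Ti: "integrable M (\<lambda>w. (T N w)\<^sup>2)" for N by (rule integrable_bounded[where B = "(real N * (2 * B))\<^sup>2"]) (use Tsq in auto)
  define m where "m N = (\<Sum>n = 3..<N. c n + mF n)" for N
  define Q where "Q N w = (\<Sum>n<N. q n (X n w) (X (Suc n) w)) - m N" for N w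
  have [measurable]: "Q N \<in> borel_measurable M" for N unfolding Q_def by measurable
  have QT: "\<bar>Q N w - T N w\<bar> \<le> 11 * K" for N w
  proof (cases "3 \<le> N")
    case True
    have "(\<Sum>n<N. q n (X n w) (X (Suc n) w)) = (\<Sum>n<3. q n (X n w) (X (Suc n) w)) + (\<Sum>n = 3..<N. q n (X n w) (X (Suc n) w))"
      using sum.atLeastLessThan_concat[of 0 3 N "\<lambda>n. q n (X n w) (X (Suc n) w)"] True by (simp add: atLeast0LessThan)
    also have "(\<Sum>n = 3..<N. q n (X n w) (X (Suc n) w)) = (\<Sum>n = 3..<N. (c n + mF n) + (h (Suc n) (X (Suc n) w) - h n (X n w)) + (F n (X n w) (X (Suc n) w) - mF n))"
      by (intro sum.cong refl) (simp add: q)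
    also have "\<dots> = m N + (h N (X N w) - h 3 (X 3 w)) + T N w"
      unfolding sum.distrib m_def T_def using True by (subst sum_Suc_diff') (auto simp: sum.distrib)
    finally have "Q N w - T N w = (\<Sum>n<3. q n (X n w) (X (Suc n) w)) + (h N (X N w) - h 3 (X 3 w))" by (simp add: Q_def)
    moreover have "\<bar>\<Sum>n<3. q n (X n w) (X (Suc n) w)\<bar> \<le> 3 * K"
      using sum_norm_bound[of "{..<3::nat}" "\<lambda>n. q n (X n w) (X (Suc n) w)" K] q3 by simp
    ultimately show ?thesis using h[of N "X N w"] h[of 3 "X 3 w"] by linarith
  next
    case False
    then have "\<bar>\<Sum>n<N. q n (X n w) (X (Suc n) w)\<bar> \<le> real N * K"
      using sum_norm_bound[of "{..<N}" "\<lambda>n. q n (X n w) (X (Suc n) w)" K] q3 by simp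
    also have "\<dots> \<le> 3 * K" using False K_nonneg by (intro mult_right_mono) auto
    finally show ?thesis using False K_nonneg by (simp add: Q_def T_def m_def)
  qed
  have Qsq: "(Q N w)\<^sup>2 \<le> 2 * (T N w)\<^sup>2 + 2 * (11 * K)\<^sup>2" for N w
  proof -
    have "(Q N w - T N w)\<^sup>2 \<le> (11 * K)\<^sup>2" using power_mono[OF QT[of N w] abs_ge_zero, of 2] by simp
    moreover have "(Q N w)\<^sup>2 \<le> 2 * (T N w)\<^sup>2 + 2 * (Q N w - T N w)\<^sup>2"
      using zero_le_power2[of "Q N w - 2 * T N w"] by (simp add: power2_eq_square algebra_simps)
    ultimately show ?thesis by linarith
  qed
  have Qi: "integrable M (\<lambda>w. (Q N w)\<^sup>2)" for N
  proof (rule Bochner_Integration.integrable_bound)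
    show "integrable M (\<lambda>w. 2 * (T N w)\<^sup>2 + 2 * (11 * K)\<^sup>2)"
      by (rule Bochner_Integration.integrable_add[OF integrable_mult_right[OF Ti] integrable_const])
    show "AE w in M. norm ((Q N w)\<^sup>2) \<le> norm (2 * (T N w)\<^sup>2 + 2 * (11 * K)\<^sup>2)"
      using Qsq by (intro AE_I2) (simp only: real_norm_def abs_power2 abs_of_nonneg add_nonneg_nonneg mult_nonneg_nonneg zero_le_power2 zero_le_numeral)
  qed simp
  have "expectation (\<lambda>w. (Q N w)\<^sup>2) \<le> 2 * (var_const * (\<Sum>n = 3..<N. a n)) + 2 * (11 * K)\<^sup>2" for N
  proof -
    have "expectation (\<lambda>w. (Q N w)\<^sup>2) \<le> expectation (\<lambda>w. 2 * (T N w)\<^sup>2 + 2 * (11 * K)\<^sup>2)"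
      by (rule integral_mono[OF Qi Bochner_Integration.integrable_add[OF integrable_mult_right[OF Ti] integrable_const] Qsq])
    also have "\<dots> = 2 * expectation (\<lambda>w. (T N w)\<^sup>2) + 2 * (11 * K)\<^sup>2"
      by (subst Bochner_Integration.integral_add[OF integrable_mult_right[OF Ti] integrable_const]) (simp add: prob_space)
    also have "expectation (\<lambda>w. (T N w)\<^sup>2) \<le> var_const * (\<Sum>n = 3..<N. a n)"
      unfolding T_def mF_def by (rule second_moment_sum_le[OF Fm FB]) (use a in auto)
    finally show ?thesis by simp
  qed
  with Qi show ?thesis unfolding Q_def by blast
qed

text \<open>The remainder in the coboundary decomposition is bounded by
  \<open>K + 4 * K + 4 * K + K\<close>. Multiplied by \<open>r0\<close> it is at most 1, where
  \<open>1 - cos\<close> is comparable with the square. The 1 in the denominator covers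
  \<open>K = 0\<close>.\<close>

definition r0 :: real where "r0 = 1 / (10 * K + 1)"

lemma r0: "0 < r0" "r0 * (10 * K) \<le> 1" "r0 * (6 * K) \<le> 1"
  using K_nonneg by (auto simp: r0_def field_simps)

text \<open>At the frequency \<open>r0\<close> the gap of the remainder dominates its square, so the
  decomposition leaves a coboundary, constants and a remainder whose second moments are bounded by
  the slacks.\<close>

lemma variance_le_D: "\<exists>C>0. \<forall>N. variance (S N) \<le> C * (D N r0 + 1)"
proof -
  obtain h c where hc: "\<And>n. h n \<in> borel_measurable (\<mu> n)" "\<And>n y. \<bar>h n y\<bar> \<le> 4 * K" "\<And>n. \<bar>c n\<bar> \<le> K"
    and dec: "\<And>n. 3 \<le> n \<Longrightarrow> (\<integral>\<^sup>+x. \<integral>\<^sup>+y. ennreal (p n x y * gap r0 (f n x y + h n x - h (Suc n) y - c n)) \<partial>\<mu> (Suc n) \<partial>\<mu> n)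
        \<le> ennreal (const_dec * (slack r0 (n - 3) + slack r0 (n - 2)))"
    using coboundary_decomposition[of r0] by blast
  have [measurable]: "h n \<in> borel_measurable (\<mu> n)" for n by (rule hc)
  define F where "F n x y = f n x y + h n x - h (Suc n) y - c n" for n x y
  have FB: "\<bar>F n x y\<bar> \<le> 10 * K" for n x y
    unfolding F_def using f_le[of n x y] hc(2)[of n x] hc(2)[of "Suc n" y] hc(3)[of n] by linarith
  define A where "A = 4 / r0\<^sup>2 * const_dec"
  have A0: "0 \<le> A" using const_dec_nonneg r0(1) by (simp add: A_def)
  define a where "a n = A * (slack r0 (n - 3) + slack r0 (n - 2))" for n
  have a: "(\<integral>\<^sup>+x. \<integral>\<^sup>+y. ennreal (p n x y * (F n x y)\<^sup>2) \<partial>\<mu> (Suc n) \<partial>\<mu> n) \<le> ennreal (a n)" if "3 \<le> n" for n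
  proof -
    have "(\<integral>\<^sup>+x. \<integral>\<^sup>+y. ennreal (p n x y * (F n x y)\<^sup>2) \<partial>\<mu> (Suc n) \<partial>\<mu> n) \<le> (\<integral>\<^sup>+x. \<integral>\<^sup>+y. ennreal (4 / r0\<^sup>2) * ennreal (p n x y * gap r0 (F n x y)) \<partial>\<mu> (Suc n) \<partial>\<mu> n)"
    proof (intro nn_integral_mono)
      fix x y
      have "\<bar>r0 * F n x y\<bar> \<le> 1"
        unfolding abs_mult abs_of_pos[OF r0(1)]
        by (rule order_trans[OF mult_left_mono[OF FB less_imp_le[OF r0(1)]] r0(2)])
      then have "(r0 * F n x y)\<^sup>2 / 4 \<le> gap r0 (F n x y)" unfolding gap_def by (rule one_minus_cos_ge_quarter)
      then have "(F n x y)\<^sup>2 \<le> 4 / r0\<^sup>2 * gap r0 (F n x y)" using r0(1) by (simp add: power_mult_distrib field_simps)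
      then have "p n x y * (F n x y)\<^sup>2 \<le> 4 / r0\<^sup>2 * (p n x y * gap r0 (F n x y))"
        using mult_left_mono[OF _ p_nonneg[of n x y]] by (metis mult.left_commute)
      then show "ennreal (p n x y * (F n x y)\<^sup>2) \<le> ennreal (4 / r0\<^sup>2) * ennreal (p n x y * gap r0 (F n x y))"
        by (subst ennreal_mult'[symmetric]) (auto intro: ennreal_leI)
    qed
    also have "\<dots> = ennreal (4 / r0\<^sup>2) * (\<integral>\<^sup>+x. \<integral>\<^sup>+y. ennreal (p n x y * gap r0 (F n x y)) \<partial>\<mu> (Suc n) \<partial>\<mu> n)"
      unfolding F_def by (simp add: nn_integral_cmult)
    also have "\<dots> \<le> ennreal (4 / r0\<^sup>2) * ennreal (const_dec * (slack r0 (n - 3) + slack r0 (n - 2)))"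
      unfolding F_def by (intro mult_left_mono dec that) simp
    also have "\<dots> = ennreal (a n)" unfolding a_def A_def by (subst ennreal_mult'[symmetric]) (simp_all add: mult.assoc)
    finally show ?thesis .
  qed
  have a0: "0 \<le> a n" for n unfolding a_def using A0 slack_pos by (intro mult_nonneg_nonneg add_nonneg_nonneg) (auto intro: less_imp_le)
  have "\<exists>m. \<forall>N. integrable M (\<lambda>w. ((\<Sum>n<N. f n (X n w) (X (Suc n) w)) - m N)\<^sup>2) \<and>
     expectation (\<lambda>w. ((\<Sum>n<N. f n (X n w) (X (Suc n) w)) - m N)\<^sup>2) \<le> 2 * (var_const * (\<Sum>n = 3..<N. a n)) + 2 * (11 * K)\<^sup>2"
    by (rule second_moment_coboundary_le[where F = F and h = h and c = c and B = "10 * K"])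
       (use f_le hc FB a a0 in \<open>auto simp: F_def f_pair\<close>)
  then obtain m where m: "\<And>N. expectation (\<lambda>w. (S N w - m N)\<^sup>2) \<le> 2 * (var_const * (\<Sum>n = 3..<N. a n)) + 2 * (11 * K)\<^sup>2"
    unfolding S_def[symmetric] by blast
  let ?C = "2 * (var_const * (A * (2 * 2))) + 2 * (11 * K)\<^sup>2 + 1"
  have "variance (S N) \<le> ?C * (D N r0 + 1)" for N
  proof -
    have "variance (S N) \<le> expectation (\<lambda>w. (S N w - m N)\<^sup>2)" by (rule variance_le_second_moment[OF S_measurable abs_S_le])
    also have "\<dots> \<le> 2 * (var_const * (\<Sum>n = 3..<N. a n)) + 2 * (11 * K)\<^sup>2" by (rule m)
    also have "(\<Sum>n = 3..<N. a n) \<le> A * (2 * (D N r0 + 2))"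
    proof -
      have "(\<Sum>n = 3..<N. a n) = A * (\<Sum>n = 3..<N. slack r0 (n - 3) + slack r0 (n - 2))" unfolding a_def sum_distrib_left ..
      also have "\<dots> \<le> A * (2 * (\<Sum>n<N. slack r0 n))" by (intro mult_left_mono slack_shift_sum A0)
      also have "\<dots> \<le> A * (2 * (D N r0 + 2))" by (intro mult_left_mono D_bounded_slack order_refl A0) simp
      finally show ?thesis .
    qed
    also have "2 * (var_const * (A * (2 * (D N r0 + 2)))) + 2 * (11 * K)\<^sup>2 \<le> 2 * (var_const * (A * (2 * 2 * (D N r0 + 1)))) + (2 * (11 * K)\<^sup>2 + 1) * (D N r0 + 1)"
    proof (intro add_mono mult_left_mono var_const_nonneg A0)
      have "2 * (11 * K)\<^sup>2 * 1 \<le> (2 * (11 * K)\<^sup>2 + 1) * (D N r0 + 1)" using D_nonneg[of N r0] by (intro mult_mono) auto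
      then show "2 * (11 * K)\<^sup>2 \<le> (2 * (11 * K)\<^sup>2 + 1) * (D N r0 + 1)" by simp
    qed (use D_nonneg[of N r0] in auto)
    also have "\<dots> = ?C * (D N r0 + 1)" by (simp add: algebra_simps)
    finally show ?thesis using var_const_nonneg by (simp add: mult_left_mono)
  qed
  moreover have "0 < ?C" using var_const_nonneg A0 by (intro add_nonneg_pos add_nonneg_nonneg) auto
  ultimately show ?thesis by blast
qed

lemma D_low: "\<exists>c1>0. \<exists>C1. \<forall>N t. \<bar>t\<bar> \<le> r0 \<longrightarrow> c1 * t\<^sup>2 * variance (S N) - C1 \<le> D N t"
proof -
  obtain C where C: "0 < C" "\<And>N. variance (S N) \<le> C * (D N r0 + 1)" using variance_le_D by blast
  have "1 / (2 * r0\<^sup>2 * C) * t\<^sup>2 * variance (S N) - 1 / 2 \<le> D N t" if t: "\<bar>t\<bar> \<le> r0" for N t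
  proof -
    have "t\<^sup>2 \<le> r0\<^sup>2" using power_mono[OF t abs_ge_zero, of 2] by simp
    then have h: "t\<^sup>2 / (2 * r0\<^sup>2) \<le> 1 / 2" using r0(1) by (simp add: field_simps)
    have "1 / (2 * r0\<^sup>2 * C) * t\<^sup>2 * variance (S N) \<le> 1 / (2 * r0\<^sup>2 * C) * t\<^sup>2 * (C * (D N r0 + 1))"
      using C r0(1) by (intro mult_left_mono C(2)) auto
    also have "\<dots> = t\<^sup>2 / (2 * r0\<^sup>2) * D N r0 + t\<^sup>2 / (2 * r0\<^sup>2)" using C r0(1) by (simp add: field_simps)
    also have "\<dots> \<le> D N t + 1 / 2" by (intro add_mono D_small_le r0 t h)
    finally show ?thesis by simp
  qed
  moreover have "0 < 1 / (2 * r0\<^sup>2 * C)" using C r0(1) by simp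
  ultimately show ?thesis by blast
qed

section \<open>Tightness and reduction to a lattice\<close>

definition tight :: "(nat \<Rightarrow> 'a \<Rightarrow> 'a \<Rightarrow> real) \<Rightarrow> bool" where
  "tight q \<longleftrightarrow> (\<exists>m. \<forall>\<epsilon>>0. \<exists>A. \<forall>N. prob {w \<in> space M. \<bar>(\<Sum>n<N. q n (X n w) (X (Suc n) w)) - m N\<bar> > A} < \<epsilon>)"

lemma tightI_second_moment:
  assumes qm: "\<And>n. (\<lambda>(x, y). q n x y) \<in> borel_measurable (\<mu> n \<Otimes>\<^sub>M \<mu> (Suc n))"
    and i: "\<And>N. integrable M (\<lambda>w. ((\<Sum>n<N. q n (X n w) (X (Suc n) w)) - m N)\<^sup>2)"
    and b: "\<And>N. expectation (\<lambda>w. ((\<Sum>n<N. q n (X n w) (X (Suc n) w)) - m N)\<^sup>2) \<le> Z"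
  shows "tight q"
  unfolding tight_def
proof (intro exI[of _ m] allI impI)
  fix \<epsilon> :: real assume "0 < \<epsilon>"
  have qr [measurable (raw)]: "(\<lambda>w. q n (g w) (h w)) \<in> borel_measurable L" if "g \<in> measurable L (\<mu> n)" "h \<in> measurable L (\<mu> (Suc n))" for n g h L
    using measurable_compose[OF measurable_Pair[OF that] qm] by simp
  have Z0: "0 \<le> Z" using b[of 0] by (rule order_trans[rotated]) simp
  define A where "A = sqrt ((Z + 1) / \<epsilon>)"
  have A: "0 < A" "A\<^sup>2 = (Z + 1) / \<epsilon>" using Z0 \<open>0 < \<epsilon>\<close> by (auto simp: A_def)
  show "\<exists>A. \<forall>N. prob {w \<in> space M. \<bar>(\<Sum>n<N. q n (X n w) (X (Suc n) w)) - m N\<bar> > A} < \<epsilon>"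
  proof (intro exI[of _ A] allI)
    fix N
    let ?Q = "\<lambda>w. (\<Sum>n<N. q n (X n w) (X (Suc n) w)) - m N"
    have "prob {w \<in> space M. \<bar>?Q w\<bar> > A} \<le> prob {w \<in> space M. A \<le> \<bar>?Q w\<bar>}" by (intro finite_measure_mono) auto
    also have "\<dots> \<le> expectation (\<lambda>w. (?Q w)\<^sup>2) / A\<^sup>2" by (rule second_moment_method[OF _ i A(1)]) simp
    also have "\<dots> \<le> Z / A\<^sup>2" by (intro divide_right_mono b) simp
    also have "\<dots> < \<epsilon>" using Z0 \<open>0 < \<epsilon>\<close> unfolding A(2) by (simp add: field_simps)
    finally show "prob {w \<in> space M. \<bar>?Q w\<bar> > A} < \<epsilon>" .
  qed
qed

lemma tight_if_D_bounded:
  assumes "bdd_above (range (\<lambda>N. D N r0))"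
  shows "tight f"
proof -
  obtain C where C: "0 < C" "\<And>N. variance (S N) \<le> C * (D N r0 + 1)" using variance_le_D by blast
  obtain Z where Z: "\<And>N. D N r0 \<le> Z" using assms by (auto simp: bdd_above_def)
  have B: "\<bar>(S N w - expectation (S N))\<^sup>2\<bar> \<le> (real N * K + \<bar>expectation (S N)\<bar>)\<^sup>2" for N w
  proof -
    have "\<bar>S N w - expectation (S N)\<bar> \<le> real N * K + \<bar>expectation (S N)\<bar>" using abs_S_le[of N w] by linarith
    from power_mono[OF this abs_ge_zero, of 2] show ?thesis by simp
  qed
  show ?thesis
  proof (rule tightI_second_moment[OF f_pair, where m = "\<lambda>N. expectation (S N)" and Z = "C * (Z + 1)"], unfold S_def[symmetric])
    show "integrable M (\<lambda>w. (S N w - expectation (S N))\<^sup>2)" for N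
      by (rule integrable_bounded[where B = "(real N * K + \<bar>expectation (S N)\<bar>)\<^sup>2"]) (use B in auto)
    show "variance (S N) \<le> C * (Z + 1)" for N
      by (rule order_trans[OF C(2)]) (use C(1) Z[of N] in auto)
  qed
qed

text \<open>If the structure constants at \<open>t\<close> are summable, subtracting the part of the
  coboundary decomposition with values in the lattice leaves a tight functional.\<close>

lemma lattice_reduction:
  assumes t: "t \<noteq> 0" and bdd: "bdd_above (range (\<lambda>N. D N t))"
  shows "\<exists>g c. (\<forall>n. (\<lambda>(x, y). g n x y) \<in> borel_measurable (\<mu> n \<Otimes>\<^sub>M \<mu> (Suc n))) \<and>
    (\<forall>n x y. \<exists>k :: int. g n x y - c n = of_int k * (2 * pi / \<bar>t\<bar>)) \<and> tight (\<lambda>n x y. f n x y - g n x y)"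
proof -
  obtain h c where hc: "\<And>n. h n \<in> borel_measurable (\<mu> n)" "\<And>n y. \<bar>h n y\<bar> \<le> 4 * K" "\<And>n. \<bar>c n\<bar> \<le> K"
    and dec: "\<And>n. 3 \<le> n \<Longrightarrow> (\<integral>\<^sup>+x. \<integral>\<^sup>+y. ennreal (p n x y * gap t (f n x y + h n x - h (Suc n) y - c n)) \<partial>\<mu> (Suc n) \<partial>\<mu> n)
        \<le> ennreal (const_dec * (slack t (n - 3) + slack t (n - 2)))"
    using coboundary_decomposition[of t] by blast
  have [measurable]: "h n \<in> borel_measurable (\<mu> n)" for n by (rule hc)
  obtain Z where Z: "\<And>N. D N t \<le> Z" using bdd by (auto simp: bdd_above_def)
  define l where "l = 2 * pi / \<bar>t\<bar>"
  have l: "0 < l" using t by (simp add: l_def)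
  define u where "u n x y = f n x y + h n x - h (Suc n) y - c n" for n x y
  \<comment> \<open>\<open>R\<close> rounds to the nearest multiple of \<open>2 * pi / |t|\<close>.
    The gap at \<open>t\<close> does not notice this, and after multiplication by \<open>t\<close>
    the remainder lies in the range of \<open>one_minus_cos_ge\<close>.\<close>
  define R where "R s = l * of_int \<lfloor>s / l + 1 / 2\<rfloor>" for s
  have [measurable]: "R \<in> borel_measurable borel" unfolding R_def by measurable
  have R: "\<bar>s - R s\<bar> \<le> pi / \<bar>t\<bar>" "gap t (s - R s) = gap t s" for s
  proof -
    let ?k = "\<lfloor>s / l + 1 / 2\<rfloor>"
    have "of_int ?k \<le> s / l + 1 / 2" "s / l + 1 / 2 \<le> of_int ?k + 1" by linarith+
    then have "l * of_int ?k \<le> l * (s / l + 1 / 2)" "l * (s / l + 1 / 2) \<le> l * (of_int ?k + 1)"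
      using l by (intro mult_left_mono; simp)+
    then have "R s \<le> s + l / 2" "s + l / 2 \<le> R s + l" using l by (simp_all add: R_def algebra_simps)
    then have "\<bar>s - R s\<bar> \<le> l / 2" by linarith
    then show "\<bar>s - R s\<bar> \<le> pi / \<bar>t\<bar>" by (simp add: l_def)
    obtain j :: int where j: "t * R s = 2 * pi * of_int j"
    proof (cases "0 < t")
      case True
      then show ?thesis by (intro that[of ?k]) (simp add: R_def l_def)
    next
      case False
      then show ?thesis using t by (intro that[of "- ?k"]) (simp add: R_def l_def)
    qed
    have "cos (t * (s - R s)) = cos (t * s)"
      unfolding right_diff_distrib j cos_diff by simp
    then show "gap t (s - R s) = gap t s" by (simp add: gap_def)
  qed
  define F where "F n x y = u n x y - R (u n x y)" for n x y
  have FB: "\<bar>F n x y\<bar> \<le> pi / \<bar>t\<bar>" for n x y unfolding F_def by (rule R)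
  \<comment> \<open>The potential is left out of \<open>g\<close> and stays in the difference from
    \<open>f\<close>, where it telescopes. Below level 3, where the decomposition gives no estimate,
    \<open>g\<close> is 0 and the bound on \<open>f\<close> suffices.\<close>
  define g where "g n x y = (if n < 3 then 0 else c n + R (u n x y))" for n x y
  define c' where "c' n = (if n < 3 then 0 else c n)" for n
  define a where "a n = 64 / t\<^sup>2 * (const_dec * (slack t (n - 3) + slack t (n - 2)))" for n
  have Fsq: "(F n x y)\<^sup>2 \<le> 64 / t\<^sup>2 * gap t (u n x y)" for n x y
  proof -
    have "\<bar>t * F n x y\<bar> \<le> \<bar>t\<bar> * (pi / \<bar>t\<bar>)" unfolding abs_mult by (intro mult_left_mono FB) simp
    also have "\<bar>t\<bar> * (pi / \<bar>t\<bar>) = pi" using t by simp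
    finally have "(t * F n x y)\<^sup>2 / 64 \<le> 1 - cos (t * F n x y)" by (rule one_minus_cos_ge)
    then have "(t * F n x y)\<^sup>2 / 64 \<le> gap t (u n x y)" using R(2)[of "u n x y"] by (simp add: gap_def F_def)
    then show ?thesis using t by (simp add: power_mult_distrib field_simps)
  qed
  have Fm: "(\<lambda>(x, y). F n x y) \<in> borel_measurable (\<mu> n \<Otimes>\<^sub>M \<mu> (Suc n))" for n unfolding F_def u_def by measurable
  have gm: "(\<lambda>(x, y). g n x y) \<in> borel_measurable (\<mu> n \<Otimes>\<^sub>M \<mu> (Suc n))" for n unfolding g_def u_def by measurable
  have qm: "(\<lambda>(x, y). f n x y - g n x y) \<in> borel_measurable (\<mu> n \<Otimes>\<^sub>M \<mu> (Suc n))" for n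
    using borel_measurable_diff[OF f_pair gm, of n] by (simp add: case_prod_unfold)
  have a: "(\<integral>\<^sup>+x. \<integral>\<^sup>+y. ennreal (p n x y * (F n x y)\<^sup>2) \<partial>\<mu> (Suc n) \<partial>\<mu> n) \<le> ennreal (a n)" if "3 \<le> n" for n
  proof -
    have "(\<integral>\<^sup>+x. \<integral>\<^sup>+y. ennreal (p n x y * (F n x y)\<^sup>2) \<partial>\<mu> (Suc n) \<partial>\<mu> n) \<le> (\<integral>\<^sup>+x. \<integral>\<^sup>+y. ennreal (64 / t\<^sup>2) * ennreal (p n x y * gap t (u n x y)) \<partial>\<mu> (Suc n) \<partial>\<mu> n)"
    proof (intro nn_integral_mono)
      fix x y
      have "p n x y * (F n x y)\<^sup>2 \<le> 64 / t\<^sup>2 * (p n x y * gap t (u n x y))"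
        using mult_left_mono[OF Fsq[of n x y] p_nonneg[of n x y]] by (simp only: mult.left_commute)
      then show "ennreal (p n x y * (F n x y)\<^sup>2) \<le> ennreal (64 / t\<^sup>2) * ennreal (p n x y * gap t (u n x y))"
        by (subst ennreal_mult'[symmetric]) (auto intro: ennreal_leI)
    qed
    also have "\<dots> = ennreal (64 / t\<^sup>2) * (\<integral>\<^sup>+x. \<integral>\<^sup>+y. ennreal (p n x y * gap t (u n x y)) \<partial>\<mu> (Suc n) \<partial>\<mu> n)"
      unfolding u_def by (simp add: nn_integral_cmult)
    also have "\<dots> \<le> ennreal (64 / t\<^sup>2) * ennreal (const_dec * (slack t (n - 3) + slack t (n - 2)))"
      unfolding u_def by (intro mult_left_mono dec that) simp
    also have "\<dots> = ennreal (a n)" unfolding a_def by (subst ennreal_mult'[symmetric]) simp_all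
    finally show ?thesis .
  qed
  have a0: "0 \<le> a n" for n
    unfolding a_def using const_dec_nonneg slack_pos by (intro mult_nonneg_nonneg add_nonneg_nonneg divide_nonneg_nonneg) (auto intro: less_imp_le)
  have "\<exists>m. \<forall>N. integrable M (\<lambda>w. ((\<Sum>n<N. f n (X n w) (X (Suc n) w) - g n (X n w) (X (Suc n) w)) - m N)\<^sup>2) \<and>
     expectation (\<lambda>w. ((\<Sum>n<N. f n (X n w) (X (Suc n) w) - g n (X n w) (X (Suc n) w)) - m N)\<^sup>2) \<le> 2 * (var_const * (\<Sum>n = 3..<N. a n)) + 2 * (11 * K)\<^sup>2"
    by (rule second_moment_coboundary_le[where q = "\<lambda>n x y. f n x y - g n x y" and F = F and h = h and c = "\<lambda>_. 0" and B = "pi / \<bar>t\<bar>", OF qm _ _ hc(2) Fm FB a0 a])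
       (use f_le in \<open>auto simp: F_def g_def u_def\<close>)
  then obtain m where m: "\<And>N. integrable M (\<lambda>w. ((\<Sum>n<N. f n (X n w) (X (Suc n) w) - g n (X n w) (X (Suc n) w)) - m N)\<^sup>2)"
     "\<And>N. expectation (\<lambda>w. ((\<Sum>n<N. f n (X n w) (X (Suc n) w) - g n (X n w) (X (Suc n) w)) - m N)\<^sup>2) \<le> 2 * (var_const * (\<Sum>n = 3..<N. a n)) + 2 * (11 * K)\<^sup>2"
    by blast
  have "(\<Sum>n = 3..<N. a n) \<le> 64 / t\<^sup>2 * (const_dec * (2 * (Z + 2)))" for N
  proof -
    have "(\<Sum>n = 3..<N. a n) = 64 / t\<^sup>2 * (const_dec * (\<Sum>n = 3..<N. slack t (n - 3) + slack t (n - 2)))"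
      unfolding a_def sum_distrib_left ..
    also have "\<dots> \<le> 64 / t\<^sup>2 * (const_dec * (2 * (\<Sum>n<N. slack t n)))"
      by (intro mult_left_mono slack_shift_sum const_dec_nonneg) simp
    also have "\<dots> \<le> 64 / t\<^sup>2 * (const_dec * (2 * (Z + 2)))"
      by (intro mult_left_mono D_bounded_slack const_dec_nonneg Z) simp_all
    finally show ?thesis .
  qed
  then have "tight (\<lambda>n x y. f n x y - g n x y)"
    by (intro tightI_second_moment[OF qm m(1), where Z = "2 * (var_const * (64 / t\<^sup>2 * (const_dec * (2 * (Z + 2))))) + 2 * (11 * K)\<^sup>2"] order_trans[OF m(2)] add_right_mono mult_left_mono var_const_nonneg) auto
  moreover have "\<exists>k :: int. g n x y - c' n = of_int k * (2 * pi / \<bar>t\<bar>)" for n x y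
  proof (cases "n < 3")
    case True
    then show ?thesis by (intro exI[of _ 0]) (simp add: g_def c'_def)
  next
    case False
    then show ?thesis by (intro exI[of _ "\<lfloor>u n x y / l + 1 / 2\<rfloor>"]) (simp add: g_def c'_def R_def l_def)
  qed
  ultimately show ?thesis using gm by blast
qed

end

section \<open>Local limit theorem\<close>

context functional_process
begin

lemma norm_integral_le_const:
  fixes g :: "'w \<Rightarrow> 'b :: {banach, second_countable_topology}"
  assumes [measurable]: "g \<in> borel_measurable M" and g: "\<And>w. norm (g w) \<le> B"
  shows "norm (\<integral>w. g w \<partial>M) \<le> B"
proof -
  have i: "integrable M g" by (rule integrable_bounded[where B = B]) (use g in auto)
  have "norm (\<integral>w. g w \<partial>M) \<le> (\<integral>w. norm (g w) \<partial>M)" by (rule integral_norm_bound)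
  also have "\<dots> \<le> (\<integral>w. B \<partial>M)" by (rule integral_mono) (use g i in auto)
  finally show ?thesis by (simp add: prob_space)
qed

text \<open>The factor \<open>Y\<close> may depend on the states up to time 2; it will carry a
  correction of the first two summands. The decay then comes from time 2 onwards, and 28 is
  \<open>2 * (n + 12)\<close> at \<open>n = 2\<close> in \<open>norm_U_le_D\<close>. For shorter
  sums the right-hand side is at least 1.\<close>

lemma norm_char_S_le:
  assumes Y: "Y \<in> borel_measurable (Fil 2)" "\<And>w. cmod (Y w) \<le> 1"
  shows "cmod (\<integral>w. Y w * cis (t * S N w) \<partial>M) \<le> exp (e\<^sup>2 / 10 * (28 / e ^ 6)) * exp (- (e\<^sup>2 / 10) * D N t)"
proof (cases "2 \<le> N")
  case True
  define k where "k = N - 2"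
  have N: "N = 2 + k" using True by (simp add: k_def)
  have [measurable]: "Y \<in> borel_measurable (Fil 2)" by (rule Y)
  have Fm: "X n \<in> measurable (Fil 2) (\<mu> n)" if "n \<le> 2" for n
    using Fil_measurable_add[OF X_Fil[of n], of "2 - n"] that by simp
  have [measurable]: "X 0 \<in> measurable (Fil 2) (\<mu> 0)" "X (Suc 0) \<in> measurable (Fil 2) (\<mu> (Suc 0))"
    "X (Suc (Suc 0)) \<in> measurable (Fil 2) (\<mu> (Suc (Suc 0)))"
    by (auto intro!: Fm)
  have S2: "S 2 w = f 0 (X 0 w) (X (Suc 0) w) + f (Suc 0) (X (Suc 0) w) (X (Suc (Suc 0)) w)" for w
    by (simp add: S_def numeral_2_eq_2)
  have SN: "S N w = S 2 w + (\<Sum>j<k. f (2 + j) (X (2 + j) w) (X (Suc (2 + j)) w))" for w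
    unfolding S_def N by (induction k) (simp_all add: add.assoc)
  let ?Y = "\<lambda>w. Y w * cis (t * S 2 w)"
  have Ym: "?Y \<in> borel_measurable (Fil 2)" unfolding S2 by measurable
  have Yb: "cmod (?Y w) \<le> 1" for w using Y(2) by (simp add: norm_mult)
  have "(\<integral>w. Y w * cis (t * S N w) \<partial>M) = (\<integral>w. ?Y w * cis (t * (\<Sum>j<k. f (2 + j) (X (2 + j) w) (X (Suc (2 + j)) w))) \<partial>M)"
    unfolding SN by (simp add: distrib_left cis_mult[symmetric] mult.assoc)
  also have "\<dots> = (\<integral>w. ?Y w * U t k 2 (X 2 w) \<partial>M)" by (rule char_eq_U[OF Ym Yb])
  finally have eq: "(\<integral>w. Y w * cis (t * S N w) \<partial>M) = (\<integral>w. ?Y w * U t k 2 (X 2 w) \<partial>M)" .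
  let ?B = "exp (e\<^sup>2 / 10 * (28 / e ^ 6)) * exp (- (e\<^sup>2 / 10) * D N t)"
  have le: "cmod (?Y w * U t k 2 (X 2 w)) \<le> ?B" for w
  proof -
    have "cmod (?Y w * U t k 2 (X 2 w)) \<le> 1 * cmod (U t k 2 (X 2 w))"
      unfolding norm_mult[of "?Y w"] by (intro mult_right_mono Yb) auto
    also have "\<dots> \<le> ?B" using norm_U_le_D[of t k 2 "X 2 w"] by (simp add: N)
    finally show ?thesis .
  qed
  have [measurable]: "Y \<in> borel_measurable M" by (rule Fil_measurable_M[OF Y(1)])
  show ?thesis
    unfolding eq by (rule norm_integral_le_const[OF _ le]) measurable
next
  case False
  have "D N t \<le> N * (2 / e ^ 6)"
    unfolding D_def using sum_mono[of "{..<N}" "\<lambda>i. d2 i t" "\<lambda>i. 2 / e ^ 6", OF d2_le] by simp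
  also have "\<dots> \<le> 14 * (2 / e ^ 6)" using False e by (intro mult_right_mono) auto
  finally have "0 \<le> e\<^sup>2 / 10 * (28 / e ^ 6 - D N t)" using e by (intro mult_nonneg_nonneg) auto
  then have *: "1 \<le> exp (e\<^sup>2 / 10 * (28 / e ^ 6)) * exp (- (e\<^sup>2 / 10) * D N t)"
    by (simp add: mult_exp_exp right_diff_distrib)
  have [measurable]: "Y \<in> borel_measurable M" by (rule Fil_measurable_M[OF Y(1)])
  have "cmod (\<integral>w. Y w * cis (t * S N w) \<partial>M) \<le> 1"
    by (rule norm_integral_le_const) (use Y(2) in \<open>auto simp: norm_mult\<close>)
  then show ?thesis using * by linarith
qed

text \<open>At a small fixed frequency \<open>\<xi>\<close> the modulus of the characteristic
  function is at least \<open>1 - \<xi>^2 / 2\<close> times the variance, but it decays as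
  \<open>D\<close> grows. Once it is below 1/2 the variance is at least \<open>1 / \<xi>^2\<close>,
  and \<open>\<xi>\<close> was chosen to make this exceed \<open>Z\<close>.\<close>

lemma variance_S_at_top:
  assumes "\<not> bdd_above (range (\<lambda>N. D N r0))"
  shows "filterlim (\<lambda>N. variance (S N)) at_top sequentially"
proof -
  have Dtop: "filterlim (\<lambda>N. D N r0) at_top sequentially"
    unfolding filterlim_at_top
  proof
    fix Z
    obtain N0 where "Z < D N0 r0" using assms by (auto simp: bdd_above_def not_le)
    then show "\<forall>\<^sub>F N in sequentially. Z \<le> D N r0"
      using lift_Suc_mono_le[of "\<lambda>N. D N r0", OF D_mono] by (intro eventually_sequentiallyI[of N0]) (metis less_imp_le order_trans)
  qed
  define C where "C = exp (e\<^sup>2 / 10 * (28 / e ^ 6))"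
  show ?thesis
    unfolding filterlim_at_top
  proof
    fix Z :: real
    define \<xi> where "\<xi> = min r0 (1 / sqrt (\<bar>Z\<bar> + 1))"
    have xi: "0 < \<xi>" "\<bar>\<xi>\<bar> \<le> r0" "\<xi> \<le> 1 / sqrt (\<bar>Z\<bar> + 1)" using r0(1) by (auto simp: \<xi>_def)
    have xiZ: "\<xi>\<^sup>2 * (\<bar>Z\<bar> + 1) \<le> 1"
    proof -
      have "\<xi>\<^sup>2 \<le> (1 / sqrt (\<bar>Z\<bar> + 1))\<^sup>2" using xi by (intro power_mono) auto
      then show ?thesis by (simp add: power_divide field_simps)
    qed
    have "filterlim (\<lambda>N. e\<^sup>2 / 10 * (\<xi>\<^sup>2 / (2 * r0\<^sup>2)) * D N r0) at_top sequentially"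
      using e xi r0(1) by (intro filterlim_tendsto_pos_mult_at_top[OF tendsto_const _ Dtop]) auto
    then have "\<forall>\<^sub>F N in sequentially. ln (2 * C) + 1 \<le> e\<^sup>2 / 10 * (\<xi>\<^sup>2 / (2 * r0\<^sup>2)) * D N r0"
      unfolding filterlim_at_top by blast
    then show "\<forall>\<^sub>F N in sequentially. Z \<le> variance (S N)"
    proof eventually_elim
      case (elim N)
      let ?E = "expectation (S N)" and ?V = "variance (S N)"
      have Sint: "integrable M (S N)" by (rule integrable_bounded[where B = "N * K"]) (auto simp: abs_S_le)
      have Sb: "\<bar>S N w - ?E\<bar> \<le> 2 * (N * K)" for w
      proof -
        have "\<bar>?E\<bar> \<le> N * K"
          unfolding expectation_S by (rule order_trans[OF sum_abs]) (use sum_mono[of "{..<N}" "\<lambda>n. \<bar>en n\<bar>" "\<lambda>n. K", OF abs_en_le] in simp)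
        then show ?thesis using abs_S_le[of N w] by linarith
      qed
      have int2: "integrable M (\<lambda>w. (S N w - ?E)\<^sup>2)"
      proof (rule integrable_bounded[where B = "(2 * (N * K))\<^sup>2"])
        show "norm ((S N w - ?E)\<^sup>2) \<le> (2 * (N * K))\<^sup>2" for w using power_mono[OF Sb, of w 2] by simp
      qed simp
      have intc: "integrable M (\<lambda>w. cis (\<xi> * (S N w - ?E)))"
        by (rule integrable_bounded[where B = 1]) auto
      have "1 - \<xi>\<^sup>2 / 2 * ?V = (\<integral>w. 1 - \<xi>\<^sup>2 / 2 * (S N w - ?E)\<^sup>2 \<partial>M)"
        using int2 by (simp add: prob_space)
      also have "\<dots> \<le> (\<integral>w. Re (cis (\<xi> * (S N w - ?E))) \<partial>M)"
      proof (rule integral_mono)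
        show "integrable M (\<lambda>w. 1 - \<xi>\<^sup>2 / 2 * (S N w - ?E)\<^sup>2)" using int2 by simp
        show "integrable M (\<lambda>w. Re (cis (\<xi> * (S N w - ?E))))" using intc by (rule integrable_Re)
        fix w
        show "1 - \<xi>\<^sup>2 / 2 * (S N w - ?E)\<^sup>2 \<le> Re (cis (\<xi> * (S N w - ?E)))"
          using one_minus_cos_le[of "\<xi> * (S N w - ?E)"] by (simp add: power_mult_distrib)
      qed
      also have "\<dots> = Re (\<integral>w. cis (\<xi> * (S N w - ?E)) \<partial>M)" using intc by (rule integral_Re)
      also have "\<dots> \<le> cmod (\<integral>w. cis (\<xi> * (S N w - ?E)) \<partial>M)" by (rule complex_Re_le_cmod)
      also have "(\<integral>w. cis (\<xi> * (S N w - ?E)) \<partial>M) = cis (- (\<xi> * ?E)) * (\<integral>w. 1 * cis (\<xi> * S N w) \<partial>M)"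
        by (subst integral_mult_right_zero[symmetric]) (simp add: cis_mult algebra_simps)
      also have "cmod \<dots> = cmod (\<integral>w. 1 * cis (\<xi> * S N w) \<partial>M)" by (simp add: norm_mult)
      also have "\<dots> \<le> C * exp (- (e\<^sup>2 / 10) * D N \<xi>)" unfolding C_def by (rule norm_char_S_le) auto
      also have "\<dots> \<le> C * exp (- (ln (2 * C) + 1))"
      proof -
        have "e\<^sup>2 / 10 * (\<xi>\<^sup>2 / (2 * r0\<^sup>2) * D N r0) \<le> e\<^sup>2 / 10 * D N \<xi>"
          using e by (intro mult_left_mono D_small_le r0 xi) auto
        then show ?thesis using elim by (simp add: C_def algebra_simps)
      qed
      also have "\<dots> \<le> 1 / 2"
      proof -
        have C: "0 < C" by (simp add: C_def)
        have "exp (- (ln (2 * C) + 1)) \<le> exp (- ln (2 * C))" by simp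
        also have "\<dots> = 1 / (2 * C)" using C by (simp add: exp_minus inverse_eq_divide)
        finally show ?thesis using C by (simp add: field_simps)
      qed
      finally have "1 \<le> \<xi>\<^sup>2 * ?V" by simp
      then have "\<xi>\<^sup>2 * (\<bar>Z\<bar> + 1) \<le> \<xi>\<^sup>2 * ?V" using xiZ by linarith
      then show "Z \<le> ?V" using xi(1) by simp
    qed
  qed
qed

text \<open>The sum runs along an arbitrary chain with the same kernels, while centring and variance
  belong to the reference chain. \<open>\<Delta>\<close> is a perturbation that does not depend on
  \<open>N\<close>.\<close>

theorem smoothed_llt:
  fixes M' :: "'v measure"
  assumes P: "chain_process \<mu> p e M' X' Fil'"
    and \<Delta>: "\<Delta> \<in> borel_measurable (Fil' 2)"
    and unb: "\<not> bdd_above (range (\<lambda>N. D N r0))"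
    and z: "(\<lambda>N. (z N - expectation (S N)) / sqrt (variance (S N))) \<longlonglongrightarrow> \<zeta>"
    and \<eta>: "\<eta> > 0" and l: "l \<ge> 0"
    and per: "\<And>t. t \<noteq> 0 \<Longrightarrow> bdd_above (range (\<lambda>N. D N t)) \<Longrightarrow> iexp (t * l) = 1"
  shows "(\<lambda>N. sqrt (variance (S N)) * smoothed_prob
      (distr M' borel (\<lambda>w. \<Delta> w + (\<Sum>n<N. f n (X' n w) (X' (Suc n) w)) - z N)) \<alpha> l \<eta>)
    \<longlonglongrightarrow> l * exp (- \<zeta>\<^sup>2 / 2) / sqrt (2 * pi)"
proof -
  interpret P': chain_process \<mu> p e M' X' Fil' by fact
  interpret F': functional_process \<mu> p e f K M' X' Fil' by unfold_locales
  have [measurable]: "\<Delta> \<in> borel_measurable (Fil' 2)" by fact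
  have \<Delta>m [measurable]: "\<Delta> \<in> borel_measurable M'" by (rule P'.Fil_measurable_M[OF \<Delta>])
  define V where "V N = variance (S N)" for N
  define Q where "Q N = distr M' borel (\<lambda>w. \<Delta> w + F'.S N w - z N)" for N
  have S'_eq: "(\<Sum>n<N. f n (X' n w) (X' (Suc n) w)) = F'.S N w" for N w by (simp add: F'.S_def)
  have V_top: "filterlim V at_top sequentially" unfolding V_def by (rule variance_S_at_top[OF unb])
  have Qr: "real_distribution (Q N)" for N
    unfolding Q_def by (intro P'.real_distribution_distr) measurable
  have char_Q: "char (Q N) t = cis (- (t * z N)) * (\<integral>w. cis (t * \<Delta> w) * cis (t * F'.S N w) \<partial>M')" for N t
  proof -
    have "char (Q N) t = (\<integral>w. cis (t * (\<Delta> w + F'.S N w - z N)) \<partial>M')"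
      unfolding Q_def char_def cis_conv_exp by (subst integral_distr) auto
    also have "\<dots> = (\<integral>w. cis (- (t * z N)) * (cis (t * \<Delta> w) * cis (t * F'.S N w)) \<partial>M')"
      by (simp add: cis_mult algebra_simps)
    finally show ?thesis by simp
  qed
  obtain c1 C1 where low: "0 < c1" "\<And>N t. \<bar>t\<bar> \<le> r0 \<Longrightarrow> c1 * t\<^sup>2 * V N - C1 \<le> D N t"
    using D_low unfolding V_def by blast
  obtain C where C: "0 \<le> C" "\<And>N t. \<bar>t\<bar> \<le> 1 \<Longrightarrow>
      cmod ((\<integral>w. cis (t * (F'.S N w - expectation (S N))) \<partial>M') - exp (- (t\<^sup>2 / 2 * V N))) \<le> C * (\<bar>t\<bar> + \<bar>t\<bar> ^ 3 * V N)"
    using clt_error[OF P] unfolding V_def S'_eq by blast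
  have clt: "(\<lambda>N. char (Q N) (t / sqrt (V N))) \<longlonglongrightarrow> complex_of_real (exp (- t\<^sup>2 / 2)) * iexp (- (t * \<zeta>))" for t
  proof -
    define s where "s N = t / sqrt (V N)" for N
    have s0: "s \<longlonglongrightarrow> 0"
      unfolding s_def by (rule real_tendsto_divide_at_top[OF tendsto_const filterlim_compose[OF sqrt_at_top V_top]])
    have Vpos: "\<forall>\<^sub>F N in sequentially. 0 < V N"
      using V_top unfolding filterlim_at_top_dense by blast
    let ?A = "\<lambda>N. \<integral>w. cis (s N * (F'.S N w - expectation (S N))) \<partial>M'"
    let ?B = "\<lambda>N. \<integral>w. cis (s N * \<Delta> w) * cis (s N * (F'.S N w - expectation (S N))) \<partial>M'"
    have A: "?A \<longlonglongrightarrow> complex_of_real (exp (- t\<^sup>2 / 2))"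
    proof (rule Lim_transform[OF tendsto_const])
      have "(\<lambda>N. C * (\<bar>s N\<bar> + t\<^sup>2 * \<bar>s N\<bar>)) \<longlonglongrightarrow> C * (\<bar>0\<bar> + t\<^sup>2 * \<bar>0\<bar>)" by (intro tendsto_intros s0)
      then have lim: "(\<lambda>N. C * (\<bar>s N\<bar> + t\<^sup>2 * \<bar>s N\<bar>)) \<longlonglongrightarrow> 0" by simp
      have s1: "\<forall>\<^sub>F N in sequentially. \<bar>s N\<bar> < 1"
        using tendsto_rabs[OF s0] by (auto dest: order_tendstoD(2)[of _ _ _ 1])
      have "\<forall>\<^sub>F N in sequentially. norm (?A N - complex_of_real (exp (- t\<^sup>2 / 2))) \<le> C * (\<bar>s N\<bar> + t\<^sup>2 * \<bar>s N\<bar>)"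
        using Vpos s1
      proof eventually_elim
        case (elim N)
        have sq: "(s N)\<^sup>2 * V N = t\<^sup>2" using elim by (simp add: s_def power_divide)
        then have "\<bar>s N\<bar> ^ 3 * V N = t\<^sup>2 * \<bar>s N\<bar>" by (simp add: power3_eq_cube power2_eq_square mult_ac abs_mult_self_eq)
        moreover have "(s N)\<^sup>2 / 2 * V N = t\<^sup>2 / 2" using sq by simp
        ultimately show ?case using C(2)[of "s N" N] elim by simp
      qed
      then show "(\<lambda>N. ?A N - complex_of_real (exp (- t\<^sup>2 / 2))) \<longlonglongrightarrow> 0"
        by (rule Lim_null_comparison[OF _ lim])
    qed
    \<comment> \<open>At frequencies of order \<open>1 / sqrt (V N)\<close> the fixed perturbation
      \<open>\<Delta>\<close> disappears in the limit, even if it is unbounded.\<close>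
    have "(\<lambda>N. \<integral>w. cmod (cis (s N * \<Delta> w) - 1) \<partial>M') \<longlonglongrightarrow> (\<integral>w. 0 \<partial>M')"
    proof (rule integral_dominated_convergence[where w = "\<lambda>w. 2"])
      show "AE w in M'. (\<lambda>N. cmod (cis (s N * \<Delta> w) - 1)) \<longlonglongrightarrow> 0"
      proof (rule AE_I2)
        fix w
        have "(\<lambda>N. cmod (cis (s N * \<Delta> w) - 1)) \<longlonglongrightarrow> cmod (cis (0 * \<Delta> w) - 1)"
          by (intro tendsto_intros s0)
        then show "(\<lambda>N. cmod (cis (s N * \<Delta> w) - 1)) \<longlonglongrightarrow> 0" by simp
      qed
      show "AE w in M'. norm (cmod (cis (s N * \<Delta> w) - 1)) \<le> 2" for N
        using norm_triangle_ineq4[of "cis (s N * \<Delta> w)" 1 for w] by (simp add: order_trans[OF norm_triangle_ineq4])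
    qed auto
    then have \<Delta>0: "(\<lambda>N. \<integral>w. cmod (cis (s N * \<Delta> w) - 1) \<partial>M') \<longlonglongrightarrow> 0" by simp
    have B: "?B \<longlonglongrightarrow> complex_of_real (exp (- t\<^sup>2 / 2))"
    proof (rule Lim_transform[OF A], rule Lim_null_comparison[OF always_eventually[OF allI] \<Delta>0])
      fix N
      have i: "integrable M' (\<lambda>w. cis (s N * (F'.S N w - expectation (S N))))"
        "integrable M' (\<lambda>w. cis (s N * \<Delta> w) * cis (s N * (F'.S N w - expectation (S N))))"
        by (rule P'.integrable_bounded[where B = 1]; simp add: norm_mult)+
      have "?B N - ?A N = (\<integral>w. (cis (s N * \<Delta> w) - 1) * cis (s N * (F'.S N w - expectation (S N))) \<partial>M')"
        by (subst Bochner_Integration.integral_diff[symmetric, OF i(2,1)]) (simp add: left_diff_distrib)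
      then have "norm (?B N - ?A N) \<le> (\<integral>w. norm ((cis (s N * \<Delta> w) - 1) * cis (s N * (F'.S N w - expectation (S N)))) \<partial>M')"
        by simp
      then show "norm (?B N - ?A N) \<le> (\<integral>w. cmod (cis (s N * \<Delta> w) - 1) \<partial>M')" by (simp add: norm_mult)
    qed
    have sz: "(\<lambda>N. s N * (z N - expectation (S N))) \<longlonglongrightarrow> t * \<zeta>"
      using tendsto_mult[OF tendsto_const[of t] z] by (simp add: s_def V_def)
    have eq: "char (Q N) (s N) = cis (- (s N * (z N - expectation (S N)))) * ?B N" for N
    proof -
      have "cis (- (s N * (z N - expectation (S N)))) * ?B N
          = (\<integral>w. cis (- (s N * (z N - expectation (S N)))) * (cis (s N * \<Delta> w) * cis (s N * (F'.S N w - expectation (S N)))) \<partial>M')"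
        by simp
      also have "\<dots> = (\<integral>w. cis (- (s N * z N)) * (cis (s N * \<Delta> w) * cis (s N * F'.S N w)) \<partial>M')"
        by (simp add: cis_mult algebra_simps)
      finally show ?thesis unfolding char_Q by simp
    qed
    have "(\<lambda>N. cis (- (s N * (z N - expectation (S N)))) * ?B N) \<longlonglongrightarrow> cis (- (t * \<zeta>)) * complex_of_real (exp (- t\<^sup>2 / 2))"
      by (intro tendsto_mult tendsto_cis tendsto_minus sz B)
    then show ?thesis unfolding eq[symmetric] by (simp add: s_def cis_conv_exp mult.commute)
  qed
  interpret charfun_decay Q D V "exp (e\<^sup>2 / 10 * (28 / e ^ 6))" "e\<^sup>2 / 10" c1 C1 r0 \<zeta>
  proof (rule charfun_decay.intro)
    show "cmod (char (Q N) t) \<le> exp (e\<^sup>2 / 10 * (28 / e ^ 6)) * exp (- (e\<^sup>2 / 10) * D N t)" for N t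
      unfolding char_Q norm_mult[of "cis _"] norm_cis mult_1_left by (rule F'.norm_char_S_le) simp_all
  qed (use Qr continuous_D D_mono D_diff_le low V_top clt e r0 in simp_all)
  show ?thesis
    unfolding S'_eq using smoothed_prob_asymp[OF \<eta> l per, of \<alpha>] by (simp add: Q_def V_def)
qed

end

section \<open>Essential range and intervals\<close>

lemma closed_subgroup_mult_int:
  assumes G: "closed_subgroup G" and t: "t \<in> G"
  shows "of_int k * t \<in> G"
proof -
  have nat: "real n * t \<in> G" for n
    using G t by (induction n) (auto simp: closed_subgroup_def distrib_right)
  show ?thesis
  proof (cases "0 \<le> k")
    case True
    then show ?thesis using nat[of "nat k"] by simp
  next
    case False
    then have "- (real (nat (- k)) * t) \<in> G" using nat[of "nat (- k)"] G by (auto simp: closed_subgroup_def)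
    with False show ?thesis by simp
  qed
qed

lemma closed_subgroup_Inter: "(\<And>G. G \<in> A \<Longrightarrow> closed_subgroup G) \<Longrightarrow> closed_subgroup (\<Inter>A)"
  by (auto simp: closed_subgroup_def intro!: closed_Inter)

lemma closed_subgroup_multiples: "closed_subgroup (range (\<lambda>k :: int. of_int k * t))"
proof -
  have "range (\<lambda>k :: int. of_int k * t) = (\<lambda>x. t *\<^sub>R x) ` \<int>"
    unfolding Ints_def image_image by (simp add: mult.commute)
  then have "closed (range (\<lambda>k :: int. of_int k * t))" by (simp only:) (intro closed_scaling closed_Ints)
  moreover have "of_int j * t + of_int k * t \<in> range (\<lambda>k :: int. of_int k * t)" for j k :: int
    by (rule range_eqI[of _ _ "j + k"]) (simp add: distrib_right)
  moreover have "- (of_int j * t) \<in> range (\<lambda>k :: int. of_int k * t)" for j :: int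
    by (rule range_eqI[of _ _ "- j"]) simp
  moreover have "0 \<in> range (\<lambda>k :: int. of_int k * t)" by (rule range_eqI[of _ _ 0]) simp
  ultimately show ?thesis unfolding closed_subgroup_def by blast
qed

text \<open>The infimum of the positive elements decides. If it is 0, multiples of small elements
  are dense; otherwise it belongs to the group because the group is closed, and division with
  remainder shows that it generates.\<close>

lemma closed_subgroup_cases:
  assumes G: "closed_subgroup G"
  obtains "G = {0}" | "G = UNIV" | t where "0 < t" "G = range (\<lambda>k :: int. of_int k * t)"
proof (cases "G = {0}")
  case False
  note mult = closed_subgroup_mult_int[OF G]
  have diff: "x - y \<in> G" if "x \<in> G" "y \<in> G" for x y
    using that G by (metis closed_subgroup_def diff_conv_add_uminus)
  define P where "P = G \<inter> {0<..}"
  obtain u where u: "u \<in> G" "u \<noteq> 0" using False G by (auto simp: closed_subgroup_def)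
  have "\<bar>u\<bar> \<in> P" using u G by (auto simp: P_def closed_subgroup_def abs_if)
  then have ne: "P \<noteq> {}" by auto
  have bb: "bdd_below P" by (rule bdd_belowI[of _ 0]) (auto simp: P_def)
  define t where "t = Inf P"
  have t0: "0 \<le> t" unfolding t_def by (rule cInf_greatest[OF ne]) (auto simp: P_def)
  have tle: "t \<le> y" if "y \<in> P" for y unfolding t_def by (rule cInf_lower[OF that bb])
  have near: "\<exists>y\<in>P. y < s" if "t < s" for s using that cInf_less_iff[OF ne bb] by (auto simp: t_def)
  have "t \<in> closure G"
  proof -
    have "t \<in> closure P" unfolding t_def by (rule closure_contains_Inf[OF ne bb])
    then show ?thesis using closure_mono[of P G] by (auto simp: P_def)
  qed
  then have tG: "t \<in> G" using G by (simp add: closed_subgroup_def)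
  have floor: "0 \<le> x - of_int \<lfloor>x / s\<rfloor> * s" "x - of_int \<lfloor>x / s\<rfloor> * s < s" if "0 < s" for x s :: real
  proof -
    have "of_int \<lfloor>x / s\<rfloor> \<le> x / s" "x / s < of_int \<lfloor>x / s\<rfloor> + 1" by linarith+
    then show "0 \<le> x - of_int \<lfloor>x / s\<rfloor> * s" "x - of_int \<lfloor>x / s\<rfloor> * s < s"
      using that mult_right_mono[of "of_int \<lfloor>x / s\<rfloor>" "x / s" s] mult_strict_right_mono[of "x / s" "of_int \<lfloor>x / s\<rfloor> + 1" s]
      by (auto simp: distrib_right)
  qed
  show thesis
  proof (cases "t = 0")
    case True
    have "x \<in> closure G" for x
      unfolding closure_approachable
    proof (intro allI impI)
      fix \<epsilon> :: real assume "0 < \<epsilon>"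
      then obtain y where y: "y \<in> P" "y < \<epsilon>" using near True by auto
      then have "dist (of_int \<lfloor>x / y\<rfloor> * y) x < \<epsilon>"
        using floor[of y x] by (auto simp: P_def dist_real_def)
      then show "\<exists>z\<in>G. dist z x < \<epsilon>" using mult[of y "\<lfloor>x / y\<rfloor>"] y by (auto simp: P_def)
    qed
    then have "G = UNIV" using G by (auto simp: closed_subgroup_def)
    then show thesis by (rule that(2))
  next
    case False
    then have t: "0 < t" using t0 by simp
    have "x \<in> range (\<lambda>k :: int. of_int k * t)" if "x \<in> G" for x
    proof -
      let ?y = "x - of_int \<lfloor>x / t\<rfloor> * t"
      have "?y \<notin> P" using tle[of ?y] floor[OF t, of x] by auto
      then have "?y = 0" using diff[OF that mult[OF tG]] floor[OF t, of x] by (auto simp: P_def)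
      then show ?thesis by auto
    qed
    then have "G = range (\<lambda>k :: int. of_int k * t)" using mult[OF tG] by auto
    then show thesis by (rule that(3)[OF t])
  qed
qed (rule that(1))

lemma multiples_eq_iff:
  fixes s t :: real
  assumes "0 < s" "0 < t" "range (\<lambda>k :: int. of_int k * s) = range (\<lambda>k :: int. of_int k * t)"
  shows "s = t"
proof -
  have "s \<in> range (\<lambda>k :: int. of_int k * s)" and t: "t \<in> range (\<lambda>k :: int. of_int k * t)"
    by (rule range_eqI[of _ _ 1], simp)+
  then have "s \<in> range (\<lambda>k :: int. of_int k * t)" unfolding assms(3) by simp
  then obtain j :: int where j: "s = of_int j * t" by (rule rangeE)
  from t have "t \<in> range (\<lambda>k :: int. of_int k * s)" unfolding assms(3) .
  then obtain k :: int where k: "t = of_int k * s" by (rule rangeE)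
  have "0 < of_int j * t" "0 < of_int k * s" using assms(1,2) unfolding j[symmetric] k[symmetric] by auto
  then have "0 < j" "0 < k" using assms(1,2) by (auto simp: zero_less_mult_iff)
  then have "1 * t \<le> of_int j * t" "1 * s \<le> of_int k * s" using assms(1,2) by (intro mult_right_mono; simp)+
  then show ?thesis unfolding j[symmetric] k[symmetric] by simp
qed

lemma closed_subgroup_ess_range: "closed_subgroup (ess_range M S X f)"
  unfolding ess_range_def by (rule closed_subgroup_Inter) (auto simp: alg_range_def intro!: closed_subgroup_Inter)

lemma graininess_cases:
  assumes "graininess M S X f < ereal L"
  obtains "ess_range M S X f = UNIV" "graininess M S X f = 0"
  | \<delta> where "0 < \<delta>" "ess_range M S X f = range (\<lambda>k :: int. of_int k * \<delta>)" "graininess M S X f = ereal \<delta>"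
proof (rule closed_subgroup_cases[OF closed_subgroup_ess_range[of M S X f]])
  assume "ess_range M S X f = {0}"
  then show ?thesis using assms by (simp add: graininess_def)
next
  assume "ess_range M S X f = UNIV"
  moreover from this have "ess_range M S X f \<noteq> {0}" using UNIV_I[of "1 :: real"] by force
  ultimately show ?thesis by (intro that(1)) (auto simp: graininess_def)
next
  fix t :: real
  assume t: "0 < t" "ess_range M S X f = range (\<lambda>k :: int. of_int k * t)"
  have "t \<in> ess_range M S X f" unfolding t(2) by (rule range_eqI[of _ _ 1]) simp
  then have "ess_range M S X f \<noteq> {0}" using t(1) by (metis less_irrefl singletonD)
  moreover have "ess_range M S X f \<noteq> UNIV"
  proof
    assume "ess_range M S X f = UNIV"
    then have "t / 2 \<in> range (\<lambda>k :: int. of_int k * t)" unfolding t(2) by (rule ssubst) (rule UNIV_I)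
    then obtain k :: int where "t / 2 = of_int k * t" by (rule rangeE)
    then have "real_of_int (2 * k) = of_int 1" using t(1) by (simp add: field_simps)
    then have "2 * k = 1" by (simp only: of_int_eq_iff)
    then show False by presburger
  qed
  moreover have "(THE s. 0 < s \<and> ess_range M S X f = range (\<lambda>k :: int. of_int k * s)) = t"
    by (rule the_equality, rule conjI, rule t(1), rule t(2), erule conjE) (rule multiples_eq_iff[OF _ t(1)], simp_all only: t(2))
  ultimately show ?thesis using t by (intro that(2)[of t]) (simp_all add: graininess_def)
qed

text \<open>The smoothing variable takes values between 0 and \<open>\<eta>\<close>, up to a null
  set. It can therefore push a point of the interval upwards by at most \<open>\<eta>\<close>, and a
  smoothed value comes from a point at most \<open>\<eta>\<close> below it.\<close>

lemma
  assumes Q: "real_distribution Q" and \<eta>: "0 < \<eta>"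
  shows interval_le_smoothed_prob: "b + \<eta> \<le> a + l \<Longrightarrow> measure Q {a<..<b} \<le> smoothed_prob Q a l \<eta>"
    and smoothed_prob_le_interval: "a + \<eta> + l < b \<Longrightarrow> smoothed_prob Q (a + \<eta>) l \<eta> \<le> measure Q {a<..<b}"
proof -
  interpret Q: real_distribution Q by fact
  interpret U: real_distribution "smoother \<eta>" using \<eta> by (intro real_distribution_smoother)
  interpret P: pair_prob_space Q "smoother \<eta>" ..
  let ?P = "Q \<Otimes>\<^sub>M smoother \<eta>"
  have sP [measurable_cong]: "sets ?P = sets (borel \<Otimes>\<^sub>M borel)" by (intro sets_pair_measure_cong) auto
  have "{w \<in> space (borel \<Otimes>\<^sub>M borel). \<alpha> < fst w + snd w \<and> fst w + snd w \<le> \<alpha> + l} \<in> sets (borel \<Otimes>\<^sub>M borel)" for \<alpha>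
    by measurable
  then have [measurable]: "{w. \<alpha> < fst w + snd w \<and> fst w + snd w \<le> \<alpha> + l} \<in> sets (borel \<Otimes>\<^sub>M borel)" for \<alpha>
    by (simp add: space_pair_measure)
  have U1: "emeasure (smoother \<eta>) {0..\<eta>} = 1" using \<eta> by simp
  have rect: "measure ?P ({a<..<b} \<times> {0..\<eta>}) = measure Q {a<..<b}"
    using U1 by (simp add: measure_def U.emeasure_pair_measure_Times)
  have "emeasure (smoother \<eta>) (- {0..\<eta>}) = 0" using \<eta> by simp
  then have rectc: "measure ?P (UNIV \<times> - {0..\<eta>}) = 0"
    by (simp add: measure_def U.emeasure_pair_measure_Times)
  show "measure Q {a<..<b} \<le> smoothed_prob Q a l \<eta>" if "b + \<eta> \<le> a + l"
    unfolding rect[symmetric] smoothed_prob_def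
    by (rule P.finite_measure_mono) (use that \<eta> in auto)
  show "smoothed_prob Q (a + \<eta>) l \<eta> \<le> measure Q {a<..<b}" if "a + \<eta> + l < b"
  proof -
    have "smoothed_prob Q (a + \<eta>) l \<eta> \<le> measure (Q \<Otimes>\<^sub>M smoother \<eta>) (({a<..<b} \<times> {0..\<eta>}) \<union> (UNIV \<times> - {0..\<eta>}))"
      unfolding smoothed_prob_def
      by (rule P.finite_measure_mono) (use that in auto)
    also have "\<dots> \<le> measure (Q \<Otimes>\<^sub>M smoother \<eta>) ({a<..<b} \<times> {0..\<eta>}) + measure (Q \<Otimes>\<^sub>M smoother \<eta>) (UNIV \<times> - {0..\<eta>})"
      by (rule measure_Un_le) auto
    finally show ?thesis using rect rectc by simp
  qed
qed

section \<open>From admissible window lengths to the interval\<close>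

context
  fixes P V s :: "nat \<Rightarrow> real" and l \<kappa> :: real
  assumes V: "filterlim V at_top sequentially" and s: "s \<longlonglongrightarrow> l * \<kappa>"
begin

lemma eventually_V_pos: "\<forall>\<^sub>F N in sequentially. 0 < V N"
  using V unfolding filterlim_at_top_dense by blast

lemma eventually_upper_bound:
  assumes up: "\<forall>\<^sub>F N in sequentially. sqrt (V N) * P N \<le> s N" and c: "l * \<kappa> < c"
  shows "\<forall>\<^sub>F N in sequentially. P N \<le> c / sqrt (V N)"
  using eventually_V_pos up order_tendstoD(2)[OF s c]
  by eventually_elim (auto simp: pos_le_divide_eq mult.commute)

lemma eventually_lower_bound:
  assumes low: "\<forall>\<^sub>F N in sequentially. s N \<le> sqrt (V N) * P N" and c: "c < l * \<kappa>"
  shows "\<forall>\<^sub>F N in sequentially. c / sqrt (V N) \<le> P N"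
  using eventually_V_pos low order_tendstoD(1)[OF s c]
  by eventually_elim (auto simp: pos_divide_le_eq mult.commute)

lemma asymp_le_upper:
  assumes up: "\<forall>\<^sub>F N in sequentially. sqrt (V N) * P N \<le> s N" and pos: "0 < l" "0 < \<kappa>"
  shows "P \<lesssim> (\<lambda>N. \<kappa> / sqrt (V N) * l)"
proof -
  have "\<forall>\<^sub>F N in sequentially. ereal (P N) / ereal (\<kappa> / sqrt (V N) * l) \<le> ereal (s N / (l * \<kappa>))"
    using eventually_V_pos up
  proof eventually_elim
    case (elim N)
    have "P N / (\<kappa> / sqrt (V N) * l) = sqrt (V N) * P N / (l * \<kappa>)" using elim pos by (simp add: field_simps)
    also have "\<dots> \<le> s N / (l * \<kappa>)" using elim pos by (intro divide_right_mono) auto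
    finally have le: "P N / (\<kappa> / sqrt (V N) * l) \<le> s N / (l * \<kappa>)" .
    have "\<kappa> / sqrt (V N) * l \<noteq> 0" using elim pos by simp
    then have "ereal (P N) / ereal (\<kappa> / sqrt (V N) * l) = ereal (P N / (\<kappa> / sqrt (V N) * l))" by (simp only: ereal_divide if_False)
    then show ?case using le by (simp only: ereal_less_eq)
  qed
  then have "limsup (\<lambda>N. ereal (P N) / ereal (\<kappa> / sqrt (V N) * l)) \<le> limsup (\<lambda>N. ereal (s N / (l * \<kappa>)))"
    by (rule Limsup_mono)
  also have "(\<lambda>N. s N / (l * \<kappa>)) \<longlonglongrightarrow> l * \<kappa> / (l * \<kappa>)" using pos by (intro tendsto_divide s tendsto_const) auto
  then have "limsup (\<lambda>N. ereal (s N / (l * \<kappa>))) = 1"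
    using pos by (intro lim_imp_Limsup) (simp_all add: one_ereal_def)
  finally show ?thesis unfolding asymp_le_def .
qed

lemma asymp_le_lower:
  assumes low: "\<forall>\<^sub>F N in sequentially. s N \<le> sqrt (V N) * P N" and pos: "0 \<le> l" "0 < \<kappa>"
  shows "(\<lambda>N. \<kappa> / sqrt (V N) * l) \<lesssim> P"
proof (cases "l = 0")
  case True
  \<comment> \<open>For \<open>k = 0\<close> the numerator vanishes, and in the extended reals the
    quotient is 0 even if the denominator is 0.\<close>
  then show ?thesis by (simp add: asymp_le_def zero_ereal_def[symmetric] Limsup_const)
next
  case False
  then have l: "0 < l * \<kappa>" using pos by simp
  have "\<forall>\<^sub>F N in sequentially. ereal (\<kappa> / sqrt (V N) * l) / ereal (P N) \<le> ereal (l * \<kappa> / s N)"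
    using eventually_V_pos low order_tendstoD(1)[OF s l]
  proof eventually_elim
    case (elim N)
    then have "0 < sqrt (V N) * P N" by linarith
    then have P: "0 < P N" using elim by (simp add: zero_less_mult_iff)
    have "\<kappa> / sqrt (V N) * l / P N = l * \<kappa> / (sqrt (V N) * P N)" by (simp add: field_simps)
    also have "\<dots> \<le> l * \<kappa> / s N" using elim l by (intro divide_left_mono) auto
    finally have le: "\<kappa> / sqrt (V N) * l / P N \<le> l * \<kappa> / s N" .
    have "ereal (\<kappa> / sqrt (V N) * l) / ereal (P N) = ereal (\<kappa> / sqrt (V N) * l / P N)" using P by (simp only: ereal_divide less_imp_neq[symmetric] if_False)
    then show ?case using le by (simp only: ereal_less_eq)
  qed
  then have "limsup (\<lambda>N. ereal (\<kappa> / sqrt (V N) * l) / ereal (P N)) \<le> limsup (\<lambda>N. ereal (l * \<kappa> / s N))"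
    by (rule Limsup_mono)
  also have "(\<lambda>N. l * \<kappa> / s N) \<longlonglongrightarrow> l * \<kappa> / (l * \<kappa>)" using l by (intro tendsto_divide s tendsto_const) auto
  then have "limsup (\<lambda>N. ereal (l * \<kappa> / s N)) = 1"
    using False pos by (intro lim_imp_Limsup) (simp_all add: one_ereal_def)
  finally show ?thesis unfolding asymp_le_def .
qed

end

text \<open>Windows are available for the multiples of \<open>\<delta>\<close>, or for all lengths
  if \<open>\<delta> = 0\<close>. The next multiple above \<open>L\<close> exceeds it by at most
  \<open>\<delta>\<close>, well within \<open>21 * \<delta>\<close>, and the next one below falls
  short by at most \<open>\<delta>\<close>. If \<open>L\<close> lies strictly between two
  consecutive multiples, the same two windows give the limit superior bounds.\<close>

lemma lattice_length_bounds:
  fixes P V :: "nat \<Rightarrow> real" and \<kappa> L \<delta> :: real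
  assumes V: "filterlim V at_top sequentially" and \<kappa>: "0 < \<kappa>" and \<delta>: "0 \<le> \<delta>" "\<delta> < L"
    and up: "\<And>l. \<delta> = 0 \<or> (\<exists>k :: nat. l = k * \<delta>) \<Longrightarrow> L < l \<Longrightarrow>
      \<exists>s. s \<longlonglongrightarrow> l * \<kappa> \<and> (\<forall>\<^sub>F N in sequentially. sqrt (V N) * P N \<le> s N)"
    and low: "\<And>l. \<delta> = 0 \<or> (\<exists>k :: nat. l = k * \<delta>) \<Longrightarrow> 0 \<le> l \<Longrightarrow> l < L \<Longrightarrow>
      \<exists>s. s \<longlonglongrightarrow> l * \<kappa> \<and> (\<forall>\<^sub>F N in sequentially. s N \<le> sqrt (V N) * P N)"
  shows "(\<forall>\<epsilon>>0. \<forall>\<^sub>F N in sequentially.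
            P N \<le> \<kappa> * L / sqrt (V N) * (1 + 21 * \<delta> / L + \<epsilon>) \<and>
            P N \<ge> \<kappa> * L / sqrt (V N) * (1 - \<delta> / L - \<epsilon>)) \<and>
         (\<forall>k :: nat. 0 < \<delta> \<and> real k * \<delta> < L \<and> L < (real k + 1) * \<delta> \<longrightarrow>
            (\<lambda>N. \<kappa> / sqrt (V N) * (real k * \<delta>)) \<lesssim> P \<and> P \<lesssim> (\<lambda>N. \<kappa> / sqrt (V N) * ((real k + 1) * \<delta>)))"
proof (intro conjI allI impI)
  have L: "0 < L" using \<delta> by simp
  show "\<forall>\<^sub>F N in sequentially. P N \<le> \<kappa> * L / sqrt (V N) * (1 + 21 * \<delta> / L + \<epsilon>) \<and>
            P N \<ge> \<kappa> * L / sqrt (V N) * (1 - \<delta> / L - \<epsilon>)" if \<epsilon>: "0 < \<epsilon>" for \<epsilon>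
  proof (rule eventually_conj)
    have "\<exists>l. (\<delta> = 0 \<or> (\<exists>k :: nat. l = k * \<delta>)) \<and> L < l \<and> l < L + 21 * \<delta> + \<epsilon> * L"
    proof (cases "\<delta> = 0")
      case True
      then show ?thesis using L \<epsilon> by (intro exI[of _ "L + \<epsilon> * L / 2"]) (auto intro: mult_pos_pos)
    next
      case False
      \<comment> \<open>The floor plus 1 and not the ceiling: the window must be strictly longer
        than the interval, since the excess becomes the width of the smoothing.\<close>
      define k where "k = nat \<lfloor>L / \<delta>\<rfloor> + 1"
      have "0 \<le> \<lfloor>L / \<delta>\<rfloor>" using L \<delta> by simp
      then have "real k = of_int \<lfloor>L / \<delta>\<rfloor> + 1" unfolding k_def by simp
      then have "real k - 1 \<le> L / \<delta>" "L / \<delta> < real k" by linarith+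
      then have "(real k - 1) * \<delta> \<le> L" "L < real k * \<delta>" using False \<delta> by (simp_all add: field_simps)
      moreover have "0 < \<epsilon> * L" using \<epsilon> L by simp
      ultimately have "L < real k * \<delta> \<and> real k * \<delta> < L + 21 * \<delta> + \<epsilon> * L" using \<delta> False by (simp add: left_diff_distrib)
      then show ?thesis by blast
    qed
    then obtain l where l: "\<delta> = 0 \<or> (\<exists>k :: nat. l = k * \<delta>)" "L < l" "l < L + 21 * \<delta> + \<epsilon> * L" by blast
    obtain s where s: "s \<longlonglongrightarrow> l * \<kappa>" "\<forall>\<^sub>F N in sequentially. sqrt (V N) * P N \<le> s N" using up[OF l(1,2)] by blast
    have "l * \<kappa> < (L + 21 * \<delta> + \<epsilon> * L) * \<kappa>" using l(3) \<kappa> by simp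
    from eventually_upper_bound[OF V s this]
    show "\<forall>\<^sub>F N in sequentially. P N \<le> \<kappa> * L / sqrt (V N) * (1 + 21 * \<delta> / L + \<epsilon>)"
    proof eventually_elim
      case (elim N)
      have "(L + 21 * \<delta> + \<epsilon> * L) * \<kappa> = \<kappa> * L * (1 + 21 * \<delta> / L + \<epsilon>)" using L by (simp add: field_simps)
      then show ?case using elim by (simp only: times_divide_eq_left)
    qed
  next
    have "\<exists>l. (\<delta> = 0 \<or> (\<exists>k :: nat. l = k * \<delta>)) \<and> 0 \<le> l \<and> l < L \<and> L - \<delta> - \<epsilon> * L < l"
    proof (cases "\<delta> = 0")
      case True
      have "0 < \<epsilon> * L" using \<epsilon> L by simp
      then show ?thesis using L True by (intro exI[of _ "max 0 (L - \<epsilon> * L / 2)"]) auto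
    next
      case False
      \<comment> \<open>Likewise the ceiling minus 1 gives a window strictly shorter than the
        interval even if \<open>L\<close> is itself a multiple of \<open>\<delta>\<close>.\<close>
      define k where "k = nat (\<lceil>L / \<delta>\<rceil> - 1)"
      have "0 < L / \<delta>" using L \<delta> False by simp
      then have "1 \<le> \<lceil>L / \<delta>\<rceil>" by linarith
      then have "real k = of_int \<lceil>L / \<delta>\<rceil> - 1" unfolding k_def by simp
      then have "real k < L / \<delta>" "L / \<delta> \<le> real k + 1" by linarith+
      then have "real k * \<delta> < L" "L \<le> (real k + 1) * \<delta>" using False \<delta> by (simp_all add: field_simps)
      moreover have "0 < \<epsilon> * L" using \<epsilon> L by simp
      ultimately have "0 \<le> real k * \<delta> \<and> real k * \<delta> < L \<and> L - \<delta> - \<epsilon> * L < real k * \<delta>" using \<delta> False by (simp add: distrib_right)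
      then show ?thesis by blast
    qed
    then obtain l where l: "\<delta> = 0 \<or> (\<exists>k :: nat. l = k * \<delta>)" "0 \<le> l" "l < L" "L - \<delta> - \<epsilon> * L < l" by blast
    obtain s where s: "s \<longlonglongrightarrow> l * \<kappa>" "\<forall>\<^sub>F N in sequentially. s N \<le> sqrt (V N) * P N" using low[OF l(1,2,3)] by blast
    have "(L - \<delta> - \<epsilon> * L) * \<kappa> < l * \<kappa>" using l(4) \<kappa> by simp
    from eventually_lower_bound[OF V s this]
    show "\<forall>\<^sub>F N in sequentially. P N \<ge> \<kappa> * L / sqrt (V N) * (1 - \<delta> / L - \<epsilon>)"
    proof eventually_elim
      case (elim N)
      have "(L - \<delta> - \<epsilon> * L) * \<kappa> = \<kappa> * L * (1 - \<delta> / L - \<epsilon>)" using L by (simp add: field_simps)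
      then show ?case using elim by (simp only: times_divide_eq_left)
    qed
  qed
  fix k :: nat
  assume k: "0 < \<delta> \<and> real k * \<delta> < L \<and> L < (real k + 1) * \<delta>"
  have k1: "(real k + 1) * \<delta> = real (Suc k) * \<delta>" by simp
  obtain s where "s \<longlonglongrightarrow> real k * \<delta> * \<kappa>" "\<forall>\<^sub>F N in sequentially. s N \<le> sqrt (V N) * P N"
    using low[of "real k * \<delta>"] k by auto
  then show "(\<lambda>N. \<kappa> / sqrt (V N) * (real k * \<delta>)) \<lesssim> P" by (rule asymp_le_lower[OF V]) (use k \<kappa> in auto)
  have "L < real (Suc k) * \<delta>" using k by (simp only: k1)
  then obtain s where "s \<longlonglongrightarrow> real (Suc k) * \<delta> * \<kappa>" "\<forall>\<^sub>F N in sequentially. sqrt (V N) * P N \<le> s N"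
    using up[of "real (Suc k) * \<delta>"] by blast
  then show "P \<lesssim> (\<lambda>N. \<kappa> / sqrt (V N) * ((real k + 1) * \<delta>))"
    unfolding k1 by (rule asymp_le_upper[OF V]) (use k \<kappa> in auto)
qed

section \<open>Transfer to the given chain\<close>

lemma space_borel_msets [simp]: "space (borel_msets m) = mspace m"
proof -
  have "{U. openin (mtopology_of m) U} \<subseteq> Pow (mspace m)"
    using openin_subset[of "mtopology_of m"] by auto
  then show ?thesis unfolding borel_msets_def by (rule space_measure_of)
qed

text \<open>A point outside the state space is treated as a fixed state. In this way a chain with varying
  state spaces becomes a chain on the whole type.\<close>

definition retract :: "'a metric \<Rightarrow> 'a \<Rightarrow> 'a" where
  "retract m x = (if x \<in> mspace m then x else (SOME y. y \<in> mspace m))"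

definition full_borel :: "'a metric \<Rightarrow> 'a measure" where
  "full_borel m = vimage_algebra UNIV (retract m) (borel_msets m)"

lemma retract_id [simp]: "x \<in> mspace m \<Longrightarrow> retract m x = x"
  by (simp add: retract_def)

lemma retract_in: "mspace m \<noteq> {} \<Longrightarrow> retract m x \<in> mspace m"
  by (auto simp: retract_def some_in_eq)

lemma space_full_borel [simp]: "space (full_borel m) = UNIV"
  by (simp add: full_borel_def)

lemma measurable_retract: "mspace m \<noteq> {} \<Longrightarrow> retract m \<in> measurable (full_borel m) (borel_msets m)"
  unfolding full_borel_def by (rule measurable_vimage_algebra1) (simp add: retract_in)

lemma measurable_full_borel:
  assumes h: "h \<in> measurable N (borel_msets m)" shows "h \<in> measurable N (full_borel m)"
  unfolding full_borel_def
proof (rule measurable_vimage_algebra2)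
  have "retract m (h x) = h x" if "x \<in> space N" for x
    using measurable_space[OF h that] by simp
  then show "(\<lambda>x. retract m (h x)) \<in> measurable N (borel_msets m)"
    using h by (subst measurable_cong[where g = h]) auto
qed simp

text \<open>The witnesses of uniform ellipticity are fixed as parameters, so that the chain with the
  given initial distribution and the chain started at a point share reference measures and
  densities.\<close>

locale elliptic_densities =
  fixes S :: "nat \<Rightarrow> 'a metric" and \<pi> :: "nat \<Rightarrow> 'a \<Rightarrow> 'a measure" and \<epsilon> :: real
    and \<mu> :: "nat \<Rightarrow> 'a measure" and p :: "nat \<Rightarrow> 'a \<times> 'a \<Rightarrow> real"
  assumes \<epsilon>: "0 < \<epsilon>" "\<epsilon> < 1"
    and \<mu>: "\<And>n. n \<ge> 1 \<Longrightarrow> prob_space (\<mu> n)" "\<And>n. n \<ge> 1 \<Longrightarrow> sets (\<mu> n) = sets (borel_msets (S n))"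
    and p_measurable: "\<And>n. n \<ge> 1 \<Longrightarrow> p n \<in> borel_measurable (borel_msets (S n) \<Otimes>\<^sub>M borel_msets (S (Suc n)))"
    and density: "\<And>n x. n \<ge> 1 \<Longrightarrow> x \<in> mspace (S n) \<Longrightarrow> \<pi> n x = density (\<mu> (Suc n)) (\<lambda>y. ennreal (p n (x, y)))"
    and bounds: "\<And>n x y. n \<ge> 1 \<Longrightarrow> x \<in> mspace (S n) \<Longrightarrow> y \<in> mspace (S (Suc n)) \<Longrightarrow> 0 \<le> p n (x, y) \<and> p n (x, y) \<le> 1 / \<epsilon>"
    and two_step: "\<And>n x z. n \<ge> 1 \<Longrightarrow> x \<in> mspace (S n) \<Longrightarrow> z \<in> mspace (S (Suc (Suc n))) \<Longrightarrow>
      (\<integral>y. p n (x, y) * p (Suc n) (y, z) \<partial>\<mu> (Suc n)) > \<epsilon>"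
    and prob: "\<And>n x. n \<ge> 1 \<Longrightarrow> x \<in> mspace (S n) \<Longrightarrow> prob_space (\<pi> n x)"
begin

abbreviation ret :: "nat \<Rightarrow> 'a \<Rightarrow> 'a" where "ret n \<equiv> retract (S (Suc n))"

text \<open>The levels of \<open>ref\<close>, \<open>dens\<close> and \<open>trunc\<close> start at 0, the times of the given chain at 1.\<close>

definition ref :: "nat \<Rightarrow> 'a measure" where
  "ref n = distr (\<mu> (Suc n)) (full_borel (S (Suc n))) (\<lambda>x. x)"

definition dens :: "nat \<Rightarrow> 'a \<Rightarrow> 'a \<Rightarrow> real" where
  "dens n x y = p (Suc n) (ret n x, ret (Suc n) y)"

lemma space_\<mu>_Suc: "space (\<mu> (Suc n)) = mspace (S (Suc n))"
  using sets_eq_imp_space_eq[OF \<mu>(2)[of "Suc n"]] by simp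

lemma mspace_nonempty: "mspace (S (Suc n)) \<noteq> {}"
  using prob_space.not_empty[OF \<mu>(1)[of "Suc n"]] by (simp add: space_\<mu>_Suc)

lemma ret_in [simp]: "ret n x \<in> mspace (S (Suc n))" by (rule retract_in[OF mspace_nonempty])

lemma sets_ref [measurable_cong]: "sets (ref n) = sets (full_borel (S (Suc n)))"
  by (simp add: ref_def)

lemma id_measurable: "(\<lambda>x. x) \<in> measurable (\<mu> (Suc n)) (full_borel (S (Suc n)))"
  using \<mu>(2)[of "Suc n"] by (intro measurable_full_borel) (simp add: measurable_ident_sets)

lemma ret_measurable [measurable]: "ret n \<in> measurable (ref n) (borel_msets (S (Suc n)))"
  using measurable_retract[OF mspace_nonempty] by (simp cong: measurable_cong_sets add: sets_ref)

lemma integral_ref: "g \<in> borel_measurable (ref n) \<Longrightarrow> (\<integral>x. g x \<partial>ref n) = (\<integral>x. g x \<partial>\<mu> (Suc n))"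
  for g :: "'a \<Rightarrow> 'b :: {banach, second_countable_topology}"
  unfolding ref_def by (rule integral_distr[OF id_measurable]) simp

lemma dens_pair: "(\<lambda>(x, y). dens n x y) \<in> borel_measurable (ref n \<Otimes>\<^sub>M ref (Suc n))"
proof -
  note p_measurable[of "Suc n", measurable]
  show ?thesis unfolding dens_def by measurable
qed

lemma dens_eq: "y \<in> mspace (S (Suc (Suc n))) \<Longrightarrow> dens n x y = p (Suc n) (ret n x, y)"
  by (simp add: dens_def)

lemma integral_\<mu>_cong: "(\<And>y. y \<in> mspace (S (Suc n)) \<Longrightarrow> g y = h y) \<Longrightarrow> (\<integral>y. g y \<partial>\<mu> (Suc n)) = (\<integral>y. h y \<partial>\<mu> (Suc n))"
  for g h :: "'a \<Rightarrow> real"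
  by (rule Bochner_Integration.integral_cong) (auto simp: space_\<mu>_Suc)

lemma measure_\<pi>:
  assumes A: "A \<in> sets (borel_msets (S (Suc (Suc n))))"
  shows "measure (\<pi> (Suc n) (ret n x)) A = (\<integral>y. p (Suc n) (ret n x, y) * indicator A y \<partial>\<mu> (Suc (Suc n)))"
proof -
  note p_measurable[of "Suc n", measurable]
  have [measurable_cong]: "sets (\<mu> (Suc (Suc n))) = sets (borel_msets (S (Suc (Suc n))))" by (rule \<mu>) simp
  have [measurable]: "ret n x \<in> space (borel_msets (S (Suc n)))" by simp
  have m: "(\<lambda>y. p (Suc n) (ret n x, y)) \<in> borel_measurable (\<mu> (Suc (Suc n)))" by measurable
  have [measurable]: "A \<in> sets (\<mu> (Suc (Suc n)))" using A \<mu>(2)[of "Suc (Suc n)"] by simp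
  have "measure (\<pi> (Suc n) (ret n x)) A = enn2real (\<integral>\<^sup>+y. ennreal (p (Suc n) (ret n x, y)) * indicator A y \<partial>\<mu> (Suc (Suc n)))"
    using m by (simp add: density measure_def emeasure_density)
  also have "(\<integral>\<^sup>+y. ennreal (p (Suc n) (ret n x, y)) * indicator A y \<partial>\<mu> (Suc (Suc n)))
      = (\<integral>\<^sup>+y. ennreal (p (Suc n) (ret n x, y) * indicator A y) \<partial>\<mu> (Suc (Suc n)))"
    by (intro nn_integral_cong) (auto split: split_indicator)
  also have "enn2real \<dots> = (\<integral>y. p (Suc n) (ret n x, y) * indicator A y \<partial>\<mu> (Suc (Suc n)))"
    using m bounds[of "Suc n" "ret n x"]
    by (intro integral_eq_nn_integral[symmetric] AE_I2) (auto simp: space_\<mu>_Suc split: split_indicator)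
  finally show ?thesis .
qed

sublocale kernel: elliptic_kernel ref dens \<epsilon>
proof (rule elliptic_kernel.intro)
  show "prob_space (ref n)" for n
    unfolding ref_def by (rule prob_space.prob_space_distr[OF \<mu>(1) id_measurable]) simp
  show "space (ref n) = UNIV" for n by (simp add: ref_def)
  show "(\<lambda>(x, y). dens n x y) \<in> borel_measurable (ref n \<Otimes>\<^sub>M ref (Suc n))" for n by (rule dens_pair)
  show "0 < \<epsilon>" "\<epsilon> < 1" by (rule \<epsilon>)+
  show "0 \<le> dens n x y" "dens n x y \<le> 1 / \<epsilon>" for n x y
    unfolding dens_def using bounds[of "Suc n"] by simp_all
  note dens_pair[measurable]
  show "(\<integral>y. dens n x y \<partial>ref (Suc n)) = 1" for n x
  proof -
    have [measurable]: "x \<in> space (ref n)" by (simp add: ref_def)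
    have m: "(\<lambda>y. dens n x y) \<in> borel_measurable (ref (Suc n))"
      using measurable_Pair2[OF dens_pair, of x n] by simp
    have "(\<integral>y. dens n x y \<partial>ref (Suc n)) = (\<integral>y. p (Suc n) (ret n x, y) * indicator (mspace (S (Suc (Suc n)))) y \<partial>\<mu> (Suc (Suc n)))"
      unfolding integral_ref[OF m] by (rule integral_\<mu>_cong) (simp add: dens_eq)
    also have "\<dots> = measure (\<pi> (Suc n) (ret n x)) (mspace (S (Suc (Suc n))))"
      using sets.top[of "borel_msets (S (Suc (Suc n)))"] by (intro measure_\<pi>[symmetric]) simp
    also have "mspace (S (Suc (Suc n))) = space (\<pi> (Suc n) (ret n x))"
      by (simp add: density space_\<mu>_Suc)
    finally show ?thesis using prob_space.prob_space[OF prob[of "Suc n" "ret n x"]] by simp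
  qed
  show "\<epsilon> \<le> (\<integral>y. dens n x y * dens (Suc n) y z \<partial>ref (Suc n))" for n x z
  proof -
    have m: "(\<lambda>y. dens n x y) \<in> borel_measurable (ref (Suc n))"
      using measurable_Pair2[OF dens_pair, of x n] by (simp add: ref_def)
    have m': "(\<lambda>y. dens (Suc n) y z) \<in> borel_measurable (ref (Suc n))"
      using measurable_Pair1[OF dens_pair, of z "Suc n"] by (simp add: ref_def)
    have "(\<integral>y. dens n x y * dens (Suc n) y z \<partial>ref (Suc n)) = (\<integral>y. p (Suc n) (ret n x, y) * p (Suc (Suc n)) (y, ret (Suc (Suc n)) z) \<partial>\<mu> (Suc (Suc n)))"
      unfolding integral_ref[OF borel_measurable_times[OF m m']] by (rule integral_\<mu>_cong) (simp add: dens_def)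
    then show ?thesis using two_step[of "Suc n" "ret n x" "ret (Suc (Suc n)) z"] by simp
  qed
qed

text \<open>The defining property of conditional expectation, tested against a bounded variable of
  the past, is the required Markov property. The rest is the passage between the state spaces and
  the whole type.\<close>

lemma chain_process:
  assumes mc: "markov_chain M S \<nu> \<pi> X"
  shows "chain_process ref dens \<epsilon> M (\<lambda>n. X (Suc n)) (\<lambda>n. past_algebra M S X (Suc n))"
proof -
  interpret mc: markov_chain M S \<nu> \<pi> X by fact
  let ?X = "\<lambda>n. X (Suc n)" and ?F = "\<lambda>n. past_algebra M S X (Suc n)"
  have XM: "X i \<in> measurable M (borel_msets (S i))" if "1 \<le> i" for i by (rule mc.random_variable[OF that])
  have Xin: "X i w \<in> mspace (S i)" if "1 \<le> i" "w \<in> space M" for i w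
    using measurable_space[OF XM[OF that(1)] that(2)] by simp
  have spF: "space (past_algebra M S X n) = space M" for n by (simp add: past_algebra_def)
  have XF: "X i \<in> measurable (past_algebra M S X n) (borel_msets (S i))" if "i \<in> {1..n}" for i n
  proof -
    have "(\<lambda>\<omega>. \<lambda>i\<in>{1..n}. X i \<omega>) \<in> measurable (past_algebra M S X n) (Pi\<^sub>M {1..n} (\<lambda>i. borel_msets (S i)))"
      unfolding past_algebra_def by (rule measurable_vimage_algebra1) (auto simp: space_PiM Xin)
    from measurable_compose[OF this measurable_component_singleton[OF that]] show ?thesis using that by simp
  qed
  have sub: "sets (past_algebra M S X n) \<subseteq> sets N" if "space N = space M" "\<And>i. i \<in> {1..n} \<Longrightarrow> X i \<in> measurable N (borel_msets (S i))" for n N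
    unfolding past_algebra_def by (rule sets_image_in_sets[OF that(1)]) (auto intro!: measurable_restrict that(2))
  have FM: "sets (past_algebra M S X n) \<subseteq> sets M" for n by (rule sub) (auto intro: XM)
  show ?thesis
  proof
    show "?X n \<in> measurable M (ref n)" for n
      using measurable_full_borel[OF XM[of "Suc n"]] by (simp cong: measurable_cong_sets add: sets_ref)
    show "?X n \<in> measurable (?F n) (ref n)" for n
      using measurable_full_borel[OF XF[of "Suc n" "Suc n"]] by (simp cong: measurable_cong_sets add: sets_ref)
    show "space (?F n) = space M" for n by (rule spF)
    show "sets (?F n) \<subseteq> sets M" for n by (rule FM)
    show "sets (?F n) \<subseteq> sets (?F (Suc n))" for n by (rule sub) (auto intro: XF simp: spF)
    fix n and Y :: "'b \<Rightarrow> real" and B A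
    assume Y: "Y \<in> borel_measurable (?F n)" and B: "\<And>w. \<bar>Y w\<bar> \<le> B" and A: "A \<in> sets (ref (Suc n))"
    interpret F: finite_measure_subalgebra M "?F n"
      by standard (auto simp: subalgebra_def spF FM)
    \<comment> \<open>The transition law is known for Borel sets of the state space, and
      \<open>X\<close> takes its values there, so \<open>A\<close> may be cut down to it.\<close>
    define E where "E = A \<inter> mspace (S (Suc (Suc n)))"
    have E: "E \<in> sets (borel_msets (S (Suc (Suc n))))"
      using measurable_sets[OF id_measurable, of A "Suc n"] A \<mu>(2)[of "Suc (Suc n)"]
      by (simp add: E_def space_\<mu>_Suc sets_ref)
    have iE: "indicator A (?X (Suc n) w) = (indicator E (?X (Suc n) w) :: real)" if "w \<in> space M" for w
      using Xin[of "Suc (Suc n)" w] that by (simp add: E_def indicator_def)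
    have k: "kernel.kint n x (indicator A) = measure (\<pi> (Suc n) (ret n x)) E" for x
    proof -
      have m: "(\<lambda>y. dens n x y) \<in> borel_measurable (ref (Suc n))"
        using measurable_Pair2[OF dens_pair, of x n] by (simp add: ref_def)
      have "kernel.kint n x (indicator A) = (\<integral>y. dens n x y * indicator A y \<partial>\<mu> (Suc (Suc n)))"
        unfolding kernel.kint_def real_scaleR_def
        by (intro integral_ref borel_measurable_times m borel_measurable_indicator A)
      also have "\<dots> = (\<integral>y. p (Suc n) (ret n x, y) * indicator E y \<partial>\<mu> (Suc (Suc n)))"
        by (rule integral_\<mu>_cong) (simp add: dens_eq E_def indicator_def)
      finally show ?thesis by (simp add: measure_\<pi>[OF E])
    qed
    have YM: "Y \<in> borel_measurable M" using Y by (rule measurable_from_subalg[OF F.subalg])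
    have iM [measurable]: "(\<lambda>w. indicator E (?X (Suc n) w) :: real) \<in> borel_measurable M"
      using XM[of "Suc (Suc n)"] E by measurable
    have "(\<integral>w. Y w * indicator A (?X (Suc n) w) \<partial>M) = (\<integral>w. Y w * indicator E (?X (Suc n) w) \<partial>M)"
      by (rule Bochner_Integration.integral_cong) (simp_all add: iE)
    also have "\<dots> = (\<integral>w. Y w * real_cond_exp M (?F n) (\<lambda>w. indicator E (?X (Suc n) w)) w \<partial>M)"
    proof (rule F.real_cond_exp_intg(2)[symmetric, OF _ Y iM])
      show "integrable M (\<lambda>w. Y w * indicator E (?X (Suc n) w))"
      proof (rule mc.integrable_const_bound[where B = B])
        show "AE w in M. norm (Y w * indicator E (?X (Suc n) w)) \<le> B"
          using B order_trans[OF abs_ge_zero B] by (auto simp: indicator_def)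
      qed (use YM in measurable)
    qed
    also have "\<dots> = (\<integral>w. Y w * kernel.kint n (?X n w) (indicator A) \<partial>M)"
    proof (rule integral_cong_AE)
      show "AE w in M. Y w * real_cond_exp M (?F n) (\<lambda>w. indicator E (?X (Suc n) w)) w = Y w * kernel.kint n (?X n w) (indicator A)"
        using mc.transition[of "Suc n" E] E by (auto simp: k Xin)
      have Xm [measurable]: "?X n \<in> measurable M (ref n)"
        using measurable_full_borel[OF XM[of "Suc n"]] by (simp cong: measurable_cong_sets add: sets_ref)
      have [measurable]: "(\<lambda>w. kernel.kint n (?X n w) (indicator A) :: real) \<in> borel_measurable M"
        using A by measurable
      show "(\<lambda>w. Y w * kernel.kint n (?X n w) (indicator A)) \<in> borel_measurable M"
        using YM by measurable
    qed (use YM in simp)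
    finally show "(\<integral>w. Y w * indicator A (?X (Suc n) w) \<partial>M) = (\<integral>w. Y w * kernel.kint n (?X n w) (indicator A) \<partial>M)" .
  qed
qed

end

text \<open>After two steps the law of any chain with the given kernels is equivalent to the reference measure.\<close>

lemma (in elliptic_kernel) pair_null_transfer:
  fixes M :: "'w measure" and M' :: "'v measure"
  assumes P: "chain_process \<mu> p e M X Fil" and P': "chain_process \<mu> p e M' X' Fil'"
    and A: "A \<in> sets (\<mu> (Suc (Suc n)) \<Otimes>\<^sub>M \<mu> (Suc (Suc (Suc n))))"
    and null: "AE w in M. (X (Suc (Suc n)) w, X (Suc (Suc (Suc n))) w) \<notin> A"
  shows "AE w in M'. (X' (Suc (Suc n)) w, X' (Suc (Suc (Suc n))) w) \<notin> A"
proof -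
  interpret P: chain_process \<mu> p e M X Fil by fact
  interpret P': chain_process \<mu> p e M' X' Fil' by fact
  let ?n2 = "Suc (Suc n)" and ?n3 = "Suc (Suc (Suc n))"
  define k where "k x y = (indicator A (x, y) :: real)" for x y
  define g where "g x = kint ?n2 x (k x)" for x
  have k: "(\<lambda>(x, y). k x y) \<in> borel_measurable (\<mu> ?n2 \<Otimes>\<^sub>M \<mu> ?n3)" "\<And>x y. \<bar>k x y\<bar> \<le> 1"
    using A by (simp_all add: k_def indicator_def[abs_def] case_prod_unfold)
  note k(1)[measurable]
  have gm [measurable]: "g \<in> borel_measurable (\<mu> ?n2)" unfolding g_def by measurable
  have kx: "(\<lambda>y. k x y) \<in> borel_measurable (\<mu> ?n3)" for x
    using measurable_Pair2[OF k(1), of x] by simp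
  have k1: "norm (k x y) \<le> 1" for x y using k(2) by simp
  have g: "0 \<le> g x" "g x \<le> 1" for x
  proof -
    show "0 \<le> g x" unfolding g_def by (rule kint_nonneg) (simp add: k_def)
    show "g x \<le> 1" using norm_kint_bound[of "k x" ?n2 1 x, OF kx k1] by (simp add: g_def)
  qed
  have g1: "\<bar>g x\<bar> \<le> 1" and g1': "norm (g x) \<le> 1" for x using g[of x] by simp_all
  have kg: "norm (kint (Suc n) x g) \<le> 1" for x by (rule norm_kint_bound[OF gm g1'])
  then have kg': "\<bar>kint (Suc n) x g\<bar> \<le> 1" for x by simp
  have "(\<integral>w. g (X ?n2 w) \<partial>M) = (\<integral>w. k (X ?n2 w) (X ?n3 w) \<partial>M)"
    unfolding g_def by (rule P.expectation_step2[OF k, symmetric])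
  also have "\<dots> = (\<integral>w. 0 \<partial>M)"
  proof (rule integral_cong_AE)
    show "AE w in M. k (X ?n2 w) (X ?n3 w) = 0" using null by eventually_elim (simp add: k_def)
  qed measurable
  finally have zero: "(\<integral>w. g (X ?n2 w) \<partial>M) = 0" by simp
  \<comment> \<open>The lower bound on two-step densities forces \<open>g\<close> to have integral 0
    against the reference measure. The upper bound on one-step densities then carries this to the
    other chain.\<close>
  have "e * (\<integral>z. g z \<partial>\<mu> ?n2) = (\<integral>w. e * (\<integral>z. g z \<partial>\<mu> ?n2) \<partial>M)" by (simp add: P.prob_space)
  also have "\<dots> \<le> (\<integral>w. kint n (X n w) (\<lambda>y. kint (Suc n) y g) \<partial>M)"
  proof (rule integral_mono)
    show "integrable M (\<lambda>w. kint n (X n w) (\<lambda>y. kint (Suc n) y g))"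
    proof (rule P.integrable_bounded[where B = 1])
      show "norm (kint n (X n w) (\<lambda>y. kint (Suc n) y g)) \<le> 1" for w
        by (rule norm_kint_bound[OF _ kg]) measurable
    qed measurable
    show "e * (\<integral>z. g z \<partial>\<mu> ?n2) \<le> kint n (X n w) (\<lambda>y. kint (Suc n) y g)" for w
      by (rule kint_kint_ge[OF gm g])
  qed simp
  also have "\<dots> = (\<integral>w. kint (Suc n) (X (Suc n) w) g \<partial>M)"
    by (rule P.expectation_step[where B = 1, symmetric]) (use kg' in simp_all)
  also have "\<dots> = 0" using P.expectation_step[OF gm g1] zero by simp
  finally have int0: "(\<integral>z. g z \<partial>\<mu> ?n2) \<le> 0" using e by (simp add: mult_le_0_iff)
  have "(\<integral>w. k (X' ?n2 w) (X' ?n3 w) \<partial>M') = (\<integral>w. g (X' ?n2 w) \<partial>M')"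
    unfolding g_def by (rule P'.expectation_step2[OF k])
  also have "\<dots> = (\<integral>w. kint (Suc n) (X' (Suc n) w) g \<partial>M')" by (rule P'.expectation_step[OF gm g1])
  also have "\<dots> \<le> (\<integral>w. 0 \<partial>M')"
  proof (rule integral_mono)
    show "integrable M' (\<lambda>w. kint (Suc n) (X' (Suc n) w) g)"
      by (rule P'.integrable_bounded[where B = 1]) (use kg in simp_all)
    show "kint (Suc n) (X' (Suc n) w) g \<le> 0" for w
    proof -
      have "1 / e * (\<integral>z. g z \<partial>\<mu> ?n2) \<le> 0" using int0 e by (simp add: divide_le_0_iff)
      then show ?thesis using kint_le_integral[OF gm g, of "X' (Suc n) w"] by linarith
    qed
  qed simp
  finally have le: "(\<integral>w. k (X' ?n2 w) (X' ?n3 w) \<partial>M') \<le> 0" by simp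
  have i: "integrable M' (\<lambda>w. k (X' ?n2 w) (X' ?n3 w))"
    by (rule P'.integrable_bounded[where B = 1]) (use k in auto)
  have "(\<integral>w. k (X' ?n2 w) (X' ?n3 w) \<partial>M') = 0"
    using le by (intro antisym Bochner_Integration.integral_nonneg) (auto simp: k_def)
  then have "AE w in M'. k (X' ?n2 w) (X' ?n3 w) = 0"
    by (subst (asm) integral_nonneg_eq_0_iff_AE[OF i]) (auto simp: k_def)
  then show ?thesis by (auto simp: k_def indicator_def split: if_splits)
qed

section \<open>The given functional as a functional with a bound everywhere\<close>

lemma partial_sum_Suc: "partial_sum X g N w = (\<Sum>n<N. g (Suc n) (X (Suc n) w, X (Suc (Suc n)) w))"
  unfolding partial_sum_def by (simp add: sum.atLeast1_atMost_eq)

locale bounded_functional = elliptic_densities S \<pi> \<epsilon> \<mu> p + markov_chain M S \<nu> \<pi> X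
  for S :: "nat \<Rightarrow> 'a metric" and \<pi> \<epsilon> \<mu> p and M :: "'w measure" and \<nu> X +
  fixes f :: "nat \<Rightarrow> 'a \<times> 'a \<Rightarrow> real" and K :: real
  assumes additive: "additive_functional S f"
    and K: "0 \<le> K" "\<And>n. 1 \<le> n \<Longrightarrow> AE w in M. \<bar>f n (X n w, X (Suc n) w)\<bar> \<le> K"
begin

text \<open>Replacing values beyond the almost sure bound by 0 produces a bound valid everywhere and
  changes \<open>f\<close> only on a null set of the original chain. For another initial
  distribution this can fail in the first steps.\<close>

definition trunc :: "nat \<Rightarrow> 'a \<Rightarrow> 'a \<Rightarrow> real" where
  "trunc n x y = (let v = f (Suc n) (ret n x, ret (Suc n) y) in if \<bar>v\<bar> \<le> K then v else 0)"

lemma f_ret_measurable: "(\<lambda>(x, y). f (Suc n) (ret n x, ret (Suc n) y)) \<in> borel_measurable (ref n \<Otimes>\<^sub>M ref (Suc n))"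
proof -
  have [measurable]: "f (Suc n) \<in> borel_measurable (borel_msets (S (Suc n)) \<Otimes>\<^sub>M borel_msets (S (Suc (Suc n))))"
    using additive by (simp add: additive_functional_def)
  show ?thesis by measurable
qed

sublocale elliptic_functional ref dens \<epsilon> trunc K
proof unfold_locales
  show "(\<lambda>(x, y). trunc n x y) \<in> borel_measurable (ref n \<Otimes>\<^sub>M ref (Suc n))" for n
    using f_ret_measurable[of n] unfolding trunc_def Let_def case_prod_unfold by measurable
  show "\<bar>trunc n x y\<bar> \<le> K" for n x y using K(1) by (simp add: trunc_def Let_def)
qed

sublocale fp: functional_process ref dens \<epsilon> trunc K M "\<lambda>n. X (Suc n)" "\<lambda>n. past_algebra M S X (Suc n)"
proof -
  interpret chain_process ref dens \<epsilon> M "\<lambda>n. X (Suc n)" "\<lambda>n. past_algebra M S X (Suc n)"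
    by (rule chain_process) unfold_locales
  show "functional_process ref dens \<epsilon> trunc K M (\<lambda>n. X (Suc n)) (\<lambda>n. past_algebra M S X (Suc n))"
    by unfold_locales
qed

lemma trunc_eq:
  "x \<in> mspace (S (Suc n)) \<Longrightarrow> y \<in> mspace (S (Suc (Suc n))) \<Longrightarrow> \<bar>f (Suc n) (x, y)\<bar> \<le> K \<Longrightarrow> trunc n x y = f (Suc n) (x, y)"
  by (simp add: trunc_def)

lemma X_in: "w \<in> space M \<Longrightarrow> X (Suc n) w \<in> mspace (S (Suc n))"
  using measurable_space[OF random_variable[of "Suc n"]] by simp

lemma AE_trunc: "AE w in M. \<forall>n. trunc n (X (Suc n) w) (X (Suc (Suc n)) w) = f (Suc n) (X (Suc n) w, X (Suc (Suc n)) w)"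
  unfolding AE_all_countable
proof
  fix n
  show "AE w in M. trunc n (X (Suc n) w) (X (Suc (Suc n)) w) = f (Suc n) (X (Suc n) w, X (Suc (Suc n)) w)"
    using K(2)[of "Suc n"] AE_space by (auto intro: trunc_eq X_in elim: eventually_elim2)
qed

lemma AE_partial_sum: "AE w in M. \<forall>N. partial_sum X f N w = fp.S N w"
  using AE_trunc by eventually_elim (simp add: partial_sum_Suc fp.S_def)

lemma partial_sum_measurable:
  assumes "additive_functional S g" "markov_chain M' S \<nu>' \<pi> X'"
  shows "partial_sum X' g N \<in> borel_measurable M'"
proof -
  have [measurable]: "X' (Suc n) \<in> measurable M' (borel_msets (S (Suc n)))" for n
    by (rule markov_chain.random_variable[OF assms(2)]) simp
  have [measurable]: "g (Suc n) \<in> borel_measurable (borel_msets (S (Suc n)) \<Otimes>\<^sub>M borel_msets (S (Suc (Suc n))))" for n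
    using assms(1) by (simp add: additive_functional_def)
  show ?thesis unfolding partial_sum_Suc[abs_def] by measurable
qed

lemma mc: "markov_chain M S \<nu> \<pi> X" by unfold_locales

lemma expectation_partial_sum: "expectation (partial_sum X f N) = expectation (fp.S N)"
  by (rule integral_cong_AE) (use AE_partial_sum partial_sum_measurable[OF additive mc] in auto)

lemma variance_partial_sum: "variance (partial_sum X f N) = variance (fp.S N)"
  unfolding expectation_partial_sum
  by (rule integral_cong_AE) (use AE_partial_sum partial_sum_measurable[OF additive mc] in auto)

lemma center_tightI:
  assumes t: "fp.tight q" and h: "additive_functional S h"
    and q: "\<And>n. (\<lambda>(x, y). q n x y) \<in> borel_measurable (ref n \<Otimes>\<^sub>M ref (Suc n))"
    and eq: "AE w in M. \<forall>n. h (Suc n) (X (Suc n) w, X (Suc (Suc n)) w) = q n (X (Suc n) w) (X (Suc (Suc n)) w)"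
  shows "center_tight M X h"
proof -
  obtain m where m: "\<And>\<epsilon>. 0 < \<epsilon> \<Longrightarrow> \<exists>A. \<forall>N. prob {w \<in> space M. \<bar>(\<Sum>n<N. q n (X (Suc n) w) (X (Suc (Suc n)) w)) - m N\<bar> > A} < \<epsilon>"
    using t unfolding fp.tight_def by blast
  have pr: "\<P>(w in M. \<bar>partial_sum X h N w - m N\<bar> > C) = prob {w \<in> space M. \<bar>(\<Sum>n<N. q n (X (Suc n) w) (X (Suc (Suc n)) w)) - m N\<bar> > C}" for N C
  proof (rule measure_eq_AE)
    note q[measurable] partial_sum_measurable[OF h mc, measurable]
    show "AE w in M. (w \<in> {w \<in> space M. C < \<bar>partial_sum X h N w - m N\<bar>}) = (w \<in> {w \<in> space M. C < \<bar>(\<Sum>n<N. q n (X (Suc n) w) (X (Suc (Suc n)) w)) - m N\<bar>})"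
      using eq by eventually_elim (simp add: partial_sum_Suc)
    show "{w \<in> space M. C < \<bar>partial_sum X h N w - m N\<bar>} \<in> sets M" by measurable
    show "{w \<in> space M. C < \<bar>(\<Sum>n<N. q n (X (Suc n) w) (X (Suc (Suc n)) w)) - m N\<bar>} \<in> sets M" by measurable
  qed
  show ?thesis
    unfolding center_tight_def
  proof (intro exI[of _ m] allI impI)
    fix \<epsilon> :: real assume "0 < \<epsilon>"
    from m[OF this] obtain C where "\<forall>N. prob {w \<in> space M. \<bar>(\<Sum>n<N. q n (X (Suc n) w) (X (Suc (Suc n)) w)) - m N\<bar> > C} < \<epsilon>" ..
    then show "\<exists>C. \<forall>N\<ge>1. \<P>(w in M. \<bar>partial_sum X h N w - m N\<bar> > C) < \<epsilon>"
      by (intro exI[of _ C]) (simp add: pr)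
  qed
qed

lemma ess_range_subset:
  assumes g: "additive_functional S g" "center_tight M X (\<lambda>n xy. f n xy - g n xy)"
    and G: "closed_subgroup G" and c: "\<And>n w. w \<in> space M \<Longrightarrow> g (Suc n) (X (Suc n) w, X (Suc (Suc n)) w) - c n \<in> G"
  shows "ess_range M S X f \<subseteq> G"
proof -
  have "\<P>(w in M. g n (X n w, X (Suc n) w) - c (n - 1) \<in> G) = 1" if n: "1 \<le> n" for n
  proof -
    obtain m where "n = Suc m" using n by (cases n) auto
    then have "{w \<in> space M. g n (X n w, X (Suc n) w) - c (n - 1) \<in> G} = space M" using c by auto
    then show ?thesis by (simp add: prob_space)
  qed
  then have "alg_range M X g \<subseteq> G"
    unfolding alg_range_def using G by (intro Inter_lower) (auto intro!: exI[of _ "\<lambda>n. c (n - 1)"])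
  moreover have "ess_range M S X f \<subseteq> alg_range M X g"
    unfolding ess_range_def using g by (intro Inter_lower) blast
  ultimately show ?thesis by blast
qed

text \<open>If the sums stayed bounded, \<open>f\<close> would be center-tight. The zero functional
  would then compete in the definition of the essential range and reduce it to
  \<open>{0}\<close>.\<close>

lemma D_r0_unbounded:
  assumes "ess_range M S X f \<noteq> {0}"
  shows "\<not> bdd_above (range (\<lambda>N. D N fp.r0))"
proof
  assume "bdd_above (range (\<lambda>N. D N fp.r0))"
  then have "fp.tight trunc" by (rule fp.tight_if_D_bounded)
  then have "center_tight M X f"
    by (rule center_tightI[OF _ additive f_pair]) (use AE_trunc in auto)
  then have "ess_range M S X f \<subseteq> {0}"
    by (intro ess_range_subset[of "\<lambda>_ _. 0" "{0}" "\<lambda>_. 0"]) (auto simp: additive_functional_def closed_subgroup_def)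
  moreover have "0 \<in> ess_range M S X f" using closed_subgroup_ess_range by (auto simp: closed_subgroup_def)
  ultimately show False using assms by auto
qed

lemma ess_range_lattice:
  assumes "t \<noteq> 0" "bdd_above (range (\<lambda>N. D N t))"
  shows "ess_range M S X f \<subseteq> range (\<lambda>k :: int. of_int k * (2 * pi / \<bar>t\<bar>))"
proof -
  obtain g c where g: "\<And>n. (\<lambda>(x, y). g n x y) \<in> borel_measurable (ref n \<Otimes>\<^sub>M ref (Suc n))"
    and c: "\<And>n x y. \<exists>k :: int. g n x y - c n = of_int k * (2 * pi / \<bar>t\<bar>)"
    and t: "fp.tight (\<lambda>n x y. trunc n x y - g n x y)"
    using fp.lattice_reduction[OF assms] by blast
  define g' where "g' n xy = (case xy of (x, y) \<Rightarrow> g (n - 1) x y)" for n xy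
  have idm: "(\<lambda>x. x) \<in> measurable (borel_msets (S (Suc n))) (ref n)" for n
    using measurable_full_borel[of "\<lambda>x. x" "borel_msets (S (Suc n))" "S (Suc n)"]
    by (simp cong: measurable_cong_sets add: sets_ref)
  have g'_add: "additive_functional S g'"
    unfolding additive_functional_def
  proof (intro allI impI)
    fix n :: nat assume "1 \<le> n"
    then obtain m where n: "n = Suc m" by (cases n) auto
    have "(\<lambda>xy. (fst xy, snd xy)) \<in> measurable (borel_msets (S (Suc m)) \<Otimes>\<^sub>M borel_msets (S (Suc (Suc m)))) (ref m \<Otimes>\<^sub>M ref (Suc m))"
      by (intro measurable_Pair measurable_compose[OF measurable_fst idm] measurable_compose[OF measurable_snd idm])
    from measurable_compose[OF this g] show "g' n \<in> borel_measurable (borel_msets (S n) \<Otimes>\<^sub>M borel_msets (S (Suc n)))"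
      by (simp add: g'_def[abs_def] n case_prod_unfold)
  qed
  have diff: "additive_functional S (\<lambda>n xy. f n xy - g' n xy)"
    using additive g'_add unfolding additive_functional_def by (blast intro: borel_measurable_diff)
  have "center_tight M X (\<lambda>n xy. f n xy - g' n xy)"
  proof (rule center_tightI[OF t diff])
    show "(\<lambda>(x, y). trunc n x y - g n x y) \<in> borel_measurable (ref n \<Otimes>\<^sub>M ref (Suc n))" for n
      using f_pair[of n] g[of n] by (simp add: case_prod_unfold)
    show "AE w in M. \<forall>n. f (Suc n) (X (Suc n) w, X (Suc (Suc n)) w) - g' (Suc n) (X (Suc n) w, X (Suc (Suc n)) w)
        = trunc n (X (Suc n) w) (X (Suc (Suc n)) w) - g n (X (Suc n) w) (X (Suc (Suc n)) w)"
      using AE_trunc by eventually_elim (simp add: g'_def)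
  qed
  then show ?thesis
    by (intro ess_range_subset[OF g'_add _ closed_subgroup_multiples, of c]) (use c in \<open>auto simp: g'_def image_def\<close>)
qed

lemma iexp_mult_ess_range:
  assumes "t \<noteq> 0" "bdd_above (range (\<lambda>N. D N t))" "l \<in> ess_range M S X f"
  shows "iexp (t * l) = 1"
proof -
  obtain k :: int where k: "l = of_int k * (2 * pi / \<bar>t\<bar>)" using ess_range_lattice[OF assms(1,2)] assms(3) by blast
  have "t * l = 2 * pi * of_int (if 0 < t then k else - k)" using assms(1) k by auto
  then show ?thesis by (simp only: cis_conv_exp[symmetric] cis_multiple_2pi[OF Ints_of_int])
qed

text \<open>The null sets of the two chains can be compared only after two steps, since the early
  laws may be mutually singular. This is the origin of the restriction to levels from 2 on.\<close>

lemma AE_trunc_other: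
  assumes mc': "markov_chain M' S \<nu>' \<pi> X'"
  shows "AE w in M'. \<forall>n\<ge>2. trunc n (X' (Suc n) w) (X' (Suc (Suc n)) w) = f (Suc n) (X' (Suc n) w, X' (Suc (Suc n)) w)"
proof -
  interpret mc': markov_chain M' S \<nu>' \<pi> X' by fact
  have X'_in: "X' (Suc n) w \<in> mspace (S (Suc n))" if "w \<in> space M'" for n w
    using measurable_space[OF mc'.random_variable[of "Suc n"] that] by simp
  have "AE w in M'. trunc n (X' (Suc n) w) (X' (Suc (Suc n)) w) = f (Suc n) (X' (Suc n) w, X' (Suc (Suc n)) w)" if "2 \<le> n" for n
  proof -
    obtain m where n: "n = Suc (Suc m)" using \<open>2 \<le> n\<close> by (metis add_2_eq_Suc le_Suc_ex)
    define A where "A = {(x, y). K < \<bar>f (Suc n) (ret n x, ret (Suc n) y)\<bar>}"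
    have "A = {xy \<in> space (ref n \<Otimes>\<^sub>M ref (Suc n)). K < \<bar>(\<lambda>(x, y). f (Suc n) (ret n x, ret (Suc n) y)) xy\<bar>}"
      by (auto simp: A_def space_pair_measure)
    also have "\<dots> \<in> sets (ref n \<Otimes>\<^sub>M ref (Suc n))" using f_ret_measurable[of n, measurable] by measurable
    finally have A: "A \<in> sets (ref n \<Otimes>\<^sub>M ref (Suc n))" .
    have "AE w in M. (X (Suc n) w, X (Suc (Suc n)) w) \<notin> A"
      using K(2)[of "Suc n"] AE_space by (auto simp: A_def X_in elim: eventually_elim2)
    from kernel.pair_null_transfer[OF chain_process[OF mc] chain_process[OF mc'] A[unfolded n] this[unfolded n]]
    show ?thesis using AE_space unfolding n[symmetric]
      by eventually_elim (auto simp: A_def X'_in intro!: trunc_eq)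
  qed
  then show ?thesis unfolding AE_all_countable by (auto intro: AE_impI)
qed

theorem interval_prob_asymp:
  fixes M' :: "'v measure" and a b l \<zeta> :: real and z :: "nat \<Rightarrow> real"
  assumes mc': "markov_chain M' S \<nu>' \<pi> X'"
    and ne: "ess_range M S X f \<noteq> {0}"
    and z: "(\<lambda>N. (z N - expectation (partial_sum X f N)) / sqrt (variance (partial_sum X f N))) \<longlonglongrightarrow> \<zeta>"
    and l: "0 \<le> l" "l \<in> ess_range M S X f"
  defines "\<kappa> \<equiv> exp (- \<zeta>\<^sup>2 / 2) / sqrt (2 * pi)" and "P \<equiv> \<lambda>N. \<P>(w in M'. partial_sum X' f N w - z N \<in> {a<..<b})"
    and "V \<equiv> \<lambda>N. variance (partial_sum X f N)"
  shows "b - a < l \<Longrightarrow> \<exists>s. s \<longlonglongrightarrow> l * \<kappa> \<and> (\<forall>\<^sub>F N in sequentially. sqrt (V N) * P N \<le> s N)"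
    and "l < b - a \<Longrightarrow> \<exists>s. s \<longlonglongrightarrow> l * \<kappa> \<and> (\<forall>\<^sub>F N in sequentially. s N \<le> sqrt (V N) * P N)"
proof -
  interpret mc': markov_chain M' S \<nu>' \<pi> X' by fact
  let ?X' = "\<lambda>n. X' (Suc n)" and ?F' = "\<lambda>n. past_algebra M' S X' (Suc n)"
  interpret cp: chain_process ref dens \<epsilon> M' ?X' ?F' by (rule chain_process[OF mc'])
  define d where "d n w = f (Suc n) (ret n (?X' n w), ret (Suc n) (?X' (Suc n) w)) - trunc n (?X' n w) (?X' (Suc n) w)" for n w
  \<comment> \<open>Under another initial distribution the first two terms may violate the almost sure bound on \<open>f\<close>.\<close>
  define \<Delta> where "\<Delta> w = d 0 w + d (Suc 0) w" for w
  have Fm: "?X' n \<in> measurable (?F' 2) (ref n)" if "n \<le> 2" for n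
    using cp.Fil_measurable_add[OF cp.X_Fil[of n], of "2 - n"] that by simp
  have dm: "d n \<in> borel_measurable (?F' 2)" if "Suc n \<le> 2" for n
  proof -
    have [measurable]: "?X' n \<in> measurable (?F' 2) (ref n)" "?X' (Suc n) \<in> measurable (?F' 2) (ref (Suc n))"
      using that by (intro Fm; simp)+
    note f_ret_measurable[of n, measurable] f_pair[of n, measurable]
    show ?thesis unfolding d_def[abs_def] by measurable
  qed
  have \<Delta>: "\<Delta> \<in> borel_measurable (?F' 2)"
    unfolding \<Delta>_def[abs_def] by (intro borel_measurable_add dm) auto
  have [measurable]: "\<Delta> \<in> borel_measurable M'" by (rule cp.Fil_measurable_M[OF \<Delta>])
  define T where "T N w = \<Delta> w + (\<Sum>n<N. trunc n (?X' n w) (?X' (Suc n) w)) - z N" for N w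
  note f_pair[measurable]
  have Tm [measurable]: "T N \<in> borel_measurable M'" for N unfolding T_def by measurable
  define Q where "Q N = distr M' borel (T N)" for N
  have Q: "real_distribution (Q N)" for N unfolding Q_def by (rule mc'.real_distribution_distr) measurable
  \<comment> \<open>As soon as \<open>N\<close> is at least 2 the sum contains both terms at which
    truncation may matter, and \<open>\<Delta>\<close> restores exactly these.\<close>
  have P_eq: "P N = measure (Q N) {a<..<b}" if N: "2 \<le> N" for N
  proof -
    have "P N = measure M' {w \<in> space M'. T N w \<in> {a<..<b}}"
      unfolding P_def
    proof (rule measure_eq_AE)
      show "AE w in M'. (w \<in> {w \<in> space M'. partial_sum X' f N w - z N \<in> {a<..<b}}) = (w \<in> {w \<in> space M'. T N w \<in> {a<..<b}})"
        using AE_trunc_other[OF mc'] AE_space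
      proof eventually_elim
        case (elim w)
        obtain k where k: "N = 2 + k" using N le_Suc_ex by blast
        have X'_in: "X' (Suc n) w \<in> mspace (S (Suc n))" for n
          using measurable_space[OF mc'.random_variable[of "Suc n"] elim(2)] by simp
        have "partial_sum X' f N w = \<Delta> w + (\<Sum>n<N. trunc n (?X' n w) (?X' (Suc n) w))"
          unfolding partial_sum_Suc k
        proof (induction k)
          case 0
          then show ?case by (simp add: \<Delta>_def d_def numeral_2_eq_2 X'_in)
        next
          case (Suc k)
          then show ?case using elim(1) by simp
        qed
        then show ?case by (simp add: T_def)
      qed
      show "{w \<in> space M'. partial_sum X' f N w - z N \<in> {a<..<b}} \<in> sets M'"
        using partial_sum_measurable[OF additive mc', measurable] by measurable
      show "{w \<in> space M'. T N w \<in> {a<..<b}} \<in> sets M'" by measurable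
    qed
    also have "\<dots> = measure (Q N) {a<..<b}"
      unfolding Q_def by (subst measure_distr) (auto simp: vimage_def Int_def conj_commute)
    finally show ?thesis .
  qed
  have V_eq: "V N = variance (fp.S N)" for N unfolding V_def by (rule variance_partial_sum)
  have z': "(\<lambda>N. (z N - expectation (fp.S N)) / sqrt (variance (fp.S N))) \<longlonglongrightarrow> \<zeta>"
    using z unfolding variance_partial_sum by (simp only: expectation_partial_sum)
  have llt: "(\<lambda>N. sqrt (V N) * smoothed_prob (Q N) \<alpha> l \<eta>) \<longlonglongrightarrow> l * \<kappa>" if "0 < \<eta>" for \<alpha> \<eta>
    using fp.smoothed_llt[OF chain_process[OF mc'] \<Delta> D_r0_unbounded[OF ne] z' that l(1) iexp_mult_ess_range[OF _ _ l(2)], of \<alpha>]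
    unfolding V_eq Q_def T_def[abs_def] \<kappa>_def by simp
  have V0: "0 \<le> V N" for N unfolding V_def by (rule Bochner_Integration.integral_nonneg) simp
  show "\<exists>s. s \<longlonglongrightarrow> l * \<kappa> \<and> (\<forall>\<^sub>F N in sequentially. sqrt (V N) * P N \<le> s N)" if "b - a < l"
  proof (intro exI conjI)
    \<comment> \<open>The width of the smoothing is the whole excess of the window over the
      interval.\<close>
    show "(\<lambda>N. sqrt (V N) * smoothed_prob (Q N) a l (l - (b - a))) \<longlonglongrightarrow> l * \<kappa>" by (rule llt) (use that in simp)
    show "\<forall>\<^sub>F N in sequentially. sqrt (V N) * P N \<le> sqrt (V N) * smoothed_prob (Q N) a l (l - (b - a))"
      using eventually_ge_at_top[of 2]
    proof eventually_elim
      case (elim N)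
      show ?case unfolding P_eq[OF elim] using that V0 by (intro mult_left_mono interval_le_smoothed_prob Q) auto
    qed
  qed
  show "\<exists>s. s \<longlonglongrightarrow> l * \<kappa> \<and> (\<forall>\<^sub>F N in sequentially. s N \<le> sqrt (V N) * P N)" if "l < b - a"
  proof (intro exI conjI)
    \<comment> \<open>Half the difference in length: the window is shifted by the width, and its
      right end must still lie strictly below \<open>b\<close>.\<close>
    let ?\<eta> = "(b - a - l) / 2"
    show "(\<lambda>N. sqrt (V N) * smoothed_prob (Q N) (a + ?\<eta>) l ?\<eta>) \<longlonglongrightarrow> l * \<kappa>" by (rule llt) (use that in simp)
    show "\<forall>\<^sub>F N in sequentially. sqrt (V N) * smoothed_prob (Q N) (a + ?\<eta>) l ?\<eta> \<le> sqrt (V N) * P N"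
      using eventually_ge_at_top[of 2]
    proof eventually_elim
      case (elim N)
      show ?case unfolding P_eq[OF elim] using that V0 by (intro mult_left_mono smoothed_prob_le_interval Q) (auto simp: field_simps)
    qed
  qed
qed

lemma variance_at_top:
  assumes "ess_range M S X f \<noteq> {0}"
  shows "filterlim (\<lambda>N. variance (partial_sum X f N)) at_top sequentially"
  unfolding variance_partial_sum by (rule fp.variance_S_at_top[OF D_r0_unbounded[OF assms]])

end

lemma as_uniformly_boundedE:
  assumes "as_uniformly_bounded M X f"
  obtains K where "0 \<le> K" "\<And>n. 1 \<le> n \<Longrightarrow> AE w in M. \<bar>f n (X n w, X (Suc n) w)\<bar> \<le> (K :: real)"
proof -
  define Z where "Z = (SUP n\<in>{1..}. esssup M (\<lambda>\<omega>. ereal \<bar>f n (X n \<omega>, X (Suc n) \<omega>)\<bar>))"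
  have "Z < \<infinity>" using assms by (simp add: as_uniformly_bounded_def Z_def)
  then obtain K where K: "Z \<le> ereal K" by (cases Z) auto
  have "AE w in M. \<bar>f n (X n w, X (Suc n) w)\<bar> \<le> max 0 K" if "1 \<le> n" for n
  proof -
    have "esssup M (\<lambda>\<omega>. ereal \<bar>f n (X n \<omega>, X (Suc n) \<omega>)\<bar>) \<le> Z"
      unfolding Z_def using that by (intro SUP_upper) simp
    then have le: "esssup M (\<lambda>\<omega>. ereal \<bar>f n (X n \<omega>, X (Suc n) \<omega>)\<bar>) \<le> ereal K" using K by (rule order_trans)
    from esssup_AE[of "\<lambda>\<omega>. ereal \<bar>f n (X n \<omega>, X (Suc n) \<omega>)\<bar>" M] show ?thesis
    proof eventually_elim
      case (elim w)
      then have "ereal \<bar>f n (X n w, X (Suc n) w)\<bar> \<le> ereal K" using le by (rule order_trans)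
      then show ?case by simp
    qed
  qed
  then show thesis by (intro that[of "max 0 K"]) auto
qed

lemma (in markov_chain) elliptic_densitiesE:
  assumes "uniformly_elliptic S \<pi>"
  obtains \<epsilon> \<mu> p where "elliptic_densities S \<pi> \<epsilon> \<mu> p"
proof -
  obtain \<epsilon> \<mu> p where h: "0 < \<epsilon>" "\<epsilon> < 1"
    "\<forall>n\<ge>1. prob_space (\<mu> n) \<and> sets (\<mu> n) = sets (borel_msets (S n))"
    "\<forall>n\<ge>1. p n \<in> borel_measurable (borel_msets (S n) \<Otimes>\<^sub>M borel_msets (S (Suc n)))"
    "\<forall>n\<ge>1. \<forall>x\<in>mspace (S n). \<pi> n x = density (\<mu> (Suc n)) (\<lambda>y. ennreal (p n (x, y)))"
    "\<forall>n\<ge>1. \<forall>x\<in>mspace (S n). \<forall>y\<in>mspace (S (Suc n)). 0 \<le> p n (x, y) \<and> p n (x, y) \<le> 1 / \<epsilon>"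
    "\<forall>n\<ge>1. \<forall>x\<in>mspace (S n). \<forall>z\<in>mspace (S (Suc (Suc n))). (\<integral>y. p n (x, y) * p (Suc n) (y, z) \<partial>\<mu> (Suc n)) > \<epsilon>"
    using assms unfolding uniformly_elliptic_def by blast
  have "prob_space (\<pi> n x)" if "1 \<le> n" "x \<in> mspace (S n)" for n x
    using measurable_space[OF kernel[OF that(1)], of x] that(2) by (simp add: space_prob_algebra)
  then have "elliptic_densities S \<pi> \<epsilon> \<mu> p"
    by (intro elliptic_densities.intro) (use h in blast)+
  then show thesis by (rule that)
qed

theorem theorem5p3:
  fixes M :: "'w measure" and M\<^sub>x :: "'v measure"
    and S :: "nat \<Rightarrow> 'a metric"
    and \<nu> :: "'a measure"
    and \<pi> :: "nat \<Rightarrow> 'a \<Rightarrow> 'a measure"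
    and X :: "nat \<Rightarrow> 'w \<Rightarrow> 'a" and X\<^sub>x :: "nat \<Rightarrow> 'v \<Rightarrow> 'a"
    and f :: "nat \<Rightarrow> 'a \<times> 'a \<Rightarrow> real"
    and x :: 'a and z :: "nat \<Rightarrow> real" and z_lim a b L \<delta> :: real
    and V :: "nat \<Rightarrow> real" and P\<^sub>x :: "nat \<Rightarrow> real"
  assumes chain: "markov_chain M S \<nu> \<pi> X"
    and elliptic: "uniformly_elliptic S \<pi>"
    and additive: "additive_functional S f"
    and bounded: "as_uniformly_bounded M X f"
    and x: "x \<in> mspace (S 1)"
    and chain_x: "markov_chain M\<^sub>x S (return (borel_msets (S 1)) x) \<pi> X\<^sub>x"
  defines "V \<equiv> \<lambda>N. prob_space.variance M (partial_sum X f N)"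
    and "\<delta> \<equiv> real_of_ereal (graininess M S X f)"
    and "P\<^sub>x \<equiv> \<lambda>N. \<P>(\<omega> in M\<^sub>x. partial_sum X\<^sub>x f N \<omega> - z N \<in> {a<..<b})"
  assumes length: "L = b - a" "graininess M S X f < ereal L"
    and z: "(\<lambda>N. (z N - prob_space.expectation M (partial_sum X f N)) / sqrt (V N))
              \<longlonglongrightarrow> z_lim"
  shows "(\<forall>\<epsilon>>0. \<forall>\<^sub>F N in sequentially.
            P\<^sub>x N \<le> exp (- z_lim\<^sup>2 / 2) * \<bar>a - b\<bar> / sqrt (2 * pi * V N) * (1 + 21 * \<delta> / L + \<epsilon>) \<and>
            P\<^sub>x N \<ge> exp (- z_lim\<^sup>2 / 2) * \<bar>a - b\<bar> / sqrt (2 * pi * V N) * (1 - \<delta> / L - \<epsilon>)) \<and>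
         (\<forall>k :: nat. 0 < \<delta> \<and> real k * \<delta> < L \<and> L < (real k + 1) * \<delta> \<longrightarrow>
            (\<lambda>N. exp (- z_lim\<^sup>2 / 2) / sqrt (2 * pi * V N) * (real k * \<delta>)) \<lesssim> P\<^sub>x \<and>
            P\<^sub>x \<lesssim> (\<lambda>N. exp (- z_lim\<^sup>2 / 2) / sqrt (2 * pi * V N) * ((real k + 1) * \<delta>)))"
proof -
  obtain \<epsilon> \<mu> p where ed: "elliptic_densities S \<pi> \<epsilon> \<mu> p"
    using markov_chain.elliptic_densitiesE[OF chain elliptic] by blast
  obtain K where K: "0 \<le> K" "\<And>n. 1 \<le> n \<Longrightarrow> AE w in M. \<bar>f n (X n w, X (Suc n) w)\<bar> \<le> K"
    using as_uniformly_boundedE[OF bounded] by blast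
  interpret bounded_functional S \<pi> \<epsilon> \<mu> p M \<nu> X f K
    by (intro bounded_functional.intro ed chain bounded_functional_axioms.intro additive K)
  \<comment> \<open>A graininess below \<open>L\<close> is finite, which rules out the essential
    range \<open>{0}\<close> and so makes the variance tend to infinity. In the other two cases
    exactly the lengths handled by \<open>lattice_length_bounds\<close> are shown to belong to the
    essential range.\<close>
  have \<delta>: "0 \<le> \<delta> \<and> \<delta> < L \<and> ess_range M S X f \<noteq> {0} \<and>
      (\<forall>l. \<delta> = 0 \<or> (\<exists>k :: nat. l = real k * \<delta>) \<longrightarrow> l \<in> ess_range M S X f)"
    using length(2)
  proof (cases rule: graininess_cases)
    case 1
    then show ?thesis using length(2) UNIV_I[of "1 :: real"] by (force simp: \<delta>_def)
  next
    case (2 d)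
    have "d \<in> ess_range M S X f" unfolding 2(2) by (rule range_eqI[of _ _ 1]) simp
    then have "ess_range M S X f \<noteq> {0}" using 2(1) by (metis less_irrefl singletonD)
    moreover have "real k * d \<in> ess_range M S X f" for k :: nat
      unfolding 2(2) by (rule range_eqI[of _ _ "int k"]) simp
    moreover have "\<delta> = d" "d < L" using 2(3) length(2) by (simp_all add: \<delta>_def)
    ultimately show ?thesis using 2(1) by auto
  qed
  define \<kappa> where "\<kappa> = exp (- z_lim\<^sup>2 / 2) / sqrt (2 * pi)"
  have eq: "exp (- z_lim\<^sup>2 / 2) * \<bar>a - b\<bar> / sqrt (2 * pi * V N) = \<kappa> * L / sqrt (V N)"
    "exp (- z_lim\<^sup>2 / 2) / sqrt (2 * pi * V N) = \<kappa> / sqrt (V N)" for N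
    using length(1) \<delta> by (simp_all add: \<kappa>_def real_sqrt_mult[of "2 * pi" "V N"])
  note asymp = interval_prob_asymp[OF chain_x _ z[unfolded V_def]]
  show ?thesis
    unfolding eq
  proof (rule lattice_length_bounds)
    show "filterlim V at_top sequentially" unfolding V_def using \<delta> by (intro variance_at_top) blast
    show "0 < \<kappa>" by (simp add: \<kappa>_def)
    show "0 \<le> \<delta>" "\<delta> < L" using \<delta> by auto
    fix l assume l: "\<delta> = 0 \<or> (\<exists>k :: nat. l = real k * \<delta>)"
    show "\<exists>s. s \<longlonglongrightarrow> l * \<kappa> \<and> (\<forall>\<^sub>F N in sequentially. sqrt (V N) * P\<^sub>x N \<le> s N)" if "L < l"
      unfolding V_def P\<^sub>x_def \<kappa>_def by (rule asymp(1)) (use \<delta> l that length(1) in auto)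
    show "\<exists>s. s \<longlonglongrightarrow> l * \<kappa> \<and> (\<forall>\<^sub>F N in sequentially. s N \<le> sqrt (V N) * P\<^sub>x N)" if "0 \<le> l" "l < L"
      unfolding V_def P\<^sub>x_def \<kappa>_def by (rule asymp(2)) (use \<delta> l that length(1) in auto)
  qed
qed

end
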